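(* Let $G=(V,E)$ be a directed graph with $n$ vertices and $m$ edges. All the $2$-vertex-connected components of $G$ can be computed in $O(nm)$ time.
   Context: For a directed graph $G=(V,E)$ and $U\subseteq V$, $G[U]$ denotes the subgraph induced by $U$. A directed graph $G=(V,E)$ is $k$-vertex-connected if it has at least $k+1$ vertices and $G[V\setminus X]$ is strongly connected for every $X\subset V$ with $|X|<k$. The $k$-vertex-connected components ($k$-vccs) of $G$ are its maximal $k$-vertex-connected subgraphs (identified with their vertex sets $C$, the subgraph being $G[C]$). *)

theory Defs
  imports "Graph_Theory.Digraph_Component"
begin

section \<open>Vertex-connected components\<close>

definition k_vertex_connected :: "nat \<Rightarrow> ('a, 'b) pre_digraph \<Rightarrow> bool" where
  "k_vertex_connected k G \<longleftrightarrow>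
     k + 1 \<le> card (verts G) \<and>
     (\<forall>X. X \<subset> verts G \<and> card X < k \<longrightarrow> strongly_connected (G \<restriction> (verts G - X)))"

text \<open>The components are identified with their vertex sets; lemma \<open>max_k_vertex_connected_induced\<close>
  shows that nothing is lost.\<close>

definition vccs :: "nat \<Rightarrow> ('a, 'b) pre_digraph \<Rightarrow> 'a set set" where
  "vccs k G = verts ` {H. pre_digraph.max_subgraph G (k_vertex_connected k) H}"

lemma arc_mono_k_vertex_connected: "arc_mono (k_vertex_connected k)"
  unfolding arc_mono_def
proof (intro allI impI, elim conjE)
  fix H H' :: "('a, 'b) pre_digraph"
  assume conn: "k_vertex_connected k H" and sub: "subgraph H H'" and verts: "verts H = verts H'"
  have wfH: "wf_digraph H" and wfH': "wf_digraph H'"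
    using sub by (auto simp: subgraph_def)
  show "k_vertex_connected k H'"
    unfolding k_vertex_connected_def
  proof (intro conjI allI impI)
    show "k + 1 \<le> card (verts H')"
      using conn verts by (simp add: k_vertex_connected_def)
  next
    fix X assume X: "X \<subset> verts H' \<and> card X < k"
    let ?S = "verts H' - X"
    have sc: "strongly_connected (H \<restriction> ?S)"
      using X conn verts by (auto simp: k_vertex_connected_def)
    have wf: "wf_digraph (H \<restriction> ?S)" "wf_digraph (H' \<restriction> ?S)"
      using wfH wfH' by (auto intro: wf_digraph.wellformed_induce_subgraph)
    then have "spanning (H \<restriction> ?S) (H' \<restriction> ?S)"
      using sub by (auto simp: spanning_def subgraph_def compatible_def)
    then show "strongly_connected (H' \<restriction> ?S)"
      by (rule wf_digraph.strongly_connected_spanning_imp_strongly_connected[OF wf(2) _ sc])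
  qed
qed

lemma max_k_vertex_connected_induced:
  "pre_digraph.max_subgraph G (k_vertex_connected k) H \<Longrightarrow> induced_subgraph H G"
  using pre_digraph.induced_subgraphI_arc_mono arc_mono_k_vertex_connected by blast

section \<open>A word RAM\<close>

text \<open>Registers and arrays are numbered, so that a program uses constantly many of each. Every
  register and every array cell holds one word, that is, a natural number below the bound \<open>W\<close>.\<close>

datatype binop = Add | Sub | Mul | Div | Mod

datatype aexp = Num nat | Reg nat | Arr nat aexp | Bin binop aexp aexp

datatype bexp = Less aexp aexp | Equal aexp aexp | Neg bexp | Conj bexp bexp

datatype com =
    Skip
  | Assign nat aexp
  | Store nat aexp aexp
  | Seq com com
  | Cond bexp com com
  | While bexp com

record state =
  reg :: "nat \<Rightarrow> nat"
  arr :: "nat \<Rightarrow> nat \<Rightarrow> nat"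

fun op_val :: "binop \<Rightarrow> nat \<Rightarrow> nat \<Rightarrow> nat" where
  "op_val Add x y = x + y"
| "op_val Sub x y = x - y"
| "op_val Mul x y = x * y"
| "op_val Div x y = x div y"
| "op_val Mod x y = x mod y"

fun aval :: "state \<Rightarrow> aexp \<Rightarrow> nat" where
  "aval s (Num x) = x"
| "aval s (Reg r) = reg s r"
| "aval s (Arr a e) = arr s a (aval s e)"
| "aval s (Bin f e1 e2) = op_val f (aval s e1) (aval s e2)"

fun bval :: "state \<Rightarrow> bexp \<Rightarrow> bool" where
  "bval s (Less e1 e2) \<longleftrightarrow> aval s e1 < aval s e2"
| "bval s (Equal e1 e2) \<longleftrightarrow> aval s e1 = aval s e2"
| "bval s (Neg b) \<longleftrightarrow> \<not> bval s b"
| "bval s (Conj b1 b2) \<longleftrightarrow> bval s b1 \<and> bval s b2"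

text \<open>All values that occur in the evaluation of an expression, intermediate ones included, are
  words.\<close>

fun afits :: "nat \<Rightarrow> state \<Rightarrow> aexp \<Rightarrow> bool" where
  "afits W s (Num x) \<longleftrightarrow> x < W"
| "afits W s (Reg r) \<longleftrightarrow> reg s r < W"
| "afits W s (Arr a e) \<longleftrightarrow> afits W s e \<and> arr s a (aval s e) < W"
| "afits W s (Bin f e1 e2) \<longleftrightarrow>
     afits W s e1 \<and> afits W s e2 \<and> op_val f (aval s e1) (aval s e2) < W"

fun bfits :: "nat \<Rightarrow> state \<Rightarrow> bexp \<Rightarrow> bool" where
  "bfits W s (Less e1 e2) \<longleftrightarrow> afits W s e1 \<and> afits W s e2"
| "bfits W s (Equal e1 e2) \<longleftrightarrow> afits W s e1 \<and> afits W s e2"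
| "bfits W s (Neg b) \<longleftrightarrow> bfits W s b"
| "bfits W s (Conj b1 b2) \<longleftrightarrow> bfits W s b1 \<and> bfits W s b2"

text \<open>Evaluation takes one step per constant, register access, array access, operation,
  comparison and connective; both arguments of a conjunction are evaluated.\<close>

fun acost :: "aexp \<Rightarrow> nat" where
  "acost (Num x) = 1"
| "acost (Reg r) = 1"
| "acost (Arr a e) = acost e + 1"
| "acost (Bin f e1 e2) = acost e1 + acost e2 + 1"

fun bcost :: "bexp \<Rightarrow> nat" where
  "bcost (Less e1 e2) = acost e1 + acost e2 + 1"
| "bcost (Equal e1 e2) = acost e1 + acost e2 + 1"
| "bcost (Neg b) = bcost b + 1"
| "bcost (Conj b1 b2) = bcost b1 + bcost b2 + 1"

text \<open>\<open>exec W c s t s'\<close>: on words below \<open>W\<close>, program \<open>c\<close> started in state \<open>s\<close> halts in state \<open>s'\<close> after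
  exactly \<open>t\<close> steps. A run in which a word overflows is stuck, so that it has no final state.\<close>

inductive exec :: "nat \<Rightarrow> com \<Rightarrow> state \<Rightarrow> nat \<Rightarrow> state \<Rightarrow> bool" for W where
  Skip: "exec W Skip s 1 s"
| Assign: "afits W s e \<Longrightarrow>
    exec W (Assign r e) s (acost e + 1) (s\<lparr>reg := (reg s)(r := aval s e)\<rparr>)"
| Store: "afits W s i \<Longrightarrow> afits W s e \<Longrightarrow>
    exec W (Store a i e) s (acost i + acost e + 1)
      (s\<lparr>arr := (arr s)(a := (arr s a)(aval s i := aval s e))\<rparr>)"
| Seq: "exec W c1 s t1 s1 \<Longrightarrow> exec W c2 s1 t2 s2 \<Longrightarrow> exec W (Seq c1 c2) s (t1 + t2) s2"
| CondTrue: "bfits W s b \<Longrightarrow> bval s b \<Longrightarrow> exec W c1 s t s1 \<Longrightarrow>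
    exec W (Cond b c1 c2) s (bcost b + 1 + t) s1"
| CondFalse: "bfits W s b \<Longrightarrow> \<not> bval s b \<Longrightarrow> exec W c2 s t s1 \<Longrightarrow>
    exec W (Cond b c1 c2) s (bcost b + 1 + t) s1"
| WhileFalse: "bfits W s b \<Longrightarrow> \<not> bval s b \<Longrightarrow> exec W (While b c) s (bcost b + 1) s"
| WhileTrue: "bfits W s b \<Longrightarrow> bval s b \<Longrightarrow> exec W c s t1 s1 \<Longrightarrow> exec W (While b c) s1 t2 s2 \<Longrightarrow>
    exec W (While b c) s (bcost b + 1 + t1 + t2) s2"

inductive_cases SkipE: "exec W Skip s t s'"
  and AssignE: "exec W (Assign r e) s t s'"
  and StoreE: "exec W (Store a i e) s t s'"
  and SeqE: "exec W (Seq c1 c2) s t s'"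
  and CondE: "exec W (Cond b c1 c2) s t s'"
  and WhileE: "exec W (While b c) s t s'"

lemma exec_deterministic:
  assumes "exec W c s t s'" "exec W c s t' s''"
  shows "t' = t \<and> s'' = s'"
  using assms
proof (induction arbitrary: t' s'' rule: exec.induct)
  case (Skip s)
  then show ?case by (auto elim: SkipE)
next
  case (Assign s e r)
  from Assign.prems show ?case by (rule AssignE) simp
next
  case (Store s i e a)
  from Store.prems show ?case by (rule StoreE) simp
next
  case (Seq c1 s t1 s1 c2 t2 s2)
  from Seq.prems show ?case by (rule SeqE) (metis Seq.IH)
next
  case (CondTrue s b c1 t s1 c2)
  from CondTrue.prems show ?case
    by (rule CondE) (simp_all add: CondTrue.hyps CondTrue.IH)
next
  case (CondFalse s b c2 t s1 c1)
  from CondFalse.prems show ?case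
    by (rule CondE) (simp_all add: CondFalse.hyps CondFalse.IH)
next
  case (WhileFalse s b c)
  from WhileFalse.prems show ?case
    by (rule WhileE) (simp_all add: WhileFalse.hyps)
next
  case (WhileTrue s b c t1 s1 t2 s2)
  from WhileTrue.prems show ?case
  proof (rule WhileE)
    assume "\<not> bval s b"
    with WhileTrue.hyps show ?thesis by simp
  next
    fix u1 r u2
    assume *: "exec W c s u1 r" "exec W (While b c) r u2 s''" "t' = Suc (bcost b + u1 + u2)"
    from WhileTrue.IH(1)[OF *(1)] have "u1 = t1" "r = s1" by simp_all
    with WhileTrue.IH(2) *(2,3) show ?thesis by simp
  qed
qed

section \<open>Input and output conventions\<close>

text \<open>Input: registers 0 and 1 hold the number of vertices and of arcs, arrays 0 and 1 the tails
  and heads of the arcs. All other registers and cells are 0.\<close>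

definition input_state :: "nat \<Rightarrow> (nat \<times> nat) list \<Rightarrow> state" where
  "input_state n es =
     \<lparr>reg = (\<lambda>_. 0)(0 := n, 1 := length es),
      arr = (\<lambda>_ _. 0)(0 := (\<lambda>i. if i < length es then fst (es ! i) else 0),
                       1 := (\<lambda>i. if i < length es then snd (es ! i) else 0))\<rparr>"

text \<open>Output: register 0 holds the number of listed sets. Array 3 holds their elements; those of the
  \<open>i\<close>-th set start at the index in cell \<open>i\<close> of array 2 and end before the index in cell \<open>i + 1\<close>.\<close>

definition output_lists :: "state \<Rightarrow> nat list list" where
  "output_lists s = map (\<lambda>i. map (arr s 3) [arr s 2 i ..< arr s 2 (i + 1)]) [0 ..< reg s 0]"

text \<open>Each member of the family is listed exactly once, without repeated elements.\<close>

definition enumerates :: "'a list list \<Rightarrow> 'a set set \<Rightarrow> bool" where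
  "enumerates xss F \<longleftrightarrow>
     set (map set xss) = F \<and> distinct (map set xss) \<and> (\<forall>xs \<in> set xss. distinct xs)"

end

theory Submission
  imports Defs "HOL-Library.Discrete_Functions"
begin

text \<open>Let \<open>x\<close> separate a vertex set \<open>C\<close> into \<open>A\<close> and \<open>C - A - {x}\<close>, with all arcs between the two sides
  in one direction. A 2-vertex-connected subset of \<open>C\<close> lies in \<open>A \<union> {x}\<close> or in \<open>C - A\<close>, so \<open>C\<close> may be
  replaced by these two sets. There are at most \<open>n\<close> such splits, and the sets that cannot be split
  are the components. A split costs \<open>O(m)\<close>; it remains to find the separations fast enough.

  Let \<open>D\<close> be about \<open>log m\<close>. A separation with a side of at most \<open>D\<close> vertices is found by searches
  from a vertex of that side, truncated after \<open>D\<close> vertices, in time polynomial in \<open>D\<close>. A vertex is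
  searched again only when it has lost an arc, hence these searches take time \<open>O(m)\<close> times a
  polynomial in \<open>log m\<close>, which is \<open>O(nm)\<close>. When no such separation is left, a global test takes time
  \<open>O(m log m)\<close>. A separation that it finds has more than \<open>D\<close> vertices on both sides, and so the test
  can be charged to \<open>D\<close> vertices, with \<open>O(m)\<close> for each.

  The global test checks, for a root \<open>r\<close> and both directions, that no vertex other than \<open>r\<close> cuts
  another one off from \<open>r\<close>. The vertices are partitioned into colour classes, each of which is
  spanned from its top vertex. A vertex that is entered from another class becomes the top of a
  class of its own: two searches, from the old and the new top, race for the vertices of the class,
  and the lighter part is recoloured, for a total of \<open>O(m log m)\<close>. A vertex that is never entered
  in this way is cut off by the top of its class.\<close>

section \<open>A program logic with running times\<close>

text \<open>A single global test exceeds linear time by a logarithm, and up to \<open>n\<close>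
  splits may each ask for one; the whole difficulty is to keep this factor out of the bound. A split
  with more than \<open>D\<close> vertices on both sides earns it, because
  \<open>card C - 1 - D\<close>, summed over the components, then falls by at least
  \<open>D\<close>. The smaller separations must be detected without a global test, and each local
  search is cubic in \<open>D\<close>: at most \<open>D + 1\<close> candidates for the deleted
  vertex, at most \<open>D + 1\<close> visited vertices for each, at most \<open>D + 2\<close> list
  entries for each of these. As there are no parallel arcs, \<open>m \<le> n^2\<close>, so this cube
  of a logarithm is \<open>O(n)\<close>, and charging a constant number of local searches to every
  arc stays within \<open>O(n * m)\<close>. Paths occur only where strong connectivity is translated
  into cuts. Elsewhere, reachability is membership in every closed set that contains the start, and
  a separation is a set that no arc leaves, or none enters, except through \<open>x\<close>; this is
  what an exhausted search leaves behind. Only ends of arcs that are not loops are ever loaded, so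
  all sizes are bounded by multiples of \<open>m\<close>.\<close>

lemma afits_mono: "afits W s e \<Longrightarrow> W \<le> W' \<Longrightarrow> afits W' s e"
  by (induction e) auto

lemma bfits_mono: "bfits W s b \<Longrightarrow> W \<le> W' \<Longrightarrow> bfits W' s b"
  by (induction b) (auto intro: afits_mono)

lemmas exec_intros = exec.intros[simplified]

lemma exec_mono: "exec W c s t s' \<Longrightarrow> W \<le> W' \<Longrightarrow> exec W' c s t s'"
  by (induction rule: exec.induct) (auto intro: exec_intros afits_mono bfits_mono)

lemma ex_afits: "\<exists>W. afits W s e"
proof (induction e)
  case (Num x) then show ?case by (auto intro: exI[of _ "Suc x"])
next
  case (Reg r) then show ?case by (auto intro: exI[of _ "Suc (reg s r)"])
next
  case (Arr a e)
  then obtain W where "afits W s e" ..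
  then show ?case
    by (auto intro!: exI[of _ "max W (Suc (arr s a (aval s e)))"] elim: afits_mono)
next
  case (Bin f e1 e2)
  then obtain W1 W2 where "afits W1 s e1" "afits W2 s e2" by blast
  then show ?case
    by (auto intro!: exI[of _ "max (max W1 W2) (Suc (op_val f (aval s e1) (aval s e2)))"]
        elim: afits_mono)
qed

lemma ex_bfits: "\<exists>W. bfits W s b"
proof (induction b)
  case (Less e1 e2)
  obtain W1 W2 where "afits W1 s e1" "afits W2 s e2" using ex_afits by blast
  then show ?case by (auto intro!: exI[of _ "max W1 W2"] elim: afits_mono)
next
  case (Equal e1 e2)
  obtain W1 W2 where "afits W1 s e1" "afits W2 s e2" using ex_afits by blast
  then show ?case by (auto intro!: exI[of _ "max W1 W2"] elim: afits_mono)
next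
  case (Conj b1 b2)
  then obtain W1 W2 where "bfits W1 s b1" "bfits W2 s b2" by blast
  then show ?case by (auto intro!: exI[of _ "max W1 W2"] elim: bfits_mono)
qed simp

text \<open>The word size is existentially quantified, so that overflow plays no role in this logic;
  \<open>exec_word\<close> below recovers it from the running time. The argument \<open>T\<close> is the time consumed so far.\<close>

definition wp :: "com \<Rightarrow> (state \<Rightarrow> nat \<Rightarrow> bool) \<Rightarrow> state \<Rightarrow> nat \<Rightarrow> bool" where
  "wp c Q s T \<longleftrightarrow> (\<exists>W t s'. exec W c s t s' \<and> Q s' (T + t))"

lemma wp_Skip [simp]: "wp Skip Q s T \<longleftrightarrow> Q s (T + 1)"
  unfolding wp_def by (auto elim!: SkipE) (metis add_Suc_right add.right_neutral exec_intros(1))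

lemma wp_Assign [simp]:
  "wp (Assign r e) Q s T \<longleftrightarrow> Q (s\<lparr>reg := (reg s)(r := aval s e)\<rparr>) (T + (acost e + 1))"
  (is "?L \<longleftrightarrow> ?R")
proof
  assume ?L then show ?R unfolding wp_def by (auto elim!: AssignE)
next
  assume R: ?R
  obtain W where "afits W s e" using ex_afits by blast
  from exec.Assign[OF this] R show ?L unfolding wp_def by blast
qed

lemma wp_Store [simp]:
  "wp (Store a i e) Q s T \<longleftrightarrow>
     Q (s\<lparr>arr := (arr s)(a := (arr s a)(aval s i := aval s e))\<rparr>) (T + (acost i + acost e + 1))"
  (is "?L \<longleftrightarrow> ?R")
proof
  assume ?L then show ?R unfolding wp_def by (auto elim!: StoreE simp: add_ac)
next
  assume R: ?R
  obtain W1 W2 where "afits W1 s i" "afits W2 s e" using ex_afits by blast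
  then have "afits (max W1 W2) s i" "afits (max W1 W2) s e" by (auto elim: afits_mono)
  from exec.Store[OF this] R show ?L unfolding wp_def by blast
qed

lemma wp_Seq [simp]: "wp (Seq c1 c2) Q s T \<longleftrightarrow> wp c1 (wp c2 Q) s T"
proof
  assume "wp (Seq c1 c2) Q s T"
  then show "wp c1 (wp c2 Q) s T"
    unfolding wp_def by (auto elim!: SeqE simp: add.assoc[symmetric]) blast
next
  assume "wp c1 (wp c2 Q) s T"
  then obtain W1 t1 s1 W2 t2 s2 where
    e: "exec W1 c1 s t1 s1" "exec W2 c2 s1 t2 s2" and q: "Q s2 (T + t1 + t2)"
    unfolding wp_def by auto
  have "exec (max W1 W2) (Seq c1 c2) s (t1 + t2) s2"
    using e by (intro exec.Seq) (auto elim: exec_mono)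
  then show "wp (Seq c1 c2) Q s T"
    unfolding wp_def using q by (auto simp: add.assoc intro!: exI)
qed

lemma wp_Cond [simp]:
  "wp (Cond b c1 c2) Q s T \<longleftrightarrow>
     (if bval s b then wp c1 Q s (T + (bcost b + 1)) else wp c2 Q s (T + (bcost b + 1)))"
  (is "?L \<longleftrightarrow> ?R")
proof
  assume ?L then show ?R
    unfolding wp_def by (auto elim!: CondE simp: add.assoc intro!: exI)
next
  assume R: ?R
  obtain W0 where W0: "bfits W0 s b" using ex_bfits by blast
  show ?L
  proof (cases "bval s b")
    case True
    with R obtain W t s' where e: "exec W c1 s t s'" and q: "Q s' (T + (bcost b + 1) + t)"
      unfolding wp_def by auto
    have "exec (max W0 W) (Cond b c1 c2) s (bcost b + 1 + t) s'"
      using W0 e True by (intro exec.CondTrue) (auto elim: exec_mono bfits_mono)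
    then show ?thesis unfolding wp_def using q by (metis add.assoc)
  next
    case False
    with R obtain W t s' where e: "exec W c2 s t s'" and q: "Q s' (T + (bcost b + 1) + t)"
      unfolding wp_def by auto
    have "exec (max W0 W) (Cond b c1 c2) s (bcost b + 1 + t) s'"
      using W0 e False by (intro exec.CondFalse) (auto elim: exec_mono bfits_mono)
    then show ?thesis unfolding wp_def using q by (metis add.assoc)
  qed
qed

lemma wp_mono: "wp c Q s T \<Longrightarrow> (\<And>s' T'. Q s' T' \<Longrightarrow> Q' s' T') \<Longrightarrow> wp c Q' s T"
  unfolding wp_def by blast

lemma wp_While_unfold:
  assumes "bval s b" "wp c (wp (While b c) Q) s (T + (bcost b + 1))"
  shows "wp (While b c) Q s T"
proof -
  obtain W1 t1 s1 W2 t2 s2 where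
    e: "exec W1 c s t1 s1" "exec W2 (While b c) s1 t2 s2"
    and q: "Q s2 (T + (bcost b + 1) + t1 + t2)"
    using assms(2) unfolding wp_def by auto
  obtain W0 where W0: "bfits W0 s b" using ex_bfits by blast
  have "exec (max W0 (max W1 W2)) (While b c) s (bcost b + 1 + t1 + t2) s2"
    using e W0 assms(1) by (intro exec.WhileTrue) (auto elim: exec_mono bfits_mono)
  then show ?thesis unfolding wp_def using q by (metis add.assoc)
qed

lemma wp_While_exit:
  assumes "\<not> bval s b" "Q s (T + (bcost b + 1))"
  shows "wp (While b c) Q s T"
proof -
  obtain W where "bfits W s b" using ex_bfits by blast
  from exec.WhileFalse[OF this assms(1)] assms(2) show ?thesis unfolding wp_def by blast
qed

section \<open>Frame conditions from the registers and arrays that a program can write\<close>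

fun wr :: "com \<Rightarrow> nat set" where
  "wr Skip = {}"
| "wr (Assign r e) = {r}"
| "wr (Store a i e) = {}"
| "wr (Seq c1 c2) = wr c1 \<union> wr c2"
| "wr (Cond b c1 c2) = wr c1 \<union> wr c2"
| "wr (While b c) = wr c"

fun wa :: "com \<Rightarrow> nat set" where
  "wa Skip = {}"
| "wa (Assign r e) = {}"
| "wa (Store a i e) = {a}"
| "wa (Seq c1 c2) = wa c1 \<union> wa c2"
| "wa (Cond b c1 c2) = wa c1 \<union> wa c2"
| "wa (While b c) = wa c"

definition same :: "nat set \<Rightarrow> nat set \<Rightarrow> state \<Rightarrow> state \<Rightarrow> bool" where
  "same R A s s' \<longleftrightarrow> (\<forall>r. r \<notin> R \<longrightarrow> reg s' r = reg s r) \<and> (\<forall>a. a \<notin> A \<longrightarrow> arr s' a = arr s a)"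

lemma same_refl [simp]: "same R A s s"
  by (simp add: same_def)

lemma same_trans: "same R A s s' \<Longrightarrow> same R A s' s'' \<Longrightarrow> same R A s s''"
  by (simp add: same_def)

lemma sameD:
  assumes "same R A s s'"
  shows "r \<notin> R \<Longrightarrow> reg s' r = reg s r" "a \<notin> A \<Longrightarrow> arr s' a = arr s a"
  using assms by (auto simp: same_def)

lemma exec_same: "exec W c s t s' \<Longrightarrow> same (wr c) (wa c) s s'"
  by (induction rule: exec.induct) (auto simp: same_def)

lemma wp_frame:
  "wp c Q s T \<Longrightarrow> (\<And>s' T'. Q s' T' \<Longrightarrow> same (wr c) (wa c) s s' \<Longrightarrow> Q' s' T') \<Longrightarrow> wp c Q' s T"
  unfolding wp_def using exec_same by blast

text \<open>Every iteration takes at least one step, so that a bound on the consumed time implies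
  termination.\<close>

lemma wp_While:
  assumes "I s0 T0"
    and bound: "\<And>s T. I s T \<Longrightarrow> same (wr c) (wa c) s0 s \<Longrightarrow> T \<le> B"
    and body: "\<And>s T. I s T \<Longrightarrow> same (wr c) (wa c) s0 s \<Longrightarrow> bval s b \<Longrightarrow>
      wp c I s (T + (bcost b + 1))"
    and exit: "\<And>s T. I s T \<Longrightarrow> same (wr c) (wa c) s0 s \<Longrightarrow> \<not> bval s b \<Longrightarrow>
      Q s (T + (bcost b + 1))"
  shows "wp (While b c) Q s0 T0"
proof -
  have "wp (While b c) Q s T" if "I s T" "same (wr c) (wa c) s0 s" for s T
    using that
  proof (induction "B - T" arbitrary: s T rule: less_induct)
    case less
    show ?case
    proof (cases "bval s b")
      case True
      have "wp c (wp (While b c) Q) s (T + (bcost b + 1))"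
      proof (rule wp_frame[OF wp_mono[of c "\<lambda>s' T'. I s' T' \<and> T < T'"]])
        show "wp c (\<lambda>s' T'. I s' T' \<and> T < T') s (T + (bcost b + 1))"
          using body[OF less.prems True] unfolding wp_def by fastforce
        fix s' T' assume I: "I s' T' \<and> T < T'" and sm: "same (wr c) (wa c) s s'"
        have sm': "same (wr c) (wa c) s0 s'" using less.prems(2) sm by (rule same_trans)
        have "B - T' < B - T" using I bound[OF _ sm'] by fastforce
        then show "wp (While b c) Q s' T'" using less.hyps I sm' by blast
      qed
      with True show ?thesis by (rule wp_While_unfold)
    next
      case False
      with exit[OF less.prems] show ?thesis by (auto intro: wp_While_exit)
    qed
  qed
  with assms(1) show ?thesis by simp
qed

subsection \<open>Overflow\<close>

fun lim_a :: "nat \<Rightarrow> aexp \<Rightarrow> bool" where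
  "lim_a d (Num x) \<longleftrightarrow> x \<le> d"
| "lim_a d (Reg r) \<longleftrightarrow> True"
| "lim_a d (Arr a e) \<longleftrightarrow> lim_a d e"
| "lim_a d (Bin f e1 e2) \<longleftrightarrow> lim_a d e1 \<and> lim_a d e2 \<and>
     (case f of Add \<Rightarrow> (case e2 of Num x \<Rightarrow> True | _ \<Rightarrow> False) | Mul \<Rightarrow> False | _ \<Rightarrow> True)"

fun lim_b :: "nat \<Rightarrow> bexp \<Rightarrow> bool" where
  "lim_b d (Less e1 e2) \<longleftrightarrow> lim_a d e1 \<and> lim_a d e2"
| "lim_b d (Equal e1 e2) \<longleftrightarrow> lim_a d e1 \<and> lim_a d e2"
| "lim_b d (Neg b) \<longleftrightarrow> lim_b d b"
| "lim_b d (Conj b1 b2) \<longleftrightarrow> lim_b d b1 \<and> lim_b d b2"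

text \<open>Programs in which one step increases the largest value by at most \<open>d\<close>.\<close>

fun lim :: "nat \<Rightarrow> com \<Rightarrow> bool" where
  "lim d Skip \<longleftrightarrow> True"
| "lim d (Assign r e) \<longleftrightarrow> lim_a d e"
| "lim d (Store a i e) \<longleftrightarrow> lim_a d i \<and> lim_a d e"
| "lim d (Seq c1 c2) \<longleftrightarrow> lim d c1 \<and> lim d c2"
| "lim d (Cond b c1 c2) \<longleftrightarrow> lim_b d b \<and> lim d c1 \<and> lim d c2"
| "lim d (While b c) \<longleftrightarrow> lim_b d b \<and> lim d c"

definition cells_le :: "nat \<Rightarrow> state \<Rightarrow> bool" where
  "cells_le M s \<longleftrightarrow> (\<forall>r. reg s r \<le> M) \<and> (\<forall>a i. arr s a i \<le> M)"

lemma cells_le_mono: "cells_le M s \<Longrightarrow> M \<le> M' \<Longrightarrow> cells_le M' s"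
  unfolding cells_le_def by (meson le_trans)

lemma aval_lim:
  assumes "lim_a d e" "cells_le M s"
  shows "aval s e \<le> M + d * acost e \<and> (M + d * acost e < W \<longrightarrow> afits W s e)"
  using assms(1)
proof (induction e)
  case (Arr a e)
  have "arr s a (aval s e) \<le> M" using assms(2) by (simp add: cells_le_def)
  then show ?case using Arr by (auto simp: algebra_simps)
next
  case (Bin f e1 e2)
  have 1: "aval s e1 \<le> M + d * acost e1" "M + d * acost e1 < W \<longrightarrow> afits W s e1"
    and 2: "aval s e2 \<le> M + d * acost e2" "M + d * acost e2 < W \<longrightarrow> afits W s e2"
    using Bin by auto
  have "op_val f (aval s e1) (aval s e2) \<le> M + d * acost (Bin f e1 e2)"
  proof (cases f)
    case Add
    then obtain x where "e2 = Num x" "x \<le> d" using Bin.prems by (cases e2) auto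
    then show ?thesis using 1 Add by (simp add: algebra_simps)
  next
    case Mul then show ?thesis using Bin.prems by simp
  next
    case Sub then show ?thesis using 1 by (simp add: algebra_simps)
  next
    case Div
    have "aval s e1 div aval s e2 \<le> aval s e1" by simp
    also have "\<dots> \<le> M + d * acost (Bin f e1 e2)" using 1(1) by (simp add: algebra_simps)
    finally show ?thesis using Div by simp
  next
    case Mod
    have "aval s e1 mod aval s e2 \<le> aval s e1" by (rule mod_less_eq_dividend)
    also have "\<dots> \<le> M + d * acost (Bin f e1 e2)" using 1(1) by (simp add: algebra_simps)
    finally show ?thesis using Mod by simp
  qed
  then show ?case using 1 2 by (auto simp: algebra_simps)
qed (use assms(2) in \<open>auto simp: cells_le_def intro: trans_le_add1 le_less_trans\<close>)

lemma bfits_lim: "lim_b d b \<Longrightarrow> cells_le M s \<Longrightarrow> M + d * bcost b < W \<Longrightarrow> bfits W s b"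
proof (induction b)
  case (Less e1 e2) then show ?case
    using aval_lim[of d e1 M s W] aval_lim[of d e2 M s W] by (auto simp: algebra_simps)
next
  case (Equal e1 e2) then show ?case
    using aval_lim[of d e1 M s W] aval_lim[of d e2 M s W] by (auto simp: algebra_simps)
qed (auto simp: algebra_simps)

text \<open>One step raises the largest cell by at most \<open>d\<close>, so after \<open>t\<close>
  steps no word exceeds \<open>M + d * t\<close>. A running time proved for some unspecified word
  size thereby determines a word size that suffices, and no program below requires an overflow
  argument of its own.\<close>

lemma exec_word:
  assumes "exec W c s t s'" "lim d c" "cells_le M s" "M + d * t < W'"
  shows "exec W' c s t s' \<and> cells_le (M + d * t) s'"
  using assms
proof (induction arbitrary: M rule: exec.induct)
  case (Skip s)
  then show ?case using exec.Skip by (auto elim: cells_le_mono)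
next
  case (Assign s e r)
  have e: "aval s e \<le> M + d * (acost e + 1)" "afits W' s e"
    using aval_lim[of d e M s W'] Assign by (auto simp: algebra_simps)
  have "cells_le (M + d * (acost e + 1)) s" using Assign.prems by (auto elim: cells_le_mono)
  with e(1) have "cells_le (M + d * (acost e + 1)) (s\<lparr>reg := (reg s)(r := aval s e)\<rparr>)"
    by (simp add: cells_le_def)
  with exec.Assign[OF e(2)] show ?case by blast
next
  case (Store s i e a)
  have e: "aval s e \<le> M + d * (acost i + acost e + 1)" "afits W' s e" "afits W' s i"
    using aval_lim[of d e M s W'] aval_lim[of d i M s W'] Store by (auto simp: algebra_simps)
  have "cells_le (M + d * (acost i + acost e + 1)) s"
    using Store.prems by (auto elim: cells_le_mono)
  with e(1) have "cells_le (M + d * (acost i + acost e + 1))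
      (s\<lparr>arr := (arr s)(a := (arr s a)(aval s i := aval s e))\<rparr>)"
    by (simp add: cells_le_def)
  with exec.Store[OF e(3,2)] show ?case by blast
next
  case (Seq c1 s t1 s1 c2 t2 s2)
  have 1: "exec W' c1 s t1 s1" "cells_le (M + d * t1) s1"
    using Seq.IH(1)[of M] Seq.prems by (auto simp: algebra_simps)
  have 2: "exec W' c2 s1 t2 s2" "cells_le (M + d * t1 + d * t2) s2"
    using Seq.IH(2)[of "M + d * t1"] Seq.prems 1 by (auto simp: algebra_simps)
  show ?case using exec.Seq[OF 1(1) 2(1)] 2(2) by (simp add: algebra_simps)
next
  case (CondTrue s b c1 t s1 c2)
  have b: "bfits W' s b"
    using CondTrue.prems by (intro bfits_lim[of d b M]) (auto simp: algebra_simps)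
  have 1: "exec W' c1 s t s1" "cells_le (M + d * t) s1"
    using CondTrue.IH[of M] CondTrue.prems by (auto simp: algebra_simps)
  have "cells_le (M + d * (bcost b + 1 + t)) s1" using 1(2) by (rule cells_le_mono) (simp add: algebra_simps)
  with exec.CondTrue[OF b CondTrue.hyps(2) 1(1)] show ?case by blast
next
  case (CondFalse s b c2 t s1 c1)
  have b: "bfits W' s b"
    using CondFalse.prems by (intro bfits_lim[of d b M]) (auto simp: algebra_simps)
  have 1: "exec W' c2 s t s1" "cells_le (M + d * t) s1"
    using CondFalse.IH[of M] CondFalse.prems by (auto simp: algebra_simps)
  have "cells_le (M + d * (bcost b + 1 + t)) s1" using 1(2) by (rule cells_le_mono) (simp add: algebra_simps)
  with exec.CondFalse[OF b CondFalse.hyps(2) 1(1)] show ?case by blast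
next
  case (WhileFalse s b c)
  have b: "bfits W' s b"
    using WhileFalse.prems by (intro bfits_lim[of d b M]) (auto simp: algebra_simps)
  have "cells_le (M + d * (bcost b + 1)) s" using WhileFalse.prems(2) by (rule cells_le_mono) (simp add: algebra_simps)
  with exec.WhileFalse[OF b WhileFalse.hyps(2)] show ?case by blast
next
  case (WhileTrue s b c t1 s1 t2 s2)
  have b: "bfits W' s b"
    using WhileTrue.prems by (intro bfits_lim[of d b M]) (auto simp: algebra_simps)
  have 1: "exec W' c s t1 s1" "cells_le (M + d * t1) s1"
    using WhileTrue.IH(1)[of M] WhileTrue.prems by (auto simp: algebra_simps)
  have 2: "exec W' (While b c) s1 t2 s2" "cells_le (M + d * t1 + d * t2) s2"
    using WhileTrue.IH(2)[of "M + d * t1"] WhileTrue.prems 1 by (auto simp: algebra_simps)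
  have "cells_le (M + d * (bcost b + 1 + t1 + t2)) s2"
    using 2(2) by (rule cells_le_mono) (simp add: algebra_simps)
  with exec.WhileTrue[OF b WhileTrue.hyps(2) 1(1) 2(1)] show ?case by blast
qed

section \<open>Separations\<close>

text \<open>The vertex \<open>x\<close> need not lie in \<open>C\<close>, so that separations without a deleted vertex are included.\<close>

definition sepx :: "('a \<times> 'a) set \<Rightarrow> 'a set \<Rightarrow> 'a \<Rightarrow> 'a set \<Rightarrow> bool" where
  "sepx E C x A \<longleftrightarrow> A \<noteq> {} \<and> A \<subseteq> C - {x} \<and> C - A - {x} \<noteq> {} \<and>
     (E \<inter> A \<times> (C - A - {x}) = {} \<or> E \<inter> (C - A - {x}) \<times> A = {})"

definition good :: "('a \<times> 'a) set \<Rightarrow> 'a set \<Rightarrow> bool" where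
  "good E C \<longleftrightarrow> 3 \<le> card C \<and> (\<forall>x A. \<not> sepx E C x A)"

lemma sepx_swap: "sepx E C x A \<Longrightarrow> sepx E C x (C - A - {x})"
proof -
  assume *: "sepx E C x A"
  then have "C - (C - A - {x}) - {x} = A" by (auto simp: sepx_def)
  with * show ?thesis by (auto simp: sepx_def)
qed

text \<open>A loop never joins two disjoint sets. The program may therefore drop loops when it reads
  the arcs.\<close>

lemma sepx_Diff_Id: "sepx (E - Id) C x A \<longleftrightarrow> sepx E C x A"
proof -
  have "(E - Id) \<inter> A \<times> (C - A - {x}) = E \<inter> A \<times> (C - A - {x})"
    "(E - Id) \<inter> (C - A - {x}) \<times> A = E \<inter> (C - A - {x}) \<times> A" by auto
  then show ?thesis by (simp add: sepx_def)
qed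

lemma good_Diff_Id: "good (E - Id) C \<longleftrightarrow> good E C"
  by (simp add: good_def sepx_Diff_Id)

text \<open>If \<open>B\<close> met both sides, \<open>A \<inter> B\<close> would separate
  \<open>B\<close> at the same vertex \<open>x\<close>.\<close>

lemma good_split:
  assumes "good E B" "B \<subseteq> C" "sepx E C x A"
  shows "B \<subseteq> A \<union> (C \<inter> {x}) \<or> B \<subseteq> C - A"
proof (rule ccontr)
  assume "\<not> ?thesis"
  then have "A \<inter> B \<noteq> {}" "B - (A \<inter> B) - {x} \<noteq> {}" using assms(2) by auto
  moreover have "A \<inter> B \<subseteq> B - {x}" using assms(3) by (auto simp: sepx_def)
  moreover have "E \<inter> (A \<inter> B) \<times> (B - (A \<inter> B) - {x}) = {} \<or> E \<inter> (B - (A \<inter> B) - {x}) \<times> (A \<inter> B) = {}"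
    using assms(2,3) unfolding sepx_def by blast
  ultimately have "sepx E B x (A \<inter> B)" by (simp add: sepx_def)
  with assms(1) show False by (auto simp: good_def)
qed

text \<open>The set \<open>P\<close> consists of the vertices that await a local search.\<close>

definition pend_inv :: "('a \<times> 'a) set \<Rightarrow> 'a set \<Rightarrow> 'a set \<Rightarrow> nat \<Rightarrow> bool" where
  "pend_inv E C P D \<longleftrightarrow> (\<forall>x A. sepx E C x A \<longrightarrow> card A \<le> D \<longrightarrow> A \<inter> P \<noteq> {})"

text \<open>A new separation has lost an arc, for otherwise it would be a separation of the larger set.\<close>

lemma pend_inv_subset:
  assumes P: "pend_inv E C P D" and C': "C' \<subseteq> C" and P': "P \<inter> C' \<subseteq> P'"
    and lost: "\<And>u v. (u, v) \<in> E \<Longrightarrow> u \<in> C' \<Longrightarrow> v \<in> C - C' \<Longrightarrow> u \<in> P'"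
      "\<And>u v. (u, v) \<in> E \<Longrightarrow> u \<in> C - C' \<Longrightarrow> v \<in> C' \<Longrightarrow> v \<in> P'"
  shows "pend_inv E C' P' D"
  unfolding pend_inv_def
proof (intro allI impI notI)
  fix x A assume s: "sepx E C' x A" and card: "card A \<le> D" and 0: "A \<inter> P' = {}"
  have "A \<subseteq> C'" using s by (auto simp: sepx_def)
  have "A \<noteq> {}" "A \<subseteq> C - {x}" "C - A - {x} \<noteq> {}" using s C' by (auto simp: sepx_def)
  moreover have "E \<inter> A \<times> (C - A - {x}) = {} \<or> E \<inter> (C - A - {x}) \<times> A = {}"
  proof -
    have "E \<inter> A \<times> (C' - A - {x}) = {} \<or> E \<inter> (C' - A - {x}) \<times> A = {}"
      using s by (simp add: sepx_def)
    moreover have "E \<inter> A \<times> (C - C') = {}" "E \<inter> (C - C') \<times> A = {}"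
      using lost 0 \<open>A \<subseteq> C'\<close> by blast+
    moreover have "C - A - {x} \<subseteq> (C' - A - {x}) \<union> (C - C')" by blast
    ultimately show ?thesis by blast
  qed
  ultimately have "sepx E C x A" by (simp add: sepx_def)
  then have "A \<inter> P \<noteq> {}" using P card by (auto simp: pend_inv_def)
  then show False using 0 P' \<open>A \<subseteq> C'\<close> by blast
qed

subsection \<open>Maximal good sets\<close>

lemma arcs_ends_induce: "arcs_ends (with_proj G \<restriction> B) = parcs G \<inter> B \<times> B"
  by (auto simp: arcs_ends_conv induce_subgraph_def)

lemma induce_induce: "B \<subseteq> A \<Longrightarrow> (G \<restriction> A) \<restriction> B = G \<restriction> B"
  by (auto simp: induce_subgraph_def)

text \<open>The vertices reachable from \<open>u\<close> form a set that no arc leaves, so a missing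
  path amounts to a proper nonempty set without leaving arcs. This replaces paths by cuts, the form
  in which \<open>sepx\<close> is stated.\<close>

lemma strongly_connected_induce_iff:
  "strongly_connected (with_proj G \<restriction> B) \<longleftrightarrow>
     B \<noteq> {} \<and> (\<forall>R. R \<subset> B \<and> R \<noteq> {} \<longrightarrow> parcs G \<inter> R \<times> (B - R) \<noteq> {})"
  (is "?L \<longleftrightarrow> ?R")
proof
  assume L: ?L
  show ?R
  proof (intro conjI allI impI notI)
    assume "B = {}" then show False using L by (auto simp: strongly_connected_def)
  next
    fix R assume R: "R \<subset> B \<and> R \<noteq> {}" and 0: "parcs G \<inter> R \<times> (B - R) = {}"
    then obtain u v where uv: "u \<in> R" "v \<in> B - R" by blast
    have "(u, v) \<in> rtrancl_on B (parcs G \<inter> B \<times> B)"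
      using L uv R unfolding strongly_connected_def reachable_def arcs_ends_induce by auto
    then have "v \<in> R" using uv(1) by (induction rule: rtrancl_on_induct) (use 0 in auto)
    with uv show False by simp
  qed
next
  assume R: ?R
  have "(u, v) \<in> rtrancl_on B (parcs G \<inter> B \<times> B)" if "u \<in> B" "v \<in> B" for u v
  proof (rule ccontr)
    assume n: "(u, v) \<notin> rtrancl_on B (parcs G \<inter> B \<times> B)"
    define S where "S = {w \<in> B. (u, w) \<in> rtrancl_on B (parcs G \<inter> B \<times> B)}"
    have "S \<subset> B" "S \<noteq> {}" using n that by (auto simp: S_def)
    moreover have "parcs G \<inter> S \<times> (B - S) = {}"
      by (auto simp: S_def intro: rtrancl_on_into_rtrancl_on)
    ultimately show False using R by blast
  qed
  then show ?L
    using R unfolding strongly_connected_def reachable_def arcs_ends_induce by simp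
qed

lemma k_vertex_connected_2_iff:
  fixes A :: "nat set"
  assumes "finite A"
  shows "k_vertex_connected 2 (with_proj G \<restriction> A) \<longleftrightarrow> good (parcs G) A"
proof -
  have "(\<forall>X. X \<subset> A \<and> card X < 2 \<longrightarrow> strongly_connected (with_proj G \<restriction> (A - X))) \<longleftrightarrow>
      (\<forall>x S. \<not> sepx (parcs G) A x S)" (is "?L \<longleftrightarrow> ?R") if 3: "3 \<le> card A"
  proof
    assume L: ?L
    show ?R
    proof (intro allI notI)
      fix x S assume s: "sepx (parcs G) A x S"
      have "A \<inter> {x} \<subset> A" "card (A \<inter> {x}) < 2"
        using s by (auto simp: sepx_def card_insert_if Int_insert_right)
      then have "strongly_connected (with_proj G \<restriction> (A - A \<inter> {x}))" using L by blast
      then have sc: "\<And>R. R \<subset> A - {x} \<Longrightarrow> R \<noteq> {} \<Longrightarrow> parcs G \<inter> R \<times> (A - {x} - R) \<noteq> {}"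
        unfolding strongly_connected_induce_iff by (simp add: Diff_Int_distrib Diff_Int)
      \<comment> \<open>Strong connectivity supplies arcs that leave a set; the arcs that enter
        \<open>S\<close> are those that leave the other side.\<close>
      have "S \<subset> A - {x}" "A - S - {x} \<subset> A - {x}" "A - {x} - S = A - S - {x}"
        "A - {x} - (A - S - {x}) = S"
        using s by (auto simp: sepx_def)
      then show False using s sc[of S] sc[of "A - S - {x}"] by (auto simp: sepx_def)
    qed
  next
    assume R: ?R
    show ?L
    proof (intro allI impI)
      fix X assume X: "X \<subset> A \<and> card X < 2"
      have "finite X" using X assms by (meson finite_subset psubset_imp_subset)
      then obtain x where x: "X \<subseteq> {x}"
        using X card_le_Suc0_iff_eq[of X] by (cases "X = {}") (auto simp: less_2_cases_iff card_1_singleton_iff)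
      \<comment> \<open>Deleting nothing amounts to deleting some \<open>y\<close> outside
        \<open>A\<close>, which exists because \<open>A\<close> is finite.\<close>
      obtain y where y: "A - X = A - {y}"
      proof (cases "X = {}")
        case True
        obtain y where "y \<notin> A" using ex_new_if_finite[OF infinite_UNIV_nat assms] by blast
        then have "A - X = A - {y}" using True by simp
        then show ?thesis by (rule that)
      next
        case False
        then show ?thesis using that x by blast
      qed
      show "strongly_connected (with_proj G \<restriction> (A - X))"
        unfolding strongly_connected_induce_iff
      proof (intro conjI allI impI notI)
        assume "A - X = {}" then show False using X by blast
      next
        fix S assume S: "S \<subset> A - X \<and> S \<noteq> {}" and 0: "parcs G \<inter> S \<times> (A - X - S) = {}"
        have "sepx (parcs G) A y S" using S 0 y unfolding sepx_def by auto
        then show False using R by blast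
      qed
    qed
  qed
  then show ?thesis
    unfolding k_vertex_connected_def good_def
    by (auto simp: induce_induce)
qed

text \<open>Adding arcs on the same vertices preserves connectivity; hence a maximal subgraph is
  induced, and maximality can be decided among vertex sets.\<close>

lemma vccs_2_eq:
  fixes G :: "nat pair_pre_digraph"
  assumes "pair_fin_digraph G"
  shows "vccs 2 (with_proj G) = {A. A \<subseteq> pverts G \<and> good (parcs G) A \<and>
    (\<forall>B. B \<subseteq> pverts G \<and> good (parcs G) B \<and> A \<subseteq> B \<longrightarrow> B = A)}" (is "_ = ?M")
proof -
  interpret pair_fin_digraph G by fact
  have k2: "k_vertex_connected 2 (with_proj G \<restriction> A) \<longleftrightarrow> good (parcs G) A" if "A \<subseteq> pverts G" for A
    using k_vertex_connected_2_iff finite_subset[OF that pair_finite_verts] by blast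
  have wfi: "wf_digraph (with_proj G \<restriction> A)" for A
    by (rule wellformed_induce_subgraph)
  have ind: "subgraph (with_proj G \<restriction> A) (with_proj G)" if "A \<subseteq> pverts G" for A
    using that wf_digraph_axioms wfi[of A]
    by (auto simp: subgraph_def compatible_def induce_subgraph_def)
  show ?thesis
  proof (intro set_eqI iffI)
    fix A assume "A \<in> vccs 2 (with_proj G)"
    then obtain H where H: "pre_digraph.max_subgraph (with_proj G) (k_vertex_connected 2) H"
      and A: "A = verts H" by (auto simp: vccs_def)
    have iH: "induced_subgraph H (with_proj G)" using H by (rule max_k_vertex_connected_induced)
    then have Heq: "H = with_proj G \<restriction> A" using A
      by (auto simp: induced_subgraph_def induce_subgraph_def subgraph_def compatible_def
          intro!: pre_digraph.equality)
    have AV: "A \<subseteq> pverts G" using iH A by (auto simp: induced_subgraph_def subgraph_def)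
    have "good (parcs G) A" using H k2[OF AV] Heq by (simp add: pre_digraph.max_subgraph_def)
    moreover have "B = A" if B: "B \<subseteq> pverts G" "good (parcs G) B" "A \<subseteq> B" for B
    proof -
      have "subgraph H (with_proj G \<restriction> B)" using B(3) wfi unfolding Heq
        by (auto simp: subgraph_def compatible_def induce_subgraph_def)
      then have "with_proj G \<restriction> B = H"
        using H ind[OF B(1)] k2[OF B(1)] B(2) unfolding pre_digraph.max_subgraph_def by blast
      then show ?thesis using A by auto
    qed
    ultimately show "A \<in> ?M" using AV by blast
  next
    fix A assume "A \<in> ?M"
    then have AV: "A \<subseteq> pverts G" and g: "good (parcs G) A"
      and mx: "\<And>B. B \<subseteq> pverts G \<Longrightarrow> good (parcs G) B \<Longrightarrow> A \<subseteq> B \<Longrightarrow> B = A" by auto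
    have "pre_digraph.max_subgraph (with_proj G) (k_vertex_connected 2) (with_proj G \<restriction> A)"
    proof (rule pre_digraph.max_subgraphI)
      show "k_vertex_connected 2 (with_proj G \<restriction> A)" using k2 AV g by blast
      show "subgraph (with_proj G \<restriction> A) (with_proj G)" using AV by (rule ind)
      fix H assume ne: "with_proj G \<restriction> A \<noteq> H" and AH: "subgraph (with_proj G \<restriction> A) H"
        and HG: "subgraph H (with_proj G)"
      show "\<not> k_vertex_connected 2 H"
      proof
        assume k: "k_vertex_connected 2 H"
        have HV: "verts H \<subseteq> pverts G" using HG by (auto simp: subgraph_def)
        have sH: "subgraph H (with_proj G \<restriction> verts H)"
          using HG by (rule subgraph_induce_subgraphI2)
        \<comment> \<open>Passing from \<open>H\<close> to the subgraph induced by its vertices only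
          adds arcs.\<close>
        then have "k_vertex_connected 2 (with_proj G \<restriction> verts H)"
          using k arc_mono_k_vertex_connected unfolding arc_mono_def by fastforce
        then have "verts H = A"
          using mx[OF HV] k2[OF HV] AH by (auto simp: subgraph_def)
        then have "H = with_proj G \<restriction> A" using AH sH HG
          by (auto simp: induce_subgraph_def subgraph_def compatible_def
              intro!: pre_digraph.equality)
        with ne show False by simp
      qed
    qed
    then show "A \<in> vccs 2 (with_proj G)" unfolding vccs_def by force
  qed
qed

text \<open>Good sets have at least three vertices, so two of them that share at most one vertex are
  incomparable. The pairwise condition thus gives distinctness and, together with the covering of
  all good sets, maximality; the program never has to compare two sets.\<close>

lemma enumerates_vccs_2:
  fixes G :: "nat pair_pre_digraph"
  assumes G: "pair_fin_digraph G"
    and out: "\<And>xs. xs \<in> set outs \<Longrightarrow> distinct xs \<and> set xs \<subseteq> pverts G \<and> good (parcs G) (set xs)"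
    and cover: "\<And>A. A \<subseteq> pverts G \<Longrightarrow> good (parcs G) A \<Longrightarrow> \<exists>xs \<in> set outs. A \<subseteq> set xs"
    and pw: "sorted_wrt (\<lambda>A B. card (A \<inter> B) \<le> 1) (map set outs)"
  shows "enumerates outs (vccs 2 (with_proj G))"
proof -
  have card3: "3 \<le> card (set xs)" if "xs \<in> set outs" for xs
    using out[OF that] by (simp add: good_def)
  have pw': "i = j" if ij: "i < length outs" "j < length outs" "set (outs ! i) \<subseteq> set (outs ! j)" for i j
  proof (rule ccontr)
    assume "i \<noteq> j"
    then have "card (set (outs ! i) \<inter> set (outs ! j)) \<le> 1"
      using ij pw unfolding sorted_wrt_iff_nth_less
      by (cases "i < j") (auto simp: Int_commute dest: spec[of _ j] spec[of _ i])
    moreover have "set (outs ! i) \<inter> set (outs ! j) = set (outs ! i)" using ij by blast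
    ultimately show False using card3[of "outs ! i"] ij by simp
  qed
  have dist: "distinct (map set outs)"
    unfolding distinct_conv_nth using pw' by (metis length_map nth_map order_refl)
  have "set (map set outs) = vccs 2 (with_proj G)"
    unfolding vccs_2_eq[OF G]
  proof (intro set_eqI iffI)
    fix A assume "A \<in> set (map set outs)"
    then obtain i where i: "i < length outs" "A = set (outs ! i)" by (auto simp: in_set_conv_nth)
    then have A: "A \<subseteq> pverts G" "good (parcs G) A" using out by auto
    moreover have "B = A" if B: "B \<subseteq> pverts G" "good (parcs G) B" "A \<subseteq> B" for B
    proof -
      obtain xs where "xs \<in> set outs" "B \<subseteq> set xs" using cover B by blast
      then obtain j where "j < length outs" "B \<subseteq> set (outs ! j)" by (auto simp: in_set_conv_nth)
      moreover from this have "i = j" using i B by (intro pw') auto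
      ultimately show ?thesis using i B by blast
    qed
    ultimately show "A \<in> {A. A \<subseteq> pverts G \<and> good (parcs G) A \<and>
        (\<forall>B. B \<subseteq> pverts G \<and> good (parcs G) B \<and> A \<subseteq> B \<longrightarrow> B = A)}" by blast
  next
    fix A assume "A \<in> {A. A \<subseteq> pverts G \<and> good (parcs G) A \<and>
        (\<forall>B. B \<subseteq> pverts G \<and> good (parcs G) B \<and> A \<subseteq> B \<longrightarrow> B = A)}"
    then have A: "A \<subseteq> pverts G" "good (parcs G) A"
      and mx: "\<And>B. B \<subseteq> pverts G \<Longrightarrow> good (parcs G) B \<Longrightarrow> A \<subseteq> B \<Longrightarrow> B = A" by auto
    obtain xs where xs: "xs \<in> set outs" "A \<subseteq> set xs" using cover A by blast
    then have "set xs = A" using mx out by blast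
    then show "A \<in> set (map set outs)" using xs by auto
  qed
  with dist out show ?thesis by (auto simp: enumerates_def)
qed

section \<open>Bounded search\<close>

text \<open>Registers 0 and 1 arrive with the numbers of vertices and arcs. \<open>rvb\<close>,
  \<open>rve\<close>, \<open>rab\<close>, \<open>rae\<close> delimit the cells of the current
  component, \<open>rvt\<close> and \<open>rat\<close> are the first free cells, \<open>rits\<close>
  counts the stored components, and \<open>rcur\<close> is the next one to be loaded.\<close>

abbreviation (input) "rn \<equiv> 0::nat"
abbreviation (input) "rm \<equiv> 1::nat"
abbreviation (input) "rD \<equiv> 2::nat"
abbreviation (input) "rcur \<equiv> 3::nat"
abbreviation (input) "rits \<equiv> 4::nat"
abbreviation (input) "rvt \<equiv> 5::nat"
abbreviation (input) "rat \<equiv> 6::nat"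
abbreviation (input) "rvb \<equiv> 7::nat"
abbreviation (input) "rve \<equiv> 8::nat"
abbreviation (input) "rab \<equiv> 9::nat"
abbreviation (input) "rae \<equiv> 10::nat"
abbreviation (input) "rfd \<equiv> 11::nat"
abbreviation (input) "rx \<equiv> 12::nat"
abbreviation (input) "rxc \<equiv> 13::nat"
abbreviation (input) "rv \<equiv> 14::nat"
abbreviation (input) "rL \<equiv> 15::nat"
abbreviation (input) "rst \<equiv> 16::nat"
abbreviation (input) "rql \<equiv> 17::nat"
abbreviation (input) "rqh \<equiv> 18::nat"
abbreviation (input) "rov \<equiv> 19::nat"
abbreviation (input) "rp \<equiv> 20::nat"
abbreviation (input) "ru \<equiv> 21::nat"
abbreviation (input) "ri \<equiv> 22::nat"
abbreviation (input) "rj \<equiv> 23::nat"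
abbreviation (input) "rbl \<equiv> 24::nat"
abbreviation (input) "rno \<equiv> 25::nat"
abbreviation (input) "rot \<equiv> 26::nat"
abbreviation (input) "rnc \<equiv> 27::nat"
abbreviation (input) "rwl \<equiv> 28::nat"
abbreviation (input) "rb \<equiv> 29::nat"
abbreviation (input) "rk \<equiv> 30::nat"
abbreviation (input) "rsd \<equiv> 31::nat"
abbreviation (input) "rdn \<equiv> 32::nat"
abbreviation (input) "rcs \<equiv> 33::nat"
abbreviation (input) "rw \<equiv> 34::nat"
abbreviation (input) "rbad \<equiv> 35::nat"
abbreviation (input) "rl \<equiv> 36::nat"
abbreviation (input) "ren \<equiv> 37::nat"

text \<open>Arrays 0 to 3 belong to input and output. In the names of the linked lists,
  \<open>f\<close> stands for first cells and \<open>n\<close> for successor cells, followed by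
  \<open>O\<close>, \<open>I\<close> or \<open>B\<close> for outgoing, incoming or all incident
  arcs.\<close>

abbreviation (input) "aT \<equiv> 4::nat"
abbreviation (input) "aH \<equiv> 5::nat"
abbreviation (input) "aV \<equiv> 6::nat"
abbreviation (input) "aP \<equiv> 7::nat"
abbreviation (input) "aVB \<equiv> 8::nat"
abbreviation (input) "aAB \<equiv> 9::nat"
abbreviation (input) "afO \<equiv> 10::nat"
abbreviation (input) "anO \<equiv> 11::nat"
abbreviation (input) "afI \<equiv> 12::nat"
abbreviation (input) "anI \<equiv> 13::nat"
abbreviation (input) "afB \<equiv> 14::nat"
abbreviation (input) "anB \<equiv> 15::nat"
abbreviation (input) "abB \<equiv> 16::nat"
abbreviation (input) "akB \<equiv> 17::nat"
abbreviation (input) "amk \<equiv> 18::nat"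
abbreviation (input) "aq \<equiv> 19::nat"
abbreviation (input) "aB \<equiv> 20::nat"
abbreviation (input) "acol \<equiv> 21::nat"
abbreviation (input) "aflg \<equiv> 22::nat"
abbreviation (input) "awl \<equiv> 23::nat"
abbreviation (input) "aRQ \<equiv> 24::nat"
abbreviation (input) "acl \<equiv> 25::nat"
abbreviation (input) "atop \<equiv> 26::nat"
abbreviation (input) "aRH \<equiv> 27::nat"
abbreviation (input) "aRL \<equiv> 28::nat"
abbreviation (input) "aRP \<equiv> 29::nat"
abbreviation (input) "aRS \<equiv> 30::nat"
abbreviation (input) "aRC \<equiv> 31::nat"
abbreviation (input) "ain1 \<equiv> 32::nat"
abbreviation (input) "ain2 \<equiv> 33::nat"
abbreviation (input) "alost \<equiv> 34::nat"

notation Seq (infixr ";;" 55)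
abbreviation asg (infix "::=" 60) where "r ::= e \<equiv> Assign r e"
abbreviation "incr r \<equiv> Assign r (Bin Add (Reg r) (Num 1))"
abbreviation "If1 b c \<equiv> Cond b c Skip"

text \<open>A search from \<open>rv\<close> that avoids \<open>rx\<close> and gives up (\<open>rov\<close>) after more than \<open>rL\<close> vertices. The
  vertex number \<open>n\<close> is unused, so that \<open>rx = n\<close>, \<open>rxc = 0\<close> means that nothing is avoided.
  Visited vertices are marked by the fresh stamp \<open>rst\<close>, and \<open>rx\<close> too.\<close>

definition scan_nb :: "nat \<Rightarrow> nat \<Rightarrow> com" where
  "scan_nb nx nb =
    While (Conj (Less (Num 0) (Reg rp)) (Equal (Reg rov) (Num 0)))
      (ru ::= Arr nb (Reg rp) ;; rp ::= Arr nx (Reg rp) ;;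
       Cond (Equal (Arr amk (Reg ru)) (Reg rst)) Skip
         (Store amk (Reg ru) (Reg rst) ;; Store aq (Reg rql) (Reg ru) ;; incr rql ;;
          If1 (Less (Reg rL) (Reg rql)) (rov ::= Num 1)))"

definition search_loop :: "nat \<Rightarrow> nat \<Rightarrow> nat \<Rightarrow> com" where
  "search_loop f nx nb =
    While (Conj (Less (Reg rqh) (Reg rql)) (Equal (Reg rov) (Num 0)))
      (rp ::= Arr f (Arr aq (Reg rqh)) ;; incr rqh ;; scan_nb nx nb)"

definition search :: "nat \<Rightarrow> nat \<Rightarrow> nat \<Rightarrow> com" where
  "search f nx nb =
    (incr rst ;; Store amk (Reg rx) (Reg rst) ;; Store amk (Reg rv) (Reg rst) ;;
     Store aq (Num 0) (Reg rv) ;; rql ::= Num 1 ;; rqh ::= Num 0 ;; rov ::= Num 0 ;;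
     search_loop f nx nb ;;
     If1 (Conj (Equal (Reg rov) (Num 0))
           (Less (Reg rql) (Bin Sub (Bin Sub (Reg rve) (Reg rvb)) (Reg rxc))))
       (rfd ::= Num 1))"

text \<open>A linked list that starts in cell \<open>p\<close> and ends with index 0. The payload
  \<open>nb\<close> is a parameter, so that the same predicate describes lists of neighbours, of
  neighbours with a direction, and of the cells themselves.\<close>

fun nbs :: "(nat \<Rightarrow> nat) \<Rightarrow> (nat \<Rightarrow> 'b) \<Rightarrow> nat \<Rightarrow> 'b list \<Rightarrow> bool" where
  "nbs nx nb p [] \<longleftrightarrow> p = 0"
| "nbs nx nb p (y # ys) \<longleftrightarrow> p \<noteq> 0 \<and> nb p = y \<and> nbs nx nb (nx p) ys"

definition adjrep :: "state \<Rightarrow> nat \<Rightarrow> nat \<Rightarrow> nat \<Rightarrow> nat set \<Rightarrow> (nat \<Rightarrow> nat list) \<Rightarrow> bool" where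
  "adjrep s f nx nb C adj \<longleftrightarrow> (\<forall>v\<in>C. nbs (arr s nx) (arr s nb) (arr s f v) (adj v) \<and>
     distinct (adj v) \<and> set (adj v) \<subseteq> C)"

definition closed_nb :: "nat set \<Rightarrow> (nat \<Rightarrow> nat list) \<Rightarrow> nat \<Rightarrow> nat set \<Rightarrow> bool" where
  "closed_nb C adj x Z \<longleftrightarrow> Z \<subseteq> C \<and> (\<forall>z\<in>Z. set (adj z) \<subseteq> Z \<union> {x})"

text \<open>The condition on \<open>Z\<close> expresses that all visited vertices are reached from
  \<open>v\<close> within the visited set. The deleted vertex \<open>x\<close> bears the stamp
  without being in the queue, which makes the search pass over it. A search that gives up has
  exactly \<open>L + 1\<close> vertices in its queue.\<close>

definition queue :: "nat set \<Rightarrow> (nat \<Rightarrow> nat list) \<Rightarrow> nat \<Rightarrow> nat \<Rightarrow> nat \<Rightarrow> nat \<Rightarrow> nat list \<Rightarrow> state \<Rightarrow> bool"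
  where
  "queue C adj x v L st qs s \<longleftrightarrow>
     reg s rql = length qs \<and> (\<forall>i<length qs. arr s aq i = qs ! i) \<and>
     distinct qs \<and> set qs \<subseteq> C \<and> x \<notin> set qs \<and> v \<in> set qs \<and>
     (\<forall>u. arr s amk u = st \<longleftrightarrow> u \<in> set qs \<or> u = x) \<and> (\<forall>u. arr s amk u \<le> st) \<and>
     (\<forall>Z. v \<in> Z \<longrightarrow> (\<forall>z\<in>Z. set (adj z) \<inter> set qs \<subseteq> Z) \<longrightarrow> set qs \<subseteq> Z) \<and>
     reg s rov = (if L < length qs then 1 else 0) \<and> length qs \<le> L + 1"

lemma wr_scan_nb [simp]: "wr (scan_nb nx nb) = {rov, rp, ru, rql}"
  by (auto simp: scan_nb_def)

lemma wa_scan_nb [simp]: "wa (scan_nb nx nb) = {amk, aq}"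
  by (auto simp: scan_nb_def)

lemma wr_search_loop [simp]: "wr (search_loop f nx nb) = {rov, rp, ru, rql, rqh}"
  by (auto simp: search_loop_def)

lemma wa_search_loop [simp]: "wa (search_loop f nx nb) = {amk, aq}"
  by (auto simp: search_loop_def)

lemma wr_search [simp]: "wr (search f nx nb) = {rov, rp, ru, rql, rst, rqh, rfd}"
  by (auto simp: search_def)

lemma wa_search [simp]: "wa (search f nx nb) = {amk, aq}"
  by (auto simp: search_def)

lemma queue_cong:
  assumes "reg s' rql = reg s rql" "reg s' rov = reg s rov" "arr s' aq = arr s aq"
    "arr s' amk = arr s amk" "queue C adj x v L st qs s"
  shows "queue C adj x v L st qs s'"
  using assms by (simp add: queue_def)

lemma queue_push:
  assumes q: "queue C adj x v L st qs s" and len: "length qs \<le> L"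
    and z: "\<not> (z \<in> set qs \<or> z = x)" "z \<in> C"
    and y: "y \<in> set qs" "z \<in> set (adj y)"
    and s': "reg s' rql = Suc (length qs)" "arr s' aq = (arr s aq)(length qs := z)"
      "arr s' amk = (arr s amk)(z := st)" "reg s' rov = (if L < Suc (length qs) then 1 else 0)"
  shows "queue C adj x v L st (qs @ [z]) s'"
proof -
  have "set (qs @ [z]) \<subseteq> Z" if Z: "v \<in> Z" "\<forall>z'\<in>Z. set (adj z') \<inter> set (qs @ [z]) \<subseteq> Z" for Z
  proof -
    have "\<forall>z'\<in>Z. set (adj z') \<inter> set qs \<subseteq> Z" using Z(2) by auto
    then have "set qs \<subseteq> Z" using q Z(1) unfolding queue_def by blast
    then show ?thesis using Z(2) y by auto
  qed
  then show ?thesis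
    using q len z unfolding queue_def s' by (auto simp: nth_append less_Suc_eq)
qed

lemma same_mono: "same R A s s' \<Longrightarrow> R \<subseteq> R' \<Longrightarrow> A \<subseteq> A' \<Longrightarrow> same R' A' s s'"
  by (auto simp: same_def)

text \<open>A list of any length takes at most \<open>L + 2\<close> iterations: its entries are
  distinct, each one read so far is visited or equal to \<open>x\<close>, and at most
  \<open>L + 1\<close> vertices are ever visited. Truncation hence bounds the work per vertex as
  well as the number of vertices.\<close>

lemma wp_scan_nb:
  assumes q: "queue C adj x v L st qs s" and st: "reg s rst = st" and L: "reg s rL = L"
    and nb: "nbs (arr s nx) (arr s nb) (reg s rp) (adj y)" "distinct (adj y)" "set (adj y) \<subseteq> C"
    and y: "y \<in> set qs"
    and ne: "nx \<noteq> amk" "nx \<noteq> aq" "nb \<noteq> amk" "nb \<noteq> aq"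
    and post: "\<And>s' T' qs'. queue C adj x v L st qs' s' \<Longrightarrow> take (length qs) qs' = qs \<Longrightarrow>
      (reg s' rov = 0 \<Longrightarrow> set (adj y) \<subseteq> set qs' \<union> {x}) \<Longrightarrow>
      same {rov, rp, ru, rql} {amk, aq} s s' \<Longrightarrow>
      T' \<le> T + 40 * min (length (adj y)) (L + 2) + 10 \<Longrightarrow> Q s' T'"
  shows "wp (scan_nb nx nb) Q s T"
proof -
  let ?b = "Conj (Less (Num 0) (Reg rp)) (Equal (Reg rov) (Num 0))"
  let ?c = "ru ::= Arr nb (Reg rp) ;; rp ::= Arr nx (Reg rp) ;;
       Cond (Equal (Arr amk (Reg ru)) (Reg rst)) Skip
         (Store amk (Reg ru) (Reg rst) ;; Store aq (Reg rql) (Reg ru) ;; incr rql ;;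
          If1 (Less (Reg rL) (Reg rql)) (rov ::= Num 1))"
  define I where "I = (\<lambda>s1 T1. \<exists>qs1 zs ys. queue C adj x v L st qs1 s1 \<and>
    take (length qs) qs1 = qs \<and>
    nbs (arr s1 nx) (arr s1 nb) (reg s1 rp) ys \<and> adj y = zs @ ys \<and> set zs \<subseteq> set qs1 \<union> {x} \<and>
    T1 \<le> T + 40 * length zs)"
  have II: "I s1 T1" if "queue C adj x v L st qs1 s1" "take (length qs) qs1 = qs"
    "nbs (arr s1 nx) (arr s1 nb) (reg s1 rp) ys" "adj y = zs @ ys" "set zs \<subseteq> set qs1 \<union> {x}"
    "T1 \<le> T + 40 * length zs" for s1 T1 qs1 zs ys
    using that unfolding I_def by blast
  show ?thesis
    unfolding scan_nb_def
  proof (rule wp_While[where I = I and B = "T + 40 * length (adj y)"])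
    show "I s T" using q nb(1) by (intro II[of qs _ "adj y" "[]"]) auto
  next
    fix s1 T1 assume "I s1 T1"
    then show "T1 \<le> T + 40 * length (adj y)" unfolding I_def by fastforce
  next
    fix s1 T1
    assume I: "I s1 T1" and sm: "same (wr ?c)
       (wa ?c) s s1"
      and b: "bval s1 ?b"
    obtain qs1 zs ys where q1: "queue C adj x v L st qs1 s1" and pre: "take (length qs) qs1 = qs"
      and n1: "nbs (arr s1 nx) (arr s1 nb) (reg s1 rp) ys" and a: "adj y = zs @ ys"
      and zs: "set zs \<subseteq> set qs1 \<union> {x}" and T1: "T1 \<le> T + 40 * length zs"
      using I unfolding I_def by blast
    have fr: "reg s1 rst = st" "reg s1 rL = L" using sameD[OF sm] st L by auto
    have p: "reg s1 rp \<noteq> 0" and ov: "reg s1 rov = 0" using b by auto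
    obtain z ys' where ys: "ys = z # ys'" using n1 p by (cases ys) auto
    have z: "arr s1 nb (reg s1 rp) = z" "nbs (arr s1 nx) (arr s1 nb) (arr s1 nx (reg s1 rp)) ys'"
      using n1 ys by auto
    have len: "length qs1 \<le> L" using q1 ov by (auto simp: queue_def split: if_splits)
    have mk: "arr s1 amk z = st \<longleftrightarrow> z \<in> set qs1 \<or> z = x" using q1 by (simp add: queue_def)
    show "wp ?c I s1 (T1 + (bcost ?b + 1))"
    proof (cases "z \<in> set qs1 \<or> z = x")
      case True
      show ?thesis
        apply (simp add: z(1) fr mk True)
        apply (rule II[of qs1 _ ys' "zs @ [z]"], rule queue_cong[OF _ _ _ _ q1])
        using z T1 zs a ys pre True by auto
    next
      case False
      have zC: "z \<in> C" using nb(3) a ys by simp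
      have yq: "y \<in> set qs1" using y pre by (metis in_set_takeD)
      have za: "z \<in> set (adj y)" using a ys by simp
      have "length qs \<le> length qs1" using pre by (metis length_take min.cobounded1)
      then have pre': "take (length qs) (qs1 @ [z]) = qs" using pre by simp
      have ql: "reg s1 rql = length qs1" using q1 by (simp add: queue_def)
      show ?thesis
        apply (simp add: z(1) fr mk False ql)
        apply (intro conjI impI)
        subgoal
          apply (rule II[of "qs1 @ [z]" _ ys' "zs @ [z]"])
               apply (rule queue_push[OF q1 len False zC yq za])
          using z T1 zs a ys pre' ov ql by (auto simp: ne)
        subgoal
          apply (rule II[of "qs1 @ [z]" _ ys' "zs @ [z]"])
               apply (rule queue_push[OF q1 len False zC yq za])
          using z T1 zs a ys pre' ov ql by (auto simp: ne)
        done
    qed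
  next
    fix s1 T1
    assume I: "I s1 T1" and sm: "same (wr ?c) (wa ?c) s s1" and b: "\<not> bval s1 ?b"
    obtain qs1 zs ys where q1: "queue C adj x v L st qs1 s1" and pre: "take (length qs) qs1 = qs"
      and n1: "nbs (arr s1 nx) (arr s1 nb) (reg s1 rp) ys" and a: "adj y = zs @ ys"
      and zs: "set zs \<subseteq> set qs1 \<union> {x}" and T1: "T1 \<le> T + 40 * length zs"
      using I unfolding I_def by blast
    have "length zs = card (set zs)" using nb(2) a by (simp add: distinct_card)
    also have "\<dots> \<le> card (set qs1 \<union> {x})" using zs by (intro card_mono) auto
    also have "\<dots> \<le> length qs1 + 1" using card_length[of "x # qs1"] by simp
    also have "\<dots> \<le> L + 2" using q1 by (simp add: queue_def)
    finally have "length zs \<le> L + 2" .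
    then have "length zs \<le> min (length (adj y)) (L + 2)" using a by simp
    then have "40 * length zs \<le> 40 * min (length (adj y)) (L + 2)" by (rule mult_le_mono2)
    moreover have "bcost ?b + 1 \<le> 10" by simp
    ultimately have T': "T1 + (bcost ?b + 1) \<le> T + 40 * min (length (adj y)) (L + 2) + 10"
      using T1 by linarith
    show "Q s1 (T1 + (bcost ?b + 1))"
    proof (rule post[OF q1 pre _ _ T'])
      assume "reg s1 rov = 0"
      then have "ys = []" using b n1 by (cases ys) auto
      then show "set (adj y) \<subseteq> set qs1 \<union> {x}" using a zs by simp
    next
      show "same {rov, rp, ru, rql} {amk, aq} s s1" using sm by (rule same_mono) auto
    qed
  qed
qed


lemma sum_set_take_Suc:
  assumes "distinct xs" "h < length xs"
  shows "sum g (set (take (Suc h) xs)) = sum g (set (take h xs)) + (g (xs ! h) :: nat)"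
proof -
  have "xs ! h \<notin> set (take h xs)"
    using assms by (auto simp: in_set_conv_nth nth_eq_iff_index_eq)
  then show ?thesis using assms by (simp add: take_Suc_conv_app_nth)
qed

text \<open>Every queue entry is scanned at most once, so the time is a sum over a set of at most
  \<open>L + 1\<close> vertices, and a bound \<open>B\<close> for all such sets is enough.\<close>

lemma wp_search:
  assumes rep: "adjrep s f nx nb C adj" and fin: "finite C"
    and v: "reg s rv = v" "v \<in> C" "v \<noteq> x" and x: "reg s rx = x" and L: "reg s rL = L" "1 \<le> L"
    and mk: "\<And>u. arr s amk u \<le> reg s rst" and fd: "reg s rfd = 0"
    and ne: "f \<noteq> amk" "f \<noteq> aq" "nx \<noteq> amk" "nx \<noteq> aq" "nb \<noteq> amk" "nb \<noteq> aq"
    and B: "\<And>U. U \<subseteq> C \<Longrightarrow> card U \<le> L + 1 \<Longrightarrow> (\<Sum>u\<in>U. min (length (adj u)) (L + 2) + 1) \<le> B"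
    and post: "\<And>s' T' qs. queue C adj x v L (reg s' rst) qs s' \<Longrightarrow>
      (length qs \<le> L \<Longrightarrow> closed_nb C adj x (set qs)) \<Longrightarrow>
      reg s' rfd = (if length qs \<le> L \<and> length qs < reg s rve - reg s rvb - reg s rxc then 1 else 0) \<Longrightarrow>
      same {rov, rp, ru, rql, rst, rqh, rfd} {amk, aq} s s' \<Longrightarrow>
      T' \<le> T + 60 * B + 60 \<Longrightarrow> Q s' T'"
  shows "wp (search f nx nb) Q s T"
proof -
  let ?b = "Conj (Less (Reg rqh) (Reg rql)) (Equal (Reg rov) (Num 0))"
  let ?c = "rp ::= Arr f (Arr aq (Reg rqh)) ;; incr rqh ;; scan_nb nx nb"
  define st where "st = Suc (reg s rst)"
  define g where "g = (\<lambda>u. min (length (adj u)) (L + 2) + 1)"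
  define I where "I = (\<lambda>s1 T1. \<exists>qs h. queue C adj x v L st qs s1 \<and> reg s1 rqh = h \<and> h \<le> length qs \<and>
    reg s1 rst = st \<and> reg s1 rfd = 0 \<and>
    (reg s1 rov = 0 \<longrightarrow> (\<forall>i<h. set (adj (qs ! i)) \<subseteq> set qs \<union> {x})) \<and>
    same {rov, rp, ru, rql, rst, rqh, rfd} {amk, aq} s s1 \<and>
    T1 \<le> T + 30 + 60 * sum g (set (take h qs)))"
  have II: "I s1 T1" if "queue C adj x v L st qs s1" "reg s1 rqh = h" "h \<le> length qs"
    "reg s1 rst = st" "reg s1 rfd = 0" "reg s1 rov = 0 \<Longrightarrow> (\<forall>i<h. set (adj (qs ! i)) \<subseteq> set qs \<union> {x})"
    "same {rov, rp, ru, rql, rst, rqh, rfd} {amk, aq} s s1"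
    "T1 \<le> T + 30 + 60 * sum g (set (take h qs))" for s1 T1 qs h
    using that unfolding I_def by (intro exI[of _ qs] exI[of _ h]) simp
  have bnd: "sum g (set (take h qs)) \<le> B" if "queue C adj x v L st' qs s1" for s1 h qs st'
  proof -
    have "set (take h qs) \<subseteq> C" "card (set (take h qs)) \<le> L + 1"
      using that set_take_subset[of h qs] card_length[of "take h qs"] by (auto simp: queue_def)
    then show ?thesis using B unfolding g_def by blast
  qed
  have w: "wp (search_loop f nx nb) (\<lambda>s' T'. \<exists>qs. queue C adj x v L st qs s' \<and> reg s' rst = st \<and> reg s' rfd = 0 \<and>
      (length qs \<le> L \<longrightarrow> closed_nb C adj x (set qs)) \<and>
      same {rov, rp, ru, rql, rst, rqh, rfd} {amk, aq} s s' \<and> T' \<le> T + 60 * B + 40) s0 T0"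
    if "I s0 T0" for s0 T0
    unfolding search_loop_def
  proof (rule wp_While[where I = I and B = "T + 30 + 60 * B", OF that])
    fix s1 T1 assume "I s1 T1"
    then show "T1 \<le> T + 30 + 60 * B" unfolding I_def using bnd
      by (meson add_left_mono le_trans mult_le_mono2)
  next
    fix s1 T1 assume "I s1 T1" and b: "bval s1 ?b"
    then obtain qs h where q: "queue C adj x v L st qs s1" and h: "reg s1 rqh = h" "h \<le> length qs"
      and st1: "reg s1 rst = st" "reg s1 rfd = 0"
      and cl: "\<And>i. i < h \<Longrightarrow> set (adj (qs ! i)) \<subseteq> set qs \<union> {x}"
      and sm: "same {rov, rp, ru, rql, rst, rqh, rfd} {amk, aq} s s1"
      and T1: "T1 \<le> T + 30 + 60 * sum g (set (take h qs))"
      unfolding I_def by auto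
    have hl: "h < length qs" using b h q by (simp add: queue_def)
    have y: "qs ! h \<in> set qs" "qs ! h \<in> C" "arr s1 aq h = qs ! h"
      using hl q by (auto simp: queue_def)
    have fr: "arr s1 f = arr s f" "arr s1 nx = arr s nx" "arr s1 nb = arr s nb" "reg s1 rL = L"
      using sameD[OF sm] ne L by auto
    have nb: "nbs (arr s nx) (arr s nb) (arr s f (qs ! h)) (adj (qs ! h))"
      "distinct (adj (qs ! h))" "set (adj (qs ! h)) \<subseteq> C"
      using rep y by (auto simp: adjrep_def)
    have sum: "sum g (set (take (Suc h) qs)) = sum g (set (take h qs)) + g (qs ! h)"
      using q hl by (intro sum_set_take_Suc) (auto simp: queue_def)
    show "wp ?c I s1 (T1 + (bcost ?b + 1))"
      apply (simp add: h y fr)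
      apply (rule wp_scan_nb[where y = "qs ! h" and qs = qs and st = st and L = L,
            OF queue_cong[OF _ _ _ _ q]])
                     apply (simp_all add: st1 fr nb y ne)
      subgoal premises p for s' T' qs'
      proof (rule II[of qs' _ "Suc h"])
        have nth: "qs' ! i = qs ! i" if "i < length qs" for i
          using p(2) that by (metis nth_take)
        have le: "length qs \<le> length qs'" using p(2) by (metis length_take min.cobounded1)
        have sub: "set qs \<subseteq> set qs'" using p(2) by (metis set_take_subset)
        show "queue C adj x v L st qs' s'" by fact
        show "reg s' rqh = Suc h" "reg s' rst = st" "reg s' rfd = 0"
          using sameD(1)[OF p(4)] st1 by auto
        show "Suc h \<le> length qs'" using le hl by simp
        show "\<forall>i<Suc h. set (adj (qs' ! i)) \<subseteq> set qs' \<union> {x}" if "reg s' rov = 0"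
        proof (intro allI impI)
          fix i assume "i < Suc h"
          then show "set (adj (qs' ! i)) \<subseteq> set qs' \<union> {x}"
            using cl[of i] p(3)[OF that] sub nth[of i] hl by (cases "i = h") auto
        qed
        show "same {rov, rp, ru, rql, rst, rqh, rfd} {amk, aq} s s'"
          using sm p(4) by (auto simp: same_def)
        have "take (Suc h) qs' = take (Suc h) qs"
          using p(2) hl by (metis Suc_leI min.absorb1 take_take)
        moreover have gq: "g (qs ! h) = min (length (adj (qs ! h))) (L + 2) + 1" by (simp add: g_def)
        ultimately show "T' \<le> T + 30 + 60 * sum g (set (take (Suc h) qs'))"
          using p(5) T1 gq by (simp add: sum)
      qed
      done
  next
    fix s1 T1 assume "I s1 T1" and b: "\<not> bval s1 ?b"
    then obtain qs h where q: "queue C adj x v L st qs s1" and h: "reg s1 rqh = h" "h \<le> length qs"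
      and st1: "reg s1 rst = st" "reg s1 rfd = 0"
      and cl: "\<And>i. reg s1 rov = 0 \<Longrightarrow> i < h \<Longrightarrow> set (adj (qs ! i)) \<subseteq> set qs \<union> {x}"
      and sm: "same {rov, rp, ru, rql, rst, rqh, rfd} {amk, aq} s s1"
      and T1: "T1 \<le> T + 30 + 60 * sum g (set (take h qs))"
      unfolding I_def by auto
    have "closed_nb C adj x (set qs)" if "length qs \<le> L"
    proof -
      have ov: "reg s1 rov = 0" using q that by (simp add: queue_def)
      then have "h = length qs" using b h q by (simp add: queue_def)
      then have "\<forall>y\<in>set qs. set (adj y) \<subseteq> set qs \<union> {x}"
        using cl[OF ov] by (metis in_set_conv_nth)
      then show ?thesis using q by (auto simp: closed_nb_def queue_def)
    qed
    moreover have "T1 + (bcost ?b + 1) \<le> T + 60 * B + 40"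
      using T1 bnd[OF q, of h] by simp
    ultimately show "\<exists>qs. queue C adj x v L st qs s1 \<and> reg s1 rst = st \<and> reg s1 rfd = 0 \<and>
      (length qs \<le> L \<longrightarrow> closed_nb C adj x (set qs)) \<and>
      same {rov, rp, ru, rql, rst, rqh, rfd} {amk, aq} s s1 \<and> T1 + (bcost ?b + 1) \<le> T + 60 * B + 40"
      using q st1 sm by blast
  qed
  have mk': "arr s amk u \<noteq> st" "arr s amk u \<le> st" for u
    using mk[of u] unfolding st_def by auto
  show ?thesis
    unfolding search_def
    apply simp
    apply (rule wp_mono[OF w])
    subgoal
      apply (rule II[of "[v]" _ 0])
      using v x L fd mk' by (auto simp: queue_def st_def same_def)
    subgoal premises p for s' T'
    proof -
      obtain qs where q: "queue C adj x v L st qs s'" and st: "reg s' rst = st" "reg s' rfd = 0"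
        and cl: "length qs \<le> L \<longrightarrow> closed_nb C adj x (set qs)"
        and sm: "same {rov, rp, ru, rql, rst, rqh, rfd} {amk, aq} s s'"
        and T': "T' \<le> T + 60 * B + 40" using p by blast
      have fr: "reg s' rve = reg s rve" "reg s' rvb = reg s rvb" "reg s' rxc = reg s rxc"
        using sameD[OF sm] by auto
      have ql: "reg s' rql = length qs" "reg s' rov = 0 \<longleftrightarrow> length qs \<le> L"
        using q by (auto simp: queue_def)
      have q2: "queue C adj x v L st qs (s'\<lparr>reg := (reg s')(rfd := Suc 0)\<rparr>)"
        by (rule queue_cong[OF _ _ _ _ q]) simp_all
      show ?thesis
        apply (simp add: fr ql)
        apply (intro conjI impI; rule post[where qs = qs])
        using q q2 st cl sm T' ql by (auto simp: same_def)
    qed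
    done
qed

section \<open>Searches as a test for separations\<close>

definition adjrel :: "(nat \<times> nat) set \<Rightarrow> nat set \<Rightarrow> (nat \<Rightarrow> nat list) \<Rightarrow> bool" where
  "adjrel E C adj \<longleftrightarrow> (\<forall>u\<in>C. set (adj u) = {w \<in> C. (u, w) \<in> E})"

definition search_ctx ::
  "state \<Rightarrow> nat \<Rightarrow> nat \<Rightarrow> nat \<Rightarrow> (nat \<times> nat) set \<Rightarrow> nat set \<Rightarrow> (nat \<Rightarrow> nat list) \<Rightarrow> bool" where
  "search_ctx s f nx nb E C adj \<longleftrightarrow> adjrep s f nx nb C adj \<and> adjrel E C adj \<and> finite C \<and>
     card C = reg s rve - reg s rvb \<and> reg s rn \<notin> C \<and> (\<forall>u. arr s amk u \<le> reg s rst) \<and>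
     {f, nx, nb} \<inter> {amk, aq, aB} = {}"

text \<open>The total work of a search that visits at most \<open>L + 1\<close> vertices. It is kept
  abstract because it has two values, one quadratic in \<open>L\<close> for truncated searches and
  one linear in the component for complete ones.\<close>

definition sbound :: "nat set \<Rightarrow> (nat \<Rightarrow> nat list) \<Rightarrow> nat \<Rightarrow> nat \<Rightarrow> bool" where
  "sbound C adj L B \<longleftrightarrow>
     (\<forall>U. U \<subseteq> C \<longrightarrow> card U \<le> L + 1 \<longrightarrow> (\<Sum>u\<in>U. min (length (adj u)) (L + 2) + 1) \<le> B)"

definition sealed :: "(nat \<times> nat) set \<Rightarrow> nat set \<Rightarrow> nat \<Rightarrow> nat set \<Rightarrow> bool" where
  "sealed E C x Z \<longleftrightarrow> Z \<subseteq> C - {x} \<and> E \<inter> Z \<times> (C - Z - {x}) = {} \<and> C - Z - {x} \<noteq> {}"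

text \<open>The side found by a search is handed on only through its stamps. The deleted vertex
  bears the same stamp and has to be excluded.\<close>

definition marked :: "nat set \<Rightarrow> state \<Rightarrow> nat set" where
  "marked C s = {u \<in> C. arr s amk u = reg s rst \<and> u \<noteq> reg s rx}"

lemma sealed_sepx: "sealed E C x Z \<Longrightarrow> Z \<noteq> {} \<Longrightarrow> sepx E C x Z"
  by (auto simp: sealed_def sepx_def)

text \<open>The two alternatives in \<open>sepx\<close> differ only in the direction of the arcs, so
  one search routine detects both when it is run on the outgoing and on the incoming lists.\<close>

lemma sepx_sealed: "sepx E C x Z \<longleftrightarrow> Z \<noteq> {} \<and> (sealed E C x Z \<or> sealed (E\<inverse>) C x Z)"
proof -
  have "E\<inverse> \<inter> Z \<times> (C - Z - {x}) = {} \<longleftrightarrow> E \<inter> (C - Z - {x}) \<times> Z = {}" by auto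
  then show ?thesis by (auto simp: sealed_def sepx_def)
qed

text \<open>The visited set lies in every sealed \<open>Z\<close> with \<open>v \<in> Z\<close>. If
  such a \<open>Z\<close> has at most \<open>L\<close> vertices, the search cannot overflow and
  misses all vertices beyond \<open>Z\<close> and \<open>x\<close>, so it is bound to report a
  separation. The report itself rests on a mere count: fewer vertices were visited than
  \<open>C - {x}\<close> contains.\<close>

lemma wp_search_sealed:
  assumes ctx: "search_ctx s f nx nb E C adj"
    and v: "reg s rv \<in> C" "reg s rv \<noteq> reg s rx" and L: "1 \<le> reg s rL"
    and xc: "reg s rxc = (if reg s rx \<in> C then 1 else 0)" and fd: "reg s rfd = 0"
    and B: "sbound C adj (reg s rL) B"
    and post: "\<And>s' T' qs. search_ctx s' f nx nb E C adj \<Longrightarrow>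
      queue C adj (reg s rx) (reg s rv) (reg s rL) (reg s' rst) qs s' \<Longrightarrow>
      same {rov, rp, ru, rql, rst, rqh, rfd} {amk, aq} s s' \<Longrightarrow>
      reg s' rfd \<le> 1 \<Longrightarrow>
      (reg s' rfd = 1 \<Longrightarrow> sealed E C (reg s' rx) (marked C s') \<and> marked C s' \<noteq> {}) \<Longrightarrow>
      (\<And>Z. reg s' rfd = 0 \<Longrightarrow> sealed E C (reg s rx) Z \<Longrightarrow> reg s rv \<in> Z \<Longrightarrow> card Z \<le> reg s rL \<Longrightarrow> False) \<Longrightarrow>
      (reg s' rfd = 0 \<Longrightarrow> length qs \<le> reg s rL \<Longrightarrow> C \<subseteq> set qs \<union> {reg s rx}) \<Longrightarrow>
      T' \<le> T + 60 * B + 60 \<Longrightarrow> Q s' T'"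
  shows "wp (search f nx nb) Q s T"
proof -
  let ?x = "reg s rx" and ?v = "reg s rv" and ?L = "reg s rL"
  have rep: "adjrep s f nx nb C adj" and rel: "adjrel E C adj" and fin: "finite C"
    and card: "card C = reg s rve - reg s rvb" and n: "reg s rn \<notin> C"
    and mk: "\<And>u. arr s amk u \<le> reg s rst"
    and ne: "f \<noteq> amk" "f \<noteq> aq" "nx \<noteq> amk" "nx \<noteq> aq" "nb \<noteq> amk" "nb \<noteq> aq"
    using ctx by (auto simp: search_ctx_def)
  have cardx: "card (C - {?x}) = card C - reg s rxc" using fin by (simp add: xc card_Diff_singleton_if)
  show ?thesis
  proof (rule wp_search[OF rep fin refl v refl refl L mk fd ne])
    show "(\<Sum>u\<in>U. min (length (adj u)) (?L + 2) + 1) \<le> B" if "U \<subseteq> C" "card U \<le> ?L + 1" for U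
      using B that unfolding sbound_def by blast
    fix s' T' qs
    assume q: "queue C adj ?x ?v ?L (reg s' rst) qs s'"
      and cl: "length qs \<le> ?L \<Longrightarrow> closed_nb C adj ?x (set qs)"
      and fd': "reg s' rfd = (if length qs \<le> ?L \<and> length qs < reg s rve - reg s rvb - reg s rxc then 1 else 0)"
      and sm: "same {rov, rp, ru, rql, rst, rqh, rfd} {amk, aq} s s'"
      and T': "T' \<le> T + 60 * B + 60"
    have fr: "reg s' rx = ?x" "arr s' f = arr s f" "arr s' nx = arr s nx" "arr s' nb = arr s nb"
      "reg s' rve = reg s rve" "reg s' rvb = reg s rvb" "reg s' rn = reg s rn"
      using sameD[OF sm] ne by auto
    have qs: "distinct qs" "set qs \<subseteq> C" "?x \<notin> set qs" "?v \<in> set qs"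
      and min: "\<And>Z. ?v \<in> Z \<Longrightarrow> (\<forall>z\<in>Z. set (adj z) \<inter> set qs \<subseteq> Z) \<Longrightarrow> set qs \<subseteq> Z"
      and mk': "\<And>u. arr s' amk u = reg s' rst \<longleftrightarrow> u \<in> set qs \<or> u = ?x" "\<And>u. arr s' amk u \<le> reg s' rst"
      using q by (auto simp: queue_def)
    have ctx': "search_ctx s' f nx nb E C adj"
      using ctx mk' unfolding search_ctx_def adjrep_def fr by auto
    have m: "marked C s' = set qs" using qs mk' by (auto simp: marked_def fr)
    have lqs: "length qs = card (set qs)" using qs by (simp add: distinct_card)
    have lt: "length qs < card (C - {?x}) \<longleftrightarrow> C - set qs - {?x} \<noteq> {}"
    proof -
      have sub: "set qs \<subseteq> C - {?x}" using qs by auto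
      then have "card (set qs) \<le> card (C - {?x})" using fin by (intro card_mono) auto
      moreover have "card (set qs) = card (C - {?x}) \<Longrightarrow> set qs = C - {?x}"
        using sub fin by (intro card_subset_eq) auto
      ultimately show ?thesis using lqs qs by (metis Diff_insert Diff_insert0 Diff_cancel Diff_eq_empty_iff
            Diff_insert2 card_mono finite_set leD le_neq_implies_less)
    qed
    have fd1: "reg s' rfd = 1 \<longleftrightarrow> length qs \<le> ?L \<and> C - set qs - {?x} \<noteq> {}" "reg s' rfd \<le> 1"
      using fd' lt card cardx by auto
    show "Q s' T'"
    proof (rule post[OF ctx' q sm fd1(2) _ _ _ T'])
      assume "reg s' rfd = 1"
      then have *: "length qs \<le> ?L" "C - set qs - {?x} \<noteq> {}" using fd1 by auto
      have "(u, w) \<notin> E" if "u \<in> set qs" "w \<in> C - set qs - {?x}" for u w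
      proof
        assume "(u, w) \<in> E"
        then have "w \<in> set (adj u)" using rel that qs by (auto simp: adjrel_def)
        then show False using cl[OF *(1)] that by (auto simp: closed_nb_def)
      qed
      then show "sealed E C (reg s' rx) (marked C s') \<and> marked C s' \<noteq> {}"
        using * qs unfolding m fr sealed_def by auto
    next
      fix Z assume f0: "reg s' rfd = 0" and Z: "sealed E C ?x Z" "?v \<in> Z" "card Z \<le> ?L"
      have "set (adj z) \<inter> set qs \<subseteq> Z" if "z \<in> Z" for z
        using rel Z(1) that qs unfolding sealed_def adjrel_def by blast
      then have sub: "set qs \<subseteq> Z" using min Z(2) by blast
      have "Z \<subseteq> C" using Z(1) by (auto simp: sealed_def)
      then have "length qs \<le> ?L"
        using sub Z(3) fin lqs card_mono[of Z "set qs"] by (simp add: finite_subset)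
      moreover have "C - set qs - {?x} \<noteq> {}" using sub Z(1) by (auto simp: sealed_def)
      ultimately show False using fd1 f0 by simp
    next
      assume "reg s' rfd = 0" "length qs \<le> ?L"
      then show "C \<subseteq> set qs \<union> {?x}" using fd1 by auto
    qed
  qed
qed

section \<open>Local search\<close>

text \<open>A separating vertex is visited by the truncated search, or its removal leaves that search
  unchanged; hence only the visited vertices need to be tried.\<close>

definition copy_queue :: com where
  "copy_queue = While (Less (Reg rj) (Reg rql)) (Store aB (Reg rj) (Arr aq (Reg rj)) ;; incr rj)"

definition try_all :: "nat \<Rightarrow> nat \<Rightarrow> nat \<Rightarrow> com" where
  "try_all f nx nb =
    While (Conj (Less (Reg rj) (Reg rbl)) (Equal (Reg rfd) (Num 0)))
      (rx ::= Arr aB (Reg rj) ;; incr rj ;; If1 (Neg (Equal (Reg rx) (Reg rv))) (search f nx nb))"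

definition local_search :: "nat \<Rightarrow> nat \<Rightarrow> nat \<Rightarrow> com" where
  "local_search f nx nb =
    (rx ::= Reg rn ;; rxc ::= Num 0 ;; search f nx nb ;;
     If1 (Equal (Reg rfd) (Num 0))
       (rj ::= Num 0 ;; copy_queue ;; rbl ::= Reg rql ;; rj ::= Num 0 ;; rxc ::= Num 1 ;;
        try_all f nx nb))"

lemma wr_copy_queue [simp]: "wr copy_queue = {rj}"
  by (auto simp: copy_queue_def)

lemma wa_copy_queue [simp]: "wa copy_queue = {aB}"
  by (auto simp: copy_queue_def)

lemma wr_try_all [simp]: "wr (try_all f nx nb) = {rov, rp, ru, rql, rst, rqh, rfd, rx, rj}"
  by (auto simp: try_all_def)

lemma wa_try_all [simp]: "wa (try_all f nx nb) = {amk, aq}"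
  by (auto simp: try_all_def)

lemma wr_local_search [simp]:
  "wr (local_search f nx nb) = {rov, rp, ru, rql, rst, rqh, rfd, rx, rxc, rj, rbl}"
  by (auto simp: local_search_def)

lemma wa_local_search [simp]: "wa (local_search f nx nb) = {amk, aq, aB}"
  by (auto simp: local_search_def)

lemma wp_copy_queue:
  assumes j: "reg s rj = 0"
    and post: "\<And>s' T'. (\<And>i. i < reg s rql \<Longrightarrow> arr s' aB i = arr s aq i) \<Longrightarrow>
      same {rj} {aB} s s' \<Longrightarrow> T' \<le> T + 20 * reg s rql + 10 \<Longrightarrow> Q s' T'"
  shows "wp copy_queue Q s T"
  unfolding copy_queue_def
proof (rule wp_While[where B = "T + 20 * reg s rql" and
      I = "\<lambda>s1 T1. reg s1 rj \<le> reg s rql \<and> (\<forall>i<reg s1 rj. arr s1 aB i = arr s aq i) \<and>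
        T1 \<le> T + 20 * reg s1 rj"])
  show "reg s rj \<le> reg s rql \<and> (\<forall>i<reg s rj. arr s aB i = arr s aq i) \<and> T \<le> T + 20 * reg s rj"
    using j by simp
next
  fix s1 T1 assume I: "reg s1 rj \<le> reg s rql \<and> (\<forall>i<reg s1 rj. arr s1 aB i = arr s aq i) \<and>
    T1 \<le> T + 20 * reg s1 rj"
    and sm: "same (wr (Store aB (Reg rj) (Arr aq (Reg rj)) ;; incr rj))
      (wa (Store aB (Reg rj) (Arr aq (Reg rj)) ;; incr rj)) s s1"
  have fr: "reg s1 rql = reg s rql" "arr s1 aq = arr s aq" using sameD[OF sm] by auto
  show "T1 \<le> T + 20 * reg s rql" using I by simp
  show "wp (Store aB (Reg rj) (Arr aq (Reg rj)) ;; incr rj)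
      (\<lambda>s1 T1. reg s1 rj \<le> reg s rql \<and> (\<forall>i<reg s1 rj. arr s1 aB i = arr s aq i) \<and>
        T1 \<le> T + 20 * reg s1 rj) s1 (T1 + (bcost (Less (Reg rj) (Reg rql)) + 1))"
    if "bval s1 (Less (Reg rj) (Reg rql))"
    using I that fr by (auto simp: less_Suc_eq)
  show "Q s1 (T1 + (bcost (Less (Reg rj) (Reg rql)) + 1))"
    if "\<not> bval s1 (Less (Reg rj) (Reg rql))"
    using I that fr sm by (intro post) (auto simp: same_def)
qed

lemma wp_local_search:
  assumes ctx: "search_ctx s f nx nb E C adj"
    and v: "reg s rv \<in> C" and L: "1 \<le> reg s rL" and fd: "reg s rfd = 0"
    and B: "sbound C adj (reg s rL) B"
    and post: "\<And>s' T'. search_ctx s' f nx nb E C adj \<Longrightarrow>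
      same {rov, rp, ru, rql, rst, rqh, rfd, rx, rxc, rj, rbl} {amk, aq, aB} s s' \<Longrightarrow>
      reg s' rfd \<le> 1 \<Longrightarrow>
      (reg s' rfd = 1 \<Longrightarrow> sealed E C (reg s' rx) (marked C s') \<and> marked C s' \<noteq> {}) \<Longrightarrow>
      (\<And>x Z. reg s' rfd = 0 \<Longrightarrow> sealed E C x Z \<Longrightarrow> reg s rv \<in> Z \<Longrightarrow> card Z \<le> reg s rL \<Longrightarrow> False) \<Longrightarrow>
      T' \<le> T + (reg s rL + 2) * (60 * B + 200) \<Longrightarrow> Q s' T'"
  shows "wp (local_search f nx nb) Q s T"
proof -
  let ?v = "reg s rv" and ?L = "reg s rL"
  let ?b = "Conj (Less (Reg rj) (Reg rbl)) (Equal (Reg rfd) (Num 0))"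
  let ?c = "rx ::= Arr aB (Reg rj) ;; incr rj ;; If1 (Neg (Equal (Reg rx) (Reg rv))) (search f nx nb)"
  let ?R = "{rov, rp, ru, rql, rst, rqh, rfd, rx, rxc, rj, rbl}" and ?A = "{amk, aq, aB}"
  have n: "reg s rn \<notin> C" using ctx by (simp add: search_ctx_def)
  have ne: "f \<notin> ?A" "nx \<notin> ?A" "nb \<notin> ?A" using ctx by (auto simp: search_ctx_def)
  define fnd where "fnd = (\<lambda>s'. sealed E C (reg s' rx) (marked C s') \<and> marked C s' \<noteq> {})"
  define I where "I = (\<lambda>qs T0 s1 T1. search_ctx s1 f nx nb E C adj \<and> same ?R ?A s s1 \<and>
    reg s1 rj \<le> length qs \<and> reg s1 rfd \<le> 1 \<and> reg s1 rxc = 1 \<and> (reg s1 rfd = 1 \<longrightarrow> fnd s1) \<and>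
    reg s1 rbl = length qs \<and> (\<forall>i<length qs. arr s1 aB i = qs ! i) \<and>
    (reg s1 rfd = 0 \<longrightarrow> (\<forall>i<reg s1 rj. \<forall>Z. sealed E C (qs ! i) Z \<longrightarrow> ?v \<in> Z \<longrightarrow> \<not> card Z \<le> ?L)) \<and>
    T1 \<le> T0 + (60 * B + 90) * reg s1 rj)"
  have loop: "wp (try_all f nx nb) Q s0 T0"
    if I0: "I qs T0 s0 T0" and qs: "set qs \<subseteq> C" "length qs \<le> ?L + 1"
      and out: "\<And>x Z. x \<notin> set qs \<Longrightarrow> sealed E C x Z \<Longrightarrow> ?v \<in> Z \<Longrightarrow> card Z \<le> ?L \<Longrightarrow> False"
      and T0: "T0 + 20 + (60 * B + 90) * length qs \<le> T + (?L + 2) * (60 * B + 200)"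
    for qs s0 T0
    unfolding try_all_def
  proof (rule wp_While[where I = "I qs T0" and B = "T0 + (60 * B + 90) * length qs", OF I0])
    fix s1 T1 assume "I qs T0 s1 T1"
    then have "T1 \<le> T0 + (60 * B + 90) * reg s1 rj" "reg s1 rj \<le> length qs" by (auto simp: I_def)
    moreover from this(2) have "(60 * B + 90) * reg s1 rj \<le> (60 * B + 90) * length qs"
      by (rule mult_le_mono2)
    ultimately show "T1 \<le> T0 + (60 * B + 90) * length qs" by linarith
  next
    fix s1 T1 assume I1: "I qs T0 s1 T1" and b: "bval s1 ?b"
    have sm: "same ?R ?A s s1" and ctx1: "search_ctx s1 f nx nb E C adj" and f0: "reg s1 rfd = 0"
      and j: "reg s1 rj < length qs" and bl: "reg s1 rbl = length qs" and xc: "reg s1 rxc = 1"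
      and aB: "\<forall>i<length qs. arr s1 aB i = qs ! i"
      and no: "\<And>i Z. i < reg s1 rj \<Longrightarrow> sealed E C (qs ! i) Z \<Longrightarrow> ?v \<in> Z \<Longrightarrow> \<not> card Z \<le> ?L"
      and T1: "T1 \<le> T0 + (60 * B + 90) * reg s1 rj"
      using I1 b by (auto simp: I_def)
    have fr: "reg s1 rv = ?v" "reg s1 rL = ?L" using sameD[OF sm] by auto
    let ?x = "qs ! reg s1 rj"
    have x: "arr s1 aB (reg s1 rj) = ?x" "?x \<in> C" using aB j qs by auto
    have ctx2: "search_ctx (s1\<lparr>reg := (reg s1)(rx := ?x, rj := Suc (reg s1 rj))\<rparr>) f nx nb E C adj"
      using ctx1 by (simp add: search_ctx_def adjrep_def)
    show "wp ?c (I qs T0) s1 (T1 + (bcost ?b + 1))"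
    proof (cases "?x = ?v")
      \<comment> \<open>\<open>Z\<close> avoids \<open>x\<close>, so a candidate equal to
        \<open>v\<close> separates no \<open>Z\<close> that contains \<open>v\<close>.\<close>
      case True
      show ?thesis
        apply (simp add: x fr True)
        apply (unfold I_def)
        using ctx2 sm j f0 bl xc aB no T1 True
        by (auto simp: same_def less_Suc_eq sealed_def)
    next
      case False
      show ?thesis
        apply (simp add: x fr False)
        apply (rule wp_search_sealed[OF ctx2])
              apply (use x v fr False L f0 B xc in \<open>simp; fail\<close>)+
        subgoal premises p for s' T' qs'
        proof -
          note fr' = sameD[OF p(3)]
          show ?thesis
            unfolding I_def
          proof (intro conjI allI impI)
            show "search_ctx s' f nx nb E C adj" by fact
            show "same ?R ?A s s'" using sm p(3) by (auto simp: same_def)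
            show "reg s' rj \<le> length qs" using fr' j by simp
            show "reg s' rfd \<le> 1" using p(4) by simp
            show "reg s' rxc = 1" using fr' xc by simp
            show "fnd s'" if "reg s' rfd = 1" using p(5) that fr' by (simp add: fnd_def)
            show "reg s' rbl = length qs" using fr' bl by simp
            show "arr s' aB i = qs ! i" if "i < length qs" for i using fr' aB that by simp
            show "\<not> card Z \<le> ?L" if "reg s' rfd = 0" "i < reg s' rj" "sealed E C (qs ! i) Z" "?v \<in> Z" for i Z
              using p(6)[of Z] that no[of i Z] fr' fr by (cases "i = reg s1 rj") auto
            show "T' \<le> T0 + (60 * B + 90) * reg s' rj" using p(8) T1 fr' by (simp add: algebra_simps)
          qed
        qed
        done
    qed
  next
    fix s1 T1 assume I1: "I qs T0 s1 T1" and b: "\<not> bval s1 ?b"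
    have sm: "same ?R ?A s s1" and ctx1: "search_ctx s1 f nx nb E C adj" and f1: "reg s1 rfd \<le> 1"
      "reg s1 rfd = 1 \<longrightarrow> fnd s1"
      and j: "reg s1 rfd = 0 \<Longrightarrow> reg s1 rj = length qs" "reg s1 rj \<le> length qs"
      and no: "\<And>i Z. reg s1 rfd = 0 \<Longrightarrow> i < reg s1 rj \<Longrightarrow> sealed E C (qs ! i) Z \<Longrightarrow> ?v \<in> Z \<Longrightarrow> \<not> card Z \<le> ?L"
      and T1: "T1 \<le> T0 + (60 * B + 90) * reg s1 rj"
      using I1 b by (auto simp: I_def)
    show "Q s1 (T1 + (bcost ?b + 1))"
    proof (rule post[OF ctx1 sm f1(1)])
      show "sealed E C (reg s1 rx) (marked C s1) \<and> marked C s1 \<noteq> {}" if "reg s1 rfd = 1"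
        using f1 that by (simp add: fnd_def)
      show False if "reg s1 rfd = 0" "sealed E C x Z" "?v \<in> Z" "card Z \<le> ?L" for x Z
        using no[OF that(1)] out[of x Z] that j by (metis in_set_conv_nth)
      have "(60 * B + 90) * reg s1 rj \<le> (60 * B + 90) * length qs"
        using j by (intro mult_le_mono2)
      moreover have "bcost ?b + 1 \<le> 20" by simp
      ultimately show "T1 + (bcost ?b + 1) \<le> T + (?L + 2) * (60 * B + 200)"
        using T1 T0 by linarith
    qed
  qed
  have ctx0: "search_ctx (s\<lparr>reg := (reg s)(rx := reg s rn, rxc := 0)\<rparr>) f nx nb E C adj"
    using ctx by (simp add: search_ctx_def adjrep_def)
  show ?thesis
    unfolding local_search_def
    apply simp
    apply (rule wp_search_sealed[OF ctx0])
           apply (use v n L fd B in \<open>auto\<close>)[6]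
    subgoal premises p for s' T' qs
    proof -
      have fr: "reg s' rv = ?v" "reg s' rL = ?L" using sameD(1)[OF p(3)] by auto
      have q: "reg s' rql = length qs" "set qs \<subseteq> C" "length qs \<le> ?L + 1" "?v \<in> set qs" "distinct qs"
        "\<And>i. i < length qs \<Longrightarrow> arr s' aq i = qs ! i"
        and min: "\<And>Z. ?v \<in> Z \<Longrightarrow> (\<forall>z\<in>Z. set (adj z) \<inter> set qs \<subseteq> Z) \<Longrightarrow> set qs \<subseteq> Z"
        using p(2) by (auto simp: queue_def)
      have rel: "adjrel E C adj" and fin: "finite C" using ctx by (auto simp: search_ctx_def)
      \<comment> \<open>A vertex \<open>x\<close> that was not visited can be deleted without
        changing the first search. The visited set then lies in \<open>Z\<close>, so this search
        stopped within the limit; as it reported nothing, it covered \<open>C\<close>, which leaves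
        no vertex beyond \<open>Z\<close>.\<close>
      have out: False if x: "x \<notin> set qs" and Z: "sealed E C x Z" "?v \<in> Z" "card Z \<le> ?L" and f0: "reg s' rfd = 0" for x Z
      proof -
        have "set (adj z) \<inter> set qs \<subseteq> Z" if "z \<in> Z" for z
          using rel Z(1) x that q(2) unfolding sealed_def adjrel_def by blast
        then have sub: "set qs \<subseteq> Z" using min Z(2) by blast
        have ZC: "Z \<subseteq> C" using Z(1) by (auto simp: sealed_def)
        have "length qs \<le> ?L"
          using sub Z(3) ZC fin card_mono[of Z "set qs"] q(5) by (simp add: finite_subset distinct_card)
        then have "C \<subseteq> set qs" using p(7) f0 n by simp blast
        then show False using sub Z(1) unfolding sealed_def by blast
      qed
      have len: "(60 * B + 200) * length qs \<le> (60 * B + 200) * (?L + 1)" using q(3) by (rule mult_le_mono2)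
      show ?thesis
      proof (cases "reg s' rfd = 0")
        case True
        have T0: "T' + 37 + 20 * length qs + 20 + (60 * B + 90) * length qs \<le> T + (?L + 2) * (60 * B + 200)"
        proof -
          have "20 * length qs \<le> 30 * length qs" by simp
          then have "20 * length qs + (60 * B + 90) * length qs \<le> (60 * B + 200) * (?L + 1)"
            using len by (simp add: algebra_simps)
          then show ?thesis using p(8) by (simp add: algebra_simps)
        qed
        show ?thesis
          apply (simp add: True)
          apply (rule wp_copy_queue)
           apply simp
          apply (simp add: q)
          subgoal premises p2 for s2 T2
            apply (rule loop[where qs = qs])
            subgoal
              unfolding I_def
              using p(1,3) p2 q True
              by (auto simp: same_def search_ctx_def adjrep_def)
            using q out True p2(3) T0 by auto
          done
      next
        case False
        show ?thesis
          apply (simp add: False)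
          apply (rule post)
          using p False len by (auto simp: same_def search_ctx_def adjrep_def marked_def algebra_simps)
      qed
    qed
    done
qed

section \<open>Colour classes\<close>

text \<open>\<open>u\<close> is flat if no vertex other than \<open>u\<close> and the root \<open>r\<close> separates it from \<open>r\<close>. Reachability
  is expressed by closed sets, here and in \<open>spans\<close>: \<open>K\<close> is reachable from \<open>t\<close> inside \<open>K\<close>.\<close>

definition flat :: "(nat \<times> nat) set \<Rightarrow> nat set \<Rightarrow> nat \<Rightarrow> nat \<Rightarrow> bool" where
  "flat E C r u \<longleftrightarrow> u = r \<or>
     (\<forall>x Z. x \<noteq> r \<longrightarrow> x \<noteq> u \<longrightarrow> r \<in> Z \<longrightarrow> (\<forall>a\<in>Z. \<forall>c\<in>C. (a, c) \<in> E \<longrightarrow> c \<in> Z \<union> {x}) \<longrightarrow> u \<in> Z)"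

definition spans :: "(nat \<times> nat) set \<Rightarrow> nat set \<Rightarrow> nat \<Rightarrow> bool" where
  "spans E K t \<longleftrightarrow> t \<in> K \<and>
     (\<forall>Z. t \<in> Z \<longrightarrow> (\<forall>a\<in>Z. \<forall>c\<in>K. (a, c) \<in> E \<longrightarrow> c \<in> Z) \<longrightarrow> K \<subseteq> Z)"

lemma spans_insert: "spans E K t \<Longrightarrow> y \<in> K \<Longrightarrow> (y, z) \<in> E \<Longrightarrow> spans E (insert z K) t"
  unfolding spans_def by blast

lemma spans_singleton: "spans E {t} t"
  by (simp add: spans_def)

text \<open>The exhausted side \<open>A\<close> of a race is closed in \<open>K\<close> up to the other side \<open>B\<close>.\<close>

lemma spans_race:
  assumes K: "spans E K t0" and A: "spans E A t" and B: "spans E B t'" and "A \<subseteq> K" "B \<subseteq> K" "A \<inter> B = {}"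
    and t0: "t0 = t \<or> t0 = t'" and ex: "\<And>a c. a \<in> A \<Longrightarrow> c \<in> K \<Longrightarrow> (a, c) \<in> E \<Longrightarrow> c \<in> A \<union> B"
  shows "spans E (K - A) t'"
  unfolding spans_def
proof (intro conjI allI impI)
  show "t' \<in> K - A" using B assms(5,6) by (auto simp: spans_def)
  fix Z assume t': "t' \<in> Z" and Z: "\<forall>a\<in>Z. \<forall>c\<in>K - A. (a, c) \<in> E \<longrightarrow> c \<in> Z"
  have BZ: "B \<subseteq> Z" using B t' Z assms(5,6) unfolding spans_def by (meson DiffI disjoint_iff subsetD)
  \<comment> \<open>\<open>A \<union> Z\<close> contains the old top and is closed in
    \<open>K\<close>, since arcs out of \<open>A\<close> end in \<open>A\<close> or in
    \<open>B \<subseteq> Z\<close>; hence it is all of \<open>K\<close>.\<close>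
  have "t0 \<in> A \<union> Z" using t0 A t' by (auto simp: spans_def)
  moreover have "\<forall>a\<in>A \<union> Z. \<forall>c\<in>K. (a, c) \<in> E \<longrightarrow> c \<in> A \<union> Z" using ex Z BZ by blast
  ultimately have "K \<subseteq> A \<union> Z" using K unfolding spans_def by blast
  then show "K - A \<subseteq> Z" by blast
qed

definition classes :: "(nat \<times> nat) set \<Rightarrow> nat set \<Rightarrow> nat \<Rightarrow> (nat \<Rightarrow> nat) \<Rightarrow> (nat \<Rightarrow> nat) \<Rightarrow> nat \<Rightarrow>
    (nat \<Rightarrow> nat) \<Rightarrow> bool" where
  "classes E C r col tp nc flg \<longleftrightarrow> (\<forall>v\<in>C. col v < nc) \<and>
     (\<forall>c<nc. tp c \<in> C \<and> col (tp c) = c \<and> flg (tp c) = 1 \<and> spans E {v \<in> C. col v = c} (tp c)) \<and>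
     (\<forall>u\<in>C. flg u = 1 \<longrightarrow> flat E C r u)"

text \<open>A deleted vertex \<open>x\<close> lies in at most one class. Every other class stays
  reachable from \<open>r\<close>: its top is flat, hence reached, and spans the class. If
  \<open>x\<close> is in the class of \<open>u\<close>, the class of \<open>a\<close> is therefore
  intact and the arc \<open>(a, u)\<close> reaches \<open>u\<close>; otherwise the class of
  \<open>u\<close> is intact. In terms of dominators, a flat vertex other than \<open>r\<close> is
  one whose immediate dominator is \<open>r\<close>.\<close>

lemma flat_cross:
  assumes cl: "classes E C r col tp nc flg" and "a \<in> C" "u \<in> C" "(a, u) \<in> E" "col a \<noteq> col u"
  shows "flat E C r u"
proof (cases "u = r")
  case True
  then show ?thesis by (simp add: flat_def)
next
  case False
  have *: "tp (col v) \<in> C \<and> col (tp (col v)) = col v \<and> flat E C r (tp (col v)) \<and>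
      spans E {w \<in> C. col w = col v} (tp (col v))" if "v \<in> C" for v
    using cl that by (auto simp: classes_def)
  have "u \<in> Z" if xr: "x \<noteq> r" and xu: "x \<noteq> u" and r: "r \<in> Z"
    and Z: "\<forall>a\<in>Z. \<forall>c\<in>C. (a, c) \<in> E \<longrightarrow> c \<in> Z \<union> {x}" for x Z
  proof -
    have in_Z: "v \<in> Z" if v: "v \<in> C" and x: "x \<notin> {w \<in> C. col w = col v}" for v
    proof -
      have "x \<noteq> tp (col v)" using x *[OF v] by auto
      then have t: "tp (col v) \<in> Z" using *[OF v] xr r Z unfolding flat_def by blast
      have "\<forall>a\<in>Z. \<forall>c\<in>{w \<in> C. col w = col v}. (a, c) \<in> E \<longrightarrow> c \<in> Z" using Z x by blast
      then have "{w \<in> C. col w = col v} \<subseteq> Z" using *[OF v] t unfolding spans_def by blast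
      then show ?thesis using v by blast
    qed
    show ?thesis
    proof (cases "x \<in> {w \<in> C. col w = col u}")
      case True
      then have "a \<in> Z" using in_Z[OF assms(2)] assms(5) by auto
      then show ?thesis using Z assms xu by blast
    next
      case False
      then show ?thesis using in_Z assms by blast
    qed
  qed
  then show ?thesis unfolding flat_def by blast
qed

text \<open>The fresh colour \<open>nc\<close> goes to the part \<open>A\<close>; the rest keeps the
  colour \<open>k\<close>, but its top may change.\<close>

lemma classes_split:
  assumes cl: "classes E C r col tp nc flg" and k: "k < nc" and A: "A \<subseteq> {v \<in> C. col v = k}"
    and sA: "spans E A t" "spans E ({v \<in> C. col v = k} - A) t'" and flg: "flg t = 1" "flg t' = 1"
    and col': "\<And>v. v \<in> C \<Longrightarrow> col' v = (if v \<in> A then nc else col v)"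
    and tp': "\<And>c. tp' c = (if c = nc then t else if c = k then t' else tp c)"
  shows "classes E C r col' tp' (Suc nc) flg"
proof -
  have t: "t \<in> A" "t' \<in> C" "col t' = k" "t' \<notin> A" using sA by (auto simp: spans_def)
  have lt: "col v < nc" if "v \<in> C" for v using cl that by (auto simp: classes_def)
  have AC: "A \<subseteq> C" using A by auto
  have K: "{v \<in> C. col' v = c} = (if c = nc then A else {v \<in> C. col v = c} - A)" for c
  proof (intro set_eqI)
    fix v
    show "v \<in> {v \<in> C. col' v = c} \<longleftrightarrow> v \<in> (if c = nc then A else {v \<in> C. col v = c} - A)"
    proof (cases "v \<in> C")
      case True
      then show ?thesis using col'[OF True] lt[OF True] by auto
    next
      case False
      then show ?thesis using AC by auto
    qed
  qed
  have other: "{v \<in> C. col v = c} - A = {v \<in> C. col v = c}" if "c \<noteq> k" for c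
    using A that by auto
  show ?thesis
    unfolding classes_def
  proof (intro conjI ballI allI impI)
    fix v assume "v \<in> C" then show "col' v < Suc nc" using lt[of v] col'[of v] by simp
  next
    fix c assume c: "c < Suc nc"
    have *: "tp c \<in> C \<and> col (tp c) = c \<and> flg (tp c) = 1 \<and> spans E {v \<in> C. col v = c} (tp c)"
      if "c \<noteq> nc" using cl c that by (simp add: classes_def)
    show "tp' c \<in> C" using * t AC tp'[of c] by auto
    show "flg (tp' c) = 1" using * flg tp'[of c] by auto
    show "spans E {v \<in> C. col' v = c} (tp' c)"
    proof (cases "c = nc")
      case True
      then show ?thesis using sA(1) K[of c] tp'[of c] by simp
    next
      case False
      then show ?thesis
        using * sA(2) K[of c] tp'[of c] other[of c] by (cases "c = k") simp_all
    qed
    show "col' (tp' c) = c"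
    proof (cases "c = nc \<or> c = k")
      case True
      then show ?thesis using t AC tp'[of c] col' k by auto
    next
      case False
      then have "tp c \<notin> A" using A * by auto
      then show ?thesis using * False tp'[of c] col' by auto
    qed
  next
    fix u assume "u \<in> C" "flg u = 1" then show "flat E C r u" using cl by (simp add: classes_def)
  qed
qed

text \<open>All vertices are flat for both directions, and deletion of \<open>r\<close> leaves a strongly connected
  graph (seen from a second vertex \<open>r2\<close>).\<close>

lemma not_sealed_flat:
  assumes r: "r \<in> C" and fin: "finite C" and flat: "\<And>u. u \<in> C \<Longrightarrow> flat E C r u"
    and s: "sealed E C x Z" and rZ: "r \<in> Z"
  shows False
proof -
  have Z: "Z \<subseteq> C - {x}" "E \<inter> Z \<times> (C - Z - {x}) = {}" using s by (auto simp: sealed_def)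
  obtain u where u: "u \<in> C" "u \<notin> Z" "u \<noteq> x" using s by (auto simp: sealed_def)
  have "\<forall>a\<in>Z. \<forall>c\<in>C. (a, c) \<in> E \<longrightarrow> c \<in> Z \<union> {x}" using Z by blast
  moreover have "x \<noteq> r" "u \<noteq> r" using Z rZ u by auto
  ultimately show False using flat[OF u(1)] u rZ unfolding flat_def by blast
qed

text \<open>For \<open>x \<noteq> r\<close> the root lies on one side of the separation, and
  flatness in the direction in which no arc leaves this side excludes it. For \<open>x = r\<close>
  the same is done with the side that contains \<open>r2\<close>.\<close>

lemma good_if_flat:
  assumes fin: "finite C" and r: "r \<in> C" and r2: "r2 \<in> C" "r2 \<noteq> r" and card: "3 \<le> card C"
    and fl: "\<And>u. u \<in> C \<Longrightarrow> flat E C r u" "\<And>u. u \<in> C \<Longrightarrow> flat (E\<inverse>) C r u"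
    and two: "\<And>Z. sealed E C r Z \<Longrightarrow> r2 \<in> Z \<Longrightarrow> False" "\<And>Z. sealed (E\<inverse>) C r Z \<Longrightarrow> r2 \<in> Z \<Longrightarrow> False"
  shows "good E C"
  unfolding good_def
proof (intro conjI allI notI)
  show "3 \<le> card C" by fact
  fix x A assume s: "sepx E C x A"
  have main: False if s: "sepx E C x A" and rA: "r \<in> A" for A
  proof -
    have "sealed E C x A \<or> sealed (E\<inverse>) C x A" using s by (simp add: sepx_sealed)
    then show False using not_sealed_flat[OF r fin fl(1) _ rA] not_sealed_flat[OF r fin fl(2) _ rA] by blast
  qed
  have main2: False if s: "sepx E C r A" and rA: "r2 \<in> A" for A
    using s two rA by (auto simp: sepx_sealed)
  consider "r \<in> A" | "r \<in> C - A - {x}" | "r = x" "r2 \<in> A" | "r = x" "r2 \<in> C - A - {x}"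
    using r r2 by blast
  then show False using main[OF s] main[OF sepx_swap[OF s]] main2 s sepx_swap[OF s] by cases auto
qed

text \<open>Pays for recolouring the lighter part of a class of weight \<open>w\<close>.\<close>

definition pot :: "nat \<Rightarrow> nat" where
  "pot w = w * floor_log w"

text \<open>The smaller-half argument: \<open>a\<close> is at most half of \<open>a + b\<close>, so
  the logarithm attached to each of its units drops by at least one.\<close>

lemma pot_add: "1 \<le> a \<Longrightarrow> a \<le> b \<Longrightarrow> pot a + pot b + a \<le> pot (a + b)"
proof -
  assume ab: "1 \<le> a" "a \<le> b"
  have "Suc (floor_log a) = floor_log (2 * a)" using ab by simp
  also have "\<dots> \<le> floor_log (a + b)" using ab by (intro floor_log_le_iff) simp
  finally have "a * Suc (floor_log a) \<le> a * floor_log (a + b)" by (rule mult_le_mono2)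
  moreover have "floor_log b \<le> floor_log (a + b)" by (intro floor_log_le_iff) simp
  then have "b * floor_log b \<le> b * floor_log (a + b)" by (rule mult_le_mono2)
  ultimately show ?thesis unfolding pot_def add_mult_distrib mult_Suc_right by linarith
qed

subsection \<open>Flagging\<close>

text \<open>Arrays: \<open>acol\<close> holds the colours, \<open>atop\<close> the top vertex of each colour, \<open>aflg\<close> marks the
  vertices known to be flat, and \<open>awl\<close> is the stack of flagged vertices that are not yet tops.\<close>

definition push_flag :: com where
  "push_flag = If1 (Equal (Arr aflg (Reg rw)) (Num 0))
    (Store aflg (Reg rw) (Num 1) ;; Store awl (Reg rwl) (Reg rw) ;; incr rwl)"

text \<open>Flags the head of every arc at \<open>rj\<close> whose other end is not coloured
  \<open>rnc\<close>. An arc of kind \<open>kd\<close> leaves \<open>rj\<close>, any other one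
  enters it, so the choice of \<open>kd\<close> also selects the direction of the test.\<close>

definition cross_nb :: "nat \<Rightarrow> com" where
  "cross_nb kd = While (Less (Num 0) (Reg rp))
    (ru ::= Arr abB (Reg rp) ;;
     If1 (Neg (Equal (Arr acol (Reg ru)) (Reg rnc)))
       (Cond (Equal (Arr akB (Reg rp)) (Num kd)) (rw ::= Reg ru) (rw ::= Reg rj) ;; push_flag) ;;
     rp ::= Arr anB (Reg rp))"

definition wl_rep :: "state \<Rightarrow> nat set \<Rightarrow> nat list \<Rightarrow> bool" where
  "wl_rep s C wl \<longleftrightarrow> reg s rwl = length wl \<and> (\<forall>j<length wl. arr s awl j = wl ! j) \<and> distinct wl \<and>
     (\<forall>u\<in>C. arr s aflg u \<le> 1) \<and>
     (\<forall>u\<in>set wl. u \<in> C \<and> arr s aflg u = 1 \<and> u \<noteq> arr s atop (arr s acol u)) \<and>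
     (\<forall>u\<in>C. arr s aflg u = 1 \<longrightarrow> u = arr s atop (arr s acol u) \<or> u \<in> set wl)"

definition wl_inv :: "(nat \<times> nat) set \<Rightarrow> nat set \<Rightarrow> nat \<Rightarrow> nat \<Rightarrow> state \<Rightarrow> bool" where
  "wl_inv E C r nc s \<longleftrightarrow> classes E C r (arr s acol) (arr s atop) nc (arr s aflg) \<and>
     (\<exists>wl. wl_rep s C wl)"

text \<open>Once every flagged vertex is the top of its class, this says that a class can be entered
  from other classes only at its top.\<close>

definition cross_ok :: "(nat \<times> nat) set \<Rightarrow> nat set \<Rightarrow> state \<Rightarrow> bool" where
  "cross_ok E C s \<longleftrightarrow> (\<forall>a\<in>C. \<forall>u\<in>C. (a, u) \<in> E \<longrightarrow> arr s acol a \<noteq> arr s acol u \<longrightarrow> arr s aflg u = 1)"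

text \<open>Stated relative to \<open>kd\<close>, so that one set of lists represents
  \<open>E\<close> for \<open>kd = 1\<close> and \<open>E\<inverse>\<close> for
  \<open>kd = 0\<close>. Arcs of both directions are listed together because a recoloured vertex may
  make either kind cross between classes.\<close>

definition increp :: "state \<Rightarrow> nat set \<Rightarrow> (nat \<times> nat) set \<Rightarrow> nat \<Rightarrow> (nat \<Rightarrow> (nat \<times> nat) list) \<Rightarrow> bool" where
  "increp s C E kd inc \<longleftrightarrow> (\<forall>v\<in>C.
     nbs (arr s anB) (\<lambda>p. (arr s abB p, arr s akB p)) (arr s afB v) (inc v) \<and>
     (\<forall>u. (u, kd) \<in> set (inc v) \<longleftrightarrow> u \<in> C \<and> (v, u) \<in> E) \<and>
     (\<forall>u k. (u, k) \<in> set (inc v) \<longrightarrow> u \<in> C \<and> (k \<noteq> kd \<longrightarrow> (u, v) \<in> E)) \<and>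
     (\<forall>u\<in>C. (u, v) \<in> E \<longrightarrow> (\<exists>k. k \<noteq> kd \<and> (u, k) \<in> set (inc v))))"

lemma increp_cong:
  assumes "increp s C E kd inc" "arr s' anB = arr s anB" "arr s' abB = arr s abB"
    "arr s' akB = arr s akB" "arr s' afB = arr s afB"
  shows "increp s' C E kd inc"
  using assms by (simp add: increp_def)

lemma wl_inv_cong:
  assumes "wl_inv E C r nc s" "reg s' rwl = reg s rwl" "arr s' acol = arr s acol"
    "arr s' atop = arr s atop" "arr s' aflg = arr s aflg" "arr s' awl = arr s awl"
  shows "wl_inv E C r nc s'"
  using assms by (simp add: wl_inv_def wl_rep_def)

lemma wr_push_flag [simp]: "wr push_flag = {rwl}"
  by (auto simp: push_flag_def)

lemma wa_push_flag [simp]: "wa push_flag = {aflg, awl}"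
  by (auto simp: push_flag_def)

lemma wr_cross_nb [simp]: "wr (cross_nb kd) = {ru, rw, rwl, rp}"
  by (auto simp: cross_nb_def)

lemma wa_cross_nb [simp]: "wa (cross_nb kd) = {aflg, awl}"
  by (auto simp: cross_nb_def)

lemma wp_push_flag:
  assumes inv: "wl_inv E C r nc s" and w: "reg s rw \<in> C" and flat: "flat E C r (reg s rw)"
    and post: "\<And>s' T'. wl_inv E C r nc s' \<Longrightarrow> arr s' aflg = (arr s aflg)(reg s rw := 1) \<Longrightarrow>
      same {rwl} {aflg, awl} s s' \<Longrightarrow> T' \<le> T + 20 \<Longrightarrow> Q s' T'"
  shows "wp push_flag Q s T"
proof -
  let ?w = "reg s rw"
  obtain wl where cl: "classes E C r (arr s acol) (arr s atop) nc (arr s aflg)" and wl: "wl_rep s C wl"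
    using inv by (auto simp: wl_inv_def)
  show ?thesis
  proof (cases "arr s aflg ?w = 0")
    case True
    have nt: "arr s atop (arr s acol ?w) \<noteq> ?w" using cl w True by (auto simp: classes_def)
    have nw: "?w \<notin> set wl" using wl True by (auto simp: wl_rep_def)
    let ?s = "s\<lparr>arr := (arr s)(aflg := (arr s aflg)(?w := 1), awl := (arr s awl)(reg s rwl := ?w)),
      reg := (reg s)(rwl := Suc (reg s rwl))\<rparr>"
    have "classes E C r (arr ?s acol) (arr ?s atop) nc (arr ?s aflg)"
      using cl flat unfolding classes_def by auto
    moreover have "wl_rep ?s C (wl @ [?w])"
      using wl w nt nw unfolding wl_rep_def by (auto simp: nth_append less_Suc_eq)
    ultimately have "wl_inv E C r nc ?s" unfolding wl_inv_def by blast
    then show ?thesis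
      unfolding push_flag_def using True by (auto intro!: post simp: same_def)
  next
    case False
    then have "arr s aflg ?w = 1" using wl w by (fastforce simp: wl_rep_def)
    then show ?thesis
      unfolding push_flag_def using inv False by (auto intro!: post simp: fun_upd_idem)
  qed
qed

lemma wp_cross_nb:
  assumes inv: "wl_inv E C r nc s" and rep: "increp s C E kd inc" and v: "reg s rj \<in> C"
    and p: "reg s rp = arr s afB (reg s rj)"
    and fl: "\<And>u k. (u, k) \<in> set (inc (reg s rj)) \<Longrightarrow> arr s acol u \<noteq> reg s rnc \<Longrightarrow>
      flat E C r (if k = kd then u else reg s rj)"
    and post: "\<And>s' T'. wl_inv E C r nc s' \<Longrightarrow> (\<And>u. arr s aflg u = 1 \<Longrightarrow> arr s' aflg u = 1) \<Longrightarrow>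
      (\<And>u k. (u, k) \<in> set (inc (reg s rj)) \<Longrightarrow> arr s acol u \<noteq> reg s rnc \<Longrightarrow>
        arr s' aflg (if k = kd then u else reg s rj) = 1) \<Longrightarrow>
      same {ru, rw, rwl, rp} {aflg, awl} s s' \<Longrightarrow>
      T' \<le> T + 50 * length (inc (reg s rj)) + 10 \<Longrightarrow> Q s' T'"
  shows "wp (cross_nb kd) Q s T"
proof -
  let ?v = "reg s rj" and ?b = "Less (Num 0) (Reg rp)"
  let ?c = "ru ::= Arr abB (Reg rp) ;;
     If1 (Neg (Equal (Arr acol (Reg ru)) (Reg rnc)))
       (Cond (Equal (Arr akB (Reg rp)) (Num kd)) (rw ::= Reg ru) (rw ::= Reg rj) ;; push_flag) ;;
     rp ::= Arr anB (Reg rp)"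
  define h where "h = (\<lambda>u k. if k = kd then u else ?v)"
  define I where "I = (\<lambda>s1 T1. \<exists>zs ys. inc ?v = zs @ ys \<and> wl_inv E C r nc s1 \<and>
    nbs (arr s anB) (\<lambda>p. (arr s abB p, arr s akB p)) (reg s1 rp) ys \<and>
    (\<forall>u. arr s aflg u = 1 \<longrightarrow> arr s1 aflg u = 1) \<and>
    (\<forall>u k. (u, k) \<in> set zs \<longrightarrow> arr s acol u \<noteq> reg s rnc \<longrightarrow> arr s1 aflg (h u k) = 1) \<and>
    T1 \<le> T + 50 * length zs)"
  have II: "I s1 T1" if "inc ?v = zs @ ys" "wl_inv E C r nc s1"
    "nbs (arr s anB) (\<lambda>p. (arr s abB p, arr s akB p)) (reg s1 rp) ys"
    "\<And>u. arr s aflg u = 1 \<Longrightarrow> arr s1 aflg u = 1"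
    "\<And>u k. (u, k) \<in> set zs \<Longrightarrow> arr s acol u \<noteq> reg s rnc \<Longrightarrow> arr s1 aflg (h u k) = 1"
    "T1 \<le> T + 50 * length zs" for zs ys s1 T1
    unfolding I_def using that by (intro exI[of _ zs] exI[of _ ys]) simp
  show ?thesis
    unfolding cross_nb_def
  proof (rule wp_While[where I = I and B = "T + 50 * length (inc ?v)"])
    show "I s T" by (rule II[of "[]" "inc ?v"]) (use inv rep v p in \<open>auto simp: increp_def\<close>)
  next
    fix s1 T1 assume "I s1 T1"
    then show "T1 \<le> T + 50 * length (inc ?v)" unfolding I_def by fastforce
  next
    fix s1 T1 assume I1: "I s1 T1" and sm: "same (wr ?c) (wa ?c) s s1" and b: "bval s1 ?b"
    obtain zs ys where a: "inc ?v = zs @ ys" and wi: "wl_inv E C r nc s1"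
      and nb: "nbs (arr s anB) (\<lambda>p. (arr s abB p, arr s akB p)) (reg s1 rp) ys"
      and mono: "\<And>u. arr s aflg u = 1 \<Longrightarrow> arr s1 aflg u = 1"
      and dn: "\<And>u k. (u, k) \<in> set zs \<Longrightarrow> arr s acol u \<noteq> reg s rnc \<Longrightarrow> arr s1 aflg (h u k) = 1"
      and T1: "T1 \<le> T + 50 * length zs" using I1 unfolding I_def by blast
    have fr: "reg s1 rj = ?v" "reg s1 rnc = reg s rnc" "arr s1 acol = arr s acol" "arr s1 anB = arr s anB"
      "arr s1 abB = arr s abB" "arr s1 akB = arr s akB" using sameD[OF sm] by auto
    obtain u k ys' where ys: "ys = (u, k) # ys'" using nb b by (cases ys) auto
    have uk: "arr s abB (reg s1 rp) = u" "arr s akB (reg s1 rp) = k"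
      "nbs (arr s anB) (\<lambda>p. (arr s abB p, arr s akB p)) (arr s anB (reg s1 rp)) ys'"
      using nb ys by auto
    have uC: "u \<in> C" using rep v a ys by (auto simp: increp_def)
    show "wp ?c I s1 (T1 + (bcost ?b + 1))"
    proof (cases "arr s acol u = reg s rnc")
      case True
      show ?thesis
        apply (simp add: fr uk True)
        apply (rule II[of "zs @ [(u, k)]" ys'])
             apply (simp add: a ys)
            apply (rule wl_inv_cong[OF wi]; simp)
        using uk mono dn T1 True by auto
    next
      case False
      have *: "wp (push_flag ;; rp ::= Arr anB (Reg rp)) I s2 T2"
        if w: "reg s2 rw = h u k" and eq: "same {ru, rw} {} s1 s2" and T2: "T2 \<le> T1 + 20" for s2 T2
      proof -
        have wi2: "wl_inv E C r nc s2" using sameD[OF eq] by (intro wl_inv_cong[OF wi]) auto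
        have f: "reg s2 rw \<in> C" "flat E C r (reg s2 rw)" using w uC v fl[of u k] False a ys by (auto simp: h_def)
        show ?thesis
          apply simp
          apply (rule wp_push_flag[OF wi2 f])
          subgoal premises q for s3 T3
          proof -
            have fr3: "reg s3 rp = reg s1 rp" "arr s3 anB = arr s anB" "arr s2 aflg = arr s1 aflg"
              using sameD[OF q(3)] sameD[OF eq] fr by auto
            show ?thesis
              apply (simp add: fr3)
              apply (rule II[of "zs @ [(u, k)]" ys'])
                   apply (simp add: a ys)
                  apply (rule wl_inv_cong[OF q(1)]; simp)
                 apply (simp add: uk)
              using mono dn q(2,4) w fr3 T1 T2 by auto
          qed
          done
      qed
      show ?thesis
        using False by (auto simp: fr uk intro!: *[simplified] simp: same_def h_def)
    qed
  next
    fix s1 T1 assume I1: "I s1 T1" and sm: "same (wr ?c) (wa ?c) s s1" and b: "\<not> bval s1 ?b"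
    obtain zs ys where a: "inc ?v = zs @ ys" and wi: "wl_inv E C r nc s1"
      and nb: "nbs (arr s anB) (\<lambda>p. (arr s abB p, arr s akB p)) (reg s1 rp) ys"
      and mono: "\<And>u. arr s aflg u = 1 \<Longrightarrow> arr s1 aflg u = 1"
      and dn: "\<And>u k. (u, k) \<in> set zs \<Longrightarrow> arr s acol u \<noteq> reg s rnc \<Longrightarrow> arr s1 aflg (h u k) = 1"
      and T1: "T1 \<le> T + 50 * length zs" using I1 unfolding I_def by blast
    have "ys = []" using nb b by (cases ys) auto
    then have "inc ?v = zs" using a by simp
    moreover have "same {ru, rw, rwl, rp} {aflg, awl} s s1" using sm by (rule same_mono) auto
    ultimately show "Q s1 (T1 + (bcost ?b + 1))"
      using wi mono dn T1 unfolding h_def by (intro post) auto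
  qed
qed


subsection \<open>The race\<close>

text \<open>Two searches, from the top of a class and from a flagged vertex of it, alternate and claim the
  vertices of the class. Side \<open>i\<close> keeps its queue in \<open>aRQ\<close> from index \<open>arr s aRS i\<close> on, its position
  in \<open>aRH\<close>, the end in \<open>aRL\<close>, its place in the current adjacency list in \<open>aRP\<close>, and its claim
  stamp in \<open>aRC\<close>.\<close>

definition race_step :: "nat \<Rightarrow> com" where
  "race_step kd =
    (rp ::= Arr aRP (Reg rsd) ;;
     Cond (Equal (Reg rp) (Num 0))
       (Store aRH (Reg rsd) (Bin Add (Arr aRH (Reg rsd)) (Num 1)) ;;
        Cond (Equal (Arr aRH (Reg rsd)) (Arr aRL (Reg rsd)))
          (rdn ::= Num 1)
          (Store aRP (Reg rsd) (Arr afB (Arr aRQ (Arr aRH (Reg rsd)))) ;;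
           rsd ::= Bin Sub (Num 1) (Reg rsd)))
       (ru ::= Arr abB (Reg rp) ;; Store aRP (Reg rsd) (Arr anB (Reg rp)) ;;
        If1 (Conj (Equal (Arr akB (Reg rp)) (Num kd))
              (Conj (Equal (Arr acol (Reg ru)) (Reg rk)) (Neg (Less (Reg rcs) (Arr acl (Reg ru))))))
          (Store acl (Reg ru) (Arr aRC (Reg rsd)) ;; Store aRQ (Arr aRL (Reg rsd)) (Reg ru) ;;
           Store aRL (Reg rsd) (Bin Add (Arr aRL (Reg rsd)) (Num 1))) ;;
        rsd ::= Bin Sub (Num 1) (Reg rsd)))"

definition race :: "nat \<Rightarrow> com" where
  "race kd = While (Equal (Reg rdn) (Num 0)) (race_step kd)"

text \<open>One unit for each list entry and one for the end of the list: the number of moves in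
  which a side of the race exhausts these vertices.\<close>

definition wt :: "(nat \<Rightarrow> 'a list) \<Rightarrow> nat set \<Rightarrow> nat" where
  "wt inc S = (\<Sum>v\<in>S. length (inc v) + 1)"

definition covered :: "nat \<Rightarrow> nat set \<Rightarrow> nat set \<Rightarrow> (nat \<times> nat) list \<Rightarrow> bool" where
  "covered kd K U l \<longleftrightarrow> (\<forall>u\<in>K. (u, kd) \<in> set l \<longrightarrow> u \<in> U)"

text \<open>\<open>U\<close> is to hold the claimed vertices of both sides. What a side has read so
  far then leads, inside \<open>K\<close>, only to its own vertices or to those of its opponent; for
  an exhausted side this is the hypothesis of \<open>spans_race\<close>.\<close>

definition side :: "(nat \<times> nat) set \<Rightarrow> nat set \<Rightarrow> nat \<Rightarrow> (nat \<Rightarrow> (nat \<times> nat) list) \<Rightarrow> state \<Rightarrow> nat \<Rightarrow> nat \<Rightarrow>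
    nat \<Rightarrow> nat set \<Rightarrow> nat list \<Rightarrow> nat \<Rightarrow> (nat \<times> nat) list \<Rightarrow> (nat \<times> nat) list \<Rightarrow> bool" where
  "side E K kd inc s i b t U q h z y \<longleftrightarrow>
     arr s aRH i = b + h \<and> arr s aRL i = b + length q \<and> (\<forall>j<length q. arr s aRQ (b + j) = q ! j) \<and>
     distinct q \<and> set q \<subseteq> K \<and> spans E (set q) t \<and> h < length q \<and> q ! 0 = t \<and>
     nbs (arr s anB) (\<lambda>p. (arr s abB p, arr s akB p)) (arr s aRP i) y \<and> inc (q ! h) = z @ y \<and>
     (\<forall>j<h. covered kd K U (inc (q ! j))) \<and> covered kd K U z"

text \<open>The moves made so far by a side that is reading the list of \<open>q ! h\<close> and has
  passed \<open>z\<close>.\<close>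

definition prog :: "(nat \<Rightarrow> 'a list) \<Rightarrow> nat list \<Rightarrow> nat \<Rightarrow> 'a list \<Rightarrow> nat" where
  "prog inc q h z = wt inc (set (take h q)) + length z"

definition won :: "(nat \<times> nat) set \<Rightarrow> nat set \<Rightarrow> (nat \<Rightarrow> (nat \<times> nat) list) \<Rightarrow> state \<Rightarrow> nat \<Rightarrow>
    (nat \<Rightarrow> nat) \<Rightarrow> nat list \<Rightarrow> bool" where
  "won E K inc s b t q \<longleftrightarrow> reg s rsd < 2 \<and>
     arr s aRL (reg s rsd) = b + length q \<and> (\<forall>j<length q. arr s aRQ (b + j) = q ! j) \<and>
     distinct q \<and> q \<noteq> [] \<and> q ! 0 = t (reg s rsd) \<and> set q \<subseteq> K \<and> spans E (set q) (t (reg s rsd)) \<and>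
     spans E (K - set q) (t (1 - reg s rsd)) \<and> wt inc (set q) \<le> wt inc (K - set q)"

lemma wr_race_step [simp]: "wr (race_step kd) = {rp, rdn, rsd, ru}"
  by (auto simp: race_step_def)

lemma wa_race_step [simp]: "wa (race_step kd) = {aRH, aRP, acl, aRQ, aRL}"
  by (auto simp: race_step_def)

lemma wr_race [simp]: "wr (race kd) = {rp, rdn, rsd, ru}"
  by (auto simp: race_def)

lemma wa_race [simp]: "wa (race kd) = {aRH, aRP, acl, aRQ, aRL}"
  by (auto simp: race_def)

lemma wt_mono: "finite B \<Longrightarrow> A \<subseteq> B \<Longrightarrow> wt inc A \<le> wt inc B"
  unfolding wt_def by (rule sum_mono2) auto

lemma wt_Un: "finite A \<Longrightarrow> finite B \<Longrightarrow> A \<inter> B = {} \<Longrightarrow> wt inc (A \<union> B) = wt inc A + wt inc B"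
  unfolding wt_def by (rule sum.union_disjoint)

lemma wt_take_Suc:
  "distinct q \<Longrightarrow> h < length q \<Longrightarrow>
     wt inc (set (take (Suc h) q)) = wt inc (set (take h q)) + length (inc (q ! h)) + 1"
  unfolding wt_def by (simp add: sum_set_take_Suc)

text \<open>The move that recognises the end of the current list is always outstanding. In
  \<open>wp_race\<close> this strictness makes the finishing side the lighter one even if it is the
  side that moves first.\<close>

lemma prog_less:
  assumes "side E K kd inc s i b t U q h z y"
  shows "prog inc q h z < wt inc (set q)"
proof -
  have q: "distinct q" "h < length q" "inc (q ! h) = z @ y" using assms by (auto simp: side_def)
  have "prog inc q h z < wt inc (set (take (Suc h) q))"
    unfolding prog_def wt_take_Suc[OF q(1,2)] using q(3) by simp
  also have "\<dots> \<le> wt inc (set q)" by (rule wt_mono) (auto dest: in_set_takeD)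
  finally show ?thesis .
qed

lemma covered_mono: "covered kd K U l \<Longrightarrow> U \<subseteq> U' \<Longrightarrow> covered kd K U' l"
  unfolding covered_def by blast

lemma side_mono:
  assumes sd: "side E K kd inc s i b t U q h z y" and U: "U \<subseteq> U'"
    and eq: "arr s' aRH i = arr s aRH i" "arr s' aRL i = arr s aRL i" "arr s' aRP i = arr s aRP i"
      "\<And>j. j < length q \<Longrightarrow> arr s' aRQ (b + j) = arr s aRQ (b + j)"
      "arr s' anB = arr s anB" "arr s' abB = arr s abB" "arr s' akB = arr s akB"
  shows "side E K kd inc s' i b t U' q h z y"
  using sd eq U by (auto simp: side_def intro: covered_mono)

lemma less_2_neq: "i < 2 \<Longrightarrow> j < 2 \<Longrightarrow> i \<noteq> j \<Longrightarrow> j = 1 - (i::nat)"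
  by auto

text \<open>The sides alternate, so their move counts differ by \<open>rsd\<close> only. When one
  side is exhausted, the number of moves is therefore at most twice its own weight, which at 80 per
  move gives 160, and its opponent has claimed vertices of at least that weight. Nothing is charged
  to the vertices that neither side has reached, as the smaller-half argument demands.\<close>

lemma wp_race:
  fixes K C :: "nat set" and n :: nat and t b :: "nat \<Rightarrow> nat"
  assumes rep: "increp s C E kd inc" and C: "finite C" "card C \<le> n"
    and K: "K = {v \<in> C. arr s acol v = reg s rk}"
    and b: "b = (\<lambda>i. if i = 0 then 0 else n)"
    and init: "\<And>i. i < 2 \<Longrightarrow> side E K kd inc s i (b i) (t i) {t 0, t 1} [t i] 0 [] (inc (t i))"
    and t: "t 0 \<noteq> t 1" "spans E K (t 0)"
    and cl: "\<And>u. reg s rcs < arr s acl u \<longleftrightarrow> u = t 0 \<or> u = t 1" "\<And>u. arr s acl u \<le> reg s rcs + 2"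
      "\<And>i. i < 2 \<Longrightarrow> arr s aRC i = reg s rcs + 1 + i"
    and regs: "reg s rsd = 0" "reg s rdn = 0"
    and post: "\<And>s' T' q. won E K inc s' (b (reg s' rsd)) t q \<Longrightarrow>
      (\<And>u. arr s' acl u \<le> reg s rcs + 2) \<Longrightarrow> (\<And>i. i < 2 \<Longrightarrow> arr s' aRQ (b i) = t i) \<Longrightarrow>
      same {rp, rdn, rsd, ru} {aRH, aRP, acl, aRQ, aRL} s s' \<Longrightarrow>
      T' \<le> T + 160 * wt inc (set q) \<Longrightarrow> Q s' T'"
  shows "wp (race kd) Q s T"
proof -
  let ?b = "Equal (Reg rdn) (Num 0)"
  let ?R = "{rp, rdn, rsd, ru}" and ?A = "{aRH, aRP, acl, aRQ, aRL}"
  let ?nb = "nbs (arr s anB) (\<lambda>p. (arr s abB p, arr s akB p))"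
  have KC: "K \<subseteq> C" using K by auto
  have finK: "finite K" using KC C(1) finite_subset by blast
  define I0 where "I0 = (\<lambda>s1 T1. \<exists>q h z y. (\<forall>i<2. side E K kd inc s1 i (b i) (t i) (set (q 0) \<union> set (q 1)) (q i) (h i) (z i) (y i)) \<and>
    set (q 0) \<inter> set (q 1) = {} \<and> (\<forall>u. reg s rcs < arr s1 acl u \<longleftrightarrow> u \<in> set (q 0) \<union> set (q 1)) \<and>
    (\<forall>u. arr s1 acl u \<le> reg s rcs + 2) \<and> reg s1 rsd < 2 \<and>
    prog inc (q 0) (h 0) (z 0) = prog inc (q 1) (h 1) (z 1) + reg s1 rsd \<and>
    T1 + 10 \<le> T + 80 * (prog inc (q 0) (h 0) (z 0) + prog inc (q 1) (h 1) (z 1)) + 20)"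
  have I0I: "I0 s1 T1" if "\<And>i. i < 2 \<Longrightarrow> side E K kd inc s1 i (b i) (t i) (set (q 0) \<union> set (q 1)) (q i) (h i) (z i) (y i)"
    "set (q 0) \<inter> set (q 1) = {}" "\<And>u. reg s rcs < arr s1 acl u \<longleftrightarrow> u \<in> set (q 0) \<union> set (q 1)"
    "\<And>u. arr s1 acl u \<le> reg s rcs + 2" "reg s1 rsd < 2"
    "prog inc (q 0) (h 0) (z 0) = prog inc (q 1) (h 1) (z 1) + reg s1 rsd"
    "T1 + 10 \<le> T + 80 * (prog inc (q 0) (h 0) (z 0) + prog inc (q 1) (h 1) (z 1)) + 20"
  for s1 T1 q h z y
    unfolding I0_def
    by (rule exI[of _ q], rule exI[of _ h], rule exI[of _ z], rule exI[of _ y]) (use that in auto)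
  define I1 where "I1 = (\<lambda>s1 T1. (\<exists>q. won E K inc s1 (b (reg s1 rsd)) t q \<and> T1 + 10 \<le> T + 160 * wt inc (set q)) \<and>
    (\<forall>u. arr s1 acl u \<le> reg s rcs + 2) \<and> (\<forall>i<2. arr s1 aRQ (b i) = t i))"
  define I where "I = (\<lambda>s1 T1. same ?R ?A s s1 \<and> (if reg s1 rdn = 0 then I0 s1 T1 else I1 s1 T1))"
  show ?thesis
    unfolding race_def
  proof (rule wp_While[where I = I and B = "T + 160 * wt inc K + 20"])
    have "I0 s T"
      using init t(1) cl regs
      by (intro I0I[of s "\<lambda>i. [t i]" "\<lambda>i. 0" "\<lambda>i. []" "\<lambda>i. inc (t i)"]) (auto simp: prog_def insert_commute)
    then show "I s T" using regs by (simp add: I_def)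
  next
    fix s1 T1 assume I: "I s1 T1"
    show "T1 \<le> T + 160 * wt inc K + 20"
    proof (cases "reg s1 rdn = 0")
      case True
      then obtain q h z y where sd: "\<forall>i<2. side E K kd inc s1 i (b i) (t i) (set (q 0) \<union> set (q 1)) (q i) (h i) (z i) (y i)"
        and T1: "T1 + 10 \<le> T + 80 * (prog inc (q 0) (h 0) (z 0) + prog inc (q 1) (h 1) (z 1)) + 20"
        using I unfolding I_def I0_def by auto
      have le: "prog inc (q i) (h i) (z i) \<le> wt inc K" if "i < 2" for i
      proof -
        have "side E K kd inc s1 i (b i) (t i) (set (q 0) \<union> set (q 1)) (q i) (h i) (z i) (y i)" using sd that by blast
        note prog_less[OF this]
        also have "wt inc (set (q i)) \<le> wt inc K" using sd that finK by (intro wt_mono) (auto simp: side_def)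
        finally show ?thesis by simp
      qed
      show ?thesis using T1 le[of 0] le[of 1] by simp
    next
      case False
      then obtain q where "won E K inc s1 (b (reg s1 rsd)) t q" "T1 + 10 \<le> T + 160 * wt inc (set q)"
        using I unfolding I_def I1_def by auto
      moreover from this(1) have "wt inc (set q) \<le> wt inc K" using finK by (intro wt_mono) (auto simp: won_def)
      ultimately show ?thesis by linarith
    qed
  next
    fix s1 T1 assume I: "I s1 T1" and bv: "bval s1 ?b"
    have sm: "same ?R ?A s s1" and dn: "reg s1 rdn = 0" and I0': "I0 s1 T1"
      using I bv by (auto simp: I_def)
    obtain q h z y where sd: "\<And>i. i < 2 \<Longrightarrow> side E K kd inc s1 i (b i) (t i) (set (q 0) \<union> set (q 1)) (q i) (h i) (z i) (y i)"
      and disj: "set (q 0) \<inter> set (q 1) = {}"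
      and claim: "\<And>u. reg s rcs < arr s1 acl u \<longleftrightarrow> u \<in> set (q 0) \<union> set (q 1)" "\<And>u. arr s1 acl u \<le> reg s rcs + 2"
      and lt2: "reg s1 rsd < 2"
      and pr: "prog inc (q 0) (h 0) (z 0) = prog inc (q 1) (h 1) (z 1) + reg s1 rsd"
      and T1: "T1 + 10 \<le> T + 80 * (prog inc (q 0) (h 0) (z 0) + prog inc (q 1) (h 1) (z 1)) + 20"
      using I0' unfolding I0_def by blast
    define i where "i = reg s1 rsd"
    define U where "U = set (q 0) \<union> set (q 1)"
    have i01: "i = 0 \<or> i = 1" using lt2 unfolding i_def by linarith
    then have i: "i < 2" "1 - i < 2" "i \<noteq> 1 - i" by auto
    have fr: "arr s1 anB = arr s anB" "arr s1 abB = arr s abB" "arr s1 akB = arr s akB"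
      "arr s1 afB = arr s afB" "arr s1 acol = arr s acol" "reg s1 rk = reg s rk" "reg s1 rcs = reg s rcs"
      "arr s1 aRC = arr s aRC" using sameD[OF sm] by auto
    note sdi = sd[OF i(1), folded U_def] and sdj = sd[OF i(2), folded U_def]
    have S: "arr s1 aRH i = b i + h i" "arr s1 aRL i = b i + length (q i)"
      "\<And>j. j < length (q i) \<Longrightarrow> arr s1 aRQ (b i + j) = q i ! j" "distinct (q i)" "set (q i) \<subseteq> K"
      "spans E (set (q i)) (t i)" "h i < length (q i)" "q i ! 0 = t i" "?nb (arr s1 aRP i) (y i)"
      "inc (q i ! h i) = z i @ y i" "\<And>j. j < h i \<Longrightarrow> covered kd K U (inc (q i ! j))" "covered kd K U (z i)"
      using sdi by (auto simp: side_def fr)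
    have U2: "U = set (q i) \<union> set (q (1 - i))" "set (q i) \<inter> set (q (1 - i)) = {}"
      using i01 disj unfolding U_def by auto
    have pr2: "prog inc (q 0) (h 0) (z 0) + prog inc (q 1) (h 1) (z 1) =
        prog inc (q i) (h i) (z i) + prog inc (q (1 - i)) (h (1 - i)) (z (1 - i))"
      using i01 by auto
    have "q i ! h i \<in> K" using S(5,7) by auto
    then have hK: "q i ! h i \<in> C" using KC by auto
    \<comment> \<open>The queues share one array, starting at 0 and at \<open>n\<close>; being
      disjoint subsets of \<open>C\<close> they have at most \<open>n\<close> entries together, so
      the first never runs into the second.\<close>
    have lq: "length (q 0) + length (q 1) \<le> n"
    proof -
      have "length (q 0) + length (q 1) = card (set (q 0) \<union> set (q 1))"
        using sd[of 0] sd[of 1] disj by (simp add: side_def distinct_card card_Un_disjoint)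
      also have "\<dots> \<le> card C" using sd[of 0] sd[of 1] KC C(1) by (intro card_mono) (auto simp: side_def)
      finally show ?thesis using C by simp
    qed
    show "wp (race_step kd) I s1 (T1 + (bcost ?b + 1))"
    proof (cases "y i")
      case Nil
      then have p0: "arr s1 aRP i = 0" using S(9) by simp
      have cov: "covered kd K U (inc (q i ! h i))" using S(10,12) Nil by simp
      have pri: "prog inc (q i) (h i) (z i) + 1 = wt inc (set (take (Suc (h i)) (q i)))"
        unfolding prog_def wt_take_Suc[OF S(4,7)] using S(10) Nil by simp
      show ?thesis
      proof (cases "Suc (h i) = length (q i)")
        case True
        have wtq: "wt inc (set (q i)) = prog inc (q i) (h i) (z i) + 1" using pri True by simp
        have less: "wt inc (set (q i)) \<le> wt inc (set (q (1 - i)))"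
          using prog_less[OF sdj] wtq pr i01 unfolding i_def[symmetric] by auto
        have sub: "set (q (1 - i)) \<subseteq> K - set (q i)" using sdj U2 by (auto simp: side_def)
        have wle: "wt inc (set (q i)) \<le> wt inc (K - set (q i))"
          using less wt_mono[OF _ sub, of inc] finK by simp
        have ex: "c \<in> set (q i) \<union> set (q (1 - i))" if ac: "a \<in> set (q i)" "c \<in> K" "(a, c) \<in> E" for a c
        proof -
          obtain j where j: "j < length (q i)" "a = q i ! j"
            using ac(1) unfolding in_set_conv_nth by blast
          have "covered kd K U (inc a)" using S(11)[of j] cov j True by (cases "j = h i") auto
          moreover have "a \<in> C" "c \<in> C" using ac S(5) KC by blast+
          then have "(c, kd) \<in> set (inc a)" using rep ac(3) by (simp add: increp_def)
          ultimately show ?thesis using ac(2) U2(1) by (auto simp: covered_def)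
        qed
        have sB: "spans E (set (q (1 - i))) (t (1 - i))" "set (q (1 - i)) \<subseteq> K" using sdj by (auto simp: side_def)
        have spB: "spans E (K - set (q i)) (t (1 - i))"
          using spans_race[OF t(2) S(6) sB(1) S(5) sB(2) U2(2) _ ex] i01 by auto
        have Tl: "T1 + 50 \<le> T + 160 * wt inc (set (q i))"
          using T1 pr wtq i01 unfolding pr2 i_def[symmetric] by auto
        let ?s = "s1\<lparr>arr := (arr s1)(aRH := (arr s1 aRH)(i := Suc (b i + h i))),
          reg := (reg s1)(rp := 0, rdn := 1)\<rparr>"
        have "won E K inc ?s (b i) t (q i)"
          unfolding won_def using S spB wle i i_def True by auto
        moreover have "arr s1 aRQ (b j) = t j" if "j < 2" for j
          using sd[OF that] by (auto simp: side_def dest: spec[of _ 0])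
        ultimately have "I1 ?s (T1 + 40)"
          unfolding I1_def using Tl claim(2) i_def by auto
        then have "I ?s T2" if "T2 \<le> T1 + 40" for T2
          using that sm unfolding I_def I1_def by (auto simp: same_def)
        then show ?thesis
          unfolding race_step_def using p0 S(1,2) True i_def by simp
      next
        case False
        have hl: "Suc (h i) < length (q i)" using False S(7) by simp
        define h' where "h' = h(i := Suc (h i))"
        define z' where "z' = z(i := [])"
        define y' where "y' = y(i := inc (q i ! Suc (h i)))"
        have ne1: "1 - i \<noteq> i" using i by simp
        have pr': "prog inc (q i) (h' i) (z' i) = prog inc (q i) (h i) (z i) + 1"
          "prog inc (q (1 - i)) (h' (1 - i)) (z' (1 - i)) = prog inc (q (1 - i)) (h (1 - i)) (z (1 - i))"
          using pri ne1 by (simp_all add: h'_def z'_def prog_def)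
        let ?y = "q i ! Suc (h i)"
        have yC: "?y \<in> C" using nth_mem[OF hl] S(5) KC by blast
        let ?s = "s1\<lparr>arr := (arr s1)(aRH := (arr s1 aRH)(i := Suc (b i + h i)),
          aRP := (arr s1 aRP)(i := arr s afB ?y)),
          reg := (reg s1)(rp := 0, rsd := 1 - i)\<rparr>"
        have "side E K kd inc ?s i (b i) (t i) U (q i) (h' i) (z' i) (y' i)"
          using S hl cov rep yC unfolding side_def
          by (auto simp: h'_def z'_def y'_def fr increp_def covered_def less_Suc_eq)
        moreover have "side E K kd inc ?s (1 - i) (b (1 - i)) (t (1 - i)) U (q (1 - i)) (h' (1 - i)) (z' (1 - i)) (y' (1 - i))"
          using side_mono[OF sdj order_refl, of ?s] ne1 by (simp add: h'_def z'_def y'_def)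
        ultimately have sd': "side E K kd inc ?s j (b j) (t j) U (q j) (h' j) (z' j) (y' j)" if "j < 2" for j
          using less_2_neq[OF i(1) that] by (cases "j = i") auto
        have I0s: "I0 ?s T2" if T2: "T2 \<le> T1 + 60" for T2
        proof (rule I0I[of _ q h' z' y'])
          show "prog inc (q 0) (h' 0) (z' 0) = prog inc (q 1) (h' 1) (z' 1) + reg ?s rsd"
            using pr pr' i01 unfolding i_def[symmetric] by auto
          have "prog inc (q 0) (h' 0) (z' 0) + prog inc (q 1) (h' 1) (z' 1) =
            prog inc (q 0) (h 0) (z 0) + prog inc (q 1) (h 1) (z 1) + 1"
            using pr' i01 by auto
          then show "T2 + 10 \<le> T + 80 * (prog inc (q 0) (h' 0) (z' 0) + prog inc (q 1) (h' 1) (z' 1)) + 20"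
            using T1 T2 by simp
        qed (use sd' disj claim i in \<open>auto simp: U_def\<close>)
        then have "I ?s T2" if "T2 \<le> T1 + 60" for T2
          using I0s[OF that] sm dn unfolding I_def by (simp add: same_def)
        then show ?thesis
          unfolding race_step_def using p0 S(1,2) S(3)[OF hl] False i_def[symmetric] fr by simp
      qed
    next
      case (Cons e y1)
      obtain u k where e: "e = (u, k)" by (cases e)
      have p: "arr s1 aRP i \<noteq> 0" "arr s abB (arr s1 aRP i) = u" "arr s akB (arr s1 aRP i) = k"
        "?nb (arr s anB (arr s1 aRP i)) y1" using S(9) Cons e by auto
      have ue: "(u, k) \<in> set (inc (q i ! h i))" using S(10) Cons e by simp
      have uC: "u \<in> C" using rep hK ue by (auto simp: increp_def)
      have ne1: "1 - i \<noteq> i" using i by simp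
      let ?cl = "k = kd \<and> arr s acol u = reg s rk \<and> \<not> reg s rcs < arr s1 acl u"
      define z' where "z' = z(i := z i @ [(u, k)])"
      define y' where "y' = y(i := y1)"
      show ?thesis
      proof (cases ?cl)
        case True
        define q' where "q' = q(i := q i @ [u])"
        have uK: "u \<in> K" "u \<notin> U" using True uC K claim(1) by (auto simp: U_def)
        have uE: "(q i ! h i, u) \<in> E" using rep hK ue True by (auto simp: increp_def)
        have sp: "spans E (set (q i @ [u])) (t i)"
          using spans_insert[OF S(6) _ uE] S(7) by auto
        let ?U = "insert u U"
        have U': "set (q' 0) \<union> set (q' 1) = ?U" "set (q' 0) \<inter> set (q' 1) = {}"
          using i01 disj uK(2) unfolding q'_def U_def by (elim disjE; simp; blast)+
        have covz: "covered kd K ?U (z i @ [(u, k)])" using S(12) by (auto simp: covered_def)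
        have covh: "covered kd K ?U (inc ((q i @ [u]) ! j))" if "j < h i" for j
          using covered_mono[OF S(11)[OF that], of ?U] that S(7) by (simp add: nth_append subset_insertI)
        let ?s = "s1\<lparr>arr := (arr s1)(aRP := (arr s1 aRP)(i := arr s anB (arr s1 aRP i)),
            acl := (arr s1 acl)(u := reg s rcs + 1 + i), aRQ := (arr s1 aRQ)(b i + length (q i) := u),
            aRL := (arr s1 aRL)(i := Suc (b i + length (q i)))),
          reg := (reg s1)(rp := arr s1 aRP i, ru := u, rsd := 1 - i)\<rparr>"
        have "side E K kd inc ?s i (b i) (t i) ?U (q' i) (h i) (z' i) (y' i)"
          using S p uK sp covz covh U2 unfolding side_def
          by (auto simp: q'_def z'_def y'_def fr nth_append less_Suc_eq Cons e)
        moreover have "side E K kd inc ?s (1 - i) (b (1 - i)) (t (1 - i)) ?U (q' (1 - i)) (h (1 - i)) (z' (1 - i)) (y' (1 - i))"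
        proof -
          have "b (1 - i) + j \<noteq> b i + length (q i)" if "j < length (q (1 - i))" for j
          proof (cases "i = 0")
            case True
            have "length (q 0) < n"
              using lq that True by simp
            then show ?thesis using True b by simp
          next
            case False
            then have "i = 1" using i by simp
            then show ?thesis using lq that b by simp
          qed
          then show ?thesis
            using side_mono[OF sdj, of ?U ?s] ne1 by (simp add: q'_def z'_def y'_def subset_insertI)
        qed
        ultimately have sd': "side E K kd inc ?s j (b j) (t j) (set (q' 0) \<union> set (q' 1)) (q' j) (h j) (z' j) (y' j)" if "j < 2" for j
          using less_2_neq[OF i(1) that] unfolding U' by (cases "j = i") auto
        have pr': "prog inc (q' i) (h i) (z' i) = prog inc (q i) (h i) (z i) + 1"
          "prog inc (q' (1 - i)) (h (1 - i)) (z' (1 - i)) = prog inc (q (1 - i)) (h (1 - i)) (z (1 - i))"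
          using S(7) ne1 by (simp_all add: q'_def z'_def prog_def)
        have I0s: "I0 ?s T2" if T2: "T2 \<le> T1 + 60" for T2
        proof (rule I0I[of _ q' h z' y'])
          show "prog inc (q' 0) (h 0) (z' 0) = prog inc (q' 1) (h 1) (z' 1) + reg ?s rsd"
            using pr pr' i01 unfolding i_def[symmetric] by auto
          have "prog inc (q' 0) (h 0) (z' 0) + prog inc (q' 1) (h 1) (z' 1) =
            prog inc (q 0) (h 0) (z 0) + prog inc (q 1) (h 1) (z 1) + 1"
            using pr' i01 by auto
          then show "T2 + 10 \<le> T + 80 * (prog inc (q' 0) (h 0) (z' 0) + prog inc (q' 1) (h 1) (z' 1)) + 20"
            using T1 T2 by simp
          show "reg s rcs < arr ?s acl v \<longleftrightarrow> v \<in> set (q' 0) \<union> set (q' 1)" for v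
            using claim(1)[of v] unfolding U' U_def by simp
        qed (use sd' U' claim(2) i in \<open>auto simp: le_Suc_eq\<close>)
        then have "I ?s T2" if "T2 \<le> T1 + 60" for T2
          using I0s[OF that] sm dn unfolding I_def by (simp add: same_def)
        then show ?thesis
          unfolding race_step_def using p S(2) True i_def[symmetric] fr cl(3)[OF i(1)] by simp
      next
        case False
        have covz: "covered kd K U (z i @ [(u, k)])"
          using S(12) False K claim(1) by (auto simp: covered_def U_def)
        let ?s = "s1\<lparr>arr := (arr s1)(aRP := (arr s1 aRP)(i := arr s anB (arr s1 aRP i))),
          reg := (reg s1)(rp := arr s1 aRP i, ru := u, rsd := 1 - i)\<rparr>"
        have "side E K kd inc ?s i (b i) (t i) U (q i) (h i) (z' i) (y' i)"
          using S p covz unfolding side_def by (auto simp: z'_def y'_def fr Cons e)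
        moreover have "side E K kd inc ?s (1 - i) (b (1 - i)) (t (1 - i)) U (q (1 - i)) (h (1 - i)) (z' (1 - i)) (y' (1 - i))"
          using side_mono[OF sdj order_refl, of ?s] ne1 by (simp add: z'_def y'_def)
        ultimately have sd': "side E K kd inc ?s j (b j) (t j) U (q j) (h j) (z' j) (y' j)" if "j < 2" for j
          using less_2_neq[OF i(1) that] by (cases "j = i") auto
        have pr': "prog inc (q i) (h i) (z' i) = prog inc (q i) (h i) (z i) + 1"
          "prog inc (q (1 - i)) (h (1 - i)) (z' (1 - i)) = prog inc (q (1 - i)) (h (1 - i)) (z (1 - i))"
          using ne1 by (simp_all add: z'_def prog_def)
        have I0s: "I0 ?s T2" if T2: "T2 \<le> T1 + 60" for T2
        proof (rule I0I[of _ q h z' y'])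
          show "prog inc (q 0) (h 0) (z' 0) = prog inc (q 1) (h 1) (z' 1) + reg ?s rsd"
            using pr pr' i01 unfolding i_def[symmetric] by auto
          have "prog inc (q 0) (h 0) (z' 0) + prog inc (q 1) (h 1) (z' 1) =
            prog inc (q 0) (h 0) (z 0) + prog inc (q 1) (h 1) (z 1) + 1"
            using pr' i01 by auto
          then show "T2 + 10 \<le> T + 80 * (prog inc (q 0) (h 0) (z' 0) + prog inc (q 1) (h 1) (z' 1)) + 20"
            using T1 T2 by simp
        qed (use sd' disj claim i in \<open>auto simp: U_def\<close>)
        then have "I ?s T2" if "T2 \<le> T1 + 60" for T2
          using I0s[OF that] sm dn unfolding I_def by (simp add: same_def)
        then show ?thesis
          unfolding race_step_def using p False i_def[symmetric] fr by auto
      qed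
    qed
  next
    fix s1 T1 assume I: "I s1 T1" and bv: "\<not> bval s1 ?b"
    then obtain q where "won E K inc s1 (b (reg s1 rsd)) t q" "T1 + 10 \<le> T + 160 * wt inc (set q)"
      "\<And>u. arr s1 acl u \<le> reg s rcs + 2" "\<And>i. i < 2 \<Longrightarrow> arr s1 aRQ (b i) = t i" "same ?R ?A s s1"
      unfolding I_def I1_def by auto
    then show "Q s1 (T1 + (bcost ?b + 1))" by (intro post) auto
  qed
qed

subsection \<open>Flat vertices\<close>

definition recolor :: com where
  "recolor = While (Less (Reg ri) (Arr aRL (Reg rsd))) (Store acol (Arr aRQ (Reg ri)) (Reg rnc) ;; incr ri)"

definition cross :: "nat \<Rightarrow> com" where
  "cross kd = While (Less (Reg ri) (Arr aRL (Reg rsd)))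
    (rj ::= Arr aRQ (Reg ri) ;; rp ::= Arr afB (Reg rj) ;; cross_nb kd ;; incr ri)"

text \<open>Claims are the stamps \<open>rcs + 1\<close> and \<open>rcs + 2\<close>. After the race
  \<open>rcs\<close> grows by 2, which voids all claims without visiting them.\<close>

definition race_init :: com where
  "race_init =
    (Store aRS (Num 0) (Num 0) ;; Store aRS (Num 1) (Reg rn) ;;
     Store aRQ (Num 0) (Arr atop (Reg rk)) ;; Store aRQ (Reg rn) (Reg rb) ;;
     Store aRH (Num 0) (Num 0) ;; Store aRH (Num 1) (Reg rn) ;;
     Store aRL (Num 0) (Num 1) ;; Store aRL (Num 1) (Bin Add (Reg rn) (Num 1)) ;;
     Store aRP (Num 0) (Arr afB (Arr atop (Reg rk))) ;; Store aRP (Num 1) (Arr afB (Reg rb)) ;;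
     Store aRC (Num 0) (Bin Add (Reg rcs) (Num 1)) ;; Store aRC (Num 1) (Bin Add (Reg rcs) (Num 2)) ;;
     Store acl (Arr atop (Reg rk)) (Bin Add (Reg rcs) (Num 1)) ;;
     Store acl (Reg rb) (Bin Add (Reg rcs) (Num 2)) ;; rsd ::= Num 0 ;; rdn ::= Num 0)"

text \<open>The finishing side gets the fresh colour, whichever of the two tops it started from.
  Only arcs at recoloured vertices can begin to cross between classes, so the cost of
  \<open>cross\<close> is bounded by the lighter part as well.\<close>

definition promote :: "nat \<Rightarrow> com" where
  "promote kd =
    (rwl ::= Bin Sub (Reg rwl) (Num 1) ;; rb ::= Arr awl (Reg rwl) ;; rk ::= Arr acol (Reg rb) ;;
     race_init ;; race kd ;; rcs ::= Bin Add (Reg rcs) (Num 2) ;;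
     Store atop (Reg rnc) (Arr aRQ (Arr aRS (Reg rsd))) ;;
     Store atop (Reg rk) (Arr aRQ (Arr aRS (Bin Sub (Num 1) (Reg rsd)))) ;;
     ri ::= Arr aRS (Reg rsd) ;; recolor ;; ri ::= Arr aRS (Reg rsd) ;; cross kd ;; incr rnc)"

definition promote_all :: "nat \<Rightarrow> com" where
  "promote_all kd = While (Less (Num 0) (Reg rwl)) (promote kd)"

lemma wr_recolor [simp]: "wr recolor = {ri}"
  by (auto simp: recolor_def)

lemma wa_recolor [simp]: "wa recolor = {acol}"
  by (auto simp: recolor_def)

lemma wr_cross [simp]: "wr (cross kd) = {ri, rj, rp, ru, rw, rwl}"
  by (auto simp: cross_def)

lemma wa_cross [simp]: "wa (cross kd) = {aflg, awl}"
  by (auto simp: cross_def)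

lemma wr_race_init [simp]: "wr race_init = {rsd, rdn}"
  by (auto simp: race_init_def)

lemma wa_race_init [simp]: "wa race_init = {aRS, aRQ, aRH, aRL, aRP, aRC, acl}"
  by (auto simp: race_init_def)

lemma wr_promote [simp]:
  "wr (promote kd) = {rwl, rb, rk, rsd, rdn, rp, ru, rcs, ri, rj, rw, rnc}"
  by (auto simp: promote_def)

lemma wa_promote [simp]:
  "wa (promote kd) = {aRS, aRQ, aRH, aRL, aRP, aRC, acl, atop, acol, aflg, awl}"
  by (auto simp: promote_def)

lemma wr_promote_all [simp]:
  "wr (promote_all kd) = {rwl, rb, rk, rsd, rdn, rp, ru, rcs, ri, rj, rw, rnc}"
  by (auto simp: promote_all_def)

lemma wa_promote_all [simp]:
  "wa (promote_all kd) = {aRS, aRQ, aRH, aRL, aRP, aRC, acl, atop, acol, aflg, awl}"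
  by (auto simp: promote_all_def)

lemma wp_recolor:
  assumes i: "reg s ri = b" and q: "arr s aRL (reg s rsd) = b + length q"
      "\<And>j. j < length q \<Longrightarrow> arr s aRQ (b + j) = q ! j"
    and post: "\<And>s' T'. (\<And>v. arr s' acol v = (if v \<in> set q then reg s rnc else arr s acol v)) \<Longrightarrow>
      same {ri} {acol} s s' \<Longrightarrow> T' \<le> T + 30 * length q + 10 \<Longrightarrow> Q s' T'"
  shows "wp recolor Q s T"
proof -
  let ?b = "Less (Reg ri) (Arr aRL (Reg rsd))"
  let ?c = "Store acol (Arr aRQ (Reg ri)) (Reg rnc) ;; incr ri"
  define I where "I = (\<lambda>(s1::state) T1. \<exists>h\<le>length q. reg s1 ri = b + h \<and>
    (\<forall>v. arr s1 acol v = (if v \<in> set (take h q) then reg s rnc else arr s acol v)) \<and> T1 \<le> T + 30 * h)"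
  show ?thesis
    unfolding recolor_def
  proof (rule wp_While[where I = I and B = "T + 30 * length q"])
    show "I s T" unfolding I_def by (rule exI[of _ 0]) (simp add: i)
  next
    fix s1 T1 assume "I s1 T1" then show "T1 \<le> T + 30 * length q" unfolding I_def by fastforce
  next
    fix s1 T1 assume I1: "I s1 T1" and sm: "same (wr ?c) (wa ?c) s s1" and bv: "bval s1 ?b"
    have fr: "arr s1 aRL = arr s aRL" "arr s1 aRQ = arr s aRQ" "reg s1 rsd = reg s rsd" "reg s1 rnc = reg s rnc"
      using sameD[OF sm] by auto
    obtain h where h: "reg s1 ri = b + h" "T1 \<le> T + 30 * h"
      and col: "\<And>v. arr s1 acol v = (if v \<in> set (take h q) then reg s rnc else arr s acol v)"
      using I1 unfolding I_def by blast
    have hl: "h < length q" using bv h q(1) fr by simp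
    show "wp ?c I s1 (T1 + (bcost ?b + 1))"
      apply (simp add: fr h q hl)
      apply (unfold I_def)
      apply (rule exI[of _ "Suc h"])
      using h hl col by (auto simp: take_Suc_conv_app_nth)
  next
    fix s1 T1 assume I1: "I s1 T1" and sm: "same (wr ?c) (wa ?c) s s1" and bv: "\<not> bval s1 ?b"
    have fr: "arr s1 aRL = arr s aRL" "reg s1 rsd = reg s rsd" using sameD[OF sm] by auto
    obtain h where h: "reg s1 ri = b + h" "T1 \<le> T + 30 * h" "h \<le> length q"
      and col: "\<And>v. arr s1 acol v = (if v \<in> set (take h q) then reg s rnc else arr s acol v)"
      using I1 unfolding I_def by blast
    have "h = length q" using bv h q(1) fr by simp
    then show "Q s1 (T1 + (bcost ?b + 1))" using h col sm by (intro post) (auto simp: same_def)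
  qed
qed

lemma wp_cross:
  assumes inv: "wl_inv E C r nc s" and rep: "increp s C E kd inc" and qC: "set q \<subseteq> C" "distinct q"
    and i: "reg s ri = b" and q: "arr s aRL (reg s rsd) = b + length q"
      "\<And>j. j < length q \<Longrightarrow> arr s aRQ (b + j) = q ! j"
    and fl: "\<And>v u k. v \<in> set q \<Longrightarrow> (u, k) \<in> set (inc v) \<Longrightarrow> arr s acol u \<noteq> reg s rnc \<Longrightarrow>
      flat E C r (if k = kd then u else v)"
    and post: "\<And>s' T'. wl_inv E C r nc s' \<Longrightarrow> (\<And>u. arr s aflg u = 1 \<Longrightarrow> arr s' aflg u = 1) \<Longrightarrow>
      (\<And>v u k. v \<in> set q \<Longrightarrow> (u, k) \<in> set (inc v) \<Longrightarrow> arr s acol u \<noteq> reg s rnc \<Longrightarrow>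
        arr s' aflg (if k = kd then u else v) = 1) \<Longrightarrow>
      same {ri, rj, rp, ru, rw, rwl} {aflg, awl} s s' \<Longrightarrow>
      T' \<le> T + 60 * wt inc (set q) + 10 \<Longrightarrow> Q s' T'"
  shows "wp (cross kd) Q s T"
proof -
  let ?b = "Less (Reg ri) (Arr aRL (Reg rsd))"
  let ?c = "rj ::= Arr aRQ (Reg ri) ;; rp ::= Arr afB (Reg rj) ;; cross_nb kd ;; incr ri"
  define hd' where "hd' = (\<lambda>(v::nat) u k. if k = kd then u else v)"
  define I where "I = (\<lambda>s1 T1. \<exists>h\<le>length q. reg s1 ri = b + h \<and> wl_inv E C r nc s1 \<and>
    (\<forall>u. arr s aflg u = 1 \<longrightarrow> arr s1 aflg u = 1) \<and>
    (\<forall>v u k. v \<in> set (take h q) \<longrightarrow> (u, k) \<in> set (inc v) \<longrightarrow> arr s acol u \<noteq> reg s rnc \<longrightarrow>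
      arr s1 aflg (hd' v u k) = 1) \<and> T1 \<le> T + 60 * wt inc (set (take h q)))"
  have wq: "wt inc (set (take h q)) \<le> wt inc (set q)" for h
    by (rule wt_mono) (auto dest: in_set_takeD)
  show ?thesis
    unfolding cross_def
  proof (rule wp_While[where I = I and B = "T + 60 * wt inc (set q)"])
    show "I s T" unfolding I_def by (rule exI[of _ 0]) (simp add: i inv)
  next
    fix s1 T1 assume "I s1 T1"
    then obtain h where "T1 \<le> T + 60 * wt inc (set (take h q))" unfolding I_def by blast
    then show "T1 \<le> T + 60 * wt inc (set q)" using wq[of h] by linarith
  next
    fix s1 T1 assume I1: "I s1 T1" and sm: "same (wr ?c) (wa ?c) s s1" and bv: "bval s1 ?b"
    have fr: "arr s1 aRL = arr s aRL" "arr s1 aRQ = arr s aRQ" "reg s1 rsd = reg s rsd" "reg s1 rnc = reg s rnc"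
      "arr s1 acol = arr s acol" "arr s1 afB = arr s afB" "arr s1 anB = arr s anB" "arr s1 abB = arr s abB"
      "arr s1 akB = arr s akB"
      using sameD[OF sm] by auto
    obtain h where h: "reg s1 ri = b + h" "T1 \<le> T + 60 * wt inc (set (take h q))" and wi: "wl_inv E C r nc s1"
      and mono: "\<And>u. arr s aflg u = 1 \<Longrightarrow> arr s1 aflg u = 1"
      and dn: "\<And>v u k. v \<in> set (take h q) \<Longrightarrow> (u, k) \<in> set (inc v) \<Longrightarrow> arr s acol u \<noteq> reg s rnc \<Longrightarrow>
        arr s1 aflg (hd' v u k) = 1"
      using I1 unfolding I_def by blast
    have hl: "h < length q" using bv h q(1) fr by simp
    let ?v = "q ! h"
    have v: "?v \<in> set q" "?v \<in> C" using hl qC by auto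
    let ?s = "s1\<lparr>reg := (reg s1)(rj := ?v, rp := arr s afB ?v)\<rparr>"
    have wi': "wl_inv E C r nc ?s" by (rule wl_inv_cong[OF wi]) simp_all
    have rep': "increp ?s C E kd inc" by (rule increp_cong[OF rep]) (simp_all add: fr)
    show "wp ?c I s1 (T1 + (bcost ?b + 1))"
      apply (simp add: h q hl fr)
      apply (rule wp_cross_nb[OF wi' rep'])
         apply (simp add: v)
        apply (simp add: fr)
      subgoal for u k using fl[OF v(1), of u k] by (simp add: fr split: if_splits)
      subgoal premises p for s' T'
      proof -
        have fr': "reg s' ri = b + h" using sameD[OF p(4)] h by simp
        have m2: "arr s' aflg u = 1" if "arr s1 aflg u = 1" for u using p(2)[of u] that by simp
        have p3: "arr s' aflg (hd' ?v u k) = 1"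
          if "(u, k) \<in> set (inc ?v)" "arr s acol u \<noteq> reg s rnc" for u k
          using p(3)[of u k] that by (simp add: hd'_def fr split: if_splits)
        have tk: "set (take (Suc h) q) = insert ?v (set (take h q))"
          using hl by (auto simp: take_Suc_conv_app_nth)
        have w: "wt inc (set (take (Suc h) q)) = wt inc (set (take h q)) + length (inc ?v) + 1"
          by (rule wt_take_Suc[OF qC(2) hl])
        show ?thesis
          apply simp
          apply (unfold I_def)
          apply (rule exI[of _ "Suc h"])
          apply (intro conjI)
          using hl apply simp
          using fr' apply simp
             apply (rule wl_inv_cong[OF p(1)]; simp)
          using p(2) mono apply simp
          subgoal using m2[OF dn] p3 unfolding tk by auto
          using p(5) h(2) unfolding w by simp
      qed
      done
  next
    fix s1 T1 assume I1: "I s1 T1" and sm: "same (wr ?c) (wa ?c) s s1" and bv: "\<not> bval s1 ?b"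
    have fr: "arr s1 aRL = arr s aRL" "reg s1 rsd = reg s rsd" using sameD[OF sm] by auto
    obtain h where h: "reg s1 ri = b + h" "T1 \<le> T + 60 * wt inc (set (take h q))" "h \<le> length q"
      and wi: "wl_inv E C r nc s1" and mono: "\<And>u. arr s aflg u = 1 \<Longrightarrow> arr s1 aflg u = 1"
      and dn: "\<And>v u k. v \<in> set (take h q) \<Longrightarrow> (u, k) \<in> set (inc v) \<Longrightarrow> arr s acol u \<noteq> reg s rnc \<Longrightarrow>
        arr s1 aflg (hd' v u k) = 1"
      using I1 unfolding I_def by blast
    have "h = length q" using bv h q(1) fr by simp
    then show "Q s1 (T1 + (bcost ?b + 1))"
      using h wi mono dn sm unfolding hd'_def by (intro post) (auto simp: same_def)
  qed
qed

lemma wp_race_init: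
  assumes rep: "increp s C E kd inc" and n: "0 < reg s rn"
    and t: "t = (\<lambda>i. if i = 0 then arr s atop (reg s rk) else reg s rb)" "t 0 \<noteq> t 1" "t 0 \<in> K" "t 1 \<in> K" "K \<subseteq> C"
    and cl: "\<And>u. arr s acl u \<le> reg s rcs"
    and post: "\<And>s' T'. (\<And>i. i < 2 \<Longrightarrow> side E K kd inc s' i (if i = 0 then 0 else reg s rn) (t i) {t 0, t 1} [t i] 0 [] (inc (t i))) \<Longrightarrow>
      (\<And>u. reg s rcs < arr s' acl u \<longleftrightarrow> u = t 0 \<or> u = t 1) \<Longrightarrow> (\<And>u. arr s' acl u \<le> reg s rcs + 2) \<Longrightarrow>
      (\<And>i. i < 2 \<Longrightarrow> arr s' aRC i = reg s rcs + 1 + i) \<Longrightarrow> reg s' rsd = 0 \<Longrightarrow> reg s' rdn = 0 \<Longrightarrow>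
      (\<And>i. i < 2 \<Longrightarrow> arr s' aRS i = (if i = 0 then 0 else reg s rn)) \<Longrightarrow>
      same {rsd, rdn} {aRS, aRQ, aRH, aRL, aRP, aRC, acl} s s' \<Longrightarrow> T' \<le> T + 80 \<Longrightarrow> Q s' T'"
  shows "wp race_init Q s T"
proof -
  have nb: "nbs (arr s anB) (\<lambda>p. (arr s abB p, arr s akB p)) (arr s afB (t i)) (inc (t i))" if "i < 2" for i
    using rep t that by (cases "i = 0") (auto simp: increp_def less_2_cases_iff)
  have cl': "\<not> reg s rcs < arr s acl u" "arr s acl u \<le> Suc (Suc (reg s rcs))" for u
    using cl[of u] by auto
  show ?thesis
    unfolding race_init_def
    apply simp
    apply (rule post)
    using nb[of 0] nb[of 1] t n cl cl' spans_singleton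
    by (auto simp: side_def covered_def same_def less_2_cases_iff le_SucI)
qed

text \<open>The out-neighbours of \<open>r\<close> have a clause of their own: they are flat at
  once, while at the start they share the class of \<open>r\<close>, where \<open>cross_ok\<close>
  demands nothing.\<close>

definition flat_inv :: "(nat \<times> nat) set \<Rightarrow> nat set \<Rightarrow> nat \<Rightarrow> state \<Rightarrow> bool" where
  "flat_inv E C r s \<longleftrightarrow> wl_inv E C r (reg s rnc) s \<and> cross_ok E C s \<and>
     (\<forall>u\<in>C. (r, u) \<in> E \<longrightarrow> arr s aflg u = 1) \<and> arr s aflg r = 1 \<and>
     (\<forall>u. arr s acl u \<le> reg s rcs)"

definition potential :: "(nat \<Rightarrow> 'a list) \<Rightarrow> nat set \<Rightarrow> state \<Rightarrow> nat" where
  "potential inc C s = (\<Sum>c<reg s rnc. pot (wt inc {v \<in> C. arr s acol v = c}))"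

text \<open>Only the class \<open>k\<close> changes, and \<open>pot_add\<close> applies to its two
  parts. The released amount \<open>wt inc A\<close> is, up to a constant factor, the cost of the
  race, the recolouring and the scan for crossing arcs.\<close>

lemma potential_split:
  assumes fin: "finite C" and k: "k < nc" and A: "A \<subseteq> {v \<in> C. col v = k}" "A \<noteq> {}"
    and lt: "\<And>v. v \<in> C \<Longrightarrow> col v < nc"
    and col': "\<And>v. v \<in> C \<Longrightarrow> col' v = (if v \<in> A then nc else col v)"
    and le: "wt inc A \<le> wt inc ({v \<in> C. col v = k} - A)"
  shows "(\<Sum>c<Suc nc. pot (wt inc {v \<in> C. col' v = c})) + wt inc A \<le>
    (\<Sum>c<nc. pot (wt inc {v \<in> C. col v = c}))"
proof -
  let ?K = "{v \<in> C. col v = k}"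
  have e: "{v \<in> C. col' v = c} = {v \<in> C. col v = c} - A" if "c < nc" for c
  proof (intro set_eqI)
    fix v show "v \<in> {v \<in> C. col' v = c} \<longleftrightarrow> v \<in> {v \<in> C. col v = c} - A"
      using col'[of v] that by (cases "v \<in> C") auto
  qed
  have A': "{v \<in> C. col' v = nc} = A"
  proof (intro set_eqI)
    fix v show "v \<in> {v \<in> C. col' v = nc} \<longleftrightarrow> v \<in> A"
      using col'[of v] lt[of v] A by (cases "v \<in> C") auto
  qed
  have o: "{v \<in> C. col v = c} - A = {v \<in> C. col v = c}" if "c \<noteq> k" for c using A that by auto
  have finA: "finite A" "finite (?K - A)" using fin finite_subset[OF A(1)] by auto
  obtain a where "a \<in> A" using A by blast
  then have "1 \<le> wt inc A" unfolding wt_def using finA(1) by (simp add: sum.remove)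
  then have "pot (wt inc A) + pot (wt inc (?K - A)) + wt inc A \<le> pot (wt inc A + wt inc (?K - A))"
    using le by (intro pot_add)
  also have "wt inc A + wt inc (?K - A) = wt inc ?K"
  proof -
    have "A \<union> (?K - A) = ?K" using A by blast
    then show ?thesis using wt_Un[OF finA, of inc] by (metis Diff_disjoint)
  qed
  finally have *: "pot (wt inc A) + pot (wt inc (?K - A)) + wt inc A \<le> pot (wt inc ?K)" .
  have "(\<Sum>c<Suc nc. pot (wt inc {v \<in> C. col' v = c})) = pot (wt inc A) + (\<Sum>c<nc. pot (wt inc ({v \<in> C. col v = c} - A)))"
    using A' e by simp
  also have "(\<Sum>c<nc. pot (wt inc ({v \<in> C. col v = c} - A))) =
      pot (wt inc (?K - A)) + (\<Sum>c\<in>{..<nc} - {k}. pot (wt inc ({v \<in> C. col v = c} - A)))"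
    using k by (simp add: sum.remove)
  also have "(\<Sum>c\<in>{..<nc} - {k}. pot (wt inc ({v \<in> C. col v = c} - A))) =
      (\<Sum>c\<in>{..<nc} - {k}. pot (wt inc {v \<in> C. col v = c}))"
    by (rule sum.cong) (auto simp: o)
  finally have **: "(\<Sum>c<Suc nc. pot (wt inc {v \<in> C. col' v = c})) = pot (wt inc A) +
      (pot (wt inc (?K - A)) + (\<Sum>c\<in>{..<nc} - {k}. pot (wt inc {v \<in> C. col v = c})))" .
  have "pot (wt inc ?K) + (\<Sum>c\<in>{..<nc} - {k}. pot (wt inc {v \<in> C. col v = c})) = (\<Sum>c<nc. pot (wt inc {v \<in> C. col v = c}))"
    using k by (simp add: sum.remove)
  with * ** show ?thesis by linarith
qed


lemmas wp_SeqD = iffD1[OF wp_Seq]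

lemma wp_state_eq: "wp c Q s T \<Longrightarrow> s = s' \<Longrightarrow> wp c Q s' T"
  by simp

lemma card_le_wt: "card S \<le> wt inc S"
proof -
  have "(\<Sum>v\<in>S. 1) \<le> (\<Sum>v\<in>S. length (inc v) + 1)" by (rule sum_mono) simp
  then show ?thesis by (simp add: wt_def)
qed

lemma wp_promote:
  assumes inv: "flat_inv E C r s" and wl0: "0 < reg s rwl" and rep: "increp s C E kd inc"
    and C: "finite C" "card C \<le> reg s rn"
    and post: "\<And>s' T'. flat_inv E C r s' \<Longrightarrow>
      T' + 20 + 600 * potential inc C s' \<le> T + 600 * potential inc C s \<Longrightarrow> Q s' T'"
  shows "wp (promote kd) Q s T"
proof -
  let ?col = "arr s acol" and ?tp = "arr s atop" and ?nc = "reg s rnc" and ?flg = "arr s aflg"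
  obtain wl where cl: "classes E C r ?col ?tp ?nc ?flg" and wl: "wl_rep s C wl"
    and cr: "cross_ok E C s" and out: "\<And>u. u \<in> C \<Longrightarrow> (r, u) \<in> E \<Longrightarrow> ?flg u = 1"
    and acl: "\<And>u. arr s acl u \<le> reg s rcs" and rf: "?flg r = 1"
    using inv unfolding flat_inv_def wl_inv_def by blast
  have "wl \<noteq> []" using wl wl0 by (auto simp: wl_rep_def)
  define wl' where "wl' = butlast wl"
  define b where "b = last wl"
  have wl_eq: "wl = wl' @ [b]" using \<open>wl \<noteq> []\<close> by (simp add: wl'_def b_def)
  have lw: "reg s rwl - 1 = length wl'" "arr s awl (length wl') = b"
    using wl unfolding wl_rep_def wl_eq by (auto dest: spec[of _ "length wl'"])
  have b: "b \<in> C" "?flg b = 1" "b \<noteq> ?tp (?col b)" "b \<notin> set wl'"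
    using wl unfolding wl_rep_def wl_eq by auto
  define k where "k = ?col b"
  define K where "K = {v \<in> C. ?col v = k}"
  have k: "k < ?nc" using cl b by (auto simp: classes_def k_def)
  have tk: "?tp k \<in> C" "?col (?tp k) = k" "?flg (?tp k) = 1" "spans E K (?tp k)"
    using cl k by (auto simp: classes_def K_def)
  define t where "t = (\<lambda>i::nat. if i = 0 then ?tp k else b)"
  define bs where "bs = (\<lambda>i::nat. if i = 0 then 0 else reg s rn)"
  have n: "0 < reg s rn" using C b by (metis card_gt_0_iff empty_iff less_le_trans)
  have finK: "finite K" using C by (simp add: K_def)
  let ?s1 = "s\<lparr>reg := (reg s)(rwl := length wl', rb := b, rk := k)\<rparr>"
  have rep1: "increp ?s1 C E kd inc" by (rule increp_cong[OF rep]) simp_all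
  have goal2: "wp (race kd ;; rcs ::= Bin Add (Reg rcs) (Num 2) ;;
     Store atop (Reg rnc) (Arr aRQ (Arr aRS (Reg rsd))) ;;
     Store atop (Reg rk) (Arr aRQ (Arr aRS (Bin Sub (Num 1) (Reg rsd)))) ;;
     ri ::= Arr aRS (Reg rsd) ;; recolor ;; ri ::= Arr aRS (Reg rsd) ;; cross kd ;; incr rnc) Q s2 T2"
    if sd: "\<And>i. i < 2 \<Longrightarrow> side E K kd inc s2 i (bs i) (t i) {t 0, t 1} [t i] 0 [] (inc (t i))"
      and c2: "\<And>u. reg s rcs < arr s2 acl u \<longleftrightarrow> u = t 0 \<or> u = t 1" "\<And>u. arr s2 acl u \<le> reg s rcs + 2"
      "\<And>i. i < 2 \<Longrightarrow> arr s2 aRC i = reg s rcs + 1 + i" and r2: "reg s2 rsd = 0" "reg s2 rdn = 0"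
      and RS: "\<And>i. i < 2 \<Longrightarrow> arr s2 aRS i = bs i"
      and sm2: "same {rsd, rdn} {aRS, aRQ, aRH, aRL, aRP, aRC, acl} ?s1 s2" and T2: "T2 \<le> T + 120"
    for s2 T2
  proof -
    have f2: "reg s2 rcs = reg s rcs" "reg s2 rnc = ?nc" "reg s2 rk = k" "reg s2 rwl = length wl'"
      "arr s2 acol = ?col" "arr s2 atop = ?tp" "arr s2 aflg = ?flg" "arr s2 awl = arr s awl"
      "arr s2 anB = arr s anB" "arr s2 abB = arr s abB" "arr s2 akB = arr s akB" "arr s2 afB = arr s afB"
      using sameD[OF sm2] by auto
    have rep2: "increp s2 C E kd inc" by (rule increp_cong[OF rep]) (simp_all add: f2)
    have t01: "t 0 \<noteq> t 1" "spans E K (t 0)" using b(3) tk by (auto simp: t_def k_def)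
    show ?thesis
      apply (subst wp_Seq)
      apply (rule wp_race[where K = K and C = C and b = bs and t = t and n = "reg s rn"
            and kd = kd and inc = inc and E = E])
                     apply (rule rep2)
                    apply (rule C)+
                  apply (simp add: K_def f2)
                 apply (simp add: bs_def)
                apply (rule sd, assumption)
               apply (rule t01)+
             apply (simp_all only: f2 c2 r2)
      subgoal premises p for s3 T3 q
      proof -
        have won: "won E K inc s3 (bs (reg s3 rsd)) t q" and T3: "T3 \<le> T2 + 160 * wt inc (set q)"
          and acl3: "\<And>u. arr s3 acl u \<le> reg s rcs + 2" using p by auto
        note sm3 = p(4)
        define i where "i = reg s3 rsd"
        have i: "i < 2" "1 - i < 2" using won by (auto simp: won_def i_def)
        have q: "arr s3 aRL i = bs i + length q" "\<And>j. j < length q \<Longrightarrow> arr s3 aRQ (bs i + j) = q ! j"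
          "distinct q" "q \<noteq> []" "q ! 0 = t i" "set q \<subseteq> K" "spans E (set q) (t i)"
          "spans E (K - set q) (t (1 - i))" "wt inc (set q) \<le> wt inc (K - set q)"
          using won by (auto simp: won_def i_def)
        have f3: "reg s3 rcs = reg s rcs" "reg s3 rnc = ?nc" "reg s3 rk = k" "reg s3 rwl = length wl'"
          "arr s3 acol = ?col" "arr s3 atop = ?tp" "arr s3 aflg = ?flg" "arr s3 awl = arr s awl"
          "arr s3 anB = arr s anB" "arr s3 abB = arr s abB" "arr s3 akB = arr s akB" "arr s3 afB = arr s afB"
          "arr s3 aRS = arr s2 aRS"
          using sameD[OF sm3] f2 by auto
        have RS3: "arr s2 aRS i = bs i" "arr s2 aRS (1 - i) = bs (1 - i)" using RS i by auto
        have hd2: "arr s3 aRQ (bs i) = t i" "arr s3 aRQ (bs (1 - i)) = t (1 - i)" using p(3) i by auto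
        have A: "set q \<subseteq> {v \<in> C. ?col v = k}" "set q \<noteq> {}" "set q \<subseteq> C" using q(4,6) by (auto simp: K_def)
        have tf: "?flg (t j) = 1" for j using b tk by (simp add: t_def)
        have tt: "t i = ?tp k \<and> t (1 - i) = b \<or> t i = b \<and> t (1 - i) = ?tp k"
          using i by (cases "i = 0") (auto simp: t_def)
        have tq: "t i \<in> set q" "t (1 - i) \<in> K - set q" using q(7,8) by (auto simp: spans_def)
        have lt: "?col v < ?nc" if "v \<in> C" for v using cl that by (auto simp: classes_def)
        have wq2: "length q \<le> wt inc (set q)"
          using q(3) card_le_wt[of "set q" inc] by (simp add: distinct_card)
        moreover have "1 \<le> length q" using q(4) by (cases q) auto
        ultimately have wq: "1 \<le> wt inc (set q)" "length q \<le> wt inc (set q)" by auto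
        define s4 where "s4 = s3\<lparr>arr := (arr s3)(atop := ?tp(?nc := t i, k := t (1 - i))),
          reg := (reg s3)(rcs := Suc (Suc (reg s rcs)), ri := bs i)\<rparr>"
        have f4: "reg s4 rcs = Suc (Suc (reg s rcs))" "reg s4 rnc = ?nc" "reg s4 rsd = i" "reg s4 ri = bs i"
          "reg s4 rwl = length wl'" "arr s4 acol = ?col" "arr s4 atop = ?tp(?nc := t i, k := t (1 - i))"
          "arr s4 aflg = ?flg" "arr s4 awl = arr s awl" "arr s4 anB = arr s anB" "arr s4 abB = arr s abB"
          "arr s4 akB = arr s akB" "arr s4 afB = arr s afB" "arr s4 aRS i = bs i" "arr s4 aRL = arr s3 aRL"
          "arr s4 aRQ = arr s3 aRQ" "arr s4 acl = arr s3 acl"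
          by (simp_all add: s4_def f3 RS3 i_def[symmetric])
        have goal4: "wp (recolor ;; ri ::= Arr aRS (Reg rsd) ;; cross kd ;; incr rnc) Q s4 T4"
          if T4: "T4 \<le> T3 + 60" for T4
          apply (subst wp_Seq)
          apply (rule wp_recolor[where q = q and b = "bs i"])
             apply (simp add: f4)
            apply (simp add: f4 q)
           apply (simp add: f4 q)
          subgoal premises r for s5 T5
          proof -
            have col5: "arr s5 acol v = (if v \<in> set q then ?nc else ?col v)" for v using r(1) f4 by simp
            have f5: "reg s5 rcs = Suc (Suc (reg s rcs))" "reg s5 rnc = ?nc" "reg s5 rsd = i"
              "reg s5 rwl = length wl'" "arr s5 atop = ?tp(?nc := t i, k := t (1 - i))"
              "arr s5 aflg = ?flg" "arr s5 awl = arr s awl" "arr s5 anB = arr s anB" "arr s5 abB = arr s abB"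
              "arr s5 akB = arr s akB" "arr s5 afB = arr s afB" "arr s5 aRS i = bs i" "arr s5 aRL = arr s3 aRL"
              "arr s5 aRQ = arr s3 aRQ" "arr s5 acl = arr s3 acl"
              using sameD[OF r(2)] f4 by auto
            have top5: "arr s5 atop c = (if c = ?nc then t i else if c = k then t (1 - i) else ?tp c)" for c
              using k by (simp add: f5)
            have cl5: "classes E C r (arr s5 acol) (arr s5 atop) (Suc ?nc) (arr s5 aflg)"
              unfolding f5(6)
              by (rule classes_split[OF cl k A(1) q(7) q(8)[unfolded K_def] tf tf col5 top5])
            \<comment> \<open>Whichever side won, the tops of the two parts are the old top and
              \<open>b\<close>; so \<open>b\<close> is the only vertex that becomes a top, and the
              rest of the stack stays valid.\<close>
            have tops: "arr s5 atop (arr s5 acol u) = u \<longleftrightarrow> u = ?tp (?col u) \<or> u = b" if "u \<in> C" for u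
            proof (cases "?col u = k")
              case True
              have "t i \<noteq> t (1 - i)" using tq by auto
              have uK: "u \<in> K" using True that by (simp add: K_def)
              show ?thesis
              proof (cases "u \<in> set q")
                case True
                then have "arr s5 atop (arr s5 acol u) = t i" "u \<noteq> t (1 - i)" using col5 top5 tq by auto
                then show ?thesis using tt \<open>?col u = k\<close> by auto
              next
                case False
                then have "arr s5 atop (arr s5 acol u) = t (1 - i)" "u \<noteq> t i" using col5 top5 tq True k by auto
                then show ?thesis using tt \<open>?col u = k\<close> by auto
              qed
            next
              case False
              then have "u \<notin> set q" "u \<noteq> b" using A by (auto simp: k_def)
              then show ?thesis using col5 top5 lt[OF that] False by auto
            qed
            have wl5: "wl_rep s5 C wl'"
              unfolding wl_rep_def f5
            proof (intro conjI ballI allI impI)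
              show "arr s awl j = wl' ! j" if "j < length wl'" for j
                using wl that unfolding wl_rep_def wl_eq by (auto simp: nth_append dest: spec[of _ j])
              show "distinct wl'" using wl unfolding wl_rep_def wl_eq by simp
              fix u
              show "?flg u \<le> 1" if "u \<in> C" using wl that unfolding wl_rep_def by blast
              show "u \<in> C" "?flg u = 1" if "u \<in> set wl'" using wl that unfolding wl_rep_def wl_eq by auto
              show "u \<noteq> (?tp(?nc := t i, k := t (1 - i))) (arr s5 acol u)" if "u \<in> set wl'"
              proof -
                have "u \<in> C" "u \<noteq> ?tp (?col u)" using wl that unfolding wl_rep_def wl_eq by auto
                moreover have "u \<noteq> b" using that b by blast
                ultimately show ?thesis using tops[of u] unfolding f5 by metis
              qed
              show "u = (?tp(?nc := t i, k := t (1 - i))) (arr s5 acol u) \<or> u \<in> set wl'"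
                if "u \<in> C" "?flg u = 1"
              proof -
                have "u = ?tp (?col u) \<or> u \<in> set wl' \<or> u = b" using wl that unfolding wl_rep_def wl_eq by auto
                then show ?thesis using tops[of u] that unfolding f5 by metis
              qed
            qed simp
            let ?s6 = "s5\<lparr>reg := (reg s5)(ri := bs i)\<rparr>"
            have wi6: "wl_inv E C r (Suc ?nc) ?s6"
              using cl5 wl5 by (auto simp: wl_inv_def wl_rep_def)
            have rep6: "increp ?s6 C E kd inc" by (rule increp_cong[OF rep]) (simp_all add: f5)
            have mem: "u \<in> C" "kk = kd \<Longrightarrow> (v, u) \<in> E" "kk \<noteq> kd \<Longrightarrow> (u, v) \<in> E"
              if "v \<in> set q" "(u, kk) \<in> set (inc v)" for v u kk
              using rep that A(3) by (auto simp: increp_def)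
            show ?thesis
              apply (simp add: f5)
              apply (rule wp_cross[OF wi6 rep6 A(3) q(3), where b = "bs i"])
                  apply simp
                 apply (simp add: f5 q)
                apply (simp add: f5 q)
              subgoal premises h for v u kk
              proof -
                have vC: "v \<in> C" and cv: "arr s5 acol v = ?nc" using h A col5 by auto
                have cu: "arr s5 acol u \<noteq> ?nc" using h(3) by (simp add: f5)
                show ?thesis
                  using flat_cross[OF cl5, of v u] flat_cross[OF cl5, of u v] mem[OF h(1,2)] vC cv cu by auto
              qed
              subgoal premises h for s7 T7
              proof -
                have f7: "reg s7 rcs = Suc (Suc (reg s rcs))" "reg s7 rnc = ?nc" "arr s7 acol = arr s5 acol"
                  "arr s7 acl = arr s3 acl" using sameD[OF h(4)] f5 by auto
                have h3: "arr s7 aflg (if kk = kd then u else v) = 1"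
                  if "v \<in> set q" "(u, kk) \<in> set (inc v)" "arr s5 acol u \<noteq> ?nc" for v u kk
                  using h(3)[OF that(1,2)] that(3) by (simp add: f5)
                have mono: "?flg u = 1 \<Longrightarrow> arr s7 aflg u = 1" for u using h(2)[of u] by (simp add: f5)
                let ?s8 = "s7\<lparr>reg := (reg s7)(rnc := Suc ?nc)\<rparr>"
                have "flat_inv E C r ?s8"
                  unfolding flat_inv_def
                proof (intro conjI)
                  show "wl_inv E C r (reg ?s8 rnc) ?s8" using h(1) by (auto simp: wl_inv_def wl_rep_def)
                  show "\<forall>u\<in>C. (r, u) \<in> E \<longrightarrow> arr ?s8 aflg u = 1" using out mono by simp
                  show "arr ?s8 aflg r = 1" using rf mono by simp
                  show "\<forall>u. arr ?s8 acl u \<le> reg ?s8 rcs" using acl3 by (simp add: f7)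
                  \<comment> \<open>An arc that joins two colours only since the split has an end in
                    the recoloured part, whose lists have just been scanned.\<close>
                  show "cross_ok E C ?s8"
                    unfolding cross_ok_def
                  proof (intro ballI impI)
                    fix a u assume au: "a \<in> C" "u \<in> C" "(a, u) \<in> E" and ne: "arr ?s8 acol a \<noteq> arr ?s8 acol u"
                    have ne5: "arr s5 acol a \<noteq> arr s5 acol u" using ne by (simp add: f7)
                    show "arr ?s8 aflg u = 1"
                    proof (cases "a \<in> set q")
                      case True
                      then have "(u, kd) \<in> set (inc a)" "arr s5 acol u \<noteq> ?nc"
                        using rep au ne5 col5[of a] by (auto simp: increp_def)
                      then show ?thesis using h3[OF True] by fastforce
                    next
                      case aq: False
                      show ?thesis
                      proof (cases "u \<in> set q")
                        case True
                        then have "arr s5 acol a \<noteq> ?nc" using ne5 col5[of u] by auto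
                        moreover obtain kk where "kk \<noteq> kd" "(a, kk) \<in> set (inc u)"
                          using rep au unfolding increp_def by blast
                        ultimately show ?thesis using h3[OF True, of a kk] by simp
                      next
                        case False
                        then have "?col a \<noteq> ?col u" using aq ne5 col5 by simp
                        then have "?flg u = 1" using cr au by (auto simp: cross_ok_def)
                        then show ?thesis using mono by simp
                      qed
                    qed
                  qed
                qed
                moreover have pot: "potential inc C ?s8 + wt inc (set q) \<le> potential inc C s"
                  using potential_split[OF C(1) k A(1,2) lt col5 q(9)[unfolded K_def]]
                  unfolding potential_def by (simp add: f7)
                \<comment> \<open>Per unit of weight, 160 for the race, 30 for recolouring and 60
                  for the crossing arcs; the constant overhead is covered because the weight is at
                  least 1.\<close>
                moreover have "T7 + 24 + 600 * potential inc C ?s8 \<le> T + 600 * potential inc C s"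
                  using T2 T3 T4 r(3) h(5) wq pot by simp
                ultimately show ?thesis by (auto intro: post simp: f7)
              qed
              done
          qed
          done
        show ?thesis
          apply (simp only: wp_Seq wp_Assign wp_Store)
          apply (rule wp_state_eq[OF wp_SeqD[OF goal4]])
          by (simp_all add: s4_def f3 RS3[unfolded One_nat_def] hd2[unfolded One_nat_def] i_def[symmetric])
      qed
      done
  qed
  have goal1: "wp (race_init ;; race kd ;; rcs ::= Bin Add (Reg rcs) (Num 2) ;;
     Store atop (Reg rnc) (Arr aRQ (Arr aRS (Reg rsd))) ;;
     Store atop (Reg rk) (Arr aRQ (Arr aRS (Bin Sub (Num 1) (Reg rsd)))) ;;
     ri ::= Arr aRS (Reg rsd) ;; recolor ;; ri ::= Arr aRS (Reg rsd) ;; cross kd ;; incr rnc) Q ?s1 T1" if T1: "T1 \<le> T + 40" for T1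
    apply (subst wp_Seq)
    apply (rule wp_race_init[OF rep1, where K = K and t = t])
          apply (use n b tk acl in \<open>auto simp: t_def K_def k_def\<close>)[7]
    subgoal premises p for s2 T2
      apply (rule goal2)
      subgoal for i using p(1)[of i] by (simp add: bs_def split: if_splits)
      using p T1 by (simp_all add: bs_def)
    done
  show ?thesis
    unfolding promote_def
    apply (simp only: wp_Seq wp_Assign)
    apply (rule wp_state_eq[OF wp_SeqD[OF goal1]])
    by (simp_all add: lw[unfolded One_nat_def] k_def)
qed


section \<open>The complete flatness test for one root and one direction\<close>

definition clear_cols :: com where
  "clear_cols = While (Less (Reg ri) (Reg rve))
    (ru ::= Arr aV (Reg ri) ;; Store acol (Reg ru) (Num 0) ;; Store aflg (Reg ru) (Num 0) ;; incr ri)"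

definition find_unflagged :: com where
  "find_unflagged = While (Less (Reg ri) (Reg rve))
    (ru ::= Arr aV (Reg ri) ;;
     If1 (Equal (Arr aflg (Reg ru)) (Num 0))
       (rbad ::= Num 1 ;; rb ::= Reg ru ;; rl ::= Arr atop (Arr acol (Reg ru))) ;;
     incr ri)"

text \<open>As colour \<open>rnc = 1\<close> does not occur yet, \<open>cross_nb\<close> flags exactly the out-neighbours of \<open>r\<close>.\<close>

definition flat_test :: "nat \<Rightarrow> com" where
  "flat_test kd =
    (ri ::= Reg rvb ;; clear_cols ;; rj ::= Arr aV (Reg rvb) ;; Store aflg (Reg rj) (Num 1) ;;
     Store atop (Num 0) (Reg rj) ;; rnc ::= Num 1 ;; rwl ::= Num 0 ;; rp ::= Arr afB (Reg rj) ;;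
     cross_nb kd ;; promote_all kd ;; rbad ::= Num 0 ;; ri ::= Reg rvb ;; find_unflagged)"

lemma wr_clear_cols [simp]: "wr clear_cols = {ru, ri}"
  by (auto simp: clear_cols_def)

lemma wa_clear_cols [simp]: "wa clear_cols = {acol, aflg}"
  by (auto simp: clear_cols_def)

lemma wr_find_unflagged [simp]: "wr find_unflagged = {ru, ri, rbad, rb, rl}"
  by (auto simp: find_unflagged_def)

lemma wa_find_unflagged [simp]: "wa find_unflagged = {}"
  by (auto simp: find_unflagged_def)

lemma wr_flat_test [simp]:
  "wr (flat_test kd) = {rwl, rb, rk, rsd, rdn, rp, ru, rcs, ri, rj, rw, rnc, rbad, rl}"
  by (auto simp: flat_test_def)

lemma wa_flat_test [simp]:
  "wa (flat_test kd) = {aRS, aRQ, aRH, aRL, aRP, aRC, acl, atop, acol, aflg, awl}"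
  by (auto simp: flat_test_def)

lemma wp_promote_all:
  assumes inv: "flat_inv E C r s" and rep: "increp s C E kd inc"
    and C: "finite C" "card C \<le> reg s rn"
    and post: "\<And>s' T'. flat_inv E C r s' \<Longrightarrow> reg s' rwl = 0 \<Longrightarrow>
      same (wr (promote_all kd)) (wa (promote_all kd)) s s' \<Longrightarrow>
      T' \<le> T + 600 * potential inc C s + 10 \<Longrightarrow> Q s' T'"
  shows "wp (promote_all kd) Q s T"
  unfolding promote_all_def
proof (rule wp_While[where B = "T + 600 * potential inc C s" and
      I = "\<lambda>s1 T1. flat_inv E C r s1 \<and> T1 + 600 * potential inc C s1 \<le> T + 600 * potential inc C s"])
  let ?I = "\<lambda>s1 T1. flat_inv E C r s1 \<and> T1 + 600 * potential inc C s1 \<le> T + 600 * potential inc C s"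
  let ?b = "Less (Num 0) (Reg rwl)"
  show "?I s T" using inv by simp
  fix s1 T1 assume I: "?I s1 T1" and sm: "same (wr (promote kd)) (wa (promote kd)) s s1"
  have fr: "arr s1 anB = arr s anB" "arr s1 abB = arr s abB" "arr s1 akB = arr s akB"
    "arr s1 afB = arr s afB" "reg s1 rn = reg s rn" using sameD[OF sm] by auto
  show "T1 \<le> T + 600 * potential inc C s" using I by linarith
  show "wp (promote kd) ?I s1 (T1 + (bcost ?b + 1))" if b: "bval s1 ?b"
  proof (rule wp_promote[of E C r s1 kd inc])
    show "flat_inv E C r s1" using I by blast
    show "0 < reg s1 rwl" using b by simp
    show "increp s1 C E kd inc" by (rule increp_cong[OF rep]) (simp_all add: fr)
    show "finite C" by fact
    show "card C \<le> reg s1 rn" using C fr by simp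
    fix s' T' assume "flat_inv E C r s'"
      "T' + 20 + 600 * potential inc C s' \<le> T1 + (bcost ?b + 1) + 600 * potential inc C s1"
    then show "?I s' T'" using I by simp
  qed
  show "Q s1 (T1 + (bcost ?b + 1))" if b: "\<not> bval s1 ?b"
    using I b sm by (intro post) auto
qed

lemma wp_clear_cols:
  assumes i: "reg s ri = reg s rvb" "reg s rvb \<le> reg s rve"
    and post: "\<And>s' T'. (\<And>v. v \<in> arr s aV ` {reg s rvb..<reg s rve} \<Longrightarrow> arr s' acol v = 0 \<and> arr s' aflg v = 0) \<Longrightarrow>
      same {ru, ri} {acol, aflg} s s' \<Longrightarrow> T' \<le> T + 30 * (reg s rve - reg s rvb) + 10 \<Longrightarrow> Q s' T'"
  shows "wp clear_cols Q s T"
  unfolding clear_cols_def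
proof -
  let ?I = "\<lambda>(s1::state) T1. reg s rvb \<le> reg s1 ri \<and> reg s1 ri \<le> reg s rve \<and>
    (\<forall>v\<in>arr s aV ` {reg s rvb..<reg s1 ri}. arr s1 acol v = 0 \<and> arr s1 aflg v = 0) \<and>
    T1 + 30 * reg s rvb \<le> T + 30 * reg s1 ri"
  let ?b = "Less (Reg ri) (Reg rve)"
  let ?c = "ru ::= Arr aV (Reg ri) ;; Store acol (Reg ru) (Num 0) ;; Store aflg (Reg ru) (Num 0) ;; incr ri"
  show "wp (While ?b ?c) Q s T"
  proof (rule wp_While[where B = "T + 30 * reg s rve" and I = ?I])
    show "?I s T" using i by simp
    fix s1 T1 assume I: "?I s1 T1" and sm: "same (wr ?c) (wa ?c) s s1"
    have fr: "reg s1 rve = reg s rve" "arr s1 aV = arr s aV" using sameD[OF sm] by auto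
    show "T1 \<le> T + 30 * reg s rve" using I by linarith
    show "wp ?c ?I s1 (T1 + (bcost ?b + 1))" if "bval s1 ?b"
      using I that fr by (auto simp: less_Suc_eq)
    show "Q s1 (T1 + (bcost ?b + 1))" if "\<not> bval s1 ?b"
      using I that fr sm i by (intro post) (auto simp: same_def)
  qed
qed

lemma wp_find_unflagged:
  assumes i: "reg s ri = reg s rvb" "reg s rvb \<le> reg s rve" and b: "reg s rbad = 0"
    and C: "C = arr s aV ` {reg s rvb..<reg s rve}"
    and post: "\<And>s' T'. reg s' rbad \<le> 1 \<Longrightarrow>
      (\<And>v. reg s' rbad = 0 \<Longrightarrow> v \<in> C \<Longrightarrow> arr s aflg v \<noteq> 0) \<Longrightarrow>
      (reg s' rbad = 1 \<Longrightarrow> reg s' rb \<in> C \<and> arr s aflg (reg s' rb) = 0 \<and>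
        reg s' rl = arr s atop (arr s acol (reg s' rb))) \<Longrightarrow>
      same {ru, ri, rbad, rb, rl} {} s s' \<Longrightarrow> T' \<le> T + 40 * (reg s rve - reg s rvb) + 10 \<Longrightarrow> Q s' T'"
  shows "wp find_unflagged Q s T"
  unfolding find_unflagged_def
proof -
  let ?I = "\<lambda>(s1::state) T1. reg s rvb \<le> reg s1 ri \<and> reg s1 ri \<le> reg s rve \<and> reg s1 rbad \<le> 1 \<and>
    (reg s1 rbad = 0 \<longrightarrow> (\<forall>v\<in>arr s aV ` {reg s rvb..<reg s1 ri}. arr s aflg v \<noteq> 0)) \<and>
    (reg s1 rbad = 1 \<longrightarrow> reg s1 rb \<in> C \<and> arr s aflg (reg s1 rb) = 0 \<and>
        reg s1 rl = arr s atop (arr s acol (reg s1 rb))) \<and>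
    T1 + 40 * reg s rvb \<le> T + 40 * reg s1 ri"
  let ?b = "Less (Reg ri) (Reg rve)"
  let ?c = "ru ::= Arr aV (Reg ri) ;;
     If1 (Equal (Arr aflg (Reg ru)) (Num 0))
       (rbad ::= Num 1 ;; rb ::= Reg ru ;; rl ::= Arr atop (Arr acol (Reg ru))) ;;
     incr ri"
  show "wp (While ?b ?c) Q s T"
  proof (rule wp_While[where B = "T + 40 * reg s rve" and I = ?I])
    show "?I s T" using i b by simp
    fix s1 T1 assume I: "?I s1 T1" and sm: "same (wr ?c) (wa ?c) s s1"
    have fr: "reg s1 rve = reg s rve" "arr s1 aV = arr s aV" "arr s1 aflg = arr s aflg"
      "arr s1 atop = arr s atop" "arr s1 acol = arr s acol" using sameD[OF sm] by auto
    show "T1 \<le> T + 40 * reg s rve" using I by linarith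
    show "wp ?c ?I s1 (T1 + (bcost ?b + 1))" if "bval s1 ?b"
      using I that fr C by (auto simp: less_Suc_eq)
    show "Q s1 (T1 + (bcost ?b + 1))" if "\<not> bval s1 ?b"
      using I that fr sm i C by (intro post) (auto simp: same_def)
  qed
qed

text \<open>All of \<open>C\<close> starts as a single class with top \<open>r\<close>, hence the
  hypothesis that \<open>r\<close> spans \<open>C\<close>; the potential of that class,
  \<open>pot (wt inc C)\<close>, pays for all promotions.\<close>

lemma wp_flat_test:
  assumes rep: "increp s C E kd inc" and C: "C = arr s aV ` {reg s rvb..<reg s rve}" "reg s rvb < reg s rve"
    "card C \<le> reg s rn"
    and acl: "\<And>u. arr s acl u \<le> reg s rcs" and r: "r = arr s aV (reg s rvb)" and sp: "spans E C r"
    and post: "\<And>s' T'. reg s' rbad \<le> 1 \<Longrightarrow> (\<And>u. reg s' rbad = 0 \<Longrightarrow> u \<in> C \<Longrightarrow> flat E C r u) \<Longrightarrow>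
      (reg s' rbad = 1 \<Longrightarrow> reg s' rl \<in> C \<and> (\<exists>Z. reg s' rb \<in> Z \<and> sealed (E\<inverse>) C (reg s' rl) Z)) \<Longrightarrow>
      (\<And>u. arr s' acl u \<le> reg s' rcs) \<Longrightarrow>
      same (wr (flat_test kd)) (wa (flat_test kd)) s s' \<Longrightarrow>
      T' \<le> T + 80 * (reg s rve - reg s rvb) + 60 * wt inc C + 600 * pot (wt inc C) + 120 \<Longrightarrow> Q s' T'"
  shows "wp (flat_test kd) Q s T"
proof (rule wp_frame)
  have fin: "finite C" using C by simp
  have rC: "r \<in> C" using C r by auto
  let ?Q = "\<lambda>s' T'. reg s' rbad \<le> 1 \<and> (\<forall>u\<in>C. reg s' rbad = 0 \<longrightarrow> flat E C r u) \<and>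
      (reg s' rbad = 1 \<longrightarrow> reg s' rl \<in> C \<and> (\<exists>Z. reg s' rb \<in> Z \<and> sealed (E\<inverse>) C (reg s' rl) Z)) \<and>
      (\<forall>u. arr s' acl u \<le> reg s' rcs) \<and>
      T' \<le> T + 80 * (reg s rve - reg s rvb) + 60 * wt inc C + 600 * pot (wt inc C) + 120"
  show "Q s' T'" if "?Q s' T'" "same (wr (flat_test kd)) (wa (flat_test kd)) s s'" for s' T'
    using that by (intro post) auto
  have tail: "wp (promote_all kd ;; rbad ::= Num 0 ;; ri ::= Reg rvb ;; find_unflagged) ?Q s3 T3"
    if inv: "flat_inv E C r s3" and rep3: "increp s3 C E kd inc" and f3: "reg s3 rn = reg s rn"
      "reg s3 rvb = reg s rvb" "reg s3 rve = reg s rve" "arr s3 aV = arr s aV"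
      and pot3: "potential inc C s3 = pot (wt inc C)"
      and T3: "T3 \<le> T + 30 * (reg s rve - reg s rvb) + 60 * wt inc C + 70" for s3 T3
  proof -
    have card3: "card C \<le> reg s3 rn" using C f3 by simp
    show ?thesis
      apply (subst wp_Seq)
      apply (rule wp_promote_all[OF inv rep3 fin card3])
      subgoal premises p for s4 T4
      proof -
        have f4: "reg s4 rvb = reg s rvb" "reg s4 rve = reg s rve" "arr s4 aV = arr s aV"
          using sameD[OF p(3)] f3 by auto
        obtain wl where cl: "classes E C r (arr s4 acol) (arr s4 atop) (reg s4 rnc) (arr s4 aflg)"
          and wl: "wl_rep s4 C wl" and cr: "cross_ok E C s4"
          and out: "\<And>u. u \<in> C \<Longrightarrow> (r, u) \<in> E \<Longrightarrow> arr s4 aflg u = 1"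
          and acl4: "\<And>u. arr s4 acl u \<le> reg s4 rcs"
          using p(1) unfolding flat_inv_def wl_inv_def by blast
        have "wl = []" using wl p(2) by (auto simp: wl_rep_def)
        then have top: "u = arr s4 atop (arr s4 acol u)" if "u \<in> C" "arr s4 aflg u = 1" for u
          using wl that by (auto simp: wl_rep_def)
        have bin: "arr s4 aflg u \<le> 1" if "u \<in> C" for u using wl that by (auto simp: wl_rep_def)
        have bad: "l \<in> C \<and> (\<exists>Z. b \<in> Z \<and> sealed (E\<inverse>) C l Z)"
          if b: "b \<in> C" "arr s4 aflg b = 0" and l: "l = arr s4 atop (arr s4 acol b)" for b l
        proof -
          define K where "K = {v \<in> C. arr s4 acol v = arr s4 acol b}"
          have K: "l \<in> K" "arr s4 aflg l = 1" "spans E K l" "l \<in> C"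
            using cl b(1) l by (auto simp: classes_def K_def)
          have fr': "arr s4 aflg r = 1" using p(1) by (simp add: flat_inv_def)
          \<comment> \<open>If the root were in the class of the unflagged \<open>b\<close>, it
            would be the top. The out-neighbours of \<open>r\<close> in this class are flagged and
            thus equal to the top, so \<open>r\<close> would span no vertex other than
            itself.\<close>
          have rK: "r \<notin> K"
          proof
            assume "r \<in> K"
            then have rl: "r = l" using top[OF rC fr'] l by (auto simp: K_def)
            have "\<forall>a\<in>{r}. \<forall>c\<in>K. (a, c) \<in> E \<longrightarrow> c \<in> {r}"
              using out top rl l by (force simp: K_def)
            then have "K \<subseteq> {r}" using K(3) rl unfolding spans_def by blast
            then have "b = r" using b by (auto simp: K_def)
            then show False using b fr' by simp
          qed
          have sl: "sealed (E\<inverse>) C l (K - {l})"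
            unfolding sealed_def
          proof (intro conjI)
            show "K - {l} \<subseteq> C - {l}" by (auto simp: K_def)
            show "C - (K - {l}) - {l} \<noteq> {}" using rC rK K by auto
            \<comment> \<open>An arc into the class from outside has a flagged head, and with an
              empty stack every flagged vertex is a top.\<close>
            have "(c, a) \<notin> E" if a: "a \<in> K - {l}" and c: "c \<in> C - (K - {l}) - {l}" for a c
            proof
              assume "(c, a) \<in> E"
              then have "arr s4 aflg a = 1" using cr a c by (auto simp: cross_ok_def K_def)
              then have "a = l" using top[of a] a l by (auto simp: K_def)
              then show False using a by simp
            qed
            then show "E\<inverse> \<inter> (K - {l}) \<times> (C - (K - {l}) - {l}) = {}" by auto
          qed
          have "b \<noteq> l" using b(2) K(2) by auto
          then have "b \<in> K - {l}" using b(1) by (simp add: K_def)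
          with sl K(4) show ?thesis by (intro conjI exI[of _ "K - {l}"]) simp_all
        qed
        have good: "flat E C r u" if "u \<in> C" "arr s4 aflg u \<noteq> 0" for u
        proof -
          have "arr s4 aflg u = 1" using bin[OF that(1)] that(2) by linarith
          then show ?thesis using cl that by (simp add: classes_def)
        qed
        show ?thesis
          apply simp
          apply (rule wp_find_unflagged[where C = C])
              apply (use f4 C in \<open>simp_all\<close>)[4]
          subgoal premises q for s5 T5
          proof -
            have f5: "arr s5 acl = arr s4 acl" "reg s5 rcs = reg s4 rcs" using sameD[OF q(4)] by auto
            show ?thesis
              using q(1,2,3,5) good bad[of "reg s5 rb" "reg s5 rl"] acl4 f5 p(4) T3 pot3 f4 by auto
          qed
          done
      qed
      done
  qed
  show "wp (flat_test kd) ?Q s T"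
    unfolding flat_test_def
    apply (subst wp_Seq, subst wp_Assign, subst wp_Seq)
    apply (rule wp_clear_cols)
      apply (use C in \<open>simp_all\<close>)[2]
    subgoal premises p for s1 T1
    proof -
      have f1: "reg s1 rn = reg s rn" "reg s1 rvb = reg s rvb" "reg s1 rve = reg s rve" "arr s1 aV = arr s aV"
        "arr s1 acl = arr s acl" "reg s1 rcs = reg s rcs" "arr s1 anB = arr s anB" "arr s1 abB = arr s abB"
        "arr s1 akB = arr s akB" "arr s1 afB = arr s afB"
        using sameD[OF p(2)] by auto
      have z: "arr s1 acol v = 0" "arr s1 aflg v = 0" if "v \<in> C" for v using p(1)[of v] that C by auto
      define s2 where "s2 = s1\<lparr>arr := (arr s1)(aflg := (arr s1 aflg)(r := 1), atop := (arr s1 atop)(0 := r)),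
        reg := (reg s1)(rj := r, rnc := 1, rwl := 0, rp := arr s afB r)\<rparr>"
      have f2: "reg s2 rj = r" "reg s2 rnc = 1" "reg s2 rwl = 0" "reg s2 rp = arr s afB r"
        "arr s2 aflg = (arr s1 aflg)(r := 1)" "arr s2 atop 0 = r" "arr s2 acol = arr s1 acol"
        "reg s2 rn = reg s rn" "reg s2 rvb = reg s rvb" "reg s2 rve = reg s rve" "arr s2 aV = arr s aV"
        "arr s2 acl = arr s acl" "reg s2 rcs = reg s rcs" "arr s2 anB = arr s anB" "arr s2 abB = arr s abB"
        "arr s2 akB = arr s akB" "arr s2 afB = arr s afB"
        by (simp_all add: s2_def f1)
      have C0: "{v \<in> C. arr s2 acol v = c} = (if c = 0 then C else {})" for c using z by (auto simp: f2)
      have cl2: "classes E C r (arr s2 acol) (arr s2 atop) 1 (arr s2 aflg)"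
        unfolding classes_def using rC z sp C0 by (auto simp: f2 flat_def)
      have wl2: "wl_rep s2 C []" unfolding wl_rep_def using z by (auto simp: f2)
      have wi2: "wl_inv E C r 1 s2" using cl2 wl2 by (auto simp: wl_inv_def)
      have rep2: "increp s2 C E kd inc" by (rule increp_cong[OF rep]) (simp_all add: f2)
      have outflat: "flat E C r u" if "(r, u) \<in> E" "u \<in> C" for u
        using that unfolding flat_def by blast
      have flat_r: "flat E C r r" by (simp add: flat_def)
      have goal: "wp (cross_nb kd ;; promote_all kd ;; rbad ::= Num 0 ;; ri ::= Reg rvb ;; find_unflagged) ?Q s2 T2"
        if T2: "T2 \<le> T1 + 40" for T2
        apply (subst wp_Seq)
        apply (rule wp_cross_nb[OF wi2 rep2])
           apply (simp add: f2 rC)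
          apply (simp add: f2)
        subgoal for u k using rep rC outflat[of u] flat_r by (auto simp: f2 increp_def)
        subgoal premises q for s3 T3
        proof -
          have f3: "reg s3 rn = reg s rn" "reg s3 rvb = reg s rvb" "reg s3 rve = reg s rve" "arr s3 aV = arr s aV"
            "arr s3 acl = arr s acl" "reg s3 rcs = reg s rcs" "arr s3 anB = arr s anB" "arr s3 abB = arr s abB"
            "arr s3 akB = arr s akB" "arr s3 afB = arr s afB" "reg s3 rnc = 1" "arr s3 acol = arr s1 acol"
            using sameD[OF q(4)] f2 by auto
          have out3: "arr s3 aflg u = 1" if "u \<in> C" "(r, u) \<in> E" for u
          proof -
            have "(u, kd) \<in> set (inc r)" using rep rC that by (simp add: increp_def)
            then show ?thesis using q(3)[of u kd] z that by (simp add: f2)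
          qed
          have "length (inc r) \<le> wt inc C"
            unfolding wt_def using member_le_sum[OF rC, of "\<lambda>v. length (inc v) + 1"] fin by simp
          then have T3: "T3 \<le> T + 30 * (reg s rve - reg s rvb) + 60 * wt inc C + 70"
            using q(5) T2 p(3) by (simp add: f2)
          show ?thesis
          proof (rule tail[OF _ _ f3(1-4) _ T3])
            show "flat_inv E C r s3"
              unfolding flat_inv_def cross_ok_def using q(1) out3 z acl q(2)[of r] by (auto simp: f3 f2)
            show "increp s3 C E kd inc" by (rule increp_cong[OF rep]) (simp_all add: f3)
            show "potential inc C s3 = pot (wt inc C)"
              using C0[of 0] by (simp add: potential_def f3 f2)
          qed
        qed
        done
      show ?thesis
        apply (simp only: wp_Seq wp_Assign wp_Store)
        apply (rule wp_state_eq[OF wp_SeqD[OF goal]])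
        by (simp_all add: s2_def f1 r[symmetric])
    qed
    done
qed

section \<open>Adjacency lists\<close>

text \<open>The vertices of the current component are the cells \<open>rvb..<rve\<close> of \<open>aV\<close>, its arcs the cells
  \<open>rab..<rae\<close> of \<open>aT\<close> and \<open>aH\<close>; indices of arcs are positive, since 0 ends a list. The third
  kind of list contains all arcs incident to a vertex, with \<open>akB\<close> telling their direction.\<close>

definition build_reset :: com where
  "build_reset = While (Less (Reg ri) (Reg rve))
    (ru ::= Arr aV (Reg ri) ;; Store afO (Reg ru) (Num 0) ;; Store afI (Reg ru) (Num 0) ;;
     Store afB (Reg ru) (Num 0) ;; incr ri)"

definition build_arcs :: com where
  "build_arcs = While (Less (Reg rp) (Reg rae))
    (rj ::= Arr aT (Reg rp) ;; rw ::= Arr aH (Reg rp) ;;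
     Store anO (Reg rp) (Arr afO (Reg rj)) ;; Store afO (Reg rj) (Reg rp) ;;
     Store anI (Reg rp) (Arr afI (Reg rw)) ;; Store afI (Reg rw) (Reg rp) ;;
     incr ren ;; Store anB (Reg ren) (Arr afB (Reg rj)) ;; Store abB (Reg ren) (Reg rw) ;;
     Store akB (Reg ren) (Num 1) ;; Store afB (Reg rj) (Reg ren) ;;
     incr ren ;; Store anB (Reg ren) (Arr afB (Reg rw)) ;; Store abB (Reg ren) (Reg rj) ;;
     Store akB (Reg ren) (Num 0) ;; Store afB (Reg rw) (Reg ren) ;; incr rp)"

definition build :: com where
  "build = (ri ::= Reg rvb ;; build_reset ;; rp ::= Reg rab ;; ren ::= Num 0 ;; build_arcs)"

lemma wr_build_reset [simp]: "wr build_reset = {ru, ri}"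
  by (auto simp: build_reset_def)

lemma wa_build_reset [simp]: "wa build_reset = {afO, afI, afB}"
  by (auto simp: build_reset_def)

lemma wr_build_arcs [simp]: "wr build_arcs = {rj, rw, ren, rp}"
  by (auto simp: build_arcs_def)

lemma wa_build_arcs [simp]: "wa build_arcs = {anO, afO, anI, afI, anB, abB, akB, afB}"
  by (auto simp: build_arcs_def)

lemma wr_build [simp]: "wr build = {ru, ri, rj, rw, ren, rp}"
  by (auto simp: build_def)

lemma wa_build [simp]: "wa build = {anO, afO, anI, afI, anB, abB, akB, afB}"
  by (auto simp: build_def)

lemma wp_build_reset:
  assumes i: "reg s ri = reg s rvb" "reg s rvb \<le> reg s rve"
    and post: "\<And>s' T'. (\<And>v. v \<in> arr s aV ` {reg s rvb..<reg s rve} \<Longrightarrow>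
        arr s' afO v = 0 \<and> arr s' afI v = 0 \<and> arr s' afB v = 0) \<Longrightarrow>
      same {ru, ri} {afO, afI, afB} s s' \<Longrightarrow> T' \<le> T + 30 * (reg s rve - reg s rvb) + 10 \<Longrightarrow> Q s' T'"
  shows "wp build_reset Q s T"
  unfolding build_reset_def
proof -
  let ?I = "\<lambda>(s1::state) T1. reg s rvb \<le> reg s1 ri \<and> reg s1 ri \<le> reg s rve \<and>
    (\<forall>v\<in>arr s aV ` {reg s rvb..<reg s1 ri}. arr s1 afO v = 0 \<and> arr s1 afI v = 0 \<and> arr s1 afB v = 0) \<and>
    T1 + 30 * reg s rvb \<le> T + 30 * reg s1 ri"
  let ?b = "Less (Reg ri) (Reg rve)"
  let ?c = "ru ::= Arr aV (Reg ri) ;; Store afO (Reg ru) (Num 0) ;; Store afI (Reg ru) (Num 0) ;;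
     Store afB (Reg ru) (Num 0) ;; incr ri"
  show "wp (While ?b ?c) Q s T"
  proof (rule wp_While[where B = "T + 30 * reg s rve" and I = ?I])
    show "?I s T" using i by simp
    fix s1 T1 assume I: "?I s1 T1" and sm: "same (wr ?c) (wa ?c) s s1"
    have fr: "reg s1 rve = reg s rve" "arr s1 aV = arr s aV" using sameD[OF sm] by auto
    show "T1 \<le> T + 30 * reg s rve" using I by linarith
    show "wp ?c ?I s1 (T1 + (bcost ?b + 1))" if "bval s1 ?b"
      using I that fr by (auto simp: less_Suc_eq)
    show "Q s1 (T1 + (bcost ?b + 1))" if "\<not> bval s1 ?b"
      using I that fr sm i by (intro post) (auto simp: same_def)
  qed
qed

lemma nbs_map: "nbs nx (\<lambda>p. p) p xs \<Longrightarrow> nbs nx nb p (map nb xs)"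
  by (induction xs arbitrary: p) auto

text \<open>With the identity as payload, a list consists of the very cells it runs through, so a
  write to any other cell leaves it intact.\<close>

lemma nbs_upd: "nbs nx nb p xs \<Longrightarrow> nb = (\<lambda>p. p) \<Longrightarrow> c \<notin> set xs \<Longrightarrow> nbs (nx(c := y)) nb p xs"
  by (induction xs arbitrary: p) auto

lemma sum_length_filter_le:
  "finite C \<Longrightarrow> (\<Sum>v\<in>C. length (filter (\<lambda>e. f e = v) xs)) \<le> length xs"
proof (induction xs)
  case (Cons x xs)
  have "(\<Sum>v\<in>C. length (filter (\<lambda>e. f e = v) (x # xs))) =
      (\<Sum>v\<in>C. (if f x = v then 1 else 0) + length (filter (\<lambda>e. f e = v) xs))"
    by (rule sum.cong) auto
  also have "\<dots> = (\<Sum>v\<in>C. if f x = v then 1 else 0) + (\<Sum>v\<in>C. length (filter (\<lambda>e. f e = v) xs))"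
    by (rule sum.distrib)
  also have "\<dots> \<le> 1 + length xs" using Cons by (simp add: sum.delta')
  finally show ?case by simp
qed simp

text \<open>The lists are described by their cells until all arcs are entered;
  \<open>nbs_map\<close> substitutes the neighbours afterwards. Every arc is put in front, hence
  \<open>rev\<close>. The lists \<open>ents\<close> consist of the entries for all incident arcs,
  two for each arc, which fixes their total length.\<close>

definition arcs_inv :: "nat set \<Rightarrow> state \<Rightarrow> nat \<Rightarrow> nat \<Rightarrow> (nat \<Rightarrow> nat list) \<Rightarrow> bool" where
  "arcs_inv C s b p ents \<longleftrightarrow> (\<forall>v\<in>C.
     nbs (arr s anO) (\<lambda>p. p) (arr s afO v) (rev (filter (\<lambda>e. arr s aT e = v) [b..<p])) \<and>
     nbs (arr s anI) (\<lambda>p. p) (arr s afI v) (rev (filter (\<lambda>e. arr s aH e = v) [b..<p])) \<and>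
     nbs (arr s anB) (\<lambda>p. p) (arr s afB v) (ents v) \<and> set (ents v) \<subseteq> {..reg s ren} \<and>
     (\<lambda>c. (arr s abB c, arr s akB c)) ` set (ents v) =
       {(arr s aH e, 1) | e. e \<in> {b..<p} \<and> arr s aT e = v} \<union>
       {(arr s aT e, 0) | e. e \<in> {b..<p} \<and> arr s aH e = v}) \<and>
   (\<Sum>v\<in>C. length (ents v)) = reg s ren \<and> reg s ren + 2 * b = 2 * p"

lemma arcs_inv_step:
  assumes inv: "arcs_inv C s b p ents" and bp: "1 \<le> b" "b \<le> p" and fin: "finite C"
    and tv: "arr s aT p = t" "arr s aH p = h" "t \<in> C" "h \<in> C" "t \<noteq> h"
    and s': "arr s' aT = arr s aT" "arr s' aH = arr s aH" "reg s' ren = reg s ren + 2"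
      "arr s' anO = (arr s anO)(p := arr s afO t)" "arr s' afO = (arr s afO)(t := p)"
      "arr s' anI = (arr s anI)(p := arr s afI h)" "arr s' afI = (arr s afI)(h := p)"
      "arr s' anB = (arr s anB)(reg s ren + 1 := arr s afB t, reg s ren + 2 := arr s afB h)"
      "arr s' afB = (arr s afB)(t := reg s ren + 1, h := reg s ren + 2)"
      "arr s' abB = (arr s abB)(reg s ren + 1 := h, reg s ren + 2 := t)"
      "arr s' akB = (arr s akB)(reg s ren + 1 := 1, reg s ren + 2 := 0)"
  shows "arcs_inv C s' b (Suc p) (ents(t := (reg s ren + 1) # ents t, h := (reg s ren + 2) # ents h))"
    (is "arcs_inv C s' b (Suc p) ?ents")
proof -
  let ?n = "reg s ren"
  have old: "nbs (arr s anO) (\<lambda>p. p) (arr s afO v) (rev (filter (\<lambda>e. arr s aT e = v) [b..<p]))"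
    "nbs (arr s anI) (\<lambda>p. p) (arr s afI v) (rev (filter (\<lambda>e. arr s aH e = v) [b..<p]))"
    "nbs (arr s anB) (\<lambda>p. p) (arr s afB v) (ents v)" "set (ents v) \<subseteq> {..?n}"
    "(\<lambda>c. (arr s abB c, arr s akB c)) ` set (ents v) =
       {(arr s aH e, 1) | e. e \<in> {b..<p} \<and> arr s aT e = v} \<union>
       {(arr s aT e, 0) | e. e \<in> {b..<p} \<and> arr s aH e = v}" if "v \<in> C" for v
    using inv that by (simp_all add: arcs_inv_def)
  have up: "[b..<Suc p] = [b..<p] @ [p]" using bp by simp
  have range: "{b..<Suc p} = insert p {b..<p}" using bp by auto
  show ?thesis
    unfolding arcs_inv_def
  proof (intro conjI ballI)
    fix v assume v: "v \<in> C"
    have O: "nbs (arr s' anO) (\<lambda>p. p) (arr s afO v) (rev (filter (\<lambda>e. arr s aT e = v) [b..<p]))"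
      unfolding s' by (rule nbs_upd[OF old(1)[OF v] refl]) simp
    show "nbs (arr s' anO) (\<lambda>p. p) (arr s' afO v) (rev (filter (\<lambda>e. arr s' aT e = v) [b..<Suc p]))"
      using O bp tv unfolding up by (auto simp: s')
    have I: "nbs (arr s' anI) (\<lambda>p. p) (arr s afI v) (rev (filter (\<lambda>e. arr s aH e = v) [b..<p]))"
      unfolding s' by (rule nbs_upd[OF old(2)[OF v] refl]) simp
    show "nbs (arr s' anI) (\<lambda>p. p) (arr s' afI v) (rev (filter (\<lambda>e. arr s' aH e = v) [b..<Suc p]))"
      using I bp tv unfolding up by (auto simp: s')
    have B: "nbs (arr s' anB) (\<lambda>p. p) (arr s afB v) (ents v)"
      unfolding s' using old(4)[OF v] by (intro nbs_upd[OF nbs_upd[OF old(3)[OF v] refl] refl]) auto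
    show "nbs (arr s' anB) (\<lambda>p. p) (arr s' afB v) (?ents v)"
      using B tv by (auto simp: s')
    show "set (?ents v) \<subseteq> {..reg s' ren}" using old(4)[OF v] tv by (auto simp: s')
    have "(\<lambda>c. (arr s' abB c, arr s' akB c)) ` set (ents v) = (\<lambda>c. (arr s abB c, arr s akB c)) ` set (ents v)"
      using old(4)[OF v] by (intro image_cong) (auto simp: s')
    also note old(5)[OF v]
    finally have img: "(\<lambda>c. (arr s' abB c, arr s' akB c)) ` set (ents v) =
       {(arr s aH e, 1) | e. e \<in> {b..<p} \<and> arr s aT e = v} \<union>
       {(arr s aT e, 0) | e. e \<in> {b..<p} \<and> arr s aH e = v}" .
    have new: "(\<lambda>c. (arr s' abB c, arr s' akB c)) (?n + 1) = (h, 1)"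
      "(\<lambda>c. (arr s' abB c, arr s' akB c)) (?n + 2) = (t, 0)" by (simp_all add: s')
    consider "v = t" | "v = h" | "v \<noteq> t" "v \<noteq> h" by blast
    then show "(\<lambda>c. (arr s' abB c, arr s' akB c)) ` set (?ents v) =
       {(arr s' aH e, 1) | e. e \<in> {b..<Suc p} \<and> arr s' aT e = v} \<union>
       {(arr s' aT e, 0) | e. e \<in> {b..<Suc p} \<and> arr s' aH e = v}"
    proof cases
      case 1
      then have "set (?ents v) = insert (?n + 1) (set (ents v))" using tv by simp
      then show ?thesis using img new 1 tv unfolding range s'(1,2) by auto
    next
      case 2
      then have "set (?ents v) = insert (?n + 2) (set (ents v))" using tv by simp
      then show ?thesis using img new 2 tv unfolding range s'(1,2) by auto
    next
      case 3
      then have "set (?ents v) = set (ents v)" by simp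
      then show ?thesis using img 3 tv unfolding range s'(1,2) by auto
    qed
  next
    have "(\<Sum>v\<in>C. length (?ents v)) = (\<Sum>v\<in>C. length (ents v) + ((if v = t then 1 else 0) + (if v = h then 1 else 0)))"
      using tv(5) by (intro sum.cong) auto
    also have "\<dots> = (\<Sum>v\<in>C. length (ents v)) + 2"
      unfolding sum.distrib using tv fin by (simp add: sum.delta)
    finally show "(\<Sum>v\<in>C. length (?ents v)) = reg s' ren"
      using inv by (simp add: arcs_inv_def s')
    show "reg s' ren + 2 * b = 2 * Suc p" using inv by (simp add: arcs_inv_def s')
  qed
qed

lemma wp_build_arcs:
  assumes p: "reg s rp = reg s rab" "1 \<le> reg s rab" "reg s rab \<le> reg s rae" "reg s ren = 0"
    and fin: "finite C"
    and arcs: "\<And>e. e \<in> {reg s rab..<reg s rae} \<Longrightarrow> arr s aT e \<in> C \<and> arr s aH e \<in> C \<and> arr s aT e \<noteq> arr s aH e"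
    and z: "\<And>v. v \<in> C \<Longrightarrow> arr s afO v = 0 \<and> arr s afI v = 0 \<and> arr s afB v = 0"
    and post: "\<And>s' T' ents. arcs_inv C s' (reg s rab) (reg s rae) ents \<Longrightarrow>
      same (wr build_arcs) (wa build_arcs) s s' \<Longrightarrow>
      T' \<le> T + 100 * (reg s rae - reg s rab) + 10 \<Longrightarrow> Q s' T'"
  shows "wp build_arcs Q s T"
  unfolding build_arcs_def
proof -
  let ?I = "\<lambda>(s1::state) T1. \<exists>ents. reg s rab \<le> reg s1 rp \<and> reg s1 rp \<le> reg s rae \<and>
    arcs_inv C s1 (reg s rab) (reg s1 rp) ents \<and> T1 + 100 * reg s rab \<le> T + 100 * reg s1 rp"
  let ?b = "Less (Reg rp) (Reg rae)"
  let ?c = "rj ::= Arr aT (Reg rp) ;; rw ::= Arr aH (Reg rp) ;;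
     Store anO (Reg rp) (Arr afO (Reg rj)) ;; Store afO (Reg rj) (Reg rp) ;;
     Store anI (Reg rp) (Arr afI (Reg rw)) ;; Store afI (Reg rw) (Reg rp) ;;
     incr ren ;; Store anB (Reg ren) (Arr afB (Reg rj)) ;; Store abB (Reg ren) (Reg rw) ;;
     Store akB (Reg ren) (Num 1) ;; Store afB (Reg rj) (Reg ren) ;;
     incr ren ;; Store anB (Reg ren) (Arr afB (Reg rw)) ;; Store abB (Reg ren) (Reg rj) ;;
     Store akB (Reg ren) (Num 0) ;; Store afB (Reg rw) (Reg ren) ;; incr rp"
  show "wp (While ?b ?c) Q s T"
  proof (rule wp_While[where B = "T + 100 * reg s rae" and I = ?I])
    show "?I s T" using p z by (intro exI[of _ "\<lambda>_. []"]) (auto simp: arcs_inv_def)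
    fix s1 T1 assume I: "?I s1 T1" and sm: "same (wr ?c) (wa ?c) s s1"
    have fr: "reg s1 rae = reg s rae" "arr s1 aT = arr s aT" "arr s1 aH = arr s aH" using sameD[OF sm] by auto
    obtain ents where I': "reg s rab \<le> reg s1 rp" "reg s1 rp \<le> reg s rae"
      "arcs_inv C s1 (reg s rab) (reg s1 rp) ents" "T1 + 100 * reg s rab \<le> T + 100 * reg s1 rp"
      using I by blast
    show "T1 \<le> T + 100 * reg s rae" using I' by linarith
    show "wp ?c ?I s1 (T1 + (bcost ?b + 1))" if bv: "bval s1 ?b"
    proof -
      have lt: "reg s1 rp < reg s rae" using bv fr by simp
      define t where "t = arr s aT (reg s1 rp)"
      define h where "h = arr s aH (reg s1 rp)"
      have th: "t \<in> C" "h \<in> C" "t \<noteq> h" using arcs[of "reg s1 rp"] I' lt by (auto simp: t_def h_def)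
      show ?thesis
        apply (simp add: fr t_def[symmetric] h_def[symmetric] th th(3)[symmetric])
        apply (intro conjI)
        using I' lt apply simp
        using I' lt apply simp
         apply (rule exI)
         apply (rule arcs_inv_step[OF I'(3) p(2) I'(1) fin _ _ th])
        using I'(4) th by (simp_all add: fr t_def h_def)
    qed
    show "Q s1 (T1 + (bcost ?b + 1))" if "\<not> bval s1 ?b"
    proof -
      have "reg s1 rp = reg s rae" using that I' fr by simp
      then show ?thesis using I' sm p by (intro post[of s1 ents]) (auto simp: build_arcs_def)
    qed
  qed
qed

section \<open>The finished lists as a representation of a component\<close>

definition comp :: "state \<Rightarrow> (nat \<times> nat) set \<Rightarrow> nat set \<Rightarrow> bool" where
  "comp s E C \<longleftrightarrow> C = arr s aV ` {reg s rvb..<reg s rve} \<and> inj_on (arr s aV) {reg s rvb..<reg s rve} \<and>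
     reg s rvb \<le> reg s rve \<and> 1 \<le> reg s rab \<and> reg s rab \<le> reg s rae \<and>
     inj_on (\<lambda>e. (arr s aT e, arr s aH e)) {reg s rab..<reg s rae} \<and>
     (\<lambda>e. (arr s aT e, arr s aH e)) ` {reg s rab..<reg s rae} = E \<inter> C \<times> C \<and> E \<inter> Id = {}"

definition lists :: "state \<Rightarrow> (nat \<times> nat) set \<Rightarrow> nat set \<Rightarrow> (nat \<Rightarrow> nat list) \<Rightarrow> (nat \<Rightarrow> nat list) \<Rightarrow>
    (nat \<Rightarrow> (nat \<times> nat) list) \<Rightarrow> bool" where
  "lists s E C adjO adjI inc \<longleftrightarrow>
     adjrep s afO anO aH C adjO \<and> adjrel E C adjO \<and> adjrep s afI anI aT C adjI \<and> adjrel (E\<inverse>) C adjI \<and>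
     increp s C E 1 inc \<and> increp s C (E\<inverse>) 0 inc \<and>
     (\<Sum>v\<in>C. length (adjO v)) \<le> reg s rae - reg s rab \<and>
     (\<Sum>v\<in>C. length (adjI v)) \<le> reg s rae - reg s rab \<and>
     wt inc C = card C + 2 * (reg s rae - reg s rab)"

lemma lists_if_arcs_inv:
  assumes c: "comp s E C" and inv: "arcs_inv C s (reg s rab) (reg s rae) ents"
  shows "\<exists>adjO adjI inc. lists s E C adjO adjI inc"
proof -
  let ?t = "arr s aT" and ?h = "arr s aH" and ?R = "{reg s rab..<reg s rae}"
  define adjO where "adjO = (\<lambda>v. map ?h (rev (filter (\<lambda>e. ?t e = v) [reg s rab..<reg s rae])))"
  define adjI where "adjI = (\<lambda>v. map ?t (rev (filter (\<lambda>e. ?h e = v) [reg s rab..<reg s rae])))"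
  define inc where "inc = (\<lambda>v. map (\<lambda>c. (arr s abB c, arr s akB c)) (ents v))"
  have fin: "finite C" and inj: "inj_on (\<lambda>e. (?t e, ?h e)) ?R"
    and im: "(\<lambda>e. (?t e, ?h e)) ` ?R = E \<inter> C \<times> C" and ab: "reg s rab \<le> reg s rae"
    using c by (auto simp: comp_def)
  have old: "nbs (arr s anO) (\<lambda>p. p) (arr s afO v) (rev (filter (\<lambda>e. ?t e = v) [reg s rab..<reg s rae]))"
    "nbs (arr s anI) (\<lambda>p. p) (arr s afI v) (rev (filter (\<lambda>e. ?h e = v) [reg s rab..<reg s rae]))"
    "nbs (arr s anB) (\<lambda>p. p) (arr s afB v) (ents v)"
    "set (inc v) = {(?h e, 1) | e. e \<in> ?R \<and> ?t e = v} \<union> {(?t e, 0) | e. e \<in> ?R \<and> ?h e = v}" if "v \<in> C" for v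
    using inv that by (simp_all add: arcs_inv_def inc_def)
  have E: "(a, b) \<in> E \<and> a \<in> C \<and> b \<in> C \<longleftrightarrow> (\<exists>e\<in>?R. ?t e = a \<and> ?h e = b)" for a b
  proof -
    have "(a, b) \<in> E \<inter> C \<times> C \<longleftrightarrow> (\<exists>e\<in>?R. ?t e = a \<and> ?h e = b)"
      unfolding im[symmetric] by auto
    then show ?thesis by auto
  qed
  have setO: "set (adjO v) = {w \<in> C. (v, w) \<in> E}" if "v \<in> C" for v
  proof (rule set_eqI)
    fix w
    have "w \<in> set (adjO v) \<longleftrightarrow> (\<exists>e\<in>?R. ?t e = v \<and> ?h e = w)" by (auto simp: adjO_def)
    also have "\<dots> \<longleftrightarrow> w \<in> {w \<in> C. (v, w) \<in> E}" using E[of v w] that by blast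
    finally show "w \<in> set (adjO v) \<longleftrightarrow> w \<in> {w \<in> C. (v, w) \<in> E}" .
  qed
  have setI: "set (adjI v) = {w \<in> C. (v, w) \<in> E\<inverse>}" if "v \<in> C" for v
  proof (rule set_eqI)
    fix w
    have "w \<in> set (adjI v) \<longleftrightarrow> (\<exists>e\<in>?R. ?t e = w \<and> ?h e = v)" by (auto simp: adjI_def)
    also have "\<dots> \<longleftrightarrow> w \<in> {w \<in> C. (v, w) \<in> E\<inverse>}" using E[of w v] that by blast
    finally show "w \<in> set (adjI v) \<longleftrightarrow> w \<in> {w \<in> C. (v, w) \<in> E\<inverse>}" .
  qed
  have dO: "distinct (adjO v)" for v
    using inj by (auto simp: adjO_def distinct_map inj_on_def)
  have dI: "distinct (adjI v)" for v
    using inj by (auto simp: adjI_def distinct_map inj_on_def)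
  have inc: "(u, 1) \<in> set (inc v) \<longleftrightarrow> u \<in> C \<and> (v, u) \<in> E" "(u, 0) \<in> set (inc v) \<longleftrightarrow> u \<in> C \<and> (u, v) \<in> E"
    "(u, k) \<in> set (inc v) \<Longrightarrow> k = 0 \<or> k = 1" if "v \<in> C" for u v k
  proof -
    have "(u, 1) \<in> set (inc v) \<longleftrightarrow> (\<exists>e\<in>?R. ?t e = v \<and> ?h e = u)" unfolding old(4)[OF that] by auto
    then show "(u, 1) \<in> set (inc v) \<longleftrightarrow> u \<in> C \<and> (v, u) \<in> E" using E[of v u] that by blast
    have "(u, 0) \<in> set (inc v) \<longleftrightarrow> (\<exists>e\<in>?R. ?t e = u \<and> ?h e = v)" unfolding old(4)[OF that] by auto
    then show "(u, 0) \<in> set (inc v) \<longleftrightarrow> u \<in> C \<and> (u, v) \<in> E" using E[of u v] that by blast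
    show "k = 0 \<or> k = 1" if "(u, k) \<in> set (inc v)" using that unfolding old(4)[OF \<open>v \<in> C\<close>] by auto
  qed
  have nbB: "nbs (arr s anB) (\<lambda>p. (arr s abB p, arr s akB p)) (arr s afB v) (inc v)" if "v \<in> C" for v
    unfolding inc_def by (rule nbs_map[OF old(3)[OF that]])
  have "adjrep s afO anO aH C adjO" "adjrep s afI anI aT C adjI"
    unfolding adjrep_def using old(1,2) setO setI dO dI by (auto simp: adjO_def adjI_def intro: nbs_map)
  moreover have "adjrel E C adjO" "adjrel (E\<inverse>) C adjI"
    using setO setI by (auto simp: adjrel_def)
  moreover have "increp s C E 1 inc"
    unfolding increp_def
  proof (intro ballI conjI allI impI)
    fix v assume v: "v \<in> C"
    show "nbs (arr s anB) (\<lambda>p. (arr s abB p, arr s akB p)) (arr s afB v) (inc v)" using nbB[OF v] .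
    show "(u, 1) \<in> set (inc v) \<longleftrightarrow> u \<in> C \<and> (v, u) \<in> E" for u using inc(1)[OF v, of u] by simp
    show "u \<in> C" if "(u, k) \<in> set (inc v)" for u k
      using inc(3)[OF v that] inc(1,2)[OF v, of u] that by auto
    show "(u, v) \<in> E" if "(u, k) \<in> set (inc v)" "k \<noteq> 1" for u k
      using inc(3)[OF v that(1)] inc(2)[OF v, of u] that by auto
    show "\<exists>k. k \<noteq> 1 \<and> (u, k) \<in> set (inc v)" if "u \<in> C" "(u, v) \<in> E" for u
      using inc(2)[OF v, of u] that by (intro exI[of _ 0]) simp
  qed
  moreover have "increp s C (E\<inverse>) 0 inc"
    unfolding increp_def
  proof (intro ballI conjI allI impI)
    fix v assume v: "v \<in> C"
    show "nbs (arr s anB) (\<lambda>p. (arr s abB p, arr s akB p)) (arr s afB v) (inc v)" using nbB[OF v] .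
    show "(u, 0) \<in> set (inc v) \<longleftrightarrow> u \<in> C \<and> (v, u) \<in> (E\<inverse>)" for u using inc(2)[OF v, of u] by simp
    show "u \<in> C" if "(u, k) \<in> set (inc v)" for u k
      using inc(3)[OF v that] inc(1,2)[OF v, of u] that by auto
    show "(u, v) \<in> (E\<inverse>)" if "(u, k) \<in> set (inc v)" "k \<noteq> 0" for u k
      using inc(3)[OF v that(1)] inc(1)[OF v, of u] that by auto
    show "\<exists>k. k \<noteq> 0 \<and> (u, k) \<in> set (inc v)" if "u \<in> C" "(u, v) \<in> (E\<inverse>)" for u
      using inc(1)[OF v, of u] that by (intro exI[of _ 1]) simp
  qed
  moreover have "(\<Sum>v\<in>C. length (adjO v)) \<le> reg s rae - reg s rab"
    using sum_length_filter_le[OF fin, of ?t "[reg s rab..<reg s rae]"] by (simp add: adjO_def)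
  moreover have "(\<Sum>v\<in>C. length (adjI v)) \<le> reg s rae - reg s rab"
    using sum_length_filter_le[OF fin, of ?h "[reg s rab..<reg s rae]"] by (simp add: adjI_def)
  \<comment> \<open>Each arc has an entry at both of its ends, and each vertex adds one
    unit.\<close>
  moreover have "wt inc C = card C + 2 * (reg s rae - reg s rab)"
  proof -
    have "(\<Sum>v\<in>C. length (ents v)) = reg s ren \<and> reg s ren + 2 * reg s rab = 2 * reg s rae"
      using inv unfolding arcs_inv_def by blast
    moreover have "wt inc C = (\<Sum>v\<in>C. length (ents v)) + card C"
      unfolding wt_def inc_def sum.distrib by simp
    ultimately show ?thesis using ab by linarith
  qed
  ultimately show ?thesis unfolding lists_def by blast
qed

lemma wp_build:
  assumes c: "comp s E C"
    and post: "\<And>s' T' adjO adjI inc. lists s' E C adjO adjI inc \<Longrightarrow>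
      same (wr build) (wa build) s s' \<Longrightarrow>
      T' \<le> T + 100 * (reg s rve - reg s rvb + (reg s rae - reg s rab)) + 50 \<Longrightarrow> Q s' T'"
  shows "wp build Q s T"
proof -
  have C: "C = arr s aV ` {reg s rvb..<reg s rve}" "reg s rvb \<le> reg s rve" "1 \<le> reg s rab" "reg s rab \<le> reg s rae"
    and E: "(\<lambda>e. (arr s aT e, arr s aH e)) ` {reg s rab..<reg s rae} = E \<inter> C \<times> C" "E \<inter> Id = {}"
    using c by (auto simp: comp_def)
  have arcs: "arr s aT e \<in> C \<and> arr s aH e \<in> C \<and> arr s aT e \<noteq> arr s aH e"
    if "e \<in> {reg s rab..<reg s rae}" for e
  proof -
    have "(arr s aT e, arr s aH e) \<in> E \<inter> C \<times> C" using E(1) that by blast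
    then show ?thesis using E(2) by auto
  qed
  show ?thesis
    unfolding build_def
    apply (subst wp_Seq, subst wp_Assign, subst wp_Seq)
    apply (rule wp_build_reset)
      apply (use C in \<open>simp_all\<close>)[2]
    subgoal premises p for s1 T1
    proof -
      have f1: "reg s1 rab = reg s rab" "reg s1 rae = reg s rae" "arr s1 aT = arr s aT" "arr s1 aH = arr s aH"
        using sameD[OF p(2)] by auto
      show ?thesis
        apply simp
        apply (rule wp_build_arcs[where C = C])
              apply (use C f1 arcs p(1) in \<open>auto\<close>)[7]
        subgoal premises q for s2 T2 ents
        proof -
          have sm: "same (wr build) (wa build) s s2"
            using p(2) q(2) by (auto simp: same_def)
          note f2 = sameD[OF sm]
          have c2: "comp s2 E C" using c unfolding comp_def by (simp add: f2)
          have "arcs_inv C s2 (reg s2 rab) (reg s2 rae) ents" using q(1) f2 f1 by simp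
          from lists_if_arcs_inv[OF c2 this] obtain adjO adjI inc where "lists s2 E C adjO adjI inc" by blast
          then show ?thesis using sm q(3) p(3) by (intro post) (auto simp: f1)
        qed
        done
    qed
    done
qed

section \<open>Examining a component\<close>

definition ctx2 :: "state \<Rightarrow> (nat \<times> nat) set \<Rightarrow> nat set \<Rightarrow> (nat \<Rightarrow> nat list) \<Rightarrow> (nat \<Rightarrow> nat list) \<Rightarrow> bool" where
  "ctx2 s E C adjO adjI \<longleftrightarrow> search_ctx s afO anO aH E C adjO \<and> search_ctx s afI anI aT (E\<inverse>) C adjI"

lemma ctx2_same:
  assumes "ctx2 s E C adjO adjI" "same R A s s'" "R \<inter> {rve, rvb, rn} = {}"
    "A \<inter> {afO, anO, aH, afI, anI, aT} = {}" "\<And>u. arr s' amk u \<le> reg s' rst"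
  shows "ctx2 s' E C adjO adjI"
proof -
  have "arr s' a = arr s a" if "a \<in> {afO, anO, aH, afI, anI, aT}" for a
    using assms(2,4) that unfolding same_def by blast
  moreover have "reg s' r = reg s r" if "r \<in> {rve, rvb, rn}" for r
    using assms(2,3) that unfolding same_def by blast
  ultimately show ?thesis using assms(1,5) by (simp add: ctx2_def search_ctx_def adjrep_def)
qed

lemma search_ctx_marks: "search_ctx s f nx nb E C adj \<Longrightarrow> arr s amk u \<le> reg s rst"
  by (simp add: search_ctx_def)

definition local_vertex :: com where
  "local_vertex =
    (rv ::= Arr aV (Reg ri) ;; local_search afO anO aH ;;
     If1 (Equal (Reg rfd) (Num 0)) (local_search afI anI aT) ;;
     If1 (Equal (Reg rfd) (Num 0)) (Store aP (Reg ri) (Num 0)))"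

definition local_loop :: com where
  "local_loop = While (Conj (Less (Reg ri) (Reg rve)) (Equal (Reg rfd) (Num 0)))
    (If1 (Equal (Arr aP (Reg ri)) (Num 1)) local_vertex ;; incr ri)"

text \<open>The test yields only a vertex \<open>rb\<close> and a top \<open>rl\<close> that cuts it
  off. The side itself is recovered by a search from \<open>rb\<close> against the tested direction
  with \<open>rl\<close> deleted, so that all separations reach \<open>split\<close> in the form of
  stamps. Direction 0 tests the reversed graph, whence the search along \<open>afO\<close>.\<close>

definition flat_in :: com where
  "flat_in = (flat_test 0 ;;
     If1 (Equal (Reg rbad) (Num 1)) (rv ::= Reg rb ;; rx ::= Reg rl ;; search afO anO aH))"

definition flat_out :: com where
  "flat_out = (flat_test 1 ;;
     Cond (Equal (Reg rbad) (Num 1)) (rv ::= Reg rb ;; rx ::= Reg rl ;; search afI anI aT) flat_in)"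

definition search_both :: "com \<Rightarrow> com" where
  "search_both c = (search afO anO aH ;;
     If1 (Equal (Reg rfd) (Num 0)) (search afI anI aT ;; If1 (Equal (Reg rfd) (Num 0)) c))"

text \<open>With the size of the component as limit \<open>rL\<close>, no search is truncated. The
  searches from the first vertex establish that it spans the component in both directions, which the
  flatness tests presuppose; those from the second vertex with the first one deleted treat the
  separations at the root itself.\<close>

definition global :: com where
  "global = (rL ::= Bin Sub (Reg rve) (Reg rvb) ;; rv ::= Arr aV (Reg rvb) ;; rx ::= Reg rn ;; rxc ::= Num 0 ;;
     search_both (rv ::= Arr aV (Bin Add (Reg rvb) (Num 1)) ;; rx ::= Arr aV (Reg rvb) ;; rxc ::= Num 1 ;;
       search_both flat_out))"

lemma wr_local_vertex [simp]:
  "wr local_vertex = {rv, rov, rp, ru, rql, rst, rqh, rfd, rx, rxc, rj, rbl}"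
  by (auto simp: local_vertex_def)

lemma wa_local_vertex [simp]: "wa local_vertex = {amk, aq, aB, aP}"
  by (auto simp: local_vertex_def)

lemma wr_local_loop [simp]:
  "wr local_loop = {rv, rov, rp, ru, rql, rst, rqh, rfd, rx, rxc, rj, rbl, ri}"
  by (auto simp: local_loop_def)

lemma wa_local_loop [simp]: "wa local_loop = {amk, aq, aB, aP}"
  by (auto simp: local_loop_def)

lemma wr_flat_in [simp]: "wr flat_in = wr (flat_test 0) \<union> {rv, rx, rov, rql, rst, rqh, rfd}"
  by (auto simp: flat_in_def)

lemma wa_flat_in [simp]: "wa flat_in = wa (flat_test 0) \<union> {amk, aq}"
  by (auto simp: flat_in_def)

lemma wr_flat_out [simp]: "wr flat_out = wr (flat_test 0) \<union> {rv, rx, rov, rql, rst, rqh, rfd}"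
  by (auto simp: flat_out_def)

lemma wa_flat_out [simp]: "wa flat_out = wa (flat_test 0) \<union> {amk, aq}"
  by (auto simp: flat_out_def)

lemma wr_search_both [simp]: "wr (search_both c) = {rov, rp, ru, rql, rst, rqh, rfd} \<union> wr c"
  by (auto simp: search_both_def)

lemma wa_search_both [simp]: "wa (search_both c) = {amk, aq} \<union> wa c"
  by (auto simp: search_both_def)

lemma wr_global [simp]: "wr global = wr (flat_test 0) \<union> {rL, rv, rx, rxc, rov, rql, rst, rqh, rfd}"
  by (auto simp: global_def)

lemma wa_global [simp]: "wa global = wa (flat_test 0) \<union> {amk, aq}"
  by (auto simp: global_def)

subsection \<open>Local searches\<close>

lemma sbound_local:
  assumes "finite C"
  shows "sbound C adj L ((L + 1) * (L + 3))"
  unfolding sbound_def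
proof (intro allI impI)
  fix U assume U: "U \<subseteq> C" "card U \<le> L + 1"
  have "(\<Sum>u\<in>U. min (length (adj u)) (L + 2) + 1) \<le> card U * (L + 3)"
    using sum_bounded_above[of U "\<lambda>u. min (length (adj u)) (L + 2) + 1" "L + 3"] by simp
  also have "\<dots> \<le> (L + 1) * (L + 3)" using U by (intro mult_le_mono1)
  finally show "(\<Sum>u\<in>U. min (length (adj u)) (L + 2) + 1) \<le> (L + 1) * (L + 3)" .
qed

lemma sbound_global:
  assumes "finite C" "(\<Sum>v\<in>C. length (adj v)) \<le> m"
  shows "sbound C adj L (card C + m)"
  unfolding sbound_def
proof (intro allI impI)
  fix U assume U: "U \<subseteq> C" "card U \<le> L + 1"
  have "(\<Sum>u\<in>U. min (length (adj u)) (L + 2) + 1) \<le> (\<Sum>u\<in>C. min (length (adj u)) (L + 2) + 1)"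
    using U assms by (intro sum_mono2) auto
  also have "\<dots> \<le> (\<Sum>u\<in>C. length (adj u) + 1)" by (intro sum_mono) simp
  also have "\<dots> \<le> card C + m" using assms unfolding sum.distrib by simp
  finally show "(\<Sum>u\<in>U. min (length (adj u)) (L + 2) + 1) \<le> card C + m" .
qed

text \<open>Two directions, and for each of them one search without a deleted vertex and at most
  \<open>D + 1\<close> further ones; the work of each is bounded by \<open>(D + 1) * (D + 3)\<close>
  according to \<open>sbound_local\<close>.\<close>

definition local_cost :: "nat \<Rightarrow> nat" where
  "local_cost D = 2 * ((D + 2) * (60 * ((D + 1) * (D + 3)) + 200)) + 60"

definition no_tiny :: "(nat \<times> nat) set \<Rightarrow> nat set \<Rightarrow> nat \<Rightarrow> nat \<Rightarrow> bool" where
  "no_tiny E C D v \<longleftrightarrow> (\<forall>x Z. sepx E C x Z \<longrightarrow> v \<in> Z \<longrightarrow> \<not> card Z \<le> D)"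

lemma wp_local_vertex:
  assumes ctx: "ctx2 s E C adjO adjI" and v: "arr s aV (reg s ri) \<in> C" and D: "reg s rL = D" "1 \<le> D"
    and fd: "reg s rfd = 0"
    and post: "\<And>s' T'. ctx2 s' E C adjO adjI \<Longrightarrow> same (wr local_vertex) (wa local_vertex) s s' \<Longrightarrow>
      reg s' rfd \<le> 1 \<Longrightarrow> (reg s' rfd = 1 \<Longrightarrow> sepx E C (reg s' rx) (marked C s') \<and> arr s' aP = arr s aP) \<Longrightarrow>
      (reg s' rfd = 0 \<Longrightarrow> no_tiny E C D (arr s aV (reg s ri)) \<and> arr s' aP = (arr s aP)(reg s ri := 0)) \<Longrightarrow>
      T' \<le> T + local_cost D - 20 \<Longrightarrow> Q s' T'"
  shows "wp local_vertex Q s T"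
proof -
  let ?v = "arr s aV (reg s ri)"
  let ?R = "wr local_vertex" and ?A = "wa local_vertex"
  let ?B = "(D + 1) * (D + 3)"
  have fin: "finite C" using ctx by (simp add: ctx2_def search_ctx_def)
  have sb: "sbound C adj D ?B" for adj using fin by (rule sbound_local)
  let ?s1 = "s\<lparr>reg := (reg s)(rv := ?v)\<rparr>"
  have ctx1: "ctx2 ?s1 E C adjO adjI"
    using ctx by (simp add: ctx2_def search_ctx_def adjrep_def)
  show ?thesis
    unfolding local_vertex_def
    apply (subst wp_Seq, subst wp_Assign, subst wp_Seq)
    apply (rule wp_local_search[where f = afO and nx = anO and nb = aH and E = E and C = C and adj = adjO and B = ?B])
         apply (use ctx1 v D fd sb in \<open>simp_all add: ctx2_def\<close>)[5]
    subgoal premises p for s2 T2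
    proof -
      have mk2: "arr s2 amk u \<le> reg s2 rst" for u using p(1) by (rule search_ctx_marks)
      have ctx2: "ctx2 s2 E C adjO adjI"
        by (rule ctx2_same[OF ctx1 _ _ _ mk2]) (use p(2) in auto)
      have f2: "reg s2 rv = ?v" "reg s2 rL = D" "reg s2 ri = reg s ri" "arr s2 aP = arr s aP"
        using sameD[OF p(2)] D by auto
      have sm2: "same ?R ?A s s2" using p(2) by (auto simp: same_def)
      have T2: "T2 \<le> T + (D + 2) * (60 * ?B + 200) + 3" using p(6) D by simp
      show ?thesis
      proof (cases "reg s2 rfd = 0")
        case False
        then have fd1: "reg s2 rfd = 1" using p(3) by simp
        have *: "sepx E C (reg s2 rx) (marked C s2)" using p(4)[OF fd1] by (auto intro: sealed_sepx)
        show ?thesis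
          apply (simp add: False)
          apply (rule post[OF ctx2 sm2 p(3)])
          using * f2 fd1 T2 by (auto simp: local_cost_def)
      next
        case True
        show ?thesis
          apply (simp add: True)
          apply (rule wp_local_search[where f = afI and nx = anI and nb = aT and E = "E\<inverse>" and C = C and adj = adjI and B = ?B])
               apply (use ctx2 v f2 D True sb in \<open>simp_all add: ctx2_def\<close>)[5]
          subgoal premises q for s3 T3
          proof -
            have mk3: "arr s3 amk u \<le> reg s3 rst" for u using q(1) by (rule search_ctx_marks)
            have ctx3: "ctx2 s3 E C adjO adjI"
              by (rule ctx2_same[OF ctx2 _ _ _ mk3]) (use q(2) in auto)
            have f3: "reg s3 ri = reg s ri" "arr s3 aP = arr s aP" using sameD[OF q(2)] f2 by auto
            have sm3: "same ?R ?A s s3" using sm2 q(2) by (auto simp: same_def)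
            have T3: "T3 \<le> T2 + 4 + (D + 2) * (60 * ?B + 200)" using q(6) f2 by simp
            show ?thesis
            proof (cases "reg s3 rfd = 0")
              case False
              then have fd1: "reg s3 rfd = 1" using q(3) by simp
              have *: "sepx E C (reg s3 rx) (marked C s3)"
                using q(4)[OF fd1] by (auto simp: sepx_sealed)
              show ?thesis
                apply (simp add: False)
                apply (rule post[OF ctx3 sm3 q(3)])
                using * f3 fd1 T2 T3 by (auto simp: local_cost_def)
            next
              case True3: True
              have nt: "no_tiny E C D ?v"
                unfolding no_tiny_def
              proof (intro allI impI notI)
                fix x Z assume "sepx E C x Z" "?v \<in> Z" "card Z \<le> D"
                then show False
                  using p(5)[OF True, of x Z] q(5)[OF True3, of x Z] D f2 by (auto simp: sepx_sealed)
              qed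
              let ?s4 = "s3\<lparr>arr := (arr s3)(aP := (arr s3 aP)(reg s3 ri := 0))\<rparr>"
              have ctx4: "ctx2 ?s4 E C adjO adjI"
                using ctx3 by (simp add: ctx2_def search_ctx_def adjrep_def)
              show ?thesis
                apply (simp add: True3)
                apply (rule post[OF ctx4])
                using nt True3 f3 sm3 T2 T3 by (auto simp: local_cost_def same_def)
            qed
          qed
          done
      qed
    qed
    done
qed

definition pend :: "state \<Rightarrow> nat set" where
  "pend s = {i \<in> {reg s rvb..<reg s rve}. arr s aP i = 1}"

text \<open>A search without result shows that its vertex lies in no small separation, and is paid
  for by the removal of this vertex from the pending ones. Only the last search may succeed; its
  vertex stays pending, hence the extra \<open>reg s' rfd * local_cost D\<close>.\<close>

lemma wp_local_loop:
  assumes ctx: "ctx2 s E C adjO adjI" and c: "comp s E C" and D: "reg s rL = D" "1 \<le> D"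
    and fd: "reg s rfd = 0" and i: "reg s ri = reg s rvb"
    and pi: "pend_inv E C (arr s aV ` pend s) D"
    and post: "\<And>s' T'. ctx2 s' E C adjO adjI \<Longrightarrow> same (wr local_loop) (wa local_loop) s s' \<Longrightarrow>
      reg s' rfd \<le> 1 \<Longrightarrow> (\<And>i. arr s' aP i = arr s aP i \<or> i \<in> pend s \<and> arr s' aP i = 0) \<Longrightarrow>
      (reg s' rfd = 1 \<Longrightarrow> sepx E C (reg s' rx) (marked C s') \<and> pend_inv E C (arr s aV ` pend s') D) \<Longrightarrow>
      (\<And>x Z. reg s' rfd = 0 \<Longrightarrow> sepx E C x Z \<Longrightarrow> D < card Z) \<Longrightarrow>
      (reg s' rfd = 0 \<Longrightarrow> pend s' = {}) \<Longrightarrow>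
      T' + local_cost D * card (pend s') \<le> T + local_cost D * card (pend s) +
        reg s' rfd * local_cost D + 40 * card C + 10 \<Longrightarrow> Q s' T'"
  shows "wp local_loop Q s T"
proof -
  let ?b = "Conj (Less (Reg ri) (Reg rve)) (Equal (Reg rfd) (Num 0))"
  let ?c = "If1 (Equal (Arr aP (Reg ri)) (Num 1)) local_vertex ;; incr ri"
  let ?V = "arr s aV" and ?L = "local_cost D"
  have C: "C = ?V ` {reg s rvb..<reg s rve}" "inj_on ?V {reg s rvb..<reg s rve}" "reg s rvb \<le> reg s rve"
    using c by (auto simp: comp_def)
  have cardC: "card C = reg s rve - reg s rvb" using C by (simp add: card_image)
  have VC: "?V i \<in> C" if "i \<in> {reg s rvb..<reg s rve}" for i using C(1) that by blast
  define I where "I = (\<lambda>s1 T1. ctx2 s1 E C adjO adjI \<and> reg s rvb \<le> reg s1 ri \<and> reg s1 ri \<le> reg s rve \<and>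
    reg s1 rfd \<le> 1 \<and> (reg s1 rfd = 1 \<longrightarrow> sepx E C (reg s1 rx) (marked C s1)) \<and>
    (\<forall>i. arr s1 aP i = arr s aP i \<or> i \<in> pend s \<and> arr s1 aP i = 0 \<and> no_tiny E C D (?V i)) \<and>
    (reg s1 rfd = 0 \<longrightarrow> (\<forall>i\<in>{reg s rvb..<reg s1 ri}. arr s1 aP i \<noteq> 1)) \<and>
    T1 + ?L * card (pend s1) + 40 * reg s rvb \<le> T + ?L * card (pend s) + reg s1 rfd * ?L + 40 * reg s1 ri)"
  have Lc: "20 \<le> ?L" by (simp add: local_cost_def)
  have fin: "finite (pend s1)" for s1 by (simp add: pend_def)
  show ?thesis
    unfolding local_loop_def
  proof (rule wp_While[where I = I and B = "T + ?L * card (pend s) + ?L + 40 * reg s rve"])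
    show "I s T" unfolding I_def using ctx fd i C by simp
    fix s1 T1 assume I1: "I s1 T1" and sm: "same (wr ?c) (wa ?c) s s1"
    have fr: "reg s1 rve = reg s rve" "reg s1 rvb = reg s rvb" "arr s1 aV = ?V" "reg s1 rL = D"
      using sameD[OF sm] D by auto
    have ctx1: "ctx2 s1 E C adjO adjI" and ri: "reg s rvb \<le> reg s1 ri" "reg s1 ri \<le> reg s rve"
      and f1: "reg s1 rfd \<le> 1" "reg s1 rfd = 1 \<longrightarrow> sepx E C (reg s1 rx) (marked C s1)"
      and P1: "\<And>i. arr s1 aP i = arr s aP i \<or> i \<in> pend s \<and> arr s1 aP i = 0 \<and> no_tiny E C D (?V i)"
      and cl: "reg s1 rfd = 0 \<Longrightarrow> i \<in> {reg s rvb..<reg s1 ri} \<Longrightarrow> arr s1 aP i \<noteq> 1"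
      and T1: "T1 + ?L * card (pend s1) + 40 * reg s rvb \<le> T + ?L * card (pend s) + reg s1 rfd * ?L + 40 * reg s1 ri"
      for i
      using I1 unfolding I_def by blast+
    have fl: "reg s1 rfd * ?L \<le> ?L" using f1(1) by (cases "reg s1 rfd") auto
    show "T1 \<le> T + ?L * card (pend s) + ?L + 40 * reg s rve" using T1 fl ri by linarith
    show "wp ?c I s1 (T1 + (bcost ?b + 1))" if b: "bval s1 ?b"
    proof -
      have lt: "reg s1 ri < reg s rve" and fd1: "reg s1 rfd = 0" using b fr by auto
      have T1': "T1 + ?L * card (pend s1) + 40 * reg s rvb \<le> T + ?L * card (pend s) + 40 * reg s1 ri"
        using T1 fd1 by simp
      have iin: "reg s1 ri \<in> {reg s rvb..<reg s rve}" using ri lt by simp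
      show ?thesis
      proof (cases "arr s1 aP (reg s1 ri) = 1")
        case False
        let ?s = "s1\<lparr>reg := (reg s1)(ri := Suc (reg s1 ri))\<rparr>"
        have c': "ctx2 ?s E C adjO adjI" using ctx1 by (simp add: ctx2_def search_ctx_def adjrep_def)
        have p': "pend ?s = pend s1" by (simp add: pend_def)
        show ?thesis
          using False apply simp
          apply (unfold I_def)
          using c' p' P1 cl[OF fd1] lt ri fd1 T1' by (auto simp: less_Suc_eq)
      next
        case True
        have vC: "arr s1 aV (reg s1 ri) \<in> C" using VC[OF iin] fr by simp
        have ip: "reg s1 ri \<in> pend s1" using True iin fr by (simp add: pend_def)
        then have ips: "reg s1 ri \<in> pend s" using P1[of "reg s1 ri"] True iin by (auto simp: pend_def)
        show ?thesis
          apply (subst wp_Seq, subst wp_Cond)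
          apply (simp add: True)
          apply (rule wp_local_vertex[OF ctx1 vC fr(4) D(2) fd1])
          subgoal premises p for s2 T2
          proof -
            have f2: "reg s2 rve = reg s rve" "reg s2 rvb = reg s rvb" "reg s2 ri = reg s1 ri"
              using sameD[OF p(2)] fr by auto
            let ?s = "s2\<lparr>reg := (reg s2)(ri := Suc (reg s1 ri))\<rparr>"
            have c': "ctx2 ?s E C adjO adjI" using p(1) by (simp add: ctx2_def search_ctx_def adjrep_def)
            have m': "marked C ?s = marked C s2" by (simp add: marked_def)
            have T2: "T2 + 5 \<le> T1 + ?L" using p(6) Lc by simp
            show ?thesis
            proof (cases "reg s2 rfd = 0")
              case True
              have aP: "arr s2 aP = (arr s1 aP)(reg s1 ri := 0)" and nt: "no_tiny E C D (?V (reg s1 ri))"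
                using p(5)[OF True] fr by auto
              have pe: "pend ?s = pend s1 - {reg s1 ri}" using fr f2 by (auto simp: pend_def aP)
              have "card (pend s1) = Suc (card (pend ?s))"
                unfolding pe using card_Suc_Diff1[OF fin ip] by simp
              then have cp: "?L * card (pend s1) = ?L + ?L * card (pend ?s)" by simp
              have "T2 + 5 + ?L * card (pend ?s) + 40 * reg s rvb \<le> T + ?L * card (pend s) + 40 * Suc (reg s1 ri)"
                using T1' T2 cp unfolding mult_Suc_right by linarith
              then show ?thesis
                apply (simp add: f2)
                apply (unfold I_def)
                using c' aP nt P1 cl[OF fd1] lt ri True ips by (auto simp: less_Suc_eq)
            next
              case False
              then have fd2: "reg s2 rfd = 1" using p(3) by simp
              have aP: "arr s2 aP = arr s1 aP" and sx: "sepx E C (reg s2 rx) (marked C s2)" using p(4)[OF fd2] by auto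
              have pe: "pend ?s = pend s1" using fr f2 by (auto simp: pend_def aP)
              have "T2 + 5 + ?L * card (pend ?s) + 40 * reg s rvb \<le> T + ?L * card (pend s) + ?L + 40 * Suc (reg s1 ri)"
                using T1' T2 unfolding pe mult_Suc_right by linarith
              then show ?thesis
                apply (simp add: f2)
                apply (unfold I_def)
                using c' m' aP P1 lt ri fd2 sx by auto
            qed
          qed
          done
      qed
    qed
    show "Q s1 (T1 + (bcost ?b + 1))" if b: "\<not> bval s1 ?b"
    proof (rule post[OF ctx1 _ f1(1)])
      show "same (wr local_loop) (wa local_loop) s s1" using sm unfolding local_loop_def by simp
      show "arr s1 aP i = arr s aP i \<or> i \<in> pend s \<and> arr s1 aP i = 0" for i using P1[of i] by blast
      have left: "i \<in> pend s1 \<or> no_tiny E C D (?V i)" if "i \<in> pend s" for i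
        using P1[of i] that fr by (auto simp: pend_def)
      show "sepx E C (reg s1 rx) (marked C s1) \<and> pend_inv E C (?V ` pend s1) D" if "reg s1 rfd = 1"
      proof
        show "sepx E C (reg s1 rx) (marked C s1)" using f1 that by simp
        show "pend_inv E C (?V ` pend s1) D"
          unfolding pend_inv_def
        proof (intro allI impI)
          fix x A assume a: "sepx E C x A" "card A \<le> D"
          then obtain i where i: "i \<in> pend s" "?V i \<in> A" using pi unfolding pend_inv_def by blast
          then have "i \<in> pend s1" using left[OF i(1)] a unfolding no_tiny_def by blast
          then show "A \<inter> ?V ` pend s1 \<noteq> {}" using i by blast
        qed
      qed
      have e: "pend s1 = {}" if "reg s1 rfd = 0"
        using b fr ri cl[OF that] that by (auto simp: pend_def)
      show "pend s1 = {}" if "reg s1 rfd = 0" using e that .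
      show "D < card Z" if z: "reg s1 rfd = 0" "sepx E C x Z" for x Z
      proof (rule ccontr)
        assume "\<not> D < card Z"
        then obtain i where i: "i \<in> pend s" "?V i \<in> Z" using pi z unfolding pend_inv_def by fastforce
        then have "no_tiny E C D (?V i)" using left[OF i(1)] e[OF z(1)] by blast
        then have "\<not> card Z \<le> D" using i(2) z(2) unfolding no_tiny_def by blast
        then show False using \<open>\<not> D < card Z\<close> by simp
      qed
      have "40 * reg s1 ri \<le> 40 * reg s rvb + 40 * card C" using ri cardC by simp
      moreover have "bcost ?b + 1 \<le> 10" by simp
      ultimately show "T1 + (bcost ?b + 1) + ?L * card (pend s1) \<le> T + ?L * card (pend s) +
          reg s1 rfd * ?L + 40 * card C + 10" using T1 by linarith
    qed
  qed
qed


subsection \<open>Global searches\<close>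

text \<open>With \<open>rL = card C\<close> the size condition on \<open>Z\<close> always holds, so
  a search without result excludes every sealed set around its start; if nothing was deleted, this
  means that the start spans \<open>C\<close>.\<close>

lemma wp_gsearch:
  assumes ctx: "ctx2 s E C adjO adjI"
    and dir: "f = afO \<and> nx = anO \<and> nb = aH \<and> E' = E \<and> adj = adjO \<or>
      f = afI \<and> nx = anI \<and> nb = aT \<and> E' = E\<inverse> \<and> adj = adjI"
    and m: "(\<Sum>v\<in>C. length (adj v)) \<le> m"
    and v: "reg s rv \<in> C" "reg s rv \<noteq> reg s rx" and L: "reg s rL = card C"
    and xc: "reg s rxc = (if reg s rx \<in> C then 1 else 0)" and fd: "reg s rfd = 0"
    and post: "\<And>s' T'. ctx2 s' E C adjO adjI \<Longrightarrow>
      same {rov, rp, ru, rql, rst, rqh, rfd} {amk, aq} s s' \<Longrightarrow> reg s' rfd \<le> 1 \<Longrightarrow>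
      (reg s' rfd = 1 \<Longrightarrow> sepx E C (reg s' rx) (marked C s')) \<Longrightarrow>
      (\<And>Z. reg s' rfd = 0 \<Longrightarrow> sealed E' C (reg s rx) Z \<Longrightarrow> reg s rv \<in> Z \<Longrightarrow> False) \<Longrightarrow>
      (reg s' rfd = 0 \<Longrightarrow> reg s rx \<notin> C \<Longrightarrow> spans E' C (reg s rv)) \<Longrightarrow>
      T' \<le> T + 60 * (card C + m) + 60 \<Longrightarrow> Q s' T'"
  shows "wp (search f nx nb) Q s T"
proof -
  have c1: "search_ctx s f nx nb E' C adj" using ctx dir by (auto simp: ctx2_def)
  have fin: "finite C" using c1 by (simp add: search_ctx_def)
  have L1: "1 \<le> reg s rL" using L v(1) fin by (metis One_nat_def Suc_leI card_gt_0_iff empty_iff)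
  have sb: "sbound C adj (reg s rL) (card C + m)" by (rule sbound_global[OF fin m])
  show ?thesis
  proof (rule wp_search_sealed[OF c1 v L1 xc fd sb])
    fix s' T' qs
    assume c': "search_ctx s' f nx nb E' C adj" and q: "queue C adj (reg s rx) (reg s rv) (reg s rL) (reg s' rst) qs s'"
      and sm: "same {rov, rp, ru, rql, rst, rqh, rfd} {amk, aq} s s'" and f1: "reg s' rfd \<le> 1"
      and f2: "reg s' rfd = 1 \<Longrightarrow> sealed E' C (reg s' rx) (marked C s') \<and> marked C s' \<noteq> {}"
      and f3: "\<And>Z. reg s' rfd = 0 \<Longrightarrow> sealed E' C (reg s rx) Z \<Longrightarrow> reg s rv \<in> Z \<Longrightarrow> card Z \<le> reg s rL \<Longrightarrow> False"
      and f4: "reg s' rfd = 0 \<Longrightarrow> length qs \<le> reg s rL \<Longrightarrow> C \<subseteq> set qs \<union> {reg s rx}"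
      and T': "T' \<le> T + 60 * (card C + m) + 60"
    have mk: "arr s' amk u \<le> reg s' rst" for u using c' by (rule search_ctx_marks)
    have ctx': "ctx2 s' E C adjO adjI" by (rule ctx2_same[OF ctx sm _ _ mk]) auto
    show "Q s' T'"
    proof (rule post[OF ctx' sm f1 _ _ _ T'])
      show "sepx E C (reg s' rx) (marked C s')" if "reg s' rfd = 1"
        using f2[OF that] dir by (auto simp: sepx_sealed)
      show False if Z: "reg s' rfd = 0" "sealed E' C (reg s rx) Z" "reg s rv \<in> Z" for Z
      proof (rule f3[OF Z])
        have "Z \<subseteq> C" using Z(2) by (auto simp: sealed_def)
        then show "card Z \<le> reg s rL" using L fin by (simp add: card_mono)
      qed
      show "spans E' C (reg s rv)" if z: "reg s' rfd = 0" "reg s rx \<notin> C"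
        unfolding spans_def
      proof (intro conjI allI impI)
        fix Z assume Z: "reg s rv \<in> Z" "\<forall>a\<in>Z. \<forall>c\<in>C. (a, c) \<in> E' \<longrightarrow> c \<in> Z"
        show "C \<subseteq> Z"
        proof (rule ccontr)
          assume n: "\<not> C \<subseteq> Z"
          have "sealed E' C (reg s rx) (Z \<inter> C)"
            using Z n z(2) v unfolding sealed_def by blast
          moreover have "card (Z \<inter> C) \<le> reg s rL" using L fin by (simp add: card_mono)
          ultimately show False using f3[OF z(1), of "Z \<inter> C"] Z(1) v by blast
        qed
      qed (rule v(1))
    qed
  qed
qed

text \<open>The potential occurs with \<open>600 * pot w\<close> for each of two flatness tests; the
  linear part covers the rest of these tests and at most five searches.\<close>

definition gcost :: "nat \<Rightarrow> nat" where
  "gcost w = 600 * w + 1200 * pot w + 1200"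

lemma wp_global:
  assumes ctx: "ctx2 s E C adjO adjI" and c: "comp s E C" and ls: "lists s E C adjO adjI inc"
    and C3: "3 \<le> card C" and n: "card C \<le> reg s rn" and fd: "reg s rfd = 0"
    and acl: "\<And>u. arr s acl u \<le> reg s rcs"
    and post: "\<And>s' T'. reg s' rfd \<le> 1 \<Longrightarrow> (reg s' rfd = 1 \<Longrightarrow> sepx E C (reg s' rx) (marked C s')) \<Longrightarrow>
      (reg s' rfd = 0 \<Longrightarrow> good E C) \<Longrightarrow> (\<And>u. arr s' acl u \<le> reg s' rcs) \<Longrightarrow>
      (\<And>u. arr s' amk u \<le> reg s' rst) \<Longrightarrow>
      same (wr global) (wa global) s s' \<Longrightarrow> T' \<le> T + gcost (wt inc C) \<Longrightarrow> Q s' T'"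
  shows "wp global Q s T"
proof -
  let ?R = "wr global" and ?A = "wa global"
  define m where "m = reg s rae - reg s rab"
  define w where "w = wt inc C"
  define r where "r = arr s aV (reg s rvb)"
  define r2 where "r2 = arr s aV (Suc (reg s rvb))"
  have C: "C = arr s aV ` {reg s rvb..<reg s rve}" "inj_on (arr s aV) {reg s rvb..<reg s rve}" "reg s rvb \<le> reg s rve"
    using c by (auto simp: comp_def)
  have cardC: "card C = reg s rve - reg s rvb" using C by (simp add: card_image)
  have fin: "finite C" using C by simp
  have m: "(\<Sum>v\<in>C. length (adjO v)) \<le> m" "(\<Sum>v\<in>C. length (adjI v)) \<le> m" "w = card C + 2 * m"
    and incs: "increp s C E 1 inc" "increp s C (E\<inverse>) 0 inc"
    using ls by (auto simp: lists_def m_def w_def)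
  have i: "reg s rvb \<in> {reg s rvb..<reg s rve}" "Suc (reg s rvb) \<in> {reg s rvb..<reg s rve}"
    using C3 cardC by auto
  have r: "r \<in> C" "r2 \<in> C" "r2 \<noteq> r"
    using i C inj_onD[OF C(2), of "Suc (reg s rvb)" "reg s rvb"] by (auto simp: r_def r2_def)
  have nC: "reg s rn \<notin> C" using ctx by (simp add: ctx2_def search_ctx_def)
  have cost: "60 * (card C + m) \<le> 60 * w" using m(3) by simp
  \<comment> \<open>What all searches and tests preserve. The stages are treated from the last one
    backwards, each with the final postcondition \<open>Q\<close>.\<close>
  define G where "G = (\<lambda>s1. ctx2 s1 E C adjO adjI \<and> same ?R ?A s s1 \<and> (\<forall>u. arr s1 acl u \<le> reg s1 rcs) \<and>
    reg s1 rL = card C)"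
  have G_D: "ctx2 s1 E C adjO adjI" "same ?R ?A s s1" "arr s1 acl u \<le> reg s1 rcs" "reg s1 rL = card C"
    "arr s1 amk u \<le> reg s1 rst" "increp s1 C E 1 inc" "increp s1 C (E\<inverse>) 0 inc"
    "arr s1 aV = arr s aV" "reg s1 rve = reg s rve" "reg s1 rvb = reg s rvb" "reg s1 rn = reg s rn" if G: "G s1" for s1 u
  proof -
    show sm: "same ?R ?A s s1" and ctx1: "ctx2 s1 E C adjO adjI" and "arr s1 acl u \<le> reg s1 rcs" "reg s1 rL = card C"
      using G by (auto simp: G_def)
    show "arr s1 aV = arr s aV" "reg s1 rve = reg s rve" "reg s1 rvb = reg s rvb" "reg s1 rn = reg s rn"
      using sameD[OF sm] by auto
    show "arr s1 amk u \<le> reg s1 rst" using ctx1 search_ctx_marks unfolding ctx2_def by blast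
    have "arr s1 anB = arr s anB" "arr s1 abB = arr s abB" "arr s1 akB = arr s akB" "arr s1 afB = arr s afB"
      using sameD[OF sm] by auto
    then show "increp s1 C E 1 inc" "increp s1 C (E\<inverse>) 0 inc" using increp_cong incs by metis+
  qed
  have G_search: "G s2" if "G s1" "ctx2 s2 E C adjO adjI" "same {rov, rp, ru, rql, rst, rqh, rfd} {amk, aq} s1 s2" for s1 s2
    unfolding G_def
  proof (intro conjI)
    note sm = sameD[OF that(3)]
    show "ctx2 s2 E C adjO adjI" by fact
    show "same ?R ?A s s2" using G_D(2)[OF that(1)] that(3) by (auto simp: same_def)
    show "\<forall>u. arr s2 acl u \<le> reg s2 rcs" using G_D(3)[OF that(1)] sm by simp
    show "reg s2 rL = card C" using G_D(4)[OF that(1)] sm by simp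
  qed
  have G_flat: "G s2" if "G s1" "same (wr (flat_test kd)) (wa (flat_test kd)) s1 s2" "\<And>u. arr s2 acl u \<le> reg s2 rcs" for s1 s2 kd
    unfolding G_def
  proof (intro conjI)
    note sm = sameD[OF that(2)]
    have mk: "arr s2 amk u \<le> reg s2 rst" for u using G_D(5)[OF that(1)] sm by simp
    show "ctx2 s2 E C adjO adjI" by (rule ctx2_same[OF G_D(1)[OF that(1)] that(2) _ _ mk]) auto
    show "same ?R ?A s s2" using G_D(2)[OF that(1)] that(2) by (auto simp: same_def)
    show "\<forall>u. arr s2 acl u \<le> reg s2 rcs" using that(3) by simp
    show "reg s2 rL = card C" using G_D(4)[OF that(1)] sm by simp
  qed
  have G_regs: "G (s1\<lparr>reg := (reg s1)(rv := a, rx := b)\<rparr>)" "G (s1\<lparr>reg := (reg s1)(rv := a, rx := b, rxc := d)\<rparr>)"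
    if "G s1" for s1 a b d
    using that by (auto simp: G_def ctx2_def search_ctx_def adjrep_def same_def)
  have fl_time: "80 * (reg s rve - reg s rvb) + 60 * w + 600 * pot w + 120 \<le> 140 * w + 600 * pot w + 120"
    using cardC m(3) by simp
  have fin_post: "Q s' T'" if "G s'" "reg s' rfd \<le> 1" "reg s' rfd = 1 \<Longrightarrow> sepx E C (reg s' rx) (marked C s')"
    "reg s' rfd = 0 \<Longrightarrow> good E C" "T' \<le> T + gcost w" for s' T'
    using that G_D[OF that(1)] by (intro post) (auto simp: w_def)
  have flatI: "wp flat_in Q s1 T1"
    if G1: "G s1" and spI: "spans (E\<inverse>) C r" and xc: "reg s1 rxc = 1" and fd1: "reg s1 rfd = 0"
      and gd: "(\<And>u. u \<in> C \<Longrightarrow> flat (E\<inverse>) C r u) \<Longrightarrow> good E C"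
      and T1: "T1 \<le> T + 400 * w + 600 * pot w + 600" for s1 T1
    unfolding flat_in_def
    apply (subst wp_Seq)
    apply (rule wp_flat_test[OF G_D(7)[OF G1], where r = r])
          apply (use C G_D[OF G1] n i spI in \<open>auto simp: r_def\<close>)[6]
    subgoal premises p for s2 T2
    proof -
      have G2: "G s2" by (rule G_flat[OF G1 p(5)]) (rule p(4))
      have f2: "reg s2 rxc = 1" "reg s2 rfd = 0" using sameD[OF p(5)] xc fd1 by auto
      have T2: "T2 \<le> T + 540 * w + 1200 * pot w + 720"
        using p(6) T1 fl_time G_D[OF G1] by (simp add: w_def[symmetric])
      show ?thesis
      proof (cases "reg s2 rbad = 1")
        case False
        then have b0: "reg s2 rbad = 0" using p(1) by simp
        have "good E C" by (rule gd, rule p(2)[OF b0])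
        then show ?thesis
          apply (simp add: b0)
          apply (rule fin_post[OF G2])
          using f2 T2 by (auto simp: gcost_def)
      next
        case True
        obtain Z where Z: "reg s2 rb \<in> Z" "sealed E C (reg s2 rl) Z" and lC: "reg s2 rl \<in> C"
          using p(3)[OF True] by auto
        have bl: "reg s2 rb \<in> C" "reg s2 rb \<noteq> reg s2 rl" using Z by (auto simp: sealed_def)
        let ?s = "s2\<lparr>reg := (reg s2)(rv := reg s2 rb, rx := reg s2 rl)\<rparr>"
        have G3: "G ?s" using G_regs G2 by blast
        show ?thesis
          apply (simp add: True)
          apply (rule wp_gsearch[OF G_D(1)[OF G3], where E' = E and adj = adjO and m = m])
                 apply (use m bl lC f2 G_D[OF G3] in \<open>auto\<close>)[7]
          subgoal premises q for s4 T4
          proof -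
            have G4: "G s4" by (rule G_search[OF G3 q(1,2)])
            \<comment> \<open>This search cannot fail, since the test has exhibited a sealed set
              around its start.\<close>
            have ne: "reg s4 rfd \<noteq> 0" using q(5)[of Z] Z by auto
            show ?thesis
              apply (rule fin_post[OF G4 q(3,4)])
              using ne q(7) T2 cost by (auto simp: gcost_def)
          qed
          done
      qed
    qed
    done
  have flatO: "wp flat_out Q s1 T1"
    if G1: "G s1" and sp: "spans E C r" "spans (E\<inverse>) C r" and xc: "reg s1 rxc = 1" and fd1: "reg s1 rfd = 0"
      and gd: "(\<And>u. u \<in> C \<Longrightarrow> flat E C r u) \<Longrightarrow> (\<And>u. u \<in> C \<Longrightarrow> flat (E\<inverse>) C r u) \<Longrightarrow> good E C"
      and T1: "T1 \<le> T + 240 * w + 400" for s1 T1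
    unfolding flat_out_def
    apply (subst wp_Seq)
    apply (rule wp_flat_test[OF G_D(6)[OF G1], where r = r])
          apply (use C G_D[OF G1] n i sp in \<open>auto simp: r_def\<close>)[6]
    subgoal premises p for s2 T2
    proof -
      have G2: "G s2" by (rule G_flat[OF G1 p(5)]) (rule p(4))
      have f2: "reg s2 rxc = 1" "reg s2 rfd = 0" using sameD[OF p(5)] xc fd1 by auto
      have T2: "T2 + 10 \<le> T + 380 * w + 600 * pot w + 530"
        using p(6) T1 fl_time G_D[OF G1] by (simp add: w_def[symmetric])
      show ?thesis
      proof (cases "reg s2 rbad = 1")
        case False
        then have b0: "reg s2 rbad = 0" using p(1) by simp
        show ?thesis
          apply (simp add: b0)
          apply (rule flatI[OF G2 sp(2) f2])
           apply (rule gd)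
            apply (rule p(2)[OF b0], assumption)
           apply assumption
          using T2 by simp
      next
        case True
        obtain Z where Z: "reg s2 rb \<in> Z" "sealed (E\<inverse>) C (reg s2 rl) Z" and lC: "reg s2 rl \<in> C"
          using p(3)[OF True] by auto
        have bl: "reg s2 rb \<in> C" "reg s2 rb \<noteq> reg s2 rl" using Z by (auto simp: sealed_def)
        let ?s = "s2\<lparr>reg := (reg s2)(rv := reg s2 rb, rx := reg s2 rl)\<rparr>"
        have G3: "G ?s" using G_regs G2 by blast
        show ?thesis
          apply (simp add: True)
          apply (rule wp_gsearch[OF G_D(1)[OF G3], where E' = "E\<inverse>" and adj = adjI and m = m])
                 apply (use m bl lC f2 G_D[OF G3] in \<open>auto\<close>)[7]
          subgoal premises q for s4 T4
          proof -
            have G4: "G s4" by (rule G_search[OF G3 q(1,2)])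
            have ne: "reg s4 rfd \<noteq> 0" using q(5)[of Z] Z by auto
            show ?thesis
              apply (rule fin_post[OF G4 q(3,4)])
              using ne q(7) T2 cost by (auto simp: gcost_def)
          qed
          done
      qed
    qed
    done
  have both: "wp (search_both c) Q s1 T1"
    if G1: "G s1" and v: "reg s1 rv \<in> C" "reg s1 rv \<noteq> reg s1 rx" and xc: "reg s1 rxc = (if reg s1 rx \<in> C then 1 else 0)"
      and fd1: "reg s1 rfd = 0" and T1: "T1 + 120 * w + 130 \<le> T + gcost w"
      and cc: "\<And>s2 T2. G s2 \<Longrightarrow> reg s2 rfd = 0 \<Longrightarrow> reg s2 rxc = reg s1 rxc \<Longrightarrow>
        (\<And>Z. sealed E C (reg s1 rx) Z \<Longrightarrow> reg s1 rv \<in> Z \<Longrightarrow> False) \<Longrightarrow>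
        (\<And>Z. sealed (E\<inverse>) C (reg s1 rx) Z \<Longrightarrow> reg s1 rv \<in> Z \<Longrightarrow> False) \<Longrightarrow>
        (reg s1 rx \<notin> C \<Longrightarrow> spans E C (reg s1 rv) \<and> spans (E\<inverse>) C (reg s1 rv)) \<Longrightarrow>
        T2 \<le> T1 + 120 * w + 130 \<Longrightarrow> wp c Q s2 T2" for c s1 T1
    unfolding search_both_def
    apply (subst wp_Seq)
    apply (rule wp_gsearch[OF G_D(1)[OF G1], where E' = E and adj = adjO and m = m])
           apply (use m v xc fd1 G_D[OF G1] in \<open>auto\<close>)[7]
    subgoal premises p for s2 T2
    proof -
      have G2: "G s2" by (rule G_search[OF G1 p(1,2)])
      have f2: "reg s2 rv = reg s1 rv" "reg s2 rx = reg s1 rx" "reg s2 rxc = reg s1 rxc" using sameD[OF p(2)] by auto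
      show ?thesis
      proof (cases "reg s2 rfd = 0")
        case False
        show ?thesis
          apply (simp add: False)
          apply (rule fin_post[OF G2 p(3,4)])
          using False p(7) T1 cost by auto
      next
        case True
        show ?thesis
          apply (simp add: True)
          apply (rule wp_gsearch[OF G_D(1)[OF G2], where E' = "E\<inverse>" and adj = adjI and m = m])
                 apply (use True m v xc f2 G_D[OF G2] in \<open>auto\<close>)[7]
          subgoal premises q for s3 T3
          proof -
            have G3: "G s3" by (rule G_search[OF G2 q(1,2)])
            have f3: "reg s3 rxc = reg s1 rxc" using sameD[OF q(2)] f2 by auto
            show ?thesis
            proof (cases "reg s3 rfd = 0")
              case False
              show ?thesis
                apply (simp add: False)
                apply (rule fin_post[OF G3 q(3,4)])
                using False q(7) p(7) T1 cost by auto
            next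
              case True3: True
              show ?thesis
                apply (simp add: True3)
                apply (rule cc[OF G3 True3 f3])
                using p(5)[OF True] q(5)[OF True3] p(6)[OF True] q(6)[OF True3] f2 p(7) q(7) cost by auto
            qed
          qed
          done
      qed
    qed
    done
  have G0: "G (s\<lparr>reg := (reg s)(rL := card C, rv := r, rx := reg s rn, rxc := 0)\<rparr>)"
    using ctx acl by (auto simp: G_def ctx2_def search_ctx_def adjrep_def same_def)
  show ?thesis
    unfolding global_def
    apply (simp only: wp_Seq wp_Assign)
    apply (rule wp_state_eq[OF both[OF G0]])
          apply (use r nC fd in \<open>auto simp: gcost_def\<close>)[5]
    subgoal premises p for s2 T2
    proof -
      have sp: "spans E C r" "spans (E\<inverse>) C r" using p(6) nC by auto
      let ?s = "s2\<lparr>reg := (reg s2)(rv := r2, rx := r, rxc := 1)\<rparr>"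
      have G3: "G ?s" using G_regs p(1) by blast
      note d = G_D[OF p(1)]
      show ?thesis
        apply (simp only: wp_Seq wp_Assign)
        apply (rule wp_state_eq[OF both[OF G3]])
              apply (use r p(2,7) in \<open>auto simp: gcost_def\<close>)[5]
        subgoal premises q for s4 T4
        proof (rule flatO[OF q(1) sp _ q(2)])
          show "reg s4 rxc = 1" using q(3) by simp
          show "T4 \<le> T + 240 * w + 400" using q(7) p(7) by simp
          show "good E C" if "\<And>u. u \<in> C \<Longrightarrow> flat E C r u" "\<And>u. u \<in> C \<Longrightarrow> flat (E\<inverse>) C r u"
            by (rule good_if_flat[OF fin r(1,2,3) C3 that]) (use q(4,5) in auto)
        qed
        by (simp add: d r_def r2_def)
    qed
    by (simp add: cardC r_def)
qed

section \<open>Splitting a component\<close>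

text \<open>A split deletes the arcs between the two sides. The vertices incident to them, and \<open>x\<close>, await
  a new local search; each deleted arc pays for two such searches.\<close>

definition deleted :: "(nat \<times> nat) set \<Rightarrow> nat set \<Rightarrow> nat \<Rightarrow> nat set \<Rightarrow> (nat \<times> nat) set" where
  "deleted E C x A = (E \<inter> C \<times> C) - (A \<union> (C \<inter> {x})) \<times> (A \<union> (C \<inter> {x})) - (C - A) \<times> (C - A)"

definition losers :: "(nat \<times> nat) set \<Rightarrow> nat set \<Rightarrow> nat \<Rightarrow> nat set \<Rightarrow> nat set" where
  "losers E C x A = {v \<in> C. v = x \<or> (\<exists>u. (u, v) \<in> deleted E C x A \<or> (v, u) \<in> deleted E C x A)}"

text \<open>The two parts share at most the vertex \<open>x\<close>, and there are no loops, so no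
  arc lies in both.\<close>

lemma card_arcs_split:
  assumes "finite C" "E \<inter> Id = {}" "A \<subseteq> C - {x}"
  shows "card (E \<inter> (A \<union> (C \<inter> {x})) \<times> (A \<union> (C \<inter> {x}))) + card (E \<inter> (C - A) \<times> (C - A)) +
    card (deleted E C x A) = card (E \<inter> C \<times> C)"
proof -
  let ?C1 = "A \<union> (C \<inter> {x})" and ?C2 = "C - A"
  have fin: "finite (E \<inter> C \<times> C)" using assms by simp
  have sub: "E \<inter> ?C1 \<times> ?C1 \<subseteq> E \<inter> C \<times> C" "E \<inter> ?C2 \<times> ?C2 \<subseteq> E \<inter> C \<times> C"
    "deleted E C x A \<subseteq> E \<inter> C \<times> C"
    using assms by (auto simp: deleted_def)
  have f: "finite (E \<inter> ?C1 \<times> ?C1)" "finite (E \<inter> ?C2 \<times> ?C2)" "finite (deleted E C x A)"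
    using sub fin by (blast intro: finite_subset)+
  have d: "(E \<inter> ?C1 \<times> ?C1) \<inter> (E \<inter> ?C2 \<times> ?C2) = {}" using assms by auto
  have d2: "(E \<inter> ?C1 \<times> ?C1 \<union> E \<inter> ?C2 \<times> ?C2) \<inter> deleted E C x A = {}" by (auto simp: deleted_def)
  have "E \<inter> C \<times> C = (E \<inter> ?C1 \<times> ?C1 \<union> E \<inter> ?C2 \<times> ?C2) \<union> deleted E C x A"
    using sub by (auto simp: deleted_def)
  then show ?thesis using f d d2 by (simp add: card_Un_disjoint)
qed

lemma card_losers:
  assumes "finite C"
  shows "card (losers E C x A - {x}) \<le> 2 * card (deleted E C x A)"
proof -
  have fin: "finite (deleted E C x A)" using assms by (auto simp: deleted_def)
  have "losers E C x A - {x} \<subseteq> fst ` deleted E C x A \<union> snd ` deleted E C x A"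
    by (force simp: losers_def)
  then have "card (losers E C x A - {x}) \<le> card (fst ` deleted E C x A \<union> snd ` deleted E C x A)"
    using fin by (intro card_mono) auto
  also have "\<dots> \<le> card (fst ` deleted E C x A) + card (snd ` deleted E C x A)" by (rule card_Un_le)
  also have "\<dots> \<le> 2 * card (deleted E C x A)"
    using card_image_le[OF fin, of fst] card_image_le[OF fin, of snd] by simp
  finally show ?thesis .
qed

text \<open>Only \<open>x\<close> can occur in both parts, and it is pending in both, whence the
  summand 2.\<close>

lemma card_pend_split:
  assumes "finite C" "A \<subseteq> C - {x}" "P \<subseteq> C"
  shows "card {v \<in> A \<union> (C \<inter> {x}). v \<in> losers E C x A \<or> v \<in> P} +
    card {v \<in> C - A. v \<in> losers E C x A \<or> v \<in> P} \<le> card P + 2 * card (deleted E C x A) + 2"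
proof -
  let ?L = "losers E C x A" and ?U = "(losers E C x A \<union> P) - {x}"
  let ?P1 = "{v \<in> A \<union> (C \<inter> {x}). v \<in> losers E C x A \<or> v \<in> P}"
  let ?P2 = "{v \<in> C - A. v \<in> losers E C x A \<or> v \<in> P}"
  have fin: "finite ?U" "finite P" using assms finite_subset[of P C] by (auto simp: losers_def)
  have "?P1 \<subseteq> insert x (?U \<inter> A)" by auto
  then have "card ?P1 \<le> card (insert x (?U \<inter> A))" using fin by (intro card_mono) auto
  then have 1: "card ?P1 \<le> Suc (card (?U \<inter> A))" using fin by (auto simp: card_insert_if split: if_splits)
  have "?P2 \<subseteq> insert x (?U - A)" by auto
  then have "card ?P2 \<le> card (insert x (?U - A))" using fin by (intro card_mono) auto
  then have 2: "card ?P2 \<le> Suc (card (?U - A))" using fin by (auto simp: card_insert_if split: if_splits)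
  have "card (?U \<inter> A) + card (?U - A) = card ?U"
    using fin(1) by (metis card_Int_Diff Int_commute)
  also have "?U \<subseteq> (?L - {x}) \<union> P" by auto
  then have "card ?U \<le> card ((?L - {x}) \<union> P)" using assms fin by (intro card_mono) (auto simp: losers_def)
  also have "\<dots> \<le> card (?L - {x}) + card P" by (rule card_Un_le)
  finally show ?thesis using 1 2 card_losers[OF assms(1), of E x A] by linarith
qed

text \<open>An arc between \<open>x\<close> and one side survives in the part of that side but is
  lost to the other part, where \<open>x\<close> remains. Such arcs are not in
  \<open>deleted\<close>, which is why \<open>x\<close> is a loser by definition.\<close>

lemma pend_inv_split:
  assumes "pend_inv E C P D" "A \<subseteq> C - {x}" "P \<subseteq> C"
  shows "pend_inv E (A \<union> (C \<inter> {x})) {v \<in> A \<union> (C \<inter> {x}). v \<in> losers E C x A \<or> v \<in> P} D"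
    and "pend_inv E (C - A) {v \<in> C - A. v \<in> losers E C x A \<or> v \<in> P} D"
proof -
  show "pend_inv E (A \<union> (C \<inter> {x})) {v \<in> A \<union> (C \<inter> {x}). v \<in> losers E C x A \<or> v \<in> P} D"
    by (rule pend_inv_subset[OF assms(1)]) (use assms in \<open>auto simp: losers_def deleted_def\<close>)
  show "pend_inv E (C - A) {v \<in> C - A. v \<in> losers E C x A \<or> v \<in> P} D"
    by (rule pend_inv_subset[OF assms(1)]) (use assms in \<open>auto simp: losers_def deleted_def\<close>)
qed

text \<open>For a component with \<open>n\<close> vertices, \<open>m\<close> arcs and \<open>p\<close> pending vertices. The second summand pays
  for the global tests that find a separation (both sides have more than \<open>D\<close> vertices then), the
  third one for the final global test.\<close>

definition phi :: "nat \<Rightarrow> nat \<Rightarrow> nat \<Rightarrow> nat \<Rightarrow> nat \<Rightarrow> nat \<Rightarrow> nat" where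
  "phi M D R n m p = R * (n - 2) + 24000 * M * ((n - 1) - D) + 2000 * (D + 2) * (n + 2 * m) +
     local_cost D * (2 * m + p) + 100"

text \<open>Before the split \<open>D + 1\<close> is subtracted from one size, afterwards from two;
  as the sizes add up to at most \<open>card C + 1\<close>, this frees \<open>D\<close>. It
  presupposes that no subtraction is cut off at 0, which holds when both sides have more than
  \<open>D\<close> vertices.\<close>

lemma card_sepx_sides:
  assumes fin: "finite C" and s: "sepx E C x A"
  shows "card (A \<union> (C \<inter> {x})) + card (C - A) \<le> card C + 1" "1 \<le> card (A \<union> (C \<inter> {x}))" "1 \<le> card (C - A)"
    "card (A \<union> (C \<inter> {x})) < card C" "card (C - A) < card C"
    "D < card A \<Longrightarrow> D < card (C - A - {x}) \<Longrightarrow>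
      (card (A \<union> (C \<inter> {x})) - 1 - D) + (card (C - A) - 1 - D) + D \<le> card C - 1 - D"
proof -
  have A: "A \<noteq> {}" "A \<subseteq> C - {x}" "C - A - {x} \<noteq> {}" using s by (auto simp: sepx_def)
  have fA: "finite A" using A fin finite_subset by blast
  have e: "card (A \<union> (C \<inter> {x})) = card A + (if x \<in> C then 1 else 0)"
    using A fA by (subst card_Un_disjoint) auto
  have e2: "card (C - A) = card (C - A - {x}) + (if x \<in> C then 1 else 0)"
  proof (cases "x \<in> C")
    case True
    then have "x \<in> C - A" using A by auto
    then show ?thesis using True fin card_Suc_Diff1[of "C - A" x] by simp
  qed simp
  have e3: "card C = card A + card (C - A)" using A fin fA by (simp add: card_Diff_subset card_mono subset_Diff_insert)
  have p: "0 < card A" "0 < card (C - A - {x})" using A fin fA by (auto simp: card_gt_0_iff)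
  define i where "i = (if x \<in> C then 1 else 0 :: nat)"
  have i: "i \<le> 1" "card (A \<union> (C \<inter> {x})) = card A + i" "card (C - A) = card (C - A - {x}) + i"
    using e e2 unfolding i_def by (simp, blast+)
  show "card (A \<union> (C \<inter> {x})) + card (C - A) \<le> card C + 1" "1 \<le> card (A \<union> (C \<inter> {x}))" "1 \<le> card (C - A)"
    "card (A \<union> (C \<inter> {x})) < card C" "card (C - A) < card C"
    using i e3 p by linarith+
  show "(card (A \<union> (C \<inter> {x})) - 1 - D) + (card (C - A) - 1 - D) + D \<le> card C - 1 - D"
    if "D < card A" "D < card (C - A - {x})"
    using i e3 that by linarith
qed

text \<open>As \<open>x\<close> is counted in both parts, the third and fourth summands may grow by
  the share of one vertex and of two pending marks; this is the excess on the right, and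
  \<open>rate\<close> is chosen above it. Because \<open>(n1 - 2) + (n2 - 2) < n - 2\<close>, the
  first summand releases \<open>R\<close> at every split, so that there are at most
  \<open>n - 2\<close> of them.\<close>

lemma phi_split:
  assumes n: "n1 + n2 \<le> n + 1" "1 \<le> n1" "1 \<le> n2" "n1 < n" "n2 < n" "3 \<le> n"
    and m: "m1 + m2 + d \<le> m" and p: "p1 + p2 \<le> p + 2 * d + 2"
    and k: "k \<le> D" "(n1 - 1 - D) + (n2 - 1 - D) + k \<le> n - 1 - D"
  shows "phi M D R n1 m1 p1 + phi M D R n2 m2 p2 + R + 24000 * M * k \<le>
    phi M D R n m p + 2000 * (D + 2) + 2 * local_cost D + 100"
proof -
  have "(n1 - 2) + (n2 - 2) + 1 \<le> n - 2" using n by linarith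
  then have "R * ((n1 - 2) + (n2 - 2) + 1) \<le> R * (n - 2)" by (rule mult_le_mono2)
  moreover have "24000 * M * ((n1 - 1 - D) + (n2 - 1 - D) + k) \<le> 24000 * M * (n - 1 - D)"
    using k by (intro mult_le_mono2)
  moreover have "2000 * (D + 2) * ((n1 + 2 * m1) + (n2 + 2 * m2)) \<le> 2000 * (D + 2) * (n + 2 * m + 1)"
    using n m by (intro mult_le_mono2; linarith)
  moreover have "local_cost D * ((2 * m1 + p1) + (2 * m2 + p2)) \<le> local_cost D * (2 * m + p + 2)"
    using m p by (intro mult_le_mono2; linarith)
  ultimately show ?thesis unfolding phi_def by (simp only: distrib_left mult_1_right)
qed

text \<open>Here \<open>D\<close> meets the logarithm: \<open>w < 2 ^ (D + 2)\<close> gives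
  \<open>floor_log w \<le> D + 1\<close>, so the test costs \<open>O(D)\<close> per unit of weight,
  with \<open>600 + 1200 * (D + 1) + 1200 \<le> 2000 * (D + 2)\<close>.\<close>

lemma gcost_le:
  assumes w: "1 \<le> w" "w < 2 ^ (D + 2)"
  shows "gcost w \<le> 2000 * (D + 2) * w"
proof -
  have "floor_log w \<le> D + 1"
  proof -
    have "2 ^ floor_log w \<le> w" using w by (intro floor_log_exp2_le) simp
    then have "(2::nat) ^ floor_log w < 2 ^ (D + 2)" using w by linarith
    then have "floor_log w < D + 2" by (rule power_less_imp_less_exp[rotated]) simp
    then show ?thesis by simp
  qed
  then have "w * floor_log w \<le> w * (D + 1)" by (rule mult_le_mono2)
  then have "gcost w \<le> 600 * w + 1200 * (w * (D + 1)) + 1200 * w" using w unfolding gcost_def pot_def by linarith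
  also have "\<dots> \<le> 2000 * (D + 2) * w" by (simp add: algebra_simps)
  finally show ?thesis .
qed

subsection \<open>Components in memory\<close>

definition seg :: "state \<Rightarrow> (nat \<times> nat) set \<Rightarrow> nat \<Rightarrow> nat \<Rightarrow> nat \<Rightarrow> nat \<Rightarrow> nat set \<Rightarrow> nat set \<Rightarrow> bool" where
  "seg s E vb ve ab ae C P \<longleftrightarrow>
     C = arr s aV ` {vb..<ve} \<and> inj_on (arr s aV) {vb..<ve} \<and> vb \<le> ve \<and> 1 \<le> ab \<and> ab \<le> ae \<and>
     inj_on (\<lambda>e. (arr s aT e, arr s aH e)) {ab..<ae} \<and>
     (\<lambda>e. (arr s aT e, arr s aH e)) ` {ab..<ae} = E \<inter> C \<times> C \<and> E \<inter> Id = {} \<and>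
     P = arr s aV ` {j \<in> {vb..<ve}. arr s aP j = 1}"

lemma seg_comp:
  "seg s E (reg s rvb) (reg s rve) (reg s rab) (reg s rae) C P \<longleftrightarrow> comp s E C \<and> P = arr s aV ` pend s"
  by (auto simp: seg_def comp_def pend_def)

lemma seg_cong:
  assumes "seg s E vb ve ab ae C P"
    and "\<And>j. vb \<le> j \<Longrightarrow> j < ve \<Longrightarrow> arr s' aV j = arr s aV j \<and> arr s' aP j = arr s aP j"
    and "\<And>j. j < ae \<Longrightarrow> arr s' aT j = arr s aT j \<and> arr s' aH j = arr s aH j"
  shows "seg s' E vb ve ab ae C P"
proof -
  have 1: "arr s' aV ` {vb..<ve} = arr s aV ` {vb..<ve}" using assms(2) by (intro image_cong) auto
  have 2: "inj_on (arr s' aV) {vb..<ve} = inj_on (arr s aV) {vb..<ve}" using assms(2) by (intro inj_on_cong) auto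
  have 3: "inj_on (\<lambda>e. (arr s' aT e, arr s' aH e)) {ab..<ae} = inj_on (\<lambda>e. (arr s aT e, arr s aH e)) {ab..<ae}"
    using assms(3) by (intro inj_on_cong) auto
  have 4: "(\<lambda>e. (arr s' aT e, arr s' aH e)) ` {ab..<ae} = (\<lambda>e. (arr s aT e, arr s aH e)) ` {ab..<ae}"
    using assms(3) by (intro image_cong) auto
  have 5: "arr s' aV ` {j \<in> {vb..<ve}. arr s' aP j = 1} = arr s aV ` {j \<in> {vb..<ve}. arr s aP j = 1}"
    using assms(2) by (intro image_cong) auto
  show ?thesis using assms(1) unfolding seg_def 1 2 3 4 5 .
qed

definition item :: "state \<Rightarrow> (nat \<times> nat) set \<Rightarrow> nat \<Rightarrow> nat set \<Rightarrow> nat set \<Rightarrow> bool" where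
  "item s E i C P \<longleftrightarrow>
     seg s E (arr s aVB i) (arr s aVB (Suc i)) (arr s aAB i) (arr s aAB (Suc i)) C P"

definition store :: "state \<Rightarrow> bool" where
  "store s \<longleftrightarrow> arr s aVB (reg s rits) = reg s rvt \<and> arr s aAB (reg s rits) = reg s rat \<and>
     (\<forall>i\<le>reg s rits. arr s aVB i \<le> reg s rvt \<and> arr s aAB i \<le> reg s rat) \<and>
     (\<forall>i j. i \<le> j \<longrightarrow> j \<le> reg s rits \<longrightarrow> arr s aVB i \<le> arr s aVB j)"

text \<open>Components are only appended in memory, so that all stored ones survive; a part of a
  split is a copy behind the last component and not an update in place.\<close>

definition ext :: "state \<Rightarrow> state \<Rightarrow> bool" where
  "ext s s' \<longleftrightarrow> (\<forall>j<reg s rvt. arr s' aV j = arr s aV j \<and> arr s' aP j = arr s aP j) \<and>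
     (\<forall>j<reg s rat. arr s' aT j = arr s aT j \<and> arr s' aH j = arr s aH j) \<and>
     (\<forall>j\<le>reg s rits. arr s' aVB j = arr s aVB j \<and> arr s' aAB j = arr s aAB j) \<and>
     reg s rvt \<le> reg s' rvt \<and> reg s rat \<le> reg s' rat \<and> reg s rits \<le> reg s' rits"

lemma ext_trans: "ext s s' \<Longrightarrow> ext s' s'' \<Longrightarrow> ext s s''"
  unfolding ext_def by auto

lemma item_ext:
  assumes "item s E i C P" "store s" "ext s s'" "i < reg s rits"
  shows "item s' E i C P"
proof -
  have b: "arr s aVB (Suc i) \<le> reg s rvt" "arr s aAB (Suc i) \<le> reg s rat"
    using assms(2,4) by (auto simp: store_def)
  have e: "arr s' aVB i = arr s aVB i" "arr s' aAB i = arr s aAB i"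
    "arr s' aVB (Suc i) = arr s aVB (Suc i)" "arr s' aAB (Suc i) = arr s aAB (Suc i)"
    using assms(3,4) by (auto simp: ext_def)
  show ?thesis
    unfolding item_def e
    by (rule seg_cong[OF assms(1)[unfolded item_def]]) (use assms(3) b in \<open>auto simp: ext_def\<close>)
qed

section \<open>Copying the two parts of a split\<close>

definition copy_arcs :: "nat \<Rightarrow> com" where
  "copy_arcs a = While (Less (Reg rp) (Reg rae))
    (rj ::= Arr aT (Reg rp) ;; rw ::= Arr aH (Reg rp) ;;
     If1 (Conj (Equal (Arr a (Reg rj)) (Num 1)) (Equal (Arr a (Reg rw)) (Num 1)))
       (Store aT (Reg rat) (Reg rj) ;; Store aH (Reg rat) (Reg rw) ;; incr rat) ;;
     incr rp)"

definition copy_verts :: "nat \<Rightarrow> com" where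
  "copy_verts a = While (Less (Reg ri) (Reg rve))
    (ru ::= Arr aV (Reg ri) ;;
     If1 (Equal (Arr a (Reg ru)) (Num 1))
       (Store aV (Reg rvt) (Reg ru) ;;
        Cond (Equal (Arr alost (Reg ru)) (Num 1)) (Store aP (Reg rvt) (Num 1))
          (Store aP (Reg rvt) (Arr aP (Reg ri))) ;;
        incr rvt) ;;
     incr ri)"

definition push :: "nat \<Rightarrow> com" where
  "push a = (rp ::= Reg rab ;; copy_arcs a ;; ri ::= Reg rvb ;; copy_verts a ;; incr rits ;;
     Store aVB (Reg rits) (Reg rvt) ;; Store aAB (Reg rits) (Reg rat))"

text \<open>The deleted vertex may bear the stamp of the last search too, so the comparison with
  \<open>rx\<close> comes first; this vertex joins both parts and counts as a loser.\<close>

definition mark_sides :: com where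
  "mark_sides = While (Less (Reg ri) (Reg rve))
    (ru ::= Arr aV (Reg ri) ;;
     Cond (Equal (Reg ru) (Reg rx))
       (Store ain1 (Reg ru) (Num 1) ;; Store ain2 (Reg ru) (Num 1) ;; Store alost (Reg ru) (Num 1))
       (Store alost (Reg ru) (Num 0) ;;
        Cond (Equal (Arr amk (Reg ru)) (Reg rst))
          (Store ain1 (Reg ru) (Num 1) ;; Store ain2 (Reg ru) (Num 0))
          (Store ain1 (Reg ru) (Num 0) ;; Store ain2 (Reg ru) (Num 1))) ;;
     incr ri)"

definition find_lost :: com where
  "find_lost = While (Less (Reg rp) (Reg rae))
    (rj ::= Arr aT (Reg rp) ;; rw ::= Arr aH (Reg rp) ;;
     If1 (Conj (Neg (Conj (Equal (Arr ain1 (Reg rj)) (Num 1)) (Equal (Arr ain1 (Reg rw)) (Num 1))))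
               (Neg (Conj (Equal (Arr ain2 (Reg rj)) (Num 1)) (Equal (Arr ain2 (Reg rw)) (Num 1)))))
       (Store alost (Reg rj) (Num 1) ;; Store alost (Reg rw) (Num 1)) ;;
     incr rp)"

definition split :: com where
  "split = (ri ::= Reg rvb ;; mark_sides ;; rp ::= Reg rab ;; find_lost ;; push ain1 ;; push ain2)"

definition emit_copy :: com where
  "emit_copy = While (Less (Reg ri) (Reg rve))
    (Store 3 (Reg rot) (Arr aV (Reg ri)) ;; incr rot ;; incr ri)"

definition emit :: com where
  "emit = (ri ::= Reg rvb ;; emit_copy ;; incr rno ;; Store 2 (Reg rno) (Reg rot))"

lemma wr_copy_arcs [simp]: "wr (copy_arcs a) = {rj, rw, rat, rp}"
  by (auto simp: copy_arcs_def)

lemma wa_copy_arcs [simp]: "wa (copy_arcs a) = {aT, aH}"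
  by (auto simp: copy_arcs_def)

lemma wr_copy_verts [simp]: "wr (copy_verts a) = {ru, rvt, ri}"
  by (auto simp: copy_verts_def)

lemma wa_copy_verts [simp]: "wa (copy_verts a) = {aV, aP}"
  by (auto simp: copy_verts_def)

lemma wr_push [simp]: "wr (push a) = {rj, rw, rat, rp, ru, rvt, ri, rits}"
  by (auto simp: push_def)

lemma wa_push [simp]: "wa (push a) = {aT, aH, aV, aP, aVB, aAB}"
  by (auto simp: push_def)

lemma wr_mark_sides [simp]: "wr mark_sides = {ru, ri}"
  by (auto simp: mark_sides_def)

lemma wa_mark_sides [simp]: "wa mark_sides = {ain1, ain2, alost}"
  by (auto simp: mark_sides_def)

lemma wr_find_lost [simp]: "wr find_lost = {rj, rw, rp}"
  by (auto simp: find_lost_def)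

lemma wa_find_lost [simp]: "wa find_lost = {alost}"
  by (auto simp: find_lost_def)

lemma wr_split [simp]: "wr split = {rj, rw, rat, rp, ru, rvt, ri, rits}"
  by (auto simp: split_def)

lemma wa_split [simp]: "wa split = {aT, aH, aV, aP, aVB, aAB, ain1, ain2, alost}"
  by (auto simp: split_def)

lemma wr_emit_copy [simp]: "wr emit_copy = {rot, ri}"
  by (auto simp: emit_copy_def)

lemma wa_emit_copy [simp]: "wa emit_copy = {3}"
  by (auto simp: emit_copy_def)

lemma wr_emit [simp]: "wr emit = {rot, ri, rno}"
  by (auto simp: emit_def)

lemma wa_emit [simp]: "wa emit = {2, 3}"
  by (auto simp: emit_def)

lemma wp_copy_arcs:
  assumes p: "reg s rp = reg s rab" "reg s rab \<le> reg s rae" "reg s rae \<le> reg s rat"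
    and a: "a \<noteq> aT" "a \<noteq> aH"
    and inj: "inj_on (\<lambda>e. (arr s aT e, arr s aH e)) {reg s rab..<reg s rae}"
    and post: "\<And>s' T'. same {rj, rw, rat, rp} {aT, aH} s s' \<Longrightarrow> reg s rat \<le> reg s' rat \<Longrightarrow>
      (\<And>e. e < reg s rat \<Longrightarrow> arr s' aT e = arr s aT e \<and> arr s' aH e = arr s aH e) \<Longrightarrow>
      inj_on (\<lambda>e. (arr s' aT e, arr s' aH e)) {reg s rat..<reg s' rat} \<Longrightarrow>
      (\<lambda>e. (arr s' aT e, arr s' aH e)) ` {reg s rat..<reg s' rat} =
        {(t, h) \<in> (\<lambda>e. (arr s aT e, arr s aH e)) ` {reg s rab..<reg s rae}. arr s a t = 1 \<and> arr s a h = 1} \<Longrightarrow>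
      T' \<le> T + 60 * (reg s rae - reg s rab) + 10 \<Longrightarrow> Q s' T'"
  shows "wp (copy_arcs a) Q s T"
proof -
  let ?F = "\<lambda>s e. (arr s aT e, arr s aH e)"
  let ?G = "{(t, h). arr s a t = 1 \<and> arr s a h = 1}"
  let ?b = "Less (Reg rp) (Reg rae)"
  let ?c = "rj ::= Arr aT (Reg rp) ;; rw ::= Arr aH (Reg rp) ;;
     If1 (Conj (Equal (Arr a (Reg rj)) (Num 1)) (Equal (Arr a (Reg rw)) (Num 1)))
       (Store aT (Reg rat) (Reg rj) ;; Store aH (Reg rat) (Reg rw) ;; incr rat) ;;
     incr rp"
  define I where "I = (\<lambda>(s1::state) T1. reg s rab \<le> reg s1 rp \<and> reg s1 rp \<le> reg s rae \<and>
    reg s rat \<le> reg s1 rat \<and>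
    (\<forall>e<reg s rat. arr s1 aT e = arr s aT e \<and> arr s1 aH e = arr s aH e) \<and>
    inj_on (?F s1) {reg s rat..<reg s1 rat} \<and>
    ?F s1 ` {reg s rat..<reg s1 rat} = ?F s ` {reg s rab..<reg s1 rp} \<inter> ?G \<and>
    T1 + 60 * reg s rab \<le> T + 60 * reg s1 rp)"
  show ?thesis
    unfolding copy_arcs_def
  proof (rule wp_While[where I = I and B = "T + 60 * reg s rae"])
    show "I s T" unfolding I_def using p by simp
    fix s1 T1 assume I1: "I s1 T1" and sm: "same (wr ?c) (wa ?c) s s1"
    have fr: "reg s1 rab = reg s rab" "reg s1 rae = reg s rae" "arr s1 a = arr s a"
      using sameD[OF sm] a by auto
    have rp: "reg s rab \<le> reg s1 rp" "reg s1 rp \<le> reg s rae" "reg s rat \<le> reg s1 rat"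
      and old: "\<And>e. e < reg s rat \<Longrightarrow> arr s1 aT e = arr s aT e \<and> arr s1 aH e = arr s aH e"
      and inj1: "inj_on (?F s1) {reg s rat..<reg s1 rat}"
      and im1: "?F s1 ` {reg s rat..<reg s1 rat} = ?F s ` {reg s rab..<reg s1 rp} \<inter> ?G"
      and T1: "T1 + 60 * reg s rab \<le> T + 60 * reg s1 rp"
      using I1 unfolding I_def by blast+
    show "T1 \<le> T + 60 * reg s rae" using T1 rp by linarith
    show "wp ?c I s1 (T1 + (bcost ?b + 1))" if b: "bval s1 ?b"
    proof -
      have lt: "reg s1 rp < reg s rae" using b fr by simp
      let ?t = "arr s1 aT (reg s1 rp)" and ?h = "arr s1 aH (reg s1 rp)"
      have th: "?t = arr s aT (reg s1 rp)" "?h = arr s aH (reg s1 rp)"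
        using old[of "reg s1 rp"] lt p by auto
      have rng: "{reg s rab..<Suc (reg s1 rp)} = insert (reg s1 rp) {reg s rab..<reg s1 rp}" using rp by auto
      show ?thesis
      proof (cases "arr s a ?t = 1 \<and> arr s a ?h = 1")
        case False
        then have "?F s ` {reg s rab..<Suc (reg s1 rp)} \<inter> ?G = ?F s ` {reg s rab..<reg s1 rp} \<inter> ?G"
          unfolding rng using th by auto
        then show ?thesis using False fr a lt rp old inj1 im1 T1 by (auto simp: I_def)
      next
        case True
        let ?n = "reg s1 rat"
        let ?s = "s1\<lparr>arr := (arr s1)(aT := (arr s1 aT)(?n := ?t), aH := (arr s1 aH)(?n := ?h))\<rparr>"
        have eq: "\<forall>e\<in>{reg s rat..<?n}. ?F ?s e = ?F s1 e" by auto
        have new: "(?t, ?h) \<notin> ?F s1 ` {reg s rat..<?n}"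
        proof
          assume "(?t, ?h) \<in> ?F s1 ` {reg s rat..<?n}"
          then obtain e where e: "e \<in> {reg s rab..<reg s1 rp}" "?F s e = (?t, ?h)" unfolding im1 by auto
          then have "e = reg s1 rp" using inj_onD[OF inj, of e "reg s1 rp"] th lt rp by auto
          then show False using e by simp
        qed
        have rn': "{reg s rat..<Suc ?n} = insert ?n {reg s rat..<?n}" using rp by auto
        have inj2: "inj_on (?F ?s) {reg s rat..<Suc ?n}"
        proof -
          have "inj_on (?F ?s) {reg s rat..<?n}" using inj1 eq inj_on_cong by (metis (no_types, lifting))
          moreover have "?F ?s ?n \<notin> ?F ?s ` {reg s rat..<?n}"
            using new image_cong[OF refl, of "{reg s rat..<?n}" "?F ?s" "?F s1"] eq by auto
          ultimately show ?thesis unfolding rn' by simp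
        qed
        have im2: "?F ?s ` {reg s rat..<Suc ?n} = ?F s ` {reg s rab..<Suc (reg s1 rp)} \<inter> ?G"
        proof -
          have "?F ?s ` {reg s rat..<?n} = ?F s1 ` {reg s rat..<?n}" using eq by (intro image_cong) auto
          then have "?F ?s ` {reg s rat..<Suc ?n} = insert (?t, ?h) (?F s1 ` {reg s rat..<?n})" unfolding rn' by simp
          also have "\<dots> = ?F s ` {reg s rab..<Suc (reg s1 rp)} \<inter> ?G" unfolding rng im1 using True th by auto
          finally show ?thesis .
        qed
        define s2 where "s2 = ?s\<lparr>reg := (reg s1)(rj := ?t, rw := ?h, rat := Suc ?n, rp := Suc (reg s1 rp))\<rparr>"
        have r2: "reg s2 rp = Suc (reg s1 rp)" "reg s2 rat = Suc ?n" by (simp_all add: s2_def)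
        have a2: "arr s2 = arr ?s" by (simp add: s2_def)
        have I2: "I s2 T2" if "T2 \<le> T1 + 60" for T2
          unfolding I_def r2 a2 using inj2 im2 lt rp old T1 that by auto
        show ?thesis
          using True fr a apply simp
          apply (rule back_subst[of "\<lambda>s. I s _", OF I2])
          by (auto simp: s2_def fun_eq_iff)
      qed
    qed
    show "Q s1 (T1 + (bcost ?b + 1))" if b: "\<not> bval s1 ?b"
    proof -
      have e: "reg s1 rp = reg s rae" using b fr rp by simp
      have im: "?F s1 ` {reg s rat..<reg s1 rat} = {(t, h) \<in> ?F s ` {reg s rab..<reg s rae}. arr s a t = 1 \<and> arr s a h = 1}"
        unfolding im1 e by auto
      have "T1 + (bcost ?b + 1) \<le> T + 60 * (reg s rae - reg s rab) + 10" using T1 e p by simp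
      then show ?thesis using sm rp(3) old inj1 im by (intro post) (simp_all add: insert_commute)
    qed
  qed
qed

lemma wp_copy_verts:
  assumes p: "reg s ri = reg s rvb" "reg s rvb \<le> reg s rve" "reg s rve \<le> reg s rvt"
    and a: "a \<noteq> aV" "a \<noteq> aP"
    and inj: "inj_on (arr s aV) {reg s rvb..<reg s rve}"
    and post: "\<And>s' T'. same {ru, rvt, ri} {aV, aP} s s' \<Longrightarrow> reg s rvt \<le> reg s' rvt \<Longrightarrow>
      (\<And>e. e < reg s rvt \<Longrightarrow> arr s' aV e = arr s aV e \<and> arr s' aP e = arr s aP e) \<Longrightarrow>
      inj_on (arr s' aV) {reg s rvt..<reg s' rvt} \<Longrightarrow>
      arr s' aV ` {reg s rvt..<reg s' rvt} = {v \<in> arr s aV ` {reg s rvb..<reg s rve}. arr s a v = 1} \<Longrightarrow>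
      arr s' aV ` {j \<in> {reg s rvt..<reg s' rvt}. arr s' aP j = 1} =
        {v \<in> arr s aV ` {reg s rvb..<reg s rve}. arr s a v = 1 \<and> (arr s alost v = 1 \<or> v \<in> arr s aV ` pend s)} \<Longrightarrow>
      T' \<le> T + 60 * (reg s rve - reg s rvb) + 10 \<Longrightarrow> Q s' T'"
  shows "wp (copy_verts a) Q s T"
proof -
  let ?V = "arr s aV" and ?r = "reg s rvt"
  let ?G = "{v. arr s a v = 1}"
  let ?H = "\<lambda>j. arr s alost (?V j) = 1 \<or> arr s aP j = 1"
  let ?b = "Less (Reg ri) (Reg rve)"
  let ?c = "ru ::= Arr aV (Reg ri) ;;
     If1 (Equal (Arr a (Reg ru)) (Num 1))
       (Store aV (Reg rvt) (Reg ru) ;;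
        Cond (Equal (Arr alost (Reg ru)) (Num 1)) (Store aP (Reg rvt) (Num 1))
          (Store aP (Reg rvt) (Arr aP (Reg ri))) ;;
        incr rvt) ;;
     incr ri"
  define I where "I = (\<lambda>(s1::state) T1. reg s rvb \<le> reg s1 ri \<and> reg s1 ri \<le> reg s rve \<and>
    ?r \<le> reg s1 rvt \<and>
    (\<forall>e<?r. arr s1 aV e = ?V e \<and> arr s1 aP e = arr s aP e) \<and>
    inj_on (arr s1 aV) {?r..<reg s1 rvt} \<and>
    arr s1 aV ` {?r..<reg s1 rvt} = ?V ` {reg s rvb..<reg s1 ri} \<inter> ?G \<and>
    arr s1 aV ` {j \<in> {?r..<reg s1 rvt}. arr s1 aP j = 1} = ?V ` {j \<in> {reg s rvb..<reg s1 ri}. ?H j} \<inter> ?G \<and>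
    T1 + 60 * reg s rvb \<le> T + 60 * reg s1 ri)"
  show ?thesis
    unfolding copy_verts_def
  proof (rule wp_While[where I = I and B = "T + 60 * reg s rve"])
    show "I s T" unfolding I_def using p by simp
    fix s1 T1 assume I1: "I s1 T1" and sm: "same (wr ?c) (wa ?c) s s1"
    have fr: "reg s1 rvb = reg s rvb" "reg s1 rve = reg s rve" "arr s1 a = arr s a" "arr s1 alost = arr s alost"
      using sameD[OF sm] a by auto
    have ri: "reg s rvb \<le> reg s1 ri" "reg s1 ri \<le> reg s rve" "?r \<le> reg s1 rvt"
      and old: "\<And>e. e < ?r \<Longrightarrow> arr s1 aV e = ?V e \<and> arr s1 aP e = arr s aP e"
      and inj1: "inj_on (arr s1 aV) {?r..<reg s1 rvt}"
      and im1: "arr s1 aV ` {?r..<reg s1 rvt} = ?V ` {reg s rvb..<reg s1 ri} \<inter> ?G"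
      and pm1: "arr s1 aV ` {j \<in> {?r..<reg s1 rvt}. arr s1 aP j = 1} = ?V ` {j \<in> {reg s rvb..<reg s1 ri}. ?H j} \<inter> ?G"
      and T1: "T1 + 60 * reg s rvb \<le> T + 60 * reg s1 ri"
      using I1 unfolding I_def by blast+
    show "T1 \<le> T + 60 * reg s rve" using T1 ri by linarith
    show "wp ?c I s1 (T1 + (bcost ?b + 1))" if b: "bval s1 ?b"
    proof -
      have lt: "reg s1 ri < reg s rve" using b fr by simp
      let ?i = "reg s1 ri" and ?n = "reg s1 rvt"
      let ?u = "?V ?i"
      have u: "arr s1 aV ?i = ?u" "arr s1 aP ?i = arr s aP ?i" using old[of ?i] lt p by auto
      have rng: "{reg s rvb..<Suc ?i} = insert ?i {reg s rvb..<?i}" using ri by auto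
      have rngH: "{j \<in> {reg s rvb..<Suc ?i}. ?H j} = (if ?H ?i then insert ?i {j \<in> {reg s rvb..<?i}. ?H j}
        else {j \<in> {reg s rvb..<?i}. ?H j})" unfolding rng by auto
      show ?thesis
      proof (cases "arr s a ?u = 1")
        case False
        have "?V ` {reg s rvb..<Suc ?i} \<inter> ?G = ?V ` {reg s rvb..<?i} \<inter> ?G"
          unfolding rng using False by auto
        moreover have "?V ` {j \<in> {reg s rvb..<Suc ?i}. ?H j} \<inter> ?G = ?V ` {j \<in> {reg s rvb..<?i}. ?H j} \<inter> ?G"
          unfolding rngH using False by auto
        ultimately have "I (s1\<lparr>reg := (reg s1)(ru := ?u, ri := Suc ?i)\<rparr>) T2" if "T2 \<le> T1 + 60" for T2
          unfolding I_def using lt ri old inj1 im1 pm1 T1 that by simp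
        then show ?thesis using False fr u by simp
      next
        case True
        let ?p = "if arr s alost ?u = 1 then 1 else arr s aP ?i"
        let ?s = "s1\<lparr>arr := (arr s1)(aV := (arr s1 aV)(?n := ?u), aP := (arr s1 aP)(?n := ?p))\<rparr>"
        have new: "?u \<notin> arr s1 aV ` {?r..<?n}"
        proof
          assume "?u \<in> arr s1 aV ` {?r..<?n}"
          then obtain e where e: "e \<in> {reg s rvb..<?i}" "?V e = ?u" unfolding im1 by auto
          then have "e = ?i" using inj_onD[OF inj, of e ?i] lt ri by auto
          then show False using e by simp
        qed
        have rn': "{?r..<Suc ?n} = insert ?n {?r..<?n}" using ri by auto
        have im': "arr ?s aV ` {?r..<?n} = arr s1 aV ` {?r..<?n}" by (intro image_cong) auto
        have inj2: "inj_on (arr ?s aV) {?r..<Suc ?n}"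
        proof -
          have "inj_on (arr ?s aV) {?r..<?n} = inj_on (arr s1 aV) {?r..<?n}" by (intro inj_on_cong) auto
          then show ?thesis unfolding rn' using inj1 new im' by simp
        qed
        have im2: "arr ?s aV ` {?r..<Suc ?n} = ?V ` {reg s rvb..<Suc ?i} \<inter> ?G"
        proof -
          have 1: "arr ?s aV ` {?r..<Suc ?n} = insert (arr ?s aV ?n) (arr ?s aV ` {?r..<?n})"
            unfolding rn' by (rule image_insert)
          have 2: "arr ?s aV ?n = ?u" by simp
          have 3: "?V ` {reg s rvb..<Suc ?i} \<inter> ?G = insert ?u (?V ` {reg s rvb..<?i} \<inter> ?G)"
            unfolding rng using True by blast
          show ?thesis unfolding 1 2 3 im' im1 ..
        qed
        have pm2: "arr ?s aV ` {j \<in> {?r..<Suc ?n}. arr ?s aP j = 1} = ?V ` {j \<in> {reg s rvb..<Suc ?i}. ?H j} \<inter> ?G"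
        proof -
          have S: "{j \<in> {?r..<Suc ?n}. arr ?s aP j = 1} =
             (if ?H ?i then insert ?n {j \<in> {?r..<?n}. arr s1 aP j = 1} else {j \<in> {?r..<?n}. arr s1 aP j = 1})"
            unfolding rn' by auto
          have J: "arr ?s aV ` {j \<in> {?r..<?n}. arr s1 aP j = 1} = ?V ` {j \<in> {reg s rvb..<?i}. ?H j} \<inter> ?G"
            unfolding pm1[symmetric] by (intro image_cong) auto
          have N: "arr ?s aV ?n = ?u" by simp
          show ?thesis
          proof (cases "?H ?i")
            case H: True
            show ?thesis unfolding S rngH if_P[OF H] image_insert J N using True by blast
          next
            case H: False
            show ?thesis unfolding S rngH if_not_P[OF H] J ..
          qed
        qed
        define s2 where "s2 = ?s\<lparr>reg := (reg s1)(ru := ?u, rvt := Suc ?n, ri := Suc ?i)\<rparr>"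
        have r2: "reg s2 ri = Suc ?i" "reg s2 rvt = Suc ?n" by (simp_all add: s2_def)
        have a2: "arr s2 = arr ?s" by (simp add: s2_def)
        have I2: "I s2 T2" if "T2 \<le> T1 + 60" for T2
          unfolding I_def r2 a2 using inj2 im2 pm2 lt ri old T1 that by auto
        have ne: "?i \<noteq> ?n" using lt ri p by simp
        show ?thesis
          using True fr a u ne apply simp
          apply (intro conjI impI)
           apply (rule back_subst[of "\<lambda>s. I s _", OF I2]; simp add: s2_def fun_eq_iff)
          apply (rule back_subst[of "\<lambda>s. I s _", OF I2]; simp add: s2_def fun_eq_iff)
          done
      qed
    qed
    show "Q s1 (T1 + (bcost ?b + 1))" if b: "\<not> bval s1 ?b"
    proof -
      have e: "reg s1 ri = reg s rve" using b fr ri by simp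
      have im: "arr s1 aV ` {?r..<reg s1 rvt} = {v \<in> ?V ` {reg s rvb..<reg s rve}. arr s a v = 1}"
        unfolding im1 e by auto
      \<comment> \<open>The vertices of the segment are distinct, so a vertex is pending if and only
        if its cell is.\<close>
      have pv: "?V j \<in> ?V ` pend s \<longleftrightarrow> arr s aP j = 1" if "j \<in> {reg s rvb..<reg s rve}" for j
      proof -
        have "pend s \<subseteq> {reg s rvb..<reg s rve}" by (auto simp: pend_def)
        from inj_on_image_mem_iff[OF inj that this] show ?thesis using that by (simp add: pend_def)
      qed
      have pm: "arr s1 aV ` {j \<in> {?r..<reg s1 rvt}. arr s1 aP j = 1} =
        {v \<in> ?V ` {reg s rvb..<reg s rve}. arr s a v = 1 \<and> (arr s alost v = 1 \<or> v \<in> ?V ` pend s)}"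
        unfolding pm1 e using pv by blast
      have "T1 + (bcost ?b + 1) \<le> T + 60 * (reg s rve - reg s rvb) + 10" using T1 e p by simp
      then show ?thesis using sm ri(3) old inj1 im pm by (intro post) (simp_all add: insert_commute)
    qed
  qed
qed


lemma wp_push:
  assumes c: "comp s E C" and b: "reg s rve \<le> reg s rvt" "reg s rae \<le> reg s rat" and st: "store s"
    and a: "a \<notin> {aT, aH, aV, aP, aVB, aAB}"
    and post: "\<And>s' T'. same (wr (push a)) (wa (push a)) s s' \<Longrightarrow> store s' \<Longrightarrow> ext s s' \<Longrightarrow>
      reg s' rits = Suc (reg s rits) \<Longrightarrow>
      item s' E (reg s rits) {v \<in> C. arr s a v = 1}
        {v \<in> C. arr s a v = 1 \<and> (arr s alost v = 1 \<or> v \<in> arr s aV ` pend s)} \<Longrightarrow>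
      T' \<le> T + 60 * ((reg s rve - reg s rvb) + (reg s rae - reg s rab)) + 50 \<Longrightarrow> Q s' T'"
  shows "wp (push a) Q s T"
proof -
  let ?F = "\<lambda>s e. (arr s aT e, arr s aH e)"
  have C: "C = arr s aV ` {reg s rvb..<reg s rve}" "inj_on (arr s aV) {reg s rvb..<reg s rve}"
    "reg s rvb \<le> reg s rve" "1 \<le> reg s rab" "reg s rab \<le> reg s rae"
    "inj_on (?F s) {reg s rab..<reg s rae}" "?F s ` {reg s rab..<reg s rae} = E \<inter> C \<times> C" "E \<inter> Id = {}"
    using c by (auto simp: comp_def)
  show ?thesis
    unfolding push_def
    apply (subst wp_Seq, subst wp_Assign, subst wp_Seq)
    apply (rule wp_copy_arcs)
          apply (use C b a in \<open>simp_all\<close>)[6]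
    subgoal premises p for s1 T1
    proof -
      have f1: "reg s1 r = reg s r" if "r \<in> {rvb, rve, rvt, rits}" for r using sameD[OF p(1)] that by auto
      have g1: "arr s1 d = arr s d" if "d \<notin> {aT, aH}" for d using sameD[OF p(1)] that by auto
      have g1a: "arr s1 a = arr s a" using a by (intro g1) auto
      have pe1: "pend (s1\<lparr>reg := (reg s1)(ri := reg s rvb)\<rparr>) = pend s" by (simp add: pend_def f1 g1)
      show ?thesis
        apply (subst wp_Seq, subst wp_Assign, subst wp_Seq)
        apply (rule wp_copy_verts)
              apply (use C b a in \<open>simp_all add: f1 g1\<close>)[6]
        subgoal premises q for s2 T2
        proof -
          let ?n = "reg s rits" and ?vt = "reg s rvt" and ?at = "reg s rat"
          have f2: "reg s2 rits = ?n" "reg s2 rat = reg s1 rat" using sameD[OF q(1)] f1 by auto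
          have g2: "arr s2 d = arr s d" if "d \<notin> {aT, aH, aV, aP}" for d
            using sameD[OF q(1)] g1 that by auto
          have g2': "arr s2 aT = arr s1 aT" "arr s2 aH = arr s1 aH" using sameD[OF q(1)] by auto
          define s3 where "s3 = s2\<lparr>arr := (arr s2)(aVB := (arr s2 aVB)(Suc ?n := reg s2 rvt),
            aAB := (arr s2 aAB)(Suc ?n := reg s2 rat)), reg := (reg s2)(rits := Suc ?n)\<rparr>"
          have h: "arr s3 d = arr s2 d" if "d \<notin> {aVB, aAB}" for d using that by (simp add: s3_def)
          have h': "arr s3 aVB = (arr s aVB)(Suc ?n := reg s2 rvt)" "arr s3 aAB = (arr s aAB)(Suc ?n := reg s1 rat)"
            "reg s3 rits = Suc ?n" "reg s3 rvt = reg s2 rvt" "reg s3 rat = reg s1 rat"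
            by (simp_all add: s3_def g2 f2)
          have q2: "?vt \<le> reg s2 rvt" using q(2) f1 by simp
          have p2: "?at \<le> reg s1 rat" using p(2) by simp
          have sto: "arr s aVB ?n = ?vt" "arr s aAB ?n = ?at"
            "\<And>i. i \<le> ?n \<Longrightarrow> arr s aVB i \<le> ?vt \<and> arr s aAB i \<le> ?at"
            "\<And>i j. i \<le> j \<Longrightarrow> j \<le> ?n \<Longrightarrow> arr s aVB i \<le> arr s aVB j" using st by (auto simp: store_def)
          have st3: "store s3"
            unfolding store_def h'
          proof (intro conjI allI impI)
            fix i assume "i \<le> Suc ?n"
            then show "((arr s aVB)(Suc ?n := reg s2 rvt)) i \<le> reg s2 rvt"
              using sto(3)[of i] q2 by (cases "i = Suc ?n") auto
            show "((arr s aAB)(Suc ?n := reg s1 rat)) i \<le> reg s1 rat"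
              using sto(3)[of i] p2 \<open>i \<le> Suc ?n\<close> by (cases "i = Suc ?n") auto
          next
            fix i j assume ij: "i \<le> j" "j \<le> Suc ?n"
            show "((arr s aVB)(Suc ?n := reg s2 rvt)) i \<le> ((arr s aVB)(Suc ?n := reg s2 rvt)) j"
            proof (cases "j = Suc ?n")
              case True
              then show ?thesis using sto(3)[of i] q2 ij by (cases "i = Suc ?n") auto
            next
              case False
              then show ?thesis using sto(4)[of i j] ij by auto
            qed
          qed auto
          have old: "j < ?vt \<Longrightarrow> arr s3 aV j = arr s aV j \<and> arr s3 aP j = arr s aP j"
            "j < ?at \<Longrightarrow> arr s3 aT j = arr s aT j \<and> arr s3 aH j = arr s aH j" for j
            using q(3)[of j] p(3)[of j] by (simp_all add: h g2' f1 g1)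
          have ex: "ext s s3" unfolding ext_def h' using old q2 p2 by auto
          let ?Y = "{v \<in> C. arr s a v = 1}"
          have S: "seg s3 E ?vt (reg s2 rvt) ?at (reg s1 rat) ?Y
              {v \<in> C. arr s a v = 1 \<and> (arr s alost v = 1 \<or> v \<in> arr s aV ` pend s)}"
            unfolding seg_def
          proof (intro conjI)
            show "?Y = arr s3 aV ` {?vt..<reg s2 rvt}"
              using q(5) by (simp add: h f1 g1 g1a C(1)[symmetric])
            show "inj_on (arr s3 aV) {?vt..<reg s2 rvt}" using q(4) by (simp add: h f1)
            show "?vt \<le> reg s2 rvt" "?at \<le> reg s1 rat" by fact+
            show "1 \<le> ?at" using C b by linarith
            show "inj_on (?F s3) {?at..<reg s1 rat}" using p(4) by (simp add: h g2')
            show "?F s3 ` {?at..<reg s1 rat} = E \<inter> ?Y \<times> ?Y"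
              using p(5) C(7) by (auto simp: h g2')
            show "E \<inter> Id = {}" by fact
            show "{v \<in> C. arr s a v = 1 \<and> (arr s alost v = 1 \<or> v \<in> arr s aV ` pend s)} =
              arr s3 aV ` {j \<in> {?vt..<reg s2 rvt}. arr s3 aP j = 1}"
              using q(6) by (simp add: h f1 g1 g1a pe1 C(1)[symmetric])
          qed
          have it: "item s3 E ?n ?Y
              {v \<in> C. arr s a v = 1 \<and> (arr s alost v = 1 \<or> v \<in> arr s aV ` pend s)}"
            unfolding item_def h' using S by (simp add: sto)
          have sm: "same (wr (push a)) (wa (push a)) s s3"
            using p(1) q(1) by (auto simp: same_def s3_def)
          have T: "T2 + 20 \<le> T + 60 * ((reg s rve - reg s rvb) + (reg s rae - reg s rab)) + 50"
            using p(6) q(7) by (simp add: f1)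
          have goal: "wp (incr rits ;; Store aVB (Reg rits) (Reg rvt) ;; Store aAB (Reg rits) (Reg rat)) Q s2 T2"
            apply (simp only: wp_Seq wp_Assign wp_Store)
            apply (rule back_subst[of "\<lambda>s. Q s _", OF post[OF sm st3 ex h'(3) it]])
            using T by (auto simp: s3_def f2 fun_eq_iff)
          show ?thesis by (rule goal)
        qed
        done
    qed
    done
qed

lemma wp_mark_sides:
  assumes i: "reg s ri = reg s rvb" "reg s rvb \<le> reg s rve"
    and post: "\<And>s' T'. (\<And>v. v \<in> arr s aV ` {reg s rvb..<reg s rve} \<Longrightarrow>
        (arr s' ain1 v = 1 \<longleftrightarrow> v = reg s rx \<or> arr s amk v = reg s rst) \<and>
        (arr s' ain2 v = 1 \<longleftrightarrow> v = reg s rx \<or> arr s amk v \<noteq> reg s rst) \<and>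
        (arr s' alost v = 1 \<longleftrightarrow> v = reg s rx)) \<Longrightarrow>
      same {ru, ri} {ain1, ain2, alost} s s' \<Longrightarrow> T' \<le> T + 50 * (reg s rve - reg s rvb) + 10 \<Longrightarrow> Q s' T'"
  shows "wp mark_sides Q s T"
proof -
  let ?V = "arr s aV"
  define K where "K a1 a2 l v \<longleftrightarrow> (a1 v = (1::nat) \<longleftrightarrow> v = reg s rx \<or> arr s amk v = reg s rst) \<and>
    (a2 v = (1::nat) \<longleftrightarrow> v = reg s rx \<or> arr s amk v \<noteq> reg s rst) \<and> (l v = (1::nat) \<longleftrightarrow> v = reg s rx)"
    for a1 a2 l v
  let ?I = "\<lambda>(s1::state) T1. reg s rvb \<le> reg s1 ri \<and> reg s1 ri \<le> reg s rve \<and>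
    (\<forall>i\<in>{reg s rvb..<reg s1 ri}. K (arr s1 ain1) (arr s1 ain2) (arr s1 alost) (?V i)) \<and>
    T1 + 50 * reg s rvb \<le> T + 50 * reg s1 ri"
  let ?b = "Less (Reg ri) (Reg rve)"
  let ?c = "ru ::= Arr aV (Reg ri) ;;
     Cond (Equal (Reg ru) (Reg rx))
       (Store ain1 (Reg ru) (Num 1) ;; Store ain2 (Reg ru) (Num 1) ;; Store alost (Reg ru) (Num 1))
       (Store alost (Reg ru) (Num 0) ;;
        Cond (Equal (Arr amk (Reg ru)) (Reg rst))
          (Store ain1 (Reg ru) (Num 1) ;; Store ain2 (Reg ru) (Num 0))
          (Store ain1 (Reg ru) (Num 0) ;; Store ain2 (Reg ru) (Num 1))) ;;
     incr ri"
  show ?thesis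
    unfolding mark_sides_def
  proof (rule wp_While[where B = "T + 50 * reg s rve" and I = ?I])
    show "?I s T" using i by simp
    fix s1 T1 assume I: "?I s1 T1" and sm: "same (wr ?c) (wa ?c) s s1"
    have fr: "reg s1 rve = reg s rve" "reg s1 rx = reg s rx" "reg s1 rst = reg s rst"
      "arr s1 aV = arr s aV" "arr s1 amk = arr s amk" using sameD[OF sm] by auto
    show "T1 \<le> T + 50 * reg s rve" using I by linarith
    let ?u = "?V (reg s1 ri)"
    have B: "\<forall>i\<in>{reg s rvb..<Suc (reg s1 ri)}. K ((arr s1 ain1)(?u := p)) ((arr s1 ain2)(?u := q)) ((arr s1 alost)(?u := r)) (?V i)"
      if "p = 1 \<longleftrightarrow> ?u = reg s rx \<or> arr s amk ?u = reg s rst" "q = 1 \<longleftrightarrow> ?u = reg s rx \<or> arr s amk ?u \<noteq> reg s rst"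
        "r = 1 \<longleftrightarrow> ?u = reg s rx" for p q r
    proof
      fix i assume i: "i \<in> {reg s rvb..<Suc (reg s1 ri)}"
      show "K ((arr s1 ain1)(?u := p)) ((arr s1 ain2)(?u := q)) ((arr s1 alost)(?u := r)) (?V i)"
      proof (cases "?V i = ?u")
        case True
        then show ?thesis using that by (simp add: K_def)
      next
        case False
        then have "i \<in> {reg s rvb..<reg s1 ri}" using i by (auto simp: less_Suc_eq)
        then have "K (arr s1 ain1) (arr s1 ain2) (arr s1 alost) (?V i)" using I by blast
        then show ?thesis using False by (simp add: K_def)
      qed
    qed
    show "wp ?c ?I s1 (T1 + (bcost ?b + 1))" if "bval s1 ?b"
    proof (cases "?u = reg s rx")
      case True
      then show ?thesis using I that fr B[of 1 1 1] by simp
    next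
      case False
      show ?thesis
      proof (cases "arr s amk ?u = reg s rst")
        case True
        then show ?thesis using False I that fr B[of 1 0 0] by simp
      next
        case F2: False
        then show ?thesis using False I that fr B[of 0 1 0] by simp
      qed
    qed
    show "Q s1 (T1 + (bcost ?b + 1))" if "\<not> bval s1 ?b"
    proof (rule post)
      fix v assume "v \<in> ?V ` {reg s rvb..<reg s rve}"
      then have "K (arr s1 ain1) (arr s1 ain2) (arr s1 alost) v" using I that fr by auto
      then show "(arr s1 ain1 v = 1 \<longleftrightarrow> v = reg s rx \<or> arr s amk v = reg s rst) \<and>
        (arr s1 ain2 v = 1 \<longleftrightarrow> v = reg s rx \<or> arr s amk v \<noteq> reg s rst) \<and> (arr s1 alost v = 1 \<longleftrightarrow> v = reg s rx)"
        by (simp add: K_def)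
    qed (use sm I that fr in \<open>auto simp: same_def\<close>)
  qed
qed

lemma wp_find_lost:
  assumes p: "reg s rp = reg s rab" "reg s rab \<le> reg s rae"
    and post: "\<And>s' T'. (\<And>v. arr s' alost v = 1 \<longleftrightarrow> arr s alost v = 1 \<or>
        (\<exists>t h. (t, h) \<in> (\<lambda>e. (arr s aT e, arr s aH e)) ` {reg s rab..<reg s rae} \<and>
          \<not> (arr s ain1 t = 1 \<and> arr s ain1 h = 1) \<and> \<not> (arr s ain2 t = 1 \<and> arr s ain2 h = 1) \<and>
          (v = t \<or> v = h))) \<Longrightarrow>
      same {rj, rw, rp} {alost} s s' \<Longrightarrow> T' \<le> T + 60 * (reg s rae - reg s rab) + 10 \<Longrightarrow> Q s' T'"
  shows "wp find_lost Q s T"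
  unfolding find_lost_def
proof -
  let ?X = "\<lambda>v e. \<not> (arr s ain1 (arr s aT e) = 1 \<and> arr s ain1 (arr s aH e) = 1) \<and>
    \<not> (arr s ain2 (arr s aT e) = 1 \<and> arr s ain2 (arr s aH e) = 1) \<and> (v = arr s aT e \<or> v = arr s aH e)"
  let ?I = "\<lambda>(s1::state) T1. reg s rab \<le> reg s1 rp \<and> reg s1 rp \<le> reg s rae \<and>
    (\<forall>v. arr s1 alost v = 1 \<longleftrightarrow> arr s alost v = 1 \<or> (\<exists>e\<in>{reg s rab..<reg s1 rp}. ?X v e)) \<and>
    T1 + 60 * reg s rab \<le> T + 60 * reg s1 rp"
  let ?b = "Less (Reg rp) (Reg rae)"
  let ?c = "rj ::= Arr aT (Reg rp) ;; rw ::= Arr aH (Reg rp) ;;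
     If1 (Conj (Neg (Conj (Equal (Arr ain1 (Reg rj)) (Num 1)) (Equal (Arr ain1 (Reg rw)) (Num 1))))
               (Neg (Conj (Equal (Arr ain2 (Reg rj)) (Num 1)) (Equal (Arr ain2 (Reg rw)) (Num 1)))))
       (Store alost (Reg rj) (Num 1) ;; Store alost (Reg rw) (Num 1)) ;;
     incr rp"
  show "wp (While ?b ?c) Q s T"
  proof (rule wp_While[where B = "T + 60 * reg s rae" and I = ?I])
    show "?I s T" using p by simp
    fix s1 T1 assume I: "?I s1 T1" and sm: "same (wr ?c) (wa ?c) s s1"
    have fr: "reg s1 rae = reg s rae" "arr s1 aT = arr s aT" "arr s1 aH = arr s aH"
      "arr s1 ain1 = arr s ain1" "arr s1 ain2 = arr s ain2" using sameD[OF sm] by auto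
    show "T1 \<le> T + 60 * reg s rae" using I by linarith
    have rng: "{reg s rab..<Suc (reg s1 rp)} = insert (reg s1 rp) {reg s rab..<reg s1 rp}" using I by auto
    show "wp ?c ?I s1 (T1 + (bcost ?b + 1))" if "bval s1 ?b"
      using I that fr by (simp add: rng)
    show "Q s1 (T1 + (bcost ?b + 1))" if "\<not> bval s1 ?b"
    proof -
      have e: "reg s1 rp = reg s rae" using that fr I by simp
      show ?thesis
      proof (rule post)
        fix v
        show "arr s1 alost v = 1 \<longleftrightarrow> arr s alost v = 1 \<or>
          (\<exists>t h. (t, h) \<in> (\<lambda>e. (arr s aT e, arr s aH e)) ` {reg s rab..<reg s rae} \<and>
          \<not> (arr s ain1 t = 1 \<and> arr s ain1 h = 1) \<and> \<not> (arr s ain2 t = 1 \<and> arr s ain2 h = 1) \<and>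
          (v = t \<or> v = h))"
          using I[unfolded e] by (simp only: image_iff prod.inject) blast
      qed (use sm I e in \<open>auto simp: same_def\<close>)
    qed
  qed
qed


lemma seg_current:
  assumes c: "comp s E C" and b: "reg s rve \<le> reg s rvt" "reg s rae \<le> reg s rat"
    and ex: "ext s s'" and r: "\<And>r. r \<in> {rvb, rve, rab, rae} \<Longrightarrow> reg s' r = reg s r"
  shows "comp s' E C" "arr s' aV ` pend s' = arr s aV ` pend s"
proof -
  have "seg s E (reg s rvb) (reg s rve) (reg s rab) (reg s rae) C (arr s aV ` pend s)"
    using c by (simp add: seg_comp)
  then have "seg s' E (reg s rvb) (reg s rve) (reg s rab) (reg s rae) C (arr s aV ` pend s)"
    by (rule seg_cong) (use ex b in \<open>auto simp: ext_def\<close>)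
  moreover have "reg s' rvb = reg s rvb" "reg s' rve = reg s rve" "reg s' rab = reg s rab" "reg s' rae = reg s rae"
    using r by auto
  ultimately have "comp s' E C \<and> arr s aV ` pend s = arr s' aV ` pend s'" using seg_comp[of s' E C] by simp
  then show "comp s' E C" "arr s' aV ` pend s' = arr s aV ` pend s" by auto
qed

lemma ext_same:
  assumes "same R A s s'" "R \<inter> {rvt, rat, rits} = {}" "A \<inter> {aV, aP, aT, aH, aVB, aAB} = {}"
  shows "ext s s'"
proof -
  have "arr s' a = arr s a" if "a \<in> {aV, aP, aT, aH, aVB, aAB}" for a
    using assms(1,3) that unfolding same_def by blast
  moreover have "reg s' r = reg s r" if "r \<in> {rvt, rat, rits}" for r
    using assms(1,2) that unfolding same_def by blast
  ultimately show ?thesis by (simp add: ext_def)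
qed

lemma store_same:
  assumes "same R A s s'" "R \<inter> {rvt, rat, rits} = {}" "A \<inter> {aVB, aAB} = {}" "store s"
  shows "store s'"
proof -
  have "arr s' a = arr s a" if "a \<in> {aVB, aAB}" for a
    using assms(1,3) that unfolding same_def by blast
  moreover have "reg s' r = reg s r" if "r \<in> {rvt, rat, rits}" for r
    using assms(1,2) that unfolding same_def by blast
  ultimately show ?thesis using assms(4) by (simp add: store_def)
qed

lemma wp_split:
  fixes s E C
  defines "A \<equiv> marked C s" and "x \<equiv> reg s rx"
  defines "C1 \<equiv> A \<union> (C \<inter> {x})" and "C2 \<equiv> C - A"
  assumes c: "comp s E C" and b: "reg s rve \<le> reg s rvt" "reg s rae \<le> reg s rat" and st: "store s"
    and post: "\<And>s' T'. same (wr split) (wa split) s s' \<Longrightarrow> store s' \<Longrightarrow> ext s s' \<Longrightarrow>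
      reg s' rits = Suc (Suc (reg s rits)) \<Longrightarrow>
      item s' E (reg s rits) C1 {v \<in> C1. v \<in> losers E C x A \<or> v \<in> arr s aV ` pend s} \<Longrightarrow>
      item s' E (Suc (reg s rits)) C2 {v \<in> C2. v \<in> losers E C x A \<or> v \<in> arr s aV ` pend s} \<Longrightarrow>
      T' \<le> T + 300 * ((reg s rve - reg s rvb) + (reg s rae - reg s rab)) + 200 \<Longrightarrow> Q s' T'"
  shows "wp split Q s T"
proof -
  have C: "C = arr s aV ` {reg s rvb..<reg s rve}" "reg s rvb \<le> reg s rve" "reg s rab \<le> reg s rae"
    "(\<lambda>e. (arr s aT e, arr s aH e)) ` {reg s rab..<reg s rae} = E \<inter> C \<times> C"
    using c by (auto simp: comp_def)
  let ?R = "{rvb, rve, rab, rae}"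
  let ?N = "(reg s rve - reg s rvb) + (reg s rae - reg s rab)"
  show ?thesis
    unfolding split_def
    apply (subst wp_Seq, subst wp_Assign, subst wp_Seq)
    apply (rule wp_mark_sides)
      apply (use C in simp, use C in simp)
    subgoal premises p for s1 T1
    proof -
      have f1: "reg s1 r = reg s r" if "r \<notin> {ru, ri}" for r using sameD(1)[OF p(2)] that by auto
      have g1: "arr s1 d = arr s d" if "d \<notin> {ain1, ain2, alost}" for d using sameD(2)[OF p(2)] that by auto
      have A: "v \<in> A \<longleftrightarrow> arr s amk v = reg s rst \<and> v \<noteq> x" if "v \<in> C" for v
        using that by (auto simp: A_def marked_def x_def)
      have AC: "A \<subseteq> C - {x}" by (auto simp: A_def marked_def x_def)
      have in1: "arr s1 ain1 v = 1 \<longleftrightarrow> v \<in> C1" and in2: "arr s1 ain2 v = 1 \<longleftrightarrow> v \<in> C2"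
        and lo: "arr s1 alost v = 1 \<longleftrightarrow> v = x" if "v \<in> C" for v
        using p(1)[of v] A[OF that] that C(1) by (auto simp: C1_def C2_def x_def)
      show ?thesis
        apply (subst wp_Seq, subst wp_Assign, subst wp_Seq)
        apply (rule wp_find_lost)
          apply (use C in \<open>simp add: f1\<close>, use C in \<open>simp add: f1\<close>)
        subgoal premises q for s2 T2
        proof -
          have f2: "reg s2 r = reg s r" if "r \<notin> {rj, rw, rp, ru, ri}" for r
            using sameD(1)[OF q(2)] f1 that by auto
          have g2: "arr s2 d = arr s d" if "d \<notin> {ain1, ain2, alost}" for d
            using sameD(2)[OF q(2)] g1 that by auto
          have g2': "arr s2 ain1 = arr s1 ain1" "arr s2 ain2 = arr s1 ain2" using sameD(2)[OF q(2)] by auto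
          have sm2: "same (wr split) (wa split) s s2" using f2 g2 by (auto simp: same_def)
          have e2: "ext s s2" using f2 g2 by (auto simp: ext_def)
          have st2: "store s2" using st f2 g2 by (auto simp: store_def)
          have r2: "\<And>r. r \<in> {rvb, rve, rab, rae} \<Longrightarrow> reg s2 r = reg s r" using f2 by auto
          have c2: "comp s2 E C" and pe2: "arr s2 aV ` pend s2 = arr s aV ` pend s"
            using seg_current[OF c b e2 r2] by simp_all
          have lost: "arr s2 alost v = 1 \<longleftrightarrow> v \<in> losers E C x A" if v: "v \<in> C" for v
          proof -
            have "arr s2 alost v = 1 \<longleftrightarrow> v = x \<or> (\<exists>t h. (t, h) \<in> E \<inter> C \<times> C \<and>
              \<not> (arr s1 ain1 t = 1 \<and> arr s1 ain1 h = 1) \<and> \<not> (arr s1 ain2 t = 1 \<and> arr s1 ain2 h = 1) \<and> (v = t \<or> v = h))"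
              using q(1)[of v] lo[OF v] C(4) by (simp add: f1 g1)
            also have "\<dots> \<longleftrightarrow> v = x \<or> (\<exists>t h. (t, h) \<in> E \<inter> C \<times> C \<and>
              \<not> (t \<in> C1 \<and> h \<in> C1) \<and> \<not> (t \<in> C2 \<and> h \<in> C2) \<and> (v = t \<or> v = h))"
              using in1 in2 by blast
            also have "\<dots> \<longleftrightarrow> v \<in> losers E C x A"
              using v unfolding losers_def deleted_def C1_def[symmetric] C2_def[symmetric] by blast
            finally show ?thesis .
          qed
          let ?P = "\<lambda>Y. {v \<in> Y. v \<in> losers E C x A \<or> v \<in> arr s aV ` pend s}"
          show ?thesis
            apply (subst wp_Seq)
            apply (rule wp_push[OF c2 _ _ st2])
               apply (use b in \<open>simp add: f2\<close>, use b in \<open>simp add: f2\<close>, simp)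
            subgoal premises r for s3 T3
            proof -
              have f3: "reg s3 d = reg s d" if "d \<notin> {rj, rw, rat, rp, ru, rvt, ri, rits}" for d
                using sameD(1)[OF r(1)] f2 that by auto
              have g3: "arr s3 ain2 = arr s1 ain2" "arr s3 alost = arr s2 alost" using sameD(2)[OF r(1)] g2' by auto
              have e3: "ext s s3" using ext_trans[OF e2 r(3)] .
              have n3: "reg s3 rits = Suc (reg s rits)" using r(4) f2 by simp
              have r3: "\<And>r. r \<in> {rvb, rve, rab, rae} \<Longrightarrow> reg s3 r = reg s r" using f3 by auto
              have c3: "comp s3 E C" and pe3: "arr s3 aV ` pend s3 = arr s aV ` pend s"
                using seg_current[OF c b e3 r3] by simp_all
              have i1: "item s3 E (reg s rits) C1 (?P C1)"
              proof -
                have "{v \<in> C. arr s2 ain1 v = 1} = C1" using in1 g2' AC by (auto simp: C1_def)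
                moreover have "{v \<in> C. arr s2 ain1 v = 1 \<and> (arr s2 alost v = 1 \<or> v \<in> arr s2 aV ` pend s2)} = ?P C1"
                  using in1 g2' AC lost unfolding pe2 by (auto simp: C1_def)
                ultimately show ?thesis using r(5) f2 by simp
              qed
              show ?thesis
                apply (rule wp_push[OF c3 _ _ r(2)])
                   apply (use b e3 in \<open>simp add: f3 ext_def\<close>, use b e3 in \<open>simp add: f3 ext_def\<close>, simp)
                subgoal premises u for s4 T4
                proof -
                  have i2: "item s4 E (Suc (reg s rits)) C2 (?P C2)"
                  proof -
                    have "{v \<in> C. arr s3 ain2 v = 1} = C2" using in2 g3 by (auto simp: C2_def)
                    moreover have "{v \<in> C. arr s3 ain2 v = 1 \<and> (arr s3 alost v = 1 \<or> v \<in> arr s3 aV ` pend s3)} = ?P C2"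
                      using in2 g3 lost unfolding pe3 by (auto simp: C2_def)
                    ultimately show ?thesis using u(5) n3 by simp
                  qed
                  have i1': "item s4 E (reg s rits) C1 (?P C1)"
                    using item_ext[OF i1 r(2) u(3)] n3 by simp
                  have sm4: "same (wr split) (wa split) s s4"
                    using sm2 r(1) u(1) by (auto simp: same_def)
                  show ?thesis
                    by (rule post[OF sm4 u(2) ext_trans[OF e3 u(3)] _ i1' i2])
                      (use u(4,6) n3 r(6) q(3) p(3) in \<open>simp_all add: f1 f2 f3\<close>)
                qed
                done
            qed
            done
        qed
        done
    qed
    done
qed

section \<open>Output of a finished component\<close>

definition listed :: "state \<Rightarrow> nat list list \<Rightarrow> bool" where
  "listed s outs \<longleftrightarrow> arr s 2 0 = 0 \<and> arr s 2 (length outs) = reg s rot \<and> reg s rno = length outs \<and>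
     (\<forall>i<length outs. map (arr s 3) [arr s 2 i..<arr s 2 (Suc i)] = outs ! i \<and> arr s 2 (Suc i) \<le> reg s rot)"

lemma wp_emit_copy:
  assumes i: "reg s ri = reg s rvb" "reg s rvb \<le> reg s rve"
    and post: "\<And>s' T'. (\<And>j. j < reg s rot \<Longrightarrow> arr s' 3 j = arr s 3 j) \<Longrightarrow> reg s rot \<le> reg s' rot \<Longrightarrow>
      map (arr s' 3) [reg s rot..<reg s' rot] = map (arr s aV) [reg s rvb..<reg s rve] \<Longrightarrow>
      same {rot, ri} {3} s s' \<Longrightarrow> T' \<le> T + 30 * (reg s rve - reg s rvb) + 10 \<Longrightarrow> Q s' T'"
  shows "wp emit_copy Q s T"
  unfolding emit_copy_def
proof -
  let ?I = "\<lambda>(s1::state) T1. reg s rvb \<le> reg s1 ri \<and> reg s1 ri \<le> reg s rve \<and> reg s rot \<le> reg s1 rot \<and>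
    (\<forall>j<reg s rot. arr s1 3 j = arr s 3 j) \<and>
    map (arr s1 3) [reg s rot..<reg s1 rot] = map (arr s aV) [reg s rvb..<reg s1 ri] \<and>
    T1 + 30 * reg s rvb \<le> T + 30 * reg s1 ri"
  let ?b = "Less (Reg ri) (Reg rve)"
  let ?c = "Store 3 (Reg rot) (Arr aV (Reg ri)) ;; incr rot ;; incr ri"
  show "wp (While ?b ?c) Q s T"
  proof (rule wp_While[where B = "T + 30 * reg s rve" and I = ?I])
    show "?I s T" using i by simp
    fix s1 T1 assume I: "?I s1 T1" and sm: "same (wr ?c) (wa ?c) s s1"
    have fr: "reg s1 rve = reg s rve" "arr s1 aV = arr s aV" using sameD[OF sm] by auto
    show "T1 \<le> T + 30 * reg s rve" using I by linarith
    have cg: "map ((arr s1 3)(reg s1 rot := y)) [reg s rot..<reg s1 rot] = map (arr s1 3) [reg s rot..<reg s1 rot]" for y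
      by (rule map_cong) auto
    show "wp ?c ?I s1 (T1 + (bcost ?b + 1))" if "bval s1 ?b"
      using I that fr by (auto simp: cg)
    show "Q s1 (T1 + (bcost ?b + 1))" if "\<not> bval s1 ?b"
      using I that fr sm i by (intro post) (auto simp: same_def)
  qed
qed

lemma wp_emit:
  assumes l: "listed s outs" and i: "reg s rvb \<le> reg s rve"
    and post: "\<And>s' T'. same (wr emit) (wa emit) s s' \<Longrightarrow>
      listed s' (outs @ [map (arr s aV) [reg s rvb..<reg s rve]]) \<Longrightarrow>
      T' \<le> T + 30 * (reg s rve - reg s rvb) + 50 \<Longrightarrow> Q s' T'"
  shows "wp emit Q s T"
  unfolding emit_def
  apply (subst wp_Seq, subst wp_Assign, subst wp_Seq)
  apply (rule wp_emit_copy)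
    apply (use i in simp, use i in simp)
  subgoal premises p for s1 T1
  proof -
    have f1: "reg s1 r = reg s r" if "r \<notin> {rot, ri}" for r using sameD(1)[OF p(4)] that by auto
    have g1: "arr s1 d = arr s d" if "d \<noteq> 3" for d using sameD(2)[OF p(4)] that by auto
    have L: "arr s 2 0 = 0" "arr s 2 (length outs) = reg s rot" "reg s rno = length outs"
      "\<And>i. i < length outs \<Longrightarrow> map (arr s 3) [arr s 2 i..<arr s 2 (Suc i)] = outs ! i \<and> arr s 2 (Suc i) \<le> reg s rot"
      using l by (auto simp: listed_def)
    let ?o = "map (arr s aV) [reg s rvb..<reg s rve]"
    define s2 where "s2 = s1\<lparr>arr := (arr s1)(2 := (arr s 2)(Suc (length outs) := reg s1 rot)),
      reg := (reg s1)(rno := Suc (length outs))\<rparr>"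
    have s2: "arr s2 3 = arr s1 3" "arr s2 2 = (arr s 2)(Suc (length outs) := reg s1 rot)"
      "reg s2 rot = reg s1 rot" "reg s2 rno = Suc (length outs)" by (simp_all add: s2_def)
    have p': "\<And>j. j < reg s rot \<Longrightarrow> arr s1 3 j = arr s 3 j" "reg s rot \<le> reg s1 rot"
      "map (arr s1 3) [reg s rot..<reg s1 rot] = ?o" using p(1-3) by simp_all
    have li: "listed s2 (outs @ [?o])"
      unfolding listed_def s2
    proof (intro conjI allI impI)
      fix i assume i: "i < length (outs @ [?o])"
      show "map (arr s1 3) [((arr s 2)(Suc (length outs) := reg s1 rot)) i..<((arr s 2)(Suc (length outs) := reg s1 rot)) (Suc i)]
        = (outs @ [?o]) ! i"
      proof (cases "i < length outs")
        case True
        have "map (arr s1 3) [arr s 2 i..<arr s 2 (Suc i)] = map (arr s 3) [arr s 2 i..<arr s 2 (Suc i)]"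
          using L(4)[OF True] p'(1) by (intro map_cong) auto
        then show ?thesis using L(4)[OF True] True by (simp add: nth_append)
      next
        case False
        then have "i = length outs" using i by simp
        then show ?thesis using p'(3) L(2) by (simp add: nth_append)
      qed
      show "((arr s 2)(Suc (length outs) := reg s1 rot)) (Suc i) \<le> reg s1 rot"
        using L(4)[of i] i p'(2) by (cases "i = length outs") auto
    qed (use L in auto)
    have sm: "same (wr emit) (wa emit) s s2" using p(4) g1 by (auto simp: same_def s2_def)
    have T: "T1 + 12 \<le> T + 30 * (reg s rve - reg s rvb) + 50" using p(5) by simp
    have goal: "wp (incr rno ;; Store 2 (Reg rno) (Reg rot)) Q s1 T1"
      apply (simp only: wp_Seq wp_Assign wp_Store)
      apply (rule back_subst[of "\<lambda>s. Q s _", OF post[OF sm li]])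
      using T L(3) by (auto simp: s2_def f1 g1 fun_eq_iff)
    show ?thesis by (rule goal)
  qed
  done

text \<open>Pays for one examination. The summand \<open>1500 * M\<close> covers the scans and
  copies that are linear in the component, which has at most \<open>2 * M\<close> vertices and
  \<open>M\<close> arcs; \<open>2000 * (D + 2)\<close> and two of the \<open>local_cost D\<close>
  make up for the excess in \<open>phi_split\<close>; the third \<open>local_cost D\<close> pays for
  a local search that succeeds.\<close>

definition rate :: "nat \<Rightarrow> nat \<Rightarrow> nat" where
  "rate M D = 1500 * M + 2000 * (D + 2) + 3 * local_cost D + 2000"

definition Phi :: "(nat \<times> nat) set \<Rightarrow> nat \<Rightarrow> nat \<Rightarrow> nat set \<Rightarrow> nat set \<Rightarrow> nat" where
  "Phi E M D C P = phi M D (rate M D) (card C) (card (E \<inter> C \<times> C)) (card P)"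

text \<open>The case \<open>k = 0\<close> is meant for a separation found locally,
  \<open>k = D\<close> for one found by the global test, when no separation has a side of at most
  \<open>D\<close> vertices. Only the latter releases \<open>24000 * M * D\<close>, the price of
  that test.\<close>

lemma wp_split_step:
  assumes c: "comp s E C" and b: "reg s rve \<le> reg s rvt" "reg s rae \<le> reg s rat" and st: "store s"
    and sx: "sepx E C (reg s rx) (marked C s)" and pi: "pend_inv E C (arr s aV ` pend s) D"
    and n: "3 \<le> card C" "card C \<le> 2 * M" "reg s rae - reg s rab \<le> M"
    and k: "k = 0 \<or> k = D \<and> (\<forall>x Z. sepx E C x Z \<longrightarrow> D < card Z)"
    and post: "\<And>s' T' x A P1 P2. same (wr split) (wa split) s s' \<Longrightarrow> store s' \<Longrightarrow> ext s s' \<Longrightarrow>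
      reg s' rits = Suc (Suc (reg s rits)) \<Longrightarrow> sepx E C x A \<Longrightarrow>
      item s' E (reg s rits) (A \<union> (C \<inter> {x})) P1 \<Longrightarrow> item s' E (Suc (reg s rits)) (C - A) P2 \<Longrightarrow>
      pend_inv E (A \<union> (C \<inter> {x})) P1 D \<Longrightarrow> pend_inv E (C - A) P2 D \<Longrightarrow>
      T' + Phi E M D (A \<union> (C \<inter> {x})) P1 + Phi E M D (C - A) P2 + 600 * M + local_cost D + 1700 +
        24000 * M * k \<le> T + Phi E M D C (arr s aV ` pend s) \<Longrightarrow> Q s' T'"
  shows "wp split Q s T"
proof (rule wp_split[OF c b st])
  let ?x = "reg s rx" and ?A = "marked C s" and ?P = "arr s aV ` pend s"
  let ?C1 = "?A \<union> (C \<inter> {?x})" and ?C2 = "C - ?A"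
  let ?P1 = "{v \<in> ?C1. v \<in> losers E C ?x ?A \<or> v \<in> ?P}" and ?P2 = "{v \<in> ?C2. v \<in> losers E C ?x ?A \<or> v \<in> ?P}"
  have C: "C = arr s aV ` {reg s rvb..<reg s rve}" "inj_on (arr s aV) {reg s rvb..<reg s rve}"
    "inj_on (\<lambda>e. (arr s aT e, arr s aH e)) {reg s rab..<reg s rae}"
    "(\<lambda>e. (arr s aT e, arr s aH e)) ` {reg s rab..<reg s rae} = E \<inter> C \<times> C" "E \<inter> Id = {}"
    using c by (auto simp: comp_def)
  have fin: "finite C" using C by simp
  have cardC: "card C = reg s rve - reg s rvb" using C by (simp add: card_image)
  have cardE: "card (E \<inter> C \<times> C) = reg s rae - reg s rab" using C(4)[symmetric] C(3) by (simp add: card_image)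
  have A: "?A \<subseteq> C - {?x}" using sx by (simp add: sepx_def)
  have P: "?P \<subseteq> C" using C(1) by (auto simp: pend_def)
  note sides = card_sepx_sides(1-5)[OF fin sx] card_sepx_sides(6)[OF fin sx, where D = D]
  have kk: "k \<le> D \<and> (card ?C1 - 1 - D) + (card ?C2 - 1 - D) + k \<le> card C - 1 - D"
  proof (cases "k = 0")
    case True
    then show ?thesis using sides(1-5) by linarith
  next
    case False
    then have k: "k = D" "\<And>x Z. sepx E C x Z \<Longrightarrow> D < card Z" using k by auto
    \<comment> \<open>Either side of a separation is one itself, so both have more than
      \<open>D\<close> vertices.\<close>
    show ?thesis using sides(6)[OF k(2)[OF sx] k(2)[OF sepx_swap[OF sx]]] k(1) by simp
  qed
  have ph: "Phi E M D ?C1 ?P1 + Phi E M D ?C2 ?P2 + rate M D + 24000 * M * k \<le>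
      Phi E M D C ?P + 2000 * (D + 2) + 2 * local_cost D + 100"
    unfolding Phi_def
  proof (rule phi_split[OF sides(1-5) n(1)])
    show "card (E \<inter> ?C1 \<times> ?C1) + card (E \<inter> ?C2 \<times> ?C2) + card (deleted E C ?x ?A) \<le> card (E \<inter> C \<times> C)"
      using card_arcs_split[OF fin C(5) A] by simp
    show "card ?P1 + card ?P2 \<le> card ?P + 2 * card (deleted E C ?x ?A) + 2"
      by (rule card_pend_split[OF fin A P])
  qed (use kk in auto)
  fix s' T'
  assume *: "same (wr split) (wa split) s s'" "store s'" "ext s s'" "reg s' rits = Suc (Suc (reg s rits))"
    "item s' E (reg s rits) ?C1 ?P1" "item s' E (Suc (reg s rits)) ?C2 ?P2"
    "T' \<le> T + 300 * ((reg s rve - reg s rvb) + (reg s rae - reg s rab)) + 200"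
  show "Q s' T'"
  proof (rule post[OF *(1-4) sx *(5,6)])
    show "pend_inv E ?C1 ?P1 D" "pend_inv E ?C2 ?P2 D" using pend_inv_split[OF pi A P] by auto
    show "T' + Phi E M D ?C1 ?P1 + Phi E M D ?C2 ?P2 + 600 * M + local_cost D + 1700 + 24000 * M * k \<le>
        T + Phi E M D C ?P"
    proof -
      have "300 * ((reg s rve - reg s rvb) + (reg s rae - reg s rab)) \<le> 900 * M"
        using mult_le_mono2[OF add_mono[OF n(2)[unfolded cardC] n(3)], of 300] by simp
      then have "T' \<le> T + 900 * M + 200" using *(7) by linarith
      then show ?thesis using ph unfolding rate_def by linarith
    qed
  qed
qed

section \<open>The examination of one component in full\<close>

definition finish :: com where
  "finish = (If1 (Equal (Reg rfd) (Num 0)) global ;; Cond (Equal (Reg rfd) (Num 1)) split emit)"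

definition examine :: com where
  "examine = (build ;; rfd ::= Num 0 ;; rL ::= Reg rD ;; ri ::= Reg rvb ;; local_loop ;; finish)"

lemma comp_same:
  assumes "comp s E C" "same R A s s'" "R \<inter> {rvb, rve, rab, rae} = {}" "A \<inter> {aV, aT, aH} = {}"
  shows "comp s' E C"
proof -
  have "arr s' a = arr s a" if "a \<in> {aV, aT, aH}" for a
    using assms(2,4) that unfolding same_def by blast
  moreover have "reg s' r = reg s r" if "r \<in> {rvb, rve, rab, rae}" for r
    using assms(2,3) that unfolding same_def by blast
  ultimately show ?thesis using assms(1) by (simp add: comp_def)
qed

lemma lists_same:
  assumes "lists s E C adjO adjI inc" "same R A s s'" "R \<inter> {rab, rae} = {}"
    "A \<inter> {aT, aH, afO, anO, afI, anI, afB, anB, abB, akB} = {}"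
  shows "lists s' E C adjO adjI inc"
proof -
  have "arr s' a = arr s a" if "a \<in> {aT, aH, afO, anO, afI, anI, afB, anB, abB, akB}" for a
    using assms(2,4) that unfolding same_def by blast
  moreover have "reg s' r = reg s r" if "r \<in> {rab, rae}" for r
    using assms(2,3) that unfolding same_def by blast
  ultimately show ?thesis using assms(1) by (simp add: lists_def adjrep_def increp_def)
qed

lemma ctx2_lists:
  assumes "lists s E C adjO adjI inc" "comp s E C" "reg s rn \<notin> C" "\<And>u. arr s amk u \<le> reg s rst"
  shows "ctx2 s E C adjO adjI"
proof -
  have "finite C" "card C = reg s rve - reg s rvb"
    using assms(2) by (auto simp: comp_def card_image)
  then show ?thesis using assms by (simp add: ctx2_def search_ctx_def lists_def)
qed

lemma Phi_pend: "Phi E M D C P + local_cost D * card P' = Phi E M D C P' + local_cost D * card P"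
  by (simp add: Phi_def phi_def algebra_simps)

definition settled :: "state \<Rightarrow> bool" where
  "settled s \<longleftrightarrow> store s \<and> (\<forall>u. arr s amk u \<le> reg s rst) \<and> (\<forall>u. arr s acl u \<le> reg s rcs)"

text \<open>The local loop clears pending marks in the cells of the current component. Items that
  start at or after \<open>rve\<close> are not affected, and only these are still to be
  examined.\<close>

definition succ :: "(nat \<times> nat) set \<Rightarrow> state \<Rightarrow> state \<Rightarrow> bool" where
  "succ E s s' \<longleftrightarrow> settled s' \<and> reg s' rn = reg s rn \<and> reg s' rD = reg s rD \<and> reg s' rcur = reg s rcur \<and>
     (\<forall>i X P. i < reg s rits \<longrightarrow> reg s rve \<le> arr s aVB i \<longrightarrow> item s E i X P \<longrightarrow> item s' E i X P)"

lemma succ_if: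
  assumes s: "store s" "comp s E C"
    and a: "\<And>d. d \<in> {aV, aT, aH, aVB, aAB} \<Longrightarrow> arr s3 d = arr s d"
    and P: "\<And>i. i \<notin> {reg s rvb..<reg s rve} \<Longrightarrow> arr s3 aP i = arr s aP i"
    and r: "\<And>r. r \<in> {rn, rD, rcur, rits, rvt, rat} \<Longrightarrow> reg s3 r = reg s r"
    and e: "ext s3 s'" "settled s'" "\<And>r. r \<in> {rn, rD, rcur} \<Longrightarrow> reg s' r = reg s3 r"
  shows "succ E s s'"
  unfolding succ_def
proof (intro conjI allI impI)
  show "settled s'" by fact
  show "reg s' rn = reg s rn" "reg s' rD = reg s rD" "reg s' rcur = reg s rcur"
    using r e by auto
  fix i X P0 assume i: "i < reg s rits" "reg s rve \<le> arr s aVB i" and it: "item s E i X P0"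
  have st3: "store s3" using s(1) a r by (simp add: store_def)
  have "item s3 E i X P0"
    using it a P i(2) unfolding item_def by (auto intro: seg_cong)
  then show "item s' E i X P0" by (rule item_ext[OF _ st3 e(1)]) (use i r in auto)
qed

lemma wp_examine:
  assumes c: "comp s E C" and b: "reg s rve \<le> reg s rvt" "reg s rae \<le> reg s rat" and st: "settled s"
    and li: "listed s outs" and pi: "pend_inv E C (arr s aV ` pend s) D" and D: "reg s rD = D" "1 \<le> D"
    and n: "3 \<le> card C" "card C \<le> 2 * M" "reg s rae - reg s rab \<le> M" "card C \<le> reg s rn" "reg s rn \<notin> C"
    and M: "4 * M < 2 ^ (D + 2)"
    and out: "\<And>s' T'. succ E s s' \<Longrightarrow> good E C \<Longrightarrow> reg s' rits = reg s rits \<Longrightarrow>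
      listed s' (outs @ [map (arr s aV) [reg s rvb..<reg s rve]]) \<Longrightarrow>
      T' + 100 \<le> T + Phi E M D C (arr s aV ` pend s) \<Longrightarrow> Q s' T'"
    and spl: "\<And>s' T' x A P1 P2. succ E s s' \<Longrightarrow> sepx E C x A \<Longrightarrow>
      reg s' rits = Suc (Suc (reg s rits)) \<Longrightarrow> listed s' outs \<Longrightarrow>
      item s' E (reg s rits) (A \<union> (C \<inter> {x})) P1 \<Longrightarrow> item s' E (Suc (reg s rits)) (C - A) P2 \<Longrightarrow>
      pend_inv E (A \<union> (C \<inter> {x})) P1 D \<Longrightarrow> pend_inv E (C - A) P2 D \<Longrightarrow>
      T' + Phi E M D (A \<union> (C \<inter> {x})) P1 + Phi E M D (C - A) P2 + 100 \<le>
        T + Phi E M D C (arr s aV ` pend s) \<Longrightarrow> Q s' T'"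
  shows "wp examine Q s T"
proof -
  let ?L = "local_cost D" and ?V = "arr s aV"
  let ?m = "reg s rae - reg s rab"
  let ?R = "{rn, rD, rcur, rits, rvt, rat, rvb, rve, rab, rae, rot, rno}"
  let ?A = "{aV, aT, aH, aVB, aAB, 2, 3}"
  have sto: "store s" and mk: "\<And>u. arr s amk u \<le> reg s rst" and cl: "\<And>u. arr s acl u \<le> reg s rcs"
    using st by (auto simp: settled_def)
  have C: "C = arr s aV ` {reg s rvb..<reg s rve}" "inj_on (arr s aV) {reg s rvb..<reg s rve}"
    "inj_on (\<lambda>e. (arr s aT e, arr s aH e)) {reg s rab..<reg s rae}"
    "(\<lambda>e. (arr s aT e, arr s aH e)) ` {reg s rab..<reg s rae} = E \<inter> C \<times> C" "reg s rvb \<le> reg s rve"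
    using c by (auto simp: comp_def)
  have cardC: "card C = reg s rve - reg s rvb" using C by (simp add: card_image)
  have cardE: "card (E \<inter> C \<times> C) = ?m" using C(4)[symmetric] C(3) by (simp add: card_image)
  have cardP: "card (?V ` X) = card X" if "X \<subseteq> {reg s rvb..<reg s rve}" for X
    using inj_on_subset[OF C(2) that] by (rule card_image)
  have w: "1 \<le> card C + 2 * ?m" "card C + 2 * ?m < 2 ^ (D + 2)" "card C + 2 * ?m \<le> 4 * M" using n M by linarith+
  have gc: "gcost (card C + 2 * ?m) \<le> 2000 * (D + 2) * (card C + 2 * ?m)" by (rule gcost_le[OF w(1,2)])
  have gc2: "gcost (card C + 2 * ?m) \<le> 24000 * M * D"
  proof -
    \<comment> \<open>\<open>D + 2 \<le> 3 * D\<close> because \<open>D \<ge> 1\<close>, and the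
      weight is at most \<open>4 * M\<close>; this is the origin of the 24000 in
      \<open>phi\<close>.\<close>
    have "2000 * (D + 2) * (card C + 2 * ?m) \<le> 2000 * (3 * D) * (4 * M)"
      using D w(3) by (intro mult_le_mono) auto
    also have "\<dots> = 24000 * M * D" by simp
    finally show ?thesis using gc by linarith
  qed
  text \<open>Both outcomes end in a state \<open>s3\<close> that agrees with \<open>s\<close> up to scratch memory.\<close>
  have split3: "wp split Q s3 T3" if c3: "comp s3 E C"
    and r3: "\<And>r. r \<in> ?R \<Longrightarrow> reg s3 r = reg s r" and a3: "\<And>d. d \<in> ?A \<Longrightarrow> arr s3 d = arr s d"
    and P3: "\<And>i. i \<notin> {reg s rvb..<reg s rve} \<Longrightarrow> arr s3 aP i = arr s aP i"
    and mk3: "\<And>u. arr s3 amk u \<le> reg s3 rst" and cl3: "\<And>u. arr s3 acl u \<le> reg s3 rcs"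
    and sx3: "sepx E C (reg s3 rx) (marked C s3)" and pi3: "pend_inv E C (arr s3 aV ` pend s3) D"
    and k: "k = 0 \<or> k = D \<and> (\<forall>x Z. sepx E C x Z \<longrightarrow> D < card Z)"
    and T3: "T3 + ?L * card (pend s3) \<le> T + ?L * card (pend s) + 600 * M + ?L + 1500 + 24000 * M * k"
    for s3 T3 k
  proof -
    have st3: "store s3" using sto r3 a3 by (simp add: store_def)
    have li3: "listed s3 outs" using li r3 a3 by (simp add: listed_def)
    show ?thesis
    proof (rule wp_split_step[OF c3 _ _ st3 sx3 pi3 n(1,2) _ k])
      show "reg s3 rve \<le> reg s3 rvt" "reg s3 rae \<le> reg s3 rat" "reg s3 rae - reg s3 rab \<le> M"
        using b n r3 by simp_all
      fix s4 T4 x A P1 P2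
      assume *: "same (wr split) (wa split) s3 s4" "store s4" "ext s3 s4" "reg s4 rits = Suc (Suc (reg s3 rits))"
        "sepx E C x A" "item s4 E (reg s3 rits) (A \<union> (C \<inter> {x})) P1" "item s4 E (Suc (reg s3 rits)) (C - A) P2"
        "pend_inv E (A \<union> (C \<inter> {x})) P1 D" "pend_inv E (C - A) P2 D"
        "T4 + Phi E M D (A \<union> (C \<inter> {x})) P1 + Phi E M D (C - A) P2 + 600 * M + ?L + 1700 + 24000 * M * k \<le>
          T3 + Phi E M D C (arr s3 aV ` pend s3)"
      have se4: "settled s4" using *(1,2) mk3 cl3 sameD[OF *(1)] by (simp add: settled_def)
      have su: "succ E s s4"
      proof (rule succ_if[OF sto c _ P3 _ *(3) se4])
        show "arr s3 d = arr s d" if "d \<in> {aV, aT, aH, aVB, aAB}" for d by (rule a3) (use that in auto)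
        show "reg s3 r = reg s r" if "r \<in> {rn, rD, rcur, rits, rvt, rat}" for r by (rule r3) (use that in auto)
        show "reg s4 r = reg s3 r" if "r \<in> {rn, rD, rcur}" for r by (rule sameD(1)[OF *(1)]) (use that in auto)
      qed
      have pc: "card (arr s3 aV ` pend s3) = card (pend s3)"
      proof -
        have "arr s3 aV = ?V" using a3 by simp
        moreover have "reg s3 rvb = reg s rvb" "reg s3 rve = reg s rve" using r3 by simp_all
        then have "pend s3 \<subseteq> {reg s rvb..<reg s rve}" by (auto simp: pend_def)
        ultimately show ?thesis by (simp only: cardP)
      qed
      have pc': "card (?V ` pend s) = card (pend s)" by (rule cardP) (auto simp: pend_def)
      show "Q s4 T4"
      proof (rule spl[OF su *(5)])
        show "reg s4 rits = Suc (Suc (reg s rits))" using *(4) r3 by simp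
        show "listed s4 outs" using li3 sameD[OF *(1)] by (simp add: listed_def)
        show "item s4 E (reg s rits) (A \<union> (C \<inter> {x})) P1" "item s4 E (Suc (reg s rits)) (C - A) P2"
          using *(6,7) r3 by simp_all
        show "T4 + Phi E M D (A \<union> (C \<inter> {x})) P1 + Phi E M D (C - A) P2 + 100 \<le> T + Phi E M D C (?V ` pend s)"
          using *(10) T3 Phi_pend[of E M D C "arr s3 aV ` pend s3" "?V ` pend s"] unfolding pc pc' by linarith
      qed (fact *)+
    qed
  qed
  have emit3: "wp emit Q s3 T3" if g: "good E C"
    and r3: "\<And>r. r \<in> ?R \<Longrightarrow> reg s3 r = reg s r" and a3: "\<And>d. d \<in> ?A \<Longrightarrow> arr s3 d = arr s d"
    and P3: "\<And>i. i \<notin> {reg s rvb..<reg s rve} \<Longrightarrow> arr s3 aP i = arr s aP i"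
    and mk3: "\<And>u. arr s3 amk u \<le> reg s3 rst" and cl3: "\<And>u. arr s3 acl u \<le> reg s3 rcs"
    and T3: "T3 \<le> T + ?L * card (pend s) + 600 * M + 1500 + 2000 * (D + 2) * (card C + 2 * ?m)" for s3 T3
  proof -
    have st3: "store s3" using sto r3 a3 by (simp add: store_def)
    have li3: "listed s3 outs" using li r3 a3 by (simp add: listed_def)
    show ?thesis
    proof (rule wp_emit[OF li3])
      show "reg s3 rvb \<le> reg s3 rve" using C r3 by simp
      fix s4 T4
      assume *: "same (wr emit) (wa emit) s3 s4"
        "listed s4 (outs @ [map (arr s3 aV) [reg s3 rvb..<reg s3 rve]])"
        "T4 \<le> T3 + 30 * (reg s3 rve - reg s3 rvb) + 50"
      have st4: "store s4" by (rule store_same[OF *(1) _ _ st3]) auto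
      have ex: "ext s3 s4" by (rule ext_same[OF *(1)]) auto
      have se4: "settled s4" using st4 mk3 cl3 sameD[OF *(1)] by (simp add: settled_def)
      have su: "succ E s s4"
      proof (rule succ_if[OF sto c _ P3 _ ex se4])
        show "arr s3 d = arr s d" if "d \<in> {aV, aT, aH, aVB, aAB}" for d by (rule a3) (use that in auto)
        show "reg s3 r = reg s r" if "r \<in> {rn, rD, rcur, rits, rvt, rat}" for r by (rule r3) (use that in auto)
        show "reg s4 r = reg s3 r" if "r \<in> {rn, rD, rcur}" for r by (rule sameD(1)[OF *(1)]) (use that in auto)
      qed
      have pc': "card (?V ` pend s) = card (pend s)" by (rule cardP) (auto simp: pend_def)
      have ph: "rate M D * 1 + 2000 * (D + 2) * (card C + 2 * ?m) + ?L * card (pend s) \<le> Phi E M D C (?V ` pend s)"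
      proof -
        have "rate M D * 1 \<le> rate M D * (card C - 2)" using n(1) by (intro mult_le_mono2) linarith
        moreover have "?L * card (pend s) \<le> ?L * (2 * card (E \<inter> C \<times> C) + card (pend s))" by simp
        ultimately show ?thesis unfolding Phi_def phi_def pc' cardE by linarith
      qed
      show "Q s4 T4"
      proof (rule out[OF su g])
        show "reg s4 rits = reg s rits" using sameD[OF *(1)] r3 by simp
        show "listed s4 (outs @ [map ?V [reg s rvb..<reg s rve]])" using *(2) r3 a3 by simp
        show "T4 + 100 \<le> T + Phi E M D C (?V ` pend s)"
          using *(3) T3 ph n(1,2) cardC r3 unfolding rate_def by simp
      qed
    qed
  qed
  show ?thesis
    unfolding examine_def
    apply (subst wp_Seq)
    apply (rule wp_build[OF c])
    subgoal premises p for s1 T1 adjO adjI inc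
    proof -
      have f1: "reg s1 r = reg s r" if "r \<in> insert rst (insert rcs ?R)" for r using sameD(1)[OF p(2)] that by auto
      have g1: "arr s1 d = arr s d" if "d \<in> insert aP (insert amk (insert acl ?A))" for d
        using sameD(2)[OF p(2)] that by auto
      define s2 where "s2 = s1\<lparr>reg := (reg s1)(rfd := 0, rL := D, ri := reg s rvb)\<rparr>"
      have sm2: "same {rfd, rL, ri} {} s1 s2" by (simp add: s2_def same_def)
      have f2: "reg s2 r = reg s r" if "r \<in> insert rst (insert rcs ?R)" for r using f1[OF that] that by (auto simp: s2_def)
      have g2: "arr s2 d = arr s d" if "d \<in> insert aP (insert amk (insert acl ?A))" for d
        using g1[OF that] by (simp add: s2_def)
      have c2: "comp s2 E C"
        by (rule comp_same[OF comp_same[OF c p(2)] sm2]) auto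
      have l2: "lists s2 E C adjO adjI inc" by (rule lists_same[OF p(1) sm2]) auto
      have x2: "ctx2 s2 E C adjO adjI"
        by (rule ctx2_lists[OF l2 c2]) (use f2 g2 n mk in simp_all)
      have pe2: "pend s2 = pend s" using f2 g2 by (simp add: pend_def)
      have goal: "wp (local_loop ;; finish) Q s2 T2" if T2: "T2 \<le> T1 + 20" for T2
        apply (subst wp_Seq)
        apply (rule wp_local_loop[OF x2 c2, where D = D])
             apply (use D(2) f1 in \<open>simp_all add: s2_def\<close>)[4]
         apply (use pi pe2 g2 in simp)
        subgoal premises q for s3 T3
        proof -
          have f3: "reg s3 r = reg s r" if "r \<in> insert rcs ?R" for r using sameD(1)[OF q(2)] f2 that by auto
          have g3: "arr s3 d = arr s d" if "d \<in> insert acl ?A" for d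
            using sameD(2)[OF q(2)] g2 that by auto
          have c3: "comp s3 E C" by (rule comp_same[OF c2 q(2)]) auto
          have P3: "arr s3 aP i = arr s aP i" if "i \<notin> {reg s rvb..<reg s rve}" for i
            using q(4)[of i] that g2 pe2 by (auto simp: pend_def)
          have mk3: "arr s3 amk u \<le> reg s3 rst" for u
            using q(1) search_ctx_marks unfolding ctx2_def by blast
          have cl3: "arr s3 acl u \<le> reg s3 rcs" for u using cl f3 g3 by simp
          have T3: "T3 + ?L * card (pend s3) \<le> T + ?L * card (pend s) + reg s3 rfd * ?L + 380 * M + 100"
            using q(8) p(3) T2 pe2 n cardC by simp
          show ?thesis
          proof (cases "reg s3 rfd = 0")
            case False
            then have fd: "reg s3 rfd = 1" using q(3) by simp
            let ?s = "s3"
            have T3': "T3 + ?L * card (pend s3) \<le> T + ?L * card (pend s) + ?L + 380 * M + 100" using T3 fd by simp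
            show ?thesis
              unfolding finish_def
              apply (simp add: fd)
              by (rule split3[where k = 0, OF c3 _ _ P3 mk3 cl3])
                (use q(5)[OF fd] f3 g3 g2[of aV] T3' in simp_all)
          next
            case True
            have l3: "lists s3 E C adjO adjI inc" by (rule lists_same[OF l2 q(2)]) auto
            have nsx: "D < card Z" if "sepx E C x Z" for x Z using q(6)[OF True that] .
            have pe3: "pend s3 = {}" using q(7)[OF True] .
            have T3': "T3 \<le> T + ?L * card (pend s) + 380 * M + 100" using T3 True pe3 by simp
            have wt: "wt inc C = card C + 2 * ?m" using l3 f3 by (simp add: lists_def)
            have goal3: "wp (global ;; Cond (Equal (Reg rfd) (Num 1)) split emit) Q s3 T4"
              if T4: "T4 \<le> T3 + 10" for T4
              apply (subst wp_Seq)
              apply (rule wp_global[OF q(1) c3 l3 n(1)])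
                 apply (use n f3 True cl3 in simp_all)[3]
              subgoal premises r for s4 T5
              proof -
                have f4: "reg s4 r = reg s r" if "r \<in> ?R" for r using sameD(1)[OF r(6)] f3 that by auto
                have g4: "arr s4 d = arr s d" if "d \<in> ?A" for d using sameD(2)[OF r(6)] g3 that by auto
                have g4': "arr s4 aP = arr s3 aP" using sameD(2)[OF r(6)] by auto
                have c4: "comp s4 E C" by (rule comp_same[OF c3 r(6)]) auto
                have P4: "arr s4 aP i = arr s aP i" if "i \<notin> {reg s rvb..<reg s rve}" for i
                  using P3[OF that] g4' by simp
                have pe4: "pend s4 = {}" using pe3 f4 f3 g4' by (simp add: pend_def)
                have T5: "T5 \<le> T + ?L * card (pend s) + 380 * M + 110 + gcost (card C + 2 * ?m)"
                  using r(7) T3' T4 wt by simp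
                show ?thesis
                proof (cases "reg s4 rfd = 1")
                  case fd: True
                  \<comment> \<open>No separation has a side of at most \<open>D\<close> vertices,
                    so the condition holds with nothing pending.\<close>
                  have pi4: "pend_inv E C {} D" unfolding pend_inv_def using nsx by (meson not_le)
                  have T6: "T5 + 10 \<le> T + ?L * card (pend s) + 600 * M + ?L + 1500 + 24000 * M * D"
                    using T5 gc2 by linarith
                  show ?thesis
                    apply (simp add: fd)
                    by (rule split3[where k = D, OF c4 _ _ P4 r(5) r(4)])
                      (use r(2)[OF fd] f4 g4 pe4 pi4 T6 nsx in simp_all)
                next
                  case False
                  then have fd: "reg s4 rfd = 0" using r(1) by simp
                  have T6: "T5 + 10 \<le> T + ?L * card (pend s) + 600 * M + 1500 + 2000 * (D + 2) * (card C + 2 * ?m)"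
                    using T5 gc by linarith
                  show ?thesis
                    apply (simp add: fd)
                    by (rule emit3[OF r(3)[OF fd] _ _ P4 r(5) r(4)])
                      (use f4 g4 T6 in simp_all)
                qed
              qed
              done
            show ?thesis
              unfolding finish_def
              apply (subst wp_Seq, subst wp_Cond)
              apply (simp add: True del: One_nat_def)
              by (rule wp_SeqD[OF goal3]) simp
          qed
        qed
        done
      show ?thesis
        apply (subst wp_Seq, subst wp_Assign, subst wp_Seq, subst wp_Assign, subst wp_Seq, subst wp_Assign)
        apply (rule wp_state_eq[OF goal])
         apply simp
        using D f1 by (simp add: s2_def)
    qed
    done
qed

section \<open>The decomposition\<close>

text \<open>Intersections of at most one vertex persist, because a split duplicates only
  \<open>x\<close>. In the end they make the listed sets incomparable, as
  \<open>enumerates_vccs_2\<close> requires.\<close>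

definition cover :: "(nat \<times> nat) set \<Rightarrow> nat set \<Rightarrow> nat list list \<Rightarrow> nat set list \<Rightarrow> bool" where
  "cover E V outs Ls \<longleftrightarrow>
     (\<forall>xs\<in>set outs. distinct xs \<and> set xs \<subseteq> V \<and> good E (set xs)) \<and> (\<forall>X\<in>set Ls. X \<subseteq> V) \<and>
     (\<forall>B. B \<subseteq> V \<longrightarrow> good E B \<longrightarrow> (\<exists>X\<in>set (map set outs @ Ls). B \<subseteq> X)) \<and>
     sorted_wrt (\<lambda>A B. card (A \<inter> B) \<le> 1) (map set outs @ Ls)"

lemma cover_drop:
  assumes c: "cover E V outs (C # Ls)" and C: "card C < 3" "finite V"
  shows "cover E V outs Ls"
proof -
  have "finite C" using c C finite_subset by (auto simp: cover_def)
  then have "\<not> B \<subseteq> C" if "good E B" for B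
    using that C(1) card_mono[of C B] by (auto simp: good_def)
  then show ?thesis using c unfolding cover_def by (auto simp: sorted_wrt_append)
qed

lemma cover_emit:
  assumes c: "cover E V outs (C # Ls)" and xs: "good E C" "distinct xs" "set xs = C"
  shows "cover E V (outs @ [xs]) Ls"
  using c xs unfolding cover_def by simp

text \<open>By \<open>good_split\<close> no good set inside \<open>C\<close> is lost. The new sets
  are subsets of \<open>C\<close>, so they meet all other sets in at most one vertex, and they meet
  each other at most in \<open>x\<close>.\<close>

lemma cover_split:
  assumes c: "cover E V outs (C # Ls)" and s: "sepx E C x A" and fin: "finite V"
  shows "cover E V outs (Ls @ [A \<union> (C \<inter> {x}), C - A])"
proof -
  let ?C1 = "A \<union> (C \<inter> {x})" and ?C2 = "C - A"
  let ?p = "\<lambda>A B :: nat set. card (A \<inter> B) \<le> 1"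
  have CV: "C \<subseteq> V" and AC: "A \<subseteq> C" using c s by (auto simp: cover_def sepx_def)
  have finC: "finite C" using CV fin finite_subset by blast
  have mono: "card (X \<inter> Y) \<le> 1" if "card (X \<inter> C) \<le> 1" "Y \<subseteq> C" for X Y
  proof -
    have "card (X \<inter> Y) \<le> card (X \<inter> C)" using that(2) finC by (intro card_mono) auto
    then show ?thesis using that by simp
  qed
  have "card (?C1 \<inter> ?C2) \<le> card {x}" by (intro card_mono) auto
  then have 12: "card (?C1 \<inter> ?C2) \<le> 1" by simp
  have so: "sorted_wrt ?p (map set outs)" "sorted_wrt ?p Ls" "\<forall>X\<in>set Ls. card (C \<inter> X) \<le> 1"
    "\<forall>X\<in>set (map set outs). \<forall>Y\<in>set (C # Ls). card (X \<inter> Y) \<le> 1"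
    using c by (auto simp: cover_def sorted_wrt_append)
  have sub: "?C1 \<subseteq> C" "?C2 \<subseteq> C" using AC by auto
  show ?thesis
    unfolding cover_def
  proof (intro conjI)
    show "\<forall>xs\<in>set outs. distinct xs \<and> set xs \<subseteq> V \<and> good E (set xs)" using c by (simp add: cover_def)
    show "\<forall>X\<in>set (Ls @ [?C1, ?C2]). X \<subseteq> V" using c CV AC by (auto simp: cover_def)
    show "\<forall>B. B \<subseteq> V \<longrightarrow> good E B \<longrightarrow> (\<exists>X\<in>set (map set outs @ Ls @ [?C1, ?C2]). B \<subseteq> X)"
    proof (intro allI impI)
      fix B assume B: "B \<subseteq> V" "good E B"
      have "\<forall>B. B \<subseteq> V \<longrightarrow> good E B \<longrightarrow> (\<exists>X\<in>set (map set outs @ C # Ls). B \<subseteq> X)"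
        using c unfolding cover_def by (elim conjE)
      then obtain X where X: "X \<in> set (map set outs @ C # Ls)" "B \<subseteq> X" using B by meson
      show "\<exists>X\<in>set (map set outs @ Ls @ [?C1, ?C2]). B \<subseteq> X"
      proof (cases "X = C")
        case True
        have "B \<subseteq> ?C1 \<or> B \<subseteq> ?C2" by (rule good_split[OF B(2) X(2)[unfolded True] s])
        moreover have "?C1 \<in> set (map set outs @ Ls @ [?C1, ?C2])" "?C2 \<in> set (map set outs @ Ls @ [?C1, ?C2])"
          by simp_all
        ultimately show ?thesis by blast
      next
        case False
        then have "X \<in> set (map set outs @ Ls @ [?C1, ?C2])" using X(1) by simp
        then show ?thesis using X(2) by blast
      qed
    qed
    have "card (X \<inter> ?C1) \<le> 1 \<and> card (X \<inter> ?C2) \<le> 1" if "X \<in> set (map set outs) \<union> set Ls" for X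
    proof -
      have "card (X \<inter> C) \<le> 1" using that so(3,4) by (auto simp: Int_commute)
      then show ?thesis using mono sub by blast
    qed
    then show "sorted_wrt ?p (map set outs @ Ls @ [?C1, ?C2])"
      using so 12 unfolding sorted_wrt_append by simp
  qed
qed

section \<open>Rounds over the stored components\<close>

definition bounds :: "(nat \<times> nat) set \<Rightarrow> nat set \<Rightarrow> nat \<Rightarrow> nat \<Rightarrow> nat \<Rightarrow> bool" where
  "bounds E V M D n \<longleftrightarrow> finite V \<and> V \<subseteq> {..<n} \<and> card V \<le> 2 * M \<and> finite E \<and> card E \<le> M \<and>
     1 \<le> D \<and> 4 * M < 2 ^ (D + 2)"

text \<open>\<open>Cs\<close> and \<open>Ps\<close> have no counterpart in the state. They assign to
  an item number its vertices and its pending ones, and a split extends them at two fresh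
  numbers.\<close>

definition rounds_inv :: "(nat \<times> nat) set \<Rightarrow> nat set \<Rightarrow> nat \<Rightarrow> nat \<Rightarrow> state \<Rightarrow> nat list list \<Rightarrow>
    (nat \<Rightarrow> nat set) \<Rightarrow> (nat \<Rightarrow> nat set) \<Rightarrow> bool" where
  "rounds_inv E V D n s outs Cs Ps \<longleftrightarrow> settled s \<and> listed s outs \<and> reg s rD = D \<and> reg s rn = n \<and>
     reg s rcur \<le> reg s rits \<and> cover E V outs (map Cs [reg s rcur..<reg s rits]) \<and>
     (\<forall>i\<in>{reg s rcur..<reg s rits}. item s E i (Cs i) (Ps i) \<and> pend_inv E (Cs i) (Ps i) D)"

definition reserve :: "(nat \<times> nat) set \<Rightarrow> nat \<Rightarrow> nat \<Rightarrow> state \<Rightarrow> (nat \<Rightarrow> nat set) \<Rightarrow> (nat \<Rightarrow> nat set) \<Rightarrow> nat" where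
  "reserve E M D s Cs Ps = (\<Sum>i\<in>{reg s rcur..<reg s rits}. Phi E M D (Cs i) (Ps i))"

definition load :: com where
  "load = (rvb ::= Arr aVB (Reg rcur) ;; rab ::= Arr aAB (Reg rcur) ;; incr rcur ;;
     rve ::= Arr aVB (Reg rcur) ;; rae ::= Arr aAB (Reg rcur))"

definition process :: com where
  "process = (load ;; If1 (Less (Num 2) (Bin Sub (Reg rve) (Reg rvb))) examine)"

definition rounds :: com where
  "rounds = While (Less (Reg rcur) (Reg rits)) process"

lemma wp_process:
  assumes su: "bounds E V M D n" and inv: "rounds_inv E V D n s outs Cs Ps" and lt: "reg s rcur < reg s rits"
    and post: "\<And>s' T' outs' Cs' Ps'. rounds_inv E V D n s' outs' Cs' Ps' \<Longrightarrow>
      T' + reserve E M D s' Cs' Ps' + 10 \<le> T + reserve E M D s Cs Ps \<Longrightarrow> Q s' T'"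
  shows "wp process Q s T"
proof -
  define c where "c = reg s rcur"
  define k where "k = reg s rits"
  let ?C = "Cs c" and ?P = "Ps c" and ?Ls = "map Cs [Suc c..<k]"
  let ?F = "\<lambda>Cs Ps i. Phi E M D (Cs i) (Ps i)"
  have ck: "c < k" using lt by (simp add: c_def k_def)
  have S: "finite V" "V \<subseteq> {..<n}" "card V \<le> 2 * M" "finite E" "card E \<le> M" "1 \<le> D" "4 * M < 2 ^ (D + 2)"
    using su by (auto simp: bounds_def)
  have I: "settled s" "listed s outs" "reg s rD = D" "reg s rn = n" "cover E V outs (?C # ?Ls)"
    and it: "\<And>i. i \<in> {c..<k} \<Longrightarrow> item s E i (Cs i) (Ps i)"
    and pi: "\<And>i. i \<in> {c..<k} \<Longrightarrow> pend_inv E (Cs i) (Ps i) D"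
    using inv ck by (auto simp: rounds_inv_def c_def k_def upt_conv_Cons)
  have tot: "reserve E M D s Cs Ps = ?F Cs Ps c + sum (?F Cs Ps) {Suc c..<k}"
    using ck unfolding reserve_def c_def[symmetric] k_def[symmetric] by (rule sum.atLeast_Suc_lessThan)
  have sto: "store s" using I(1) by (simp add: settled_def)
  define s1 where "s1 = s\<lparr>reg := (reg s)(rvb := arr s aVB c, rab := arr s aAB c, rcur := Suc c,
    rve := arr s aVB (Suc c), rae := arr s aAB (Suc c))\<rparr>"
  have a1: "arr s1 = arr s" by (simp add: s1_def)
  have r1: "reg s1 rvb = arr s aVB c" "reg s1 rve = arr s aVB (Suc c)" "reg s1 rab = arr s aAB c"
    "reg s1 rae = arr s aAB (Suc c)" "reg s1 rcur = Suc c" by (simp_all add: s1_def)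
  have r1': "reg s1 r = reg s r" if "r \<notin> {rvb, rve, rab, rae, rcur}" for r using that by (simp add: s1_def)
  have itm: "item s1 E i X P = item s E i X P" for i X P
    unfolding item_def seg_def a1 ..
  have "seg s1 E (reg s1 rvb) (reg s1 rve) (reg s1 rab) (reg s1 rae) ?C ?P"
    using it[of c] ck itm unfolding r1 by (simp add: item_def a1)
  then have c1: "comp s1 E ?C" and P1: "?P = arr s1 aV ` pend s1" unfolding seg_comp by auto
  have st1: "settled s1" using I(1) r1' a1 by (simp add: settled_def store_def)
  have li1: "listed s1 outs" using I(2) r1' a1 by (simp add: listed_def)
  have b1: "reg s1 rve \<le> reg s1 rvt" "reg s1 rae \<le> reg s1 rat"
    using sto ck r1' unfolding r1 by (simp_all add: store_def k_def)
  have CV: "?C \<subseteq> V" using I(5) by (simp add: cover_def)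
  have finC: "finite ?C" using CV S(1) by (rule finite_subset)
  have C1: "?C = arr s aV ` {reg s1 rvb..<reg s1 rve}" "inj_on (arr s aV) {reg s1 rvb..<reg s1 rve}"
    "inj_on (\<lambda>e. (arr s aT e, arr s aH e)) {reg s1 rab..<reg s1 rae}"
    "(\<lambda>e. (arr s aT e, arr s aH e)) ` {reg s1 rab..<reg s1 rae} = E \<inter> ?C \<times> ?C"
    using c1 by (auto simp: comp_def a1)
  have cardC: "card ?C = reg s1 rve - reg s1 rvb" using C1 by (simp add: card_image)
  have cardE: "card (E \<inter> ?C \<times> ?C) = reg s1 rae - reg s1 rab" using C1(4)[symmetric] C1(3) by (simp add: card_image)
  have n1: "card ?C \<le> 2 * M" using card_mono[OF S(1) CV] S(3) by simp
  have n2: "reg s1 rae - reg s1 rab \<le> M"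
    using card_mono[OF S(4), of "E \<inter> ?C \<times> ?C"] S(5) by (simp add: cardE)
  have n3: "card ?C \<le> reg s1 rn" using card_mono[of "{..<n}" ?C] CV S(2) I(4) r1' by auto
  have n4: "reg s1 rn \<notin> ?C" using CV S(2) I(4) r1' by auto
  have VBm: "reg s1 rve \<le> arr s1 aVB i" if "i \<in> {Suc c..<k}" for i
    using sto that unfolding r1 a1 by (simp add: store_def k_def)
  \<comment> \<open>The summand 100 of \<open>phi\<close> pays for loading a component and for
    dropping it if it has fewer than three vertices.\<close>
  have Phi100: "100 \<le> Phi E M D ?C ?P" by (simp add: Phi_def phi_def)
  have ri1: "reg s1 rits = k" using r1'[of rits] by (simp add: k_def)
  have goal: "wp (If1 (Less (Num 2) (Bin Sub (Reg rve) (Reg rvb))) examine) Q s1 T1" if T1: "T1 \<le> T + 30" for T1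
  proof (cases "2 < reg s1 rve - reg s1 rvb")
    case False
    have "rounds_inv E V D n s1 outs Cs Ps"
      unfolding rounds_inv_def r1(5) ri1
      using st1 li1 I(3,4) r1' ck cover_drop[OF I(5) _ S(1)] False cardC it pi itm by auto
    moreover have "reserve E M D s1 Cs Ps = sum (?F Cs Ps) {Suc c..<k}"
      by (simp add: reserve_def r1(5) ri1)
    ultimately show ?thesis using False T1 Phi100 tot by (simp add: post)
  next
    case True
    have n0: "3 \<le> card ?C" using True cardC by simp
    have ex: "wp examine Q s1 T2" if T2: "T2 \<le> T + 40" for T2
    proof (rule wp_examine[OF c1 b1 st1 li1 _ _ S(6) n0 n1 n2 n3 n4 S(7)])
      show "pend_inv E ?C (arr s1 aV ` pend s1) D" using pi[of c] ck P1 by simp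
      show "reg s1 rD = D" using I(3) r1' by simp
    next
      fix s' T' assume *: "succ E s1 s'" "good E ?C" "reg s' rits = reg s1 rits"
        "listed s' (outs @ [map (arr s1 aV) [reg s1 rvb..<reg s1 rve]])"
        "T' + 100 \<le> T2 + Phi E M D ?C (arr s1 aV ` pend s1)"
      let ?o = "map (arr s1 aV) [reg s1 rvb..<reg s1 rve]"
      have co: "cover E V (outs @ [?o]) ?Ls"
        by (rule cover_emit[OF I(5) *(2)]) (use C1 a1 in \<open>auto simp: distinct_map\<close>)
      have r': "reg s' rcur = Suc c" "reg s' rits = k" "reg s' rD = D" "reg s' rn = n"
        using *(1,3) r1 r1' I(3,4) ri1 by (simp_all add: succ_def)
      have "item s' E i (Cs i) (Ps i)" if i: "i \<in> {Suc c..<k}" for i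
        using *(1) it[of i] VBm[OF i] i unfolding succ_def ri1 itm by auto
      then have "rounds_inv E V D n s' (outs @ [?o]) Cs Ps"
        unfolding rounds_inv_def r' using *(1,4) co pi ck by (auto simp: succ_def)
      moreover have "reserve E M D s' Cs Ps = sum (?F Cs Ps) {Suc c..<k}"
        by (simp add: reserve_def r')
      ultimately show "Q s' T'" using *(5) T2 tot P1 by (intro post) auto
    next
      fix s' T' x A P1' P2'
      assume *: "succ E s1 s'" "sepx E ?C x A" "reg s' rits = Suc (Suc (reg s1 rits))" "listed s' outs"
        "item s' E (reg s1 rits) (A \<union> (?C \<inter> {x})) P1'" "item s' E (Suc (reg s1 rits)) (?C - A) P2'"
        "pend_inv E (A \<union> (?C \<inter> {x})) P1' D" "pend_inv E (?C - A) P2' D"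
        "T' + Phi E M D (A \<union> (?C \<inter> {x})) P1' + Phi E M D (?C - A) P2' + 100 \<le>
          T2 + Phi E M D ?C (arr s1 aV ` pend s1)"
      define Cs' where "Cs' = Cs(k := A \<union> (?C \<inter> {x}), Suc k := ?C - A)"
      define Ps' where "Ps' = Ps(k := P1', Suc k := P2')"
      have old: "Cs' i = Cs i" "Ps' i = Ps i" if "i < k" for i using that by (simp_all add: Cs'_def Ps'_def)
      have new: "Cs' k = A \<union> (?C \<inter> {x})" "Ps' k = P1'" "Cs' (Suc k) = ?C - A" "Ps' (Suc k) = P2'"
        by (simp_all add: Cs'_def Ps'_def)
      have r': "reg s' rcur = Suc c" "reg s' rits = Suc (Suc k)" "reg s' rD = D" "reg s' rn = n"
        using *(1,3) r1 r1' I(3,4) ri1 by (simp_all add: succ_def)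
      have m': "map Cs' [Suc c..<Suc (Suc k)] = ?Ls @ [A \<union> (?C \<inter> {x}), ?C - A]"
      proof -
        have "map Cs' [Suc c..<k] = ?Ls" using old by (intro map_cong) auto
        then show ?thesis using ck new by simp
      qed
      have it': "item s' E i (Cs' i) (Ps' i) \<and> pend_inv E (Cs' i) (Ps' i) D"
        if i: "i \<in> {Suc c..<Suc (Suc k)}" for i
      proof -
        consider "i = k" | "i = Suc k" | "i \<in> {Suc c..<k}" using i by force
        then show ?thesis
        proof cases
          case 3
          then have "item s' E i (Cs i) (Ps i)"
            using *(1) it[of i] VBm[OF 3] unfolding succ_def ri1 itm by auto
          then show ?thesis using old pi[of i] 3 by simp
        qed (use * new ri1 in auto)
      qed
      have "rounds_inv E V D n s' outs Cs' Ps'"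
        unfolding rounds_inv_def r' m' using *(1,4) cover_split[OF I(5) *(2) S(1)] it' ck by (auto simp: succ_def)
      moreover have "reserve E M D s' Cs' Ps' = sum (?F Cs Ps) {Suc c..<k} + Phi E M D (A \<union> (?C \<inter> {x})) P1' + Phi E M D (?C - A) P2'"
      proof -
        have "sum (?F Cs' Ps') {Suc c..<k} = sum (?F Cs Ps) {Suc c..<k}"
          using old by (intro sum.cong) auto
        then show ?thesis using ck new by (simp add: reserve_def r')
      qed
      ultimately show "Q s' T'" using *(9) T2 tot P1 by (intro post) auto
    qed
    show ?thesis
      apply (subst wp_Cond)
      apply (simp add: True)
      apply (rule ex)
      using T1 by simp
  qed
  show ?thesis
    unfolding process_def load_def
    apply (subst wp_Seq, subst wp_Seq, subst wp_Assign, subst wp_Seq, subst wp_Assign, subst wp_Seq,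
        subst wp_Assign, subst wp_Seq, subst wp_Assign, subst wp_Assign)
    apply (rule wp_state_eq[OF goal])
     apply simp
    by (simp add: s1_def c_def fun_eq_iff)
qed

lemma wp_rounds:
  assumes su: "bounds E V M D n" and inv: "rounds_inv E V D n s outs Cs Ps"
    and post: "\<And>s' T' outs'. listed s' outs' \<Longrightarrow> cover E V outs' [] \<Longrightarrow>
      T' \<le> T + reserve E M D s Cs Ps + 10 \<Longrightarrow> Q s' T'"
  shows "wp rounds Q s T"
  unfolding rounds_def
proof (rule wp_While[where B = "T + reserve E M D s Cs Ps" and
      I = "\<lambda>s' T'. \<exists>outs' Cs' Ps'. rounds_inv E V D n s' outs' Cs' Ps' \<and>
        T' + reserve E M D s' Cs' Ps' \<le> T + reserve E M D s Cs Ps"])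
  let ?I = "\<lambda>s' T'. \<exists>outs' Cs' Ps'. rounds_inv E V D n s' outs' Cs' Ps' \<and>
        T' + reserve E M D s' Cs' Ps' \<le> T + reserve E M D s Cs Ps"
  let ?b = "Less (Reg rcur) (Reg rits)"
  show "?I s T" using inv by auto
  fix s1 T1 assume "?I s1 T1"
  then obtain outs1 Cs1 Ps1 where I1: "rounds_inv E V D n s1 outs1 Cs1 Ps1"
    and T1: "T1 + reserve E M D s1 Cs1 Ps1 \<le> T + reserve E M D s Cs Ps" by blast
  show "T1 \<le> T + reserve E M D s Cs Ps" using T1 by linarith
  show "wp process ?I s1 (T1 + (bcost ?b + 1))" if b: "bval s1 ?b"
  proof (rule wp_process[OF su I1])
    show "reg s1 rcur < reg s1 rits" using b by simp
    fix s' T' outs' Cs' Ps'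
    assume "rounds_inv E V D n s' outs' Cs' Ps'"
      and "T' + reserve E M D s' Cs' Ps' + 10 \<le> T1 + (bcost ?b + 1) + reserve E M D s1 Cs1 Ps1"
    moreover from this(2) have "T' + reserve E M D s' Cs' Ps' \<le> T + reserve E M D s Cs Ps" using T1 by simp
    ultimately show "?I s' T'" by blast
  qed
  show "Q s1 (T1 + (bcost ?b + 1))" if b: "\<not> bval s1 ?b"
  proof (rule post)
    show "listed s1 outs1" using I1 by (simp add: rounds_inv_def)
    show "cover E V outs1 []" using I1 b by (simp add: rounds_inv_def)
    show "T1 + (bcost ?b + 1) \<le> T + reserve E M D s Cs Ps + 10" using T1 by simp
  qed
qed

section \<open>Input\<close>

text \<open>Vertices are collected from the arcs, with \<open>ain1\<close> marking those already
  present. No loop runs over all \<open>n\<close> of them, since for \<open>m = 0\<close> the bound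
  leaves only constant time.\<close>

definition enlist :: "nat \<Rightarrow> com" where
  "enlist r = If1 (Equal (Arr ain1 (Reg r)) (Num 0))
    (Store ain1 (Reg r) (Num 1) ;; Store aV (Reg rvt) (Reg r) ;; Store aP (Reg rvt) (Num 1) ;; incr rvt)"

definition read_arcs :: com where
  "read_arcs = While (Less (Reg rp) (Reg rm))
    (rj ::= Arr 0 (Reg rp) ;; rw ::= Arr 1 (Reg rp) ;;
     If1 (Neg (Equal (Reg rj) (Reg rw)))
       (Store aT (Reg rat) (Reg rj) ;; Store aH (Reg rat) (Reg rw) ;; incr rat ;; enlist rj ;; enlist rw) ;;
     incr rp)"

definition halve :: com where
  "halve = While (Less (Num 0) (Reg ru)) (ru ::= Bin Div (Reg ru) (Num 2) ;; incr rD)"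

definition init :: com where
  "init = (rat ::= Num 1 ;; read_arcs ;; rits ::= Num 1 ;; Store aAB (Num 0) (Num 1) ;;
     Store aVB (Num 1) (Reg rvt) ;; Store aAB (Num 1) (Reg rat) ;; ru ::= Reg rm ;; rD ::= Num 1 ;; halve)"

lemma wr_enlist [simp]: "wr (enlist r) = {rvt}"
  by (auto simp: enlist_def)

lemma wa_enlist [simp]: "wa (enlist r) = {ain1, aV, aP}"
  by (auto simp: enlist_def)

lemma wr_read_arcs [simp]: "wr read_arcs = {rj, rw, rat, rvt, rp}"
  by (auto simp: read_arcs_def)

lemma wa_read_arcs [simp]: "wa read_arcs = {aT, aH, ain1, aV, aP}"
  by (auto simp: read_arcs_def)

lemma wr_halve [simp]: "wr halve = {ru, rD}"
  by (auto simp: halve_def)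

lemma wa_halve [simp]: "wa halve = {}"
  by (auto simp: halve_def)

text \<open>\<open>2 ^ (D + 2)\<close> exceeds \<open>4 * m\<close>, a bound on the weight of every
  component, as \<open>gcost_le\<close> demands, while \<open>2 ^ D \<le> 4 * m\<close> keeps
  \<open>D\<close> small enough for \<open>local_cost_le\<close>. The alternative
  \<open>D = 1\<close> covers \<open>m = 0\<close>. Linear time is ample, since halving lowers a
  positive number by at least 1.\<close>

lemma wp_halve:
  assumes u: "reg s ru = m" "reg s rD = 1"
    and post: "\<And>s' T'. same {ru, rD} {} s s' \<Longrightarrow> 1 \<le> reg s' rD \<Longrightarrow> 4 * m < 2 ^ (reg s' rD + 2) \<Longrightarrow>
      reg s' rD = 1 \<or> 2 ^ reg s' rD \<le> 4 * m \<Longrightarrow> T' \<le> T + 20 * m + 10 \<Longrightarrow> Q s' T'"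
  shows "wp halve Q s T"
proof -
  let ?b = "Less (Num 0) (Reg ru)"
  let ?c = "ru ::= Bin Div (Reg ru) (Num 2) ;; incr rD"
  let ?I = "\<lambda>(s1::state) T1. 1 \<le> reg s1 rD \<and> reg s1 ru * 2 ^ (reg s1 rD - 1) \<le> m \<and>
    m < (reg s1 ru + 1) * 2 ^ (reg s1 rD - 1) \<and> (reg s1 rD = 1 \<or> 2 ^ reg s1 rD \<le> 4 * m) \<and>
    T1 + 20 * reg s1 ru \<le> T + 20 * m"
  show ?thesis
    unfolding halve_def
  proof (rule wp_While[where B = "T + 20 * m" and I = ?I])
    show "?I s T" using u by simp
    fix s1 T1 assume I: "?I s1 T1" and sm: "same (wr ?c) (wa ?c) s s1"
    show "T1 \<le> T + 20 * m" using I by linarith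
    show "wp ?c ?I s1 (T1 + (bcost ?b + 1))" if "bval s1 ?b"
    proof -
      obtain k where k: "reg s1 rD = Suc k" using I by (cases "reg s1 rD") auto
      define u where "u = reg s1 ru"
      have u0: "0 < u" using that by (simp add: u_def)
      have I': "u * 2 ^ k \<le> m" "m < (u + 1) * 2 ^ k" "T1 + 20 * u \<le> T + 20 * m"
        using I k by (simp_all add: u_def)
      have d: "2 * (u div 2) \<le> u" "u + 1 \<le> 2 * (u div 2 + 1)" by presburger+
      have "2 * (u div 2) * 2 ^ k \<le> u * 2 ^ k" using d by (intro mult_le_mono1)
      moreover have "u div 2 * 2 ^ Suc k = 2 * (u div 2) * 2 ^ k" by (simp add: ac_simps)
      ultimately have 1: "u div 2 * 2 ^ Suc k \<le> m" using I'(1) by linarith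
      have "(u + 1) * 2 ^ k \<le> 2 * (u div 2 + 1) * 2 ^ k" using d by (intro mult_le_mono1)
      moreover have "(u div 2 + 1) * 2 ^ Suc k = 2 * (u div 2 + 1) * 2 ^ k" by (simp add: algebra_simps)
      ultimately have 2: "m < (u div 2 + 1) * 2 ^ Suc k" using I'(2) by linarith
      have "1 * 2 ^ k \<le> u * (2::nat) ^ k" using u0 by (intro mult_le_mono1) linarith
      from le_trans[OF this I'(1)] have 3: "2 ^ Suc (Suc k) \<le> 4 * m" by simp
      have "u div 2 + 1 \<le> u" using u0 by linarith
      then have 4: "T1 + 14 + 20 * (u div 2) \<le> T + 20 * m" using I' by linarith
      show ?thesis using 1 2 3 4 k by (simp add: u_def[symmetric])
    qed
    show "Q s1 (T1 + (bcost ?b + 1))" if "\<not> bval s1 ?b"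
    proof -
      have u0: "reg s1 ru = 0" using that by simp
      obtain k where k: "reg s1 rD = Suc k" using I by (cases "reg s1 rD") auto
      have "m < 2 ^ k" using I u0 k by simp
      then have "4 * m < 2 ^ (reg s1 rD + 2)" using k by simp
      then show ?thesis using sm I u0 by (intro post) (simp_all add: insert_commute)
    qed
  qed
qed

lemma wp_CondI: "bval s b \<Longrightarrow> wp c1 Q s (T + (bcost b + 1)) \<Longrightarrow> wp (Cond b c1 c2) Q s T"
  by simp

lemma wp_enlist:
  assumes e: "inj_on (arr s aV) {..<reg s rvt}" "arr s aV ` {..<reg s rvt} = X" "\<And>j. j < reg s rvt \<Longrightarrow> arr s aP j = 1"
      "\<And>v. arr s ain1 v = 0 \<longleftrightarrow> v \<notin> X"
    and post: "\<And>s' T'. same {rvt} {ain1, aV, aP} s s' \<Longrightarrow> inj_on (arr s' aV) {..<reg s' rvt} \<Longrightarrow>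
      arr s' aV ` {..<reg s' rvt} = insert (reg s r) X \<Longrightarrow> (\<And>j. j < reg s' rvt \<Longrightarrow> arr s' aP j = 1) \<Longrightarrow>
      (\<And>v. arr s' ain1 v = 0 \<longleftrightarrow> v \<notin> insert (reg s r) X) \<Longrightarrow> T' \<le> T + 30 \<Longrightarrow> Q s' T'"
    and r: "r \<noteq> rvt"
  shows "wp (enlist r) Q s T"
proof (cases "reg s r \<in> X")
  case True
  then have a: "arr s ain1 (reg s r) \<noteq> 0" using e(4) by blast
  show ?thesis
    unfolding enlist_def
    apply (simp add: a del: One_nat_def)
    apply (rule post)
    using e True by (simp_all add: insert_absorb)
next
  case False
  then have a: "arr s ain1 (reg s r) = 0" using e(4) by blast
  let ?n = "reg s rvt" and ?u = "reg s r"
  define s1 where "s1 = s\<lparr>arr := (arr s)(ain1 := (arr s ain1)(?u := 1), aV := (arr s aV)(?n := ?u),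
    aP := (arr s aP)(?n := 1)), reg := (reg s)(rvt := Suc ?n)\<rparr>"
  have im: "arr s1 aV ` {..<?n} = X" using e(2) by (auto simp: s1_def)
  have inj: "inj_on (arr s1 aV) {..<?n} = inj_on (arr s aV) {..<?n}"
    by (intro inj_on_cong) (auto simp: s1_def)
  have n1: "arr s1 aV ?n = ?u" "reg s1 rvt = Suc ?n" by (simp_all add: s1_def)
  have goal: "Q s1 T1" if "T1 \<le> T + 30" for T1
  proof (rule post)
    show "same {rvt} {ain1, aV, aP} s s1" by (simp add: same_def s1_def)
    show "inj_on (arr s1 aV) {..<reg s1 rvt}"
      unfolding n1 lessThan_Suc using e(1) inj im n1 False by simp
    show "arr s1 aV ` {..<reg s1 rvt} = insert ?u X"
      unfolding n1 lessThan_Suc image_insert im ..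
    show "arr s1 aP j = 1" if "j < reg s1 rvt" for j using that e(3)[of j] by (auto simp: s1_def)
    show "arr s1 ain1 v = 0 \<longleftrightarrow> v \<notin> insert ?u X" for v using e(4)[of v] by (simp add: s1_def)
    show "T1 \<le> T + 30" by fact
  qed
  show ?thesis
    unfolding enlist_def
    apply (simp add: a r)
    apply (rule back_subst[of "\<lambda>s. Q s _", OF goal])
    using r by (auto simp: s1_def fun_eq_iff)
qed

definition read_inv :: "(nat \<times> nat) list \<Rightarrow> state \<Rightarrow> bool" where
  "read_inv es s \<longleftrightarrow> 1 \<le> reg s rat \<and> inj_on (\<lambda>e. (arr s aT e, arr s aH e)) {1..<reg s rat} \<and>
     (\<lambda>e. (arr s aT e, arr s aH e)) ` {1..<reg s rat} = set es - Id \<and>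
     inj_on (arr s aV) {..<reg s rvt} \<and> arr s aV ` {..<reg s rvt} = Field (set es - Id) \<and>
     (\<forall>j<reg s rvt. arr s aP j = 1) \<and> (\<forall>v. arr s ain1 v = 0 \<longleftrightarrow> v \<notin> Field (set es - Id))"

lemma wp_read_arcs:
  assumes r: "reg s rp = 0" "reg s rm = length es" and dist: "distinct es"
    and es: "\<And>i. i < length es \<Longrightarrow> (arr s 0 i, arr s 1 i) = es ! i"
    and i0: "read_inv [] s"
    and post: "\<And>s' T'. same (wr read_arcs) (wa read_arcs) s s' \<Longrightarrow> read_inv es s' \<Longrightarrow>
      T' \<le> T + 120 * length es + 10 \<Longrightarrow> Q s' T'"
  shows "wp read_arcs Q s T"
proof -
  let ?b = "Less (Reg rp) (Reg rm)"
  let ?c = "rj ::= Arr 0 (Reg rp) ;; rw ::= Arr 1 (Reg rp) ;;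
     If1 (Neg (Equal (Reg rj) (Reg rw)))
       (Store aT (Reg rat) (Reg rj) ;; Store aH (Reg rat) (Reg rw) ;; incr rat ;; enlist rj ;; enlist rw) ;;
     incr rp"
  define I where "I = (\<lambda>(s1::state) T1. reg s1 rp \<le> length es \<and> read_inv (take (reg s1 rp) es) s1 \<and>
    T1 \<le> T + 120 * reg s1 rp)"
  show ?thesis
    unfolding read_arcs_def
  proof (rule wp_While[where B = "T + 120 * length es" and I = I])
    show "I s T" using r i0 by (simp add: I_def)
    fix s1 T1 assume I1: "I s1 T1" and sm: "same (wr ?c) (wa ?c) s s1"
    have fr: "reg s1 rm = length es" "arr s1 0 = arr s 0" "arr s1 1 = arr s 1"
      using sameD[OF sm] r by auto
    let ?p = "reg s1 rp"
    have p: "?p \<le> length es" and ri: "read_inv (take ?p es) s1" and T1: "T1 \<le> T + 120 * ?p"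
      using I1 by (auto simp: I_def)
    show "T1 \<le> T + 120 * length es" using p T1 by linarith
    show "wp ?c I s1 (T1 + (bcost ?b + 1))" if b: "bval s1 ?b"
    proof -
      have lt: "?p < length es" using b fr by simp
      define t h where "t = arr s 0 ?p" and "h = arr s 1 ?p"
      have th: "es ! ?p = (t, h)" using es[OF lt] by (simp add: t_def h_def)
      have tk: "take (Suc ?p) es = take ?p es @ [(t, h)]" using lt th by (simp add: take_Suc_conv_app_nth)
      have new: "(t, h) \<notin> set (take ?p es)"
        using dist lt tk distinct_take[OF dist, of "Suc ?p"] by simp
      show ?thesis
      proof (cases "t = h")
        case True
        then have "set (take (Suc ?p) es) - Id = set (take ?p es) - Id" by (auto simp: tk)
        then have ri': "read_inv (take (Suc ?p) es) s1" using ri by (simp add: read_inv_def)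
        have ri2: "read_inv (take (Suc ?p) es) (s1\<lparr>reg := (reg s1)(rj := t, rw := h, rp := Suc ?p)\<rparr>)"
          using ri' by (simp add: read_inv_def)
        have eq: "arr s (Suc 0) ?p = arr s 0 ?p" using True by (simp add: t_def h_def)
        show ?thesis
          using ri2 lt T1 True fr by (simp add: I_def t_def h_def eq fun_upd_twist)
      next
        case False
        let ?n = "reg s1 rat" and ?X = "Field (set (take ?p es) - Id)"
        define s2 where "s2 = s1\<lparr>arr := (arr s1)(aT := (arr s1 aT)(?n := t), aH := (arr s1 aH)(?n := h)),
          reg := (reg s1)(rj := t, rw := h, rat := Suc ?n)\<rparr>"
        let ?F = "\<lambda>s e. (arr s aT e, arr s aH e)"
        have R: "1 \<le> ?n" "inj_on (?F s1) {1..<?n}" "?F s1 ` {1..<?n} = set (take ?p es) - Id"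
          "inj_on (arr s1 aV) {..<reg s1 rvt}" "arr s1 aV ` {..<reg s1 rvt} = ?X"
          "\<And>j. j < reg s1 rvt \<Longrightarrow> arr s1 aP j = 1" "\<And>v. arr s1 ain1 v = 0 \<longleftrightarrow> v \<notin> ?X"
          using ri by (auto simp: read_inv_def)
        have rn: "{1..<Suc ?n} = insert ?n {1..<?n}" using R(1) by auto
        have im: "?F s2 ` {1..<?n} = set (take ?p es) - Id"
        proof -
          have "?F s2 ` {1..<?n} = ?F s1 ` {1..<?n}" by (intro image_cong) (auto simp: s2_def)
          then show ?thesis using R(3) by simp
        qed
        have F2: "?F s2 ?n = (t, h)" by (simp add: s2_def)
        have se: "set (take (Suc ?p) es) - Id = insert (t, h) (set (take ?p es) - Id)"
          using False by (auto simp: tk)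
        have im2: "?F s2 ` {1..<Suc ?n} = set (take (Suc ?p) es) - Id"
          unfolding rn image_insert F2 im se ..
        have inj2: "inj_on (?F s2) {1..<Suc ?n}"
        proof -
          have "inj_on (?F s2) {1..<?n} = inj_on (?F s1) {1..<?n}" by (intro inj_on_cong) (auto simp: s2_def)
          then show ?thesis unfolding rn inj_on_insert using R(2) im F2 new by auto
        qed
        have fi: "Field (set (take (Suc ?p) es) - Id) = insert h (insert t ?X)"
          unfolding se by (auto simp: Field_def)
        have a2: "arr s2 aV = arr s1 aV" "arr s2 aP = arr s1 aP" "arr s2 ain1 = arr s1 ain1"
          "reg s2 rvt = reg s1 rvt" "reg s2 rj = t" "reg s2 rw = h" "reg s2 rat = Suc ?n" "reg s2 rp = ?p"
          by (simp_all add: s2_def)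
        have goal: "wp (enlist rj ;; enlist rw) (wp (incr rp) I) s2 T2" if T2: "T2 \<le> T1 + 50" for T2
          apply (subst wp_Seq)
          apply (rule wp_enlist[where X = ?X])
               apply (use R a2 in simp_all)[4]
          subgoal premises q for s3 T3
          proof -
            have r3: "reg s3 rw = h" using sameD[OF q(1)] a2 by auto
            show ?thesis
              apply (rule wp_enlist[where X = "insert t ?X"])
                   apply (use q a2 in simp_all)[4]
              subgoal premises u for s4 T4
              proof -
                have sm4: "same {rvt} {ain1, aV, aP} s2 s4" using same_trans[OF q(1) u(1)] .
                have f4: "reg s4 rat = Suc ?n" "reg s4 rp = ?p" "arr s4 aT = arr s2 aT" "arr s4 aH = arr s2 aH"
                  using sameD[OF sm4] a2 by auto
                let ?s = "s4\<lparr>reg := (reg s4)(rp := Suc ?p)\<rparr>"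
                have "read_inv (take (Suc ?p) es) ?s"
                  unfolding read_inv_def fi
                  using R(1) inj2 im2 u f4 r3 by simp
                moreover have "T4 + 4 \<le> T + 120 * Suc ?p" using u(6) q(6) T2 T1 by simp
                ultimately show ?thesis using lt f4 by (simp add: I_def)
              qed
              by simp
          qed
          by simp
        have goal': "wp (Store aT (Reg rat) (Reg rj) ;; Store aH (Reg rat) (Reg rw) ;; incr rat ;; enlist rj ;; enlist rw)
            (wp (incr rp) I) s3 T3"
          if s3: "s3 = s1\<lparr>reg := (reg s1)(rj := t, rw := h)\<rparr>" and "T3 \<le> T1 + 30" for s3 T3
          apply (subst wp_Seq, subst wp_Store, subst wp_Seq, subst wp_Store, subst wp_Seq, subst wp_Assign)
          apply (rule wp_state_eq[OF goal])
           apply (use that in simp)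
          by (simp add: s2_def s3 fun_eq_iff)
        show ?thesis
          apply (subst wp_Seq, subst wp_Assign, subst wp_Seq, subst wp_Assign, subst wp_Seq)
          apply (rule wp_CondI)
           apply (use False fr in \<open>simp add: t_def h_def\<close>)
          apply (rule goal')
           apply (simp add: fr[unfolded One_nat_def] t_def h_def fun_eq_iff)
          by simp
      qed
    qed
    show "Q s1 (T1 + (bcost ?b + 1))" if b: "\<not> bval s1 ?b"
    proof (rule post)
      show "same (wr read_arcs) (wa read_arcs) s s1" using sm unfolding read_arcs_def by simp
      show "read_inv es s1" using ri p b fr by simp
      show "T1 + (bcost ?b + 1) \<le> T + 120 * length es + 10" using p T1 by simp
    qed
  qed
qed

lemma input_state_simps:
  "reg (input_state n es) r = (if r = rn then n else if r = rm then length es else 0)"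
  "a \<notin> {0, 1} \<Longrightarrow> arr (input_state n es) a i = 0"
  "i < length es \<Longrightarrow> (arr (input_state n es) 0 i, arr (input_state n es) 1 i) = es ! i"
  by (auto simp: input_state_def)

lemma wp_init:
  fixes es
  defines "E \<equiv> set es - Id"
  assumes dist: "distinct es"
    and post: "\<And>s' T'. \<lbrakk>rounds_inv E (Field E) (reg s' rD) n s' [] (\<lambda>_. Field E) (\<lambda>_. Field E);
      reg s' rcur = 0; reg s' rits = 1; 1 \<le> reg s' rD; 4 * length es < 2 ^ (reg s' rD + 2);
      reg s' rD = 1 \<or> 2 ^ reg s' rD \<le> 4 * length es; T' \<le> 140 * length es + 100\<rbrakk> \<Longrightarrow> Q s' T'"
  shows "wp init Q (input_state n es) 0"
proof -
  let ?s = "input_state n es" and ?V = "Field E"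
  note ins = input_state_simps
  let ?s0 = "?s\<lparr>reg := (reg ?s)(rat := 1)\<rparr>"
  have i0: "read_inv [] ?s0" by (simp add: read_inv_def ins)
  show ?thesis
    unfolding init_def
    apply (subst wp_Seq, subst wp_Assign, subst wp_Seq)
    apply (rule wp_read_arcs[where es = es])
         apply (simp add: ins)
        apply (simp add: ins)
       apply (rule dist)
      apply (use ins(3) in simp)
     apply (use i0 in simp)
    subgoal premises p for s1 T1
    proof -
      have f1: "reg s1 r = (if r = rn then n else if r = rm then length es else 0)"
        if "r \<notin> {rj, rw, rat, rvt, rp}" for r
        using sameD(1)[OF p(1), of r] that by (simp add: ins)
      have g1: "arr s1 a i = 0" if "a \<notin> {0, 1, aT, aH, ain1, aV, aP}" for a i
        using sameD(2)[OF p(1), of a] that by (simp add: ins)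
      let ?F = "\<lambda>e. (arr s1 aT e, arr s1 aH e)"
      have R: "1 \<le> reg s1 rat" "inj_on ?F {1..<reg s1 rat}" "?F ` {1..<reg s1 rat} = E"
          "inj_on (arr s1 aV) {..<reg s1 rvt}" "arr s1 aV ` {..<reg s1 rvt} = ?V"
          "\<And>j. j < reg s1 rvt \<Longrightarrow> arr s1 aP j = 1"
        using p(2) by (auto simp: read_inv_def E_def)
      define s2 where "s2 = s1\<lparr>reg := (reg s1)(rits := 1, ru := length es, rD := 1),
        arr := (arr s1)(aAB := (arr s1 aAB)(0 := 1, 1 := reg s1 rat), aVB := (arr s1 aVB)(1 := reg s1 rvt))\<rparr>"
      have T1: "T1 \<le> 120 * length es + 20" using p(3) by simp
      have goal: "wp halve Q s2 T2" if T2: "T2 \<le> T1 + 40" for T2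
      proof (rule wp_halve[where m = "length es"])
        show "reg s2 ru = length es" "reg s2 rD = 1" by (simp_all add: s2_def)
        fix s3 T3
        assume h: "same {ru, rD} {} s2 s3" "1 \<le> reg s3 rD" "4 * length es < 2 ^ (reg s3 rD + 2)"
          "reg s3 rD = 1 \<or> 2 ^ reg s3 rD \<le> 4 * length es" "T3 \<le> T2 + 20 * length es + 10"
        have a3: "arr s3 = arr s2" using sameD(2)[OF h(1)] by auto
        have ar: "arr s3 aV = arr s1 aV" "arr s3 aP = arr s1 aP" "arr s3 aT = arr s1 aT" "arr s3 aH = arr s1 aH"
          "arr s3 aAB = (arr s1 aAB)(0 := 1, 1 := reg s1 rat)" "arr s3 aVB = (arr s1 aVB)(1 := reg s1 rvt)"
          "arr s3 2 = arr s1 2" "arr s3 3 = arr s1 3" "arr s3 amk = arr s1 amk" "arr s3 acl = arr s1 acl"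
          unfolding a3 by (simp_all add: s2_def)
        have rr: "reg s3 rits = 1" "reg s3 rvt = reg s1 rvt" "reg s3 rat = reg s1 rat"
          using sameD(1)[OF h(1)] by (simp_all add: s2_def)
        have rr0: "reg s3 r = (if r = rn then n else if r = rm then length es else 0)"
          if "r \<notin> {rits, rvt, rat, rj, rw, rp, ru, rD}" for r
          using sameD(1)[OF h(1), of r] f1[of r] that by (simp add: s2_def)
        have VB: "arr s3 aVB 0 = 0" "arr s3 aVB 1 = reg s1 rvt" "arr s3 aAB 0 = 1" "arr s3 aAB 1 = reg s1 rat"
          unfolding ar using g1 by simp_all
        have st: "store s3"
          unfolding store_def rr
          using VB[unfolded One_nat_def] R(1) by (auto simp: le_Suc_eq)
        have se: "settled s3" using st g1 rr0 by (simp add: settled_def ar)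
        have li: "listed s3 []" using g1 rr0 by (simp add: listed_def ar)
        have it: "item s3 E 0 ?V ?V"
          unfolding item_def seg_def One_nat_def[symmetric] VB ar(1-4)
        proof (intro conjI)
          show "?V = arr s1 aV ` {0..<reg s1 rvt}" using R(5) by (simp add: lessThan_atLeast0)
          show "inj_on (arr s1 aV) {0..<reg s1 rvt}" using R(4) by (simp add: lessThan_atLeast0)
          show "?F ` {1..<reg s1 rat} = E \<inter> ?V \<times> ?V" unfolding R(3) by (auto simp: Field_def)
          show "E \<inter> Id = {}" by (auto simp: E_def)
          have "{j \<in> {0..<reg s1 rvt}. arr s1 aP j = 1} = {..<reg s1 rvt}" using R(6) by auto
          then show "?V = arr s1 aV ` {j \<in> {0..<reg s1 rvt}. arr s1 aP j = 1}" using R(5) by simp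
        qed (use R in auto)
        have pi: "pend_inv E ?V ?V D" for D unfolding pend_inv_def sepx_def by blast
        have co: "cover E ?V [] [?V]" by (simp add: cover_def)
        show "Q s3 T3"
        proof (rule post)
          show "rounds_inv E ?V (reg s3 rD) n s3 [] (\<lambda>_. ?V) (\<lambda>_. ?V)"
            unfolding rounds_inv_def rr using se li it pi co rr0 by simp
          show "T3 \<le> 140 * length es + 100" using h(5) T2 T1 by simp
        qed (use h rr rr0 in simp_all)
      qed
      show ?thesis
        apply (subst wp_Seq, subst wp_Assign, subst wp_Seq, subst wp_Store, subst wp_Seq, subst wp_Store,
            subst wp_Seq, subst wp_Store, subst wp_Seq, subst wp_Assign, subst wp_Seq, subst wp_Assign)
        apply (rule wp_state_eq[OF goal])
         apply simp
        using f1 by (simp add: s2_def fun_eq_iff)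
    qed
    done
qed

section \<open>The bound\<close>

text \<open>The sixth power is the square of the cube that dominates \<open>local_cost\<close>; it
  is compared with \<open>2 ^ D\<close> because \<open>2 ^ D\<close> is bounded by a multiple of
  \<open>n^2\<close>.\<close>

lemma power6_le: "(D + 3) ^ 6 \<le> 10000 * 2 ^ D" for D :: nat
proof (cases "D < 6")
  case True
  then have "D \<in> {0, 1, 2, 3, 4, 5}" by auto
  then show ?thesis by auto
next
  case False
  then have "6 \<le> D" by simp
  then show ?thesis
  proof (induction D rule: dec_induct)
    case (step D)
    \<comment> \<open>From \<open>D = 6\<close> on, \<open>D + 3\<close> grows by a factor of at
      most 10/9 per step, and \<open>(10/9)^6 < 2\<close>.\<close>
    have "(9 * (D + 4)) ^ 6 \<le> (10 * (D + 3)) ^ 6" using step by (intro power_mono) auto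
    then have "531441 * (D + 4) ^ 6 \<le> 1000000 * (D + 3) ^ 6" unfolding power_mult_distrib by simp
    then have "(D + 4) ^ 6 \<le> 2 * (D + 3) ^ 6" by linarith
    then have "(D + 4) ^ 6 \<le> 10000 * (2 * 2 ^ D)" using step.IH by linarith
    moreover have "Suc D + 3 = D + 4" by simp
    ultimately show ?case by (simp only: power_Suc)
  qed simp
qed

text \<open>Here \<open>m \<le> n^2\<close> enters: \<open>2 ^ D\<close> is \<open>O(n^2)\<close>,
  so \<open>(D + 3)^3\<close>, the square root of a sixth power, is \<open>O(n)\<close>. The
  constant is \<open>600 * 200\<close>, where \<open>40000 = 200^2\<close>.\<close>

lemma local_cost_le:
  assumes D: "D = 1 \<or> 2 ^ D \<le> 4 * m" and m: "m \<le> n ^ 2" "1 \<le> n"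
  shows "local_cost D \<le> 120000 * n"
proof -
  have n2: "1 \<le> n ^ 2" using m(2) by simp
  have "2 ^ D \<le> 4 * n ^ 2"
  proof (cases "D = 1")
    case True
    then show ?thesis using n2 by simp
  next
    case False
    then show ?thesis using D m by linarith
  qed
  then have "(D + 3) ^ 6 \<le> 40000 * n ^ 2" using power6_le[of D] by linarith
  then have "((D + 3) ^ 3) ^ 2 \<le> (200 * n) ^ 2" by (simp add: power_mult_distrib power_mult[symmetric])
  then have c: "(D + 3) ^ 3 \<le> 200 * n" using power2_le_imp_le by blast
  let ?e = "D + 3"
  have e1: "?e \<le> ?e ^ 3" by (rule self_le_power) auto
  have "(D + 2) * (60 * ((D + 1) * (D + 3)) + 200) \<le> ?e * (60 * (?e * ?e) + 200)"
    by (intro mult_le_mono add_le_mono) auto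
  also have "\<dots> = 60 * ?e ^ 3 + 200 * ?e" by (simp add: power3_eq_cube algebra_simps)
  finally have "local_cost D \<le> 120 * ?e ^ 3 + 400 * ?e + 60" unfolding local_cost_def by linarith
  moreover have "120 * x + 400 * y + 60 \<le> 600 * x" if "y \<le> x" "3 \<le> y" for x y :: nat
    using that by linarith
  from this[OF e1] have "120 * ?e ^ 3 + 400 * ?e + 60 \<le> 600 * ?e ^ 3" by simp
  ultimately have "local_cost D \<le> 600 * ?e ^ 3" by (rule le_trans)
  then show ?thesis using c by linarith
qed

text \<open>Apart from the constant, each summand of \<open>phi\<close> is bounded by multiples of
  \<open>m * v\<close> and \<open>local_cost D * m\<close>. The former is at most
  \<open>n * m\<close> as \<open>v \<le> n\<close>, the latter is \<open>O(n * m)\<close> by the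
  bound on \<open>local_cost D\<close>. Factors linear in \<open>D\<close> are absorbed by
  \<open>D + 3 \<le> local_cost D\<close>.\<close>

lemma total_le:
  assumes v: "v \<le> n" "v \<le> 2 * m" "e \<le> m" and L: "local_cost D \<le> 120000 * n" and n: "1 \<le> n"
  shows "phi m D (rate m D) v e v \<le> 4000000000 * (n * m) + 100"
proof -
  let ?L = "local_cost D"
  have DL: "D + 3 \<le> ?L" unfolding local_cost_def by (simp add: algebra_simps)
  have r: "rate m D \<le> 1500 * m + 2005 * ?L" using DL unfolding rate_def by (simp add: algebra_simps)
  have "rate m D * (v - 2) \<le> (1500 * m + 2005 * ?L) * v" using r by (intro mult_le_mono) auto
  also have "\<dots> = 1500 * (m * v) + 2005 * (?L * v)" by (simp add: algebra_simps)
  finally have 1: "rate m D * (v - 2) \<le> 1500 * (m * v) + 2005 * (?L * v)" .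
  have "24000 * m * ((v - 1) - D) \<le> 24000 * m * v" by (intro mult_le_mono2) linarith
  then have 2: "24000 * m * ((v - 1) - D) \<le> 24000 * (m * v)" by simp
  have "2000 * (D + 2) * (v + 2 * e) \<le> 2000 * ?L * (4 * m)" using DL v by (intro mult_le_mono) auto
  then have 3: "2000 * (D + 2) * (v + 2 * e) \<le> 8000 * (?L * m)" by simp
  have "?L * (2 * e + v) \<le> ?L * (4 * m)" using v by (intro mult_le_mono2) linarith
  then have 4: "?L * (2 * e + v) \<le> 4 * (?L * m)" by simp
  have mv: "m * v \<le> n * m" using v(1) by simp
  have "?L * v \<le> ?L * (2 * m)" using v(2) by (intro mult_le_mono2)
  then have Lv: "?L * v \<le> 2 * (?L * m)" by simp
  have "?L * m \<le> 120000 * n * m" using L by (intro mult_le_mono1)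
  then have Lm: "?L * m \<le> 120000 * (n * m)" by simp
  show ?thesis unfolding phi_def using 1 2 3 4 mv Lv Lm by linarith
qed

section \<open>The theorem\<close>

definition vccs_program :: com where
  "vccs_program = (init ;; rounds ;; rn ::= Reg rno)"

text \<open>Every sum in the program adds a constant, there are no products, and 2 is the largest
  constant; so cells grow by at most 2 per step.\<close>

lemma lim_vccs_program: "lim 2 vccs_program"
  by (simp add: vccs_program_def scan_nb_def search_loop_def search_def copy_queue_def try_all_def
      local_search_def push_flag_def cross_nb_def race_step_def race_def recolor_def cross_def race_init_def
      promote_def promote_all_def clear_cols_def find_unflagged_def flat_test_def build_reset_def build_arcs_def
      build_def local_vertex_def local_loop_def flat_in_def flat_out_def search_both_def global_def copy_arcs_def
      copy_verts_def push_def mark_sides_def find_lost_def split_def emit_copy_def emit_def finish_def examine_def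
      load_def process_def rounds_def enlist_def read_arcs_def halve_def init_def)

text \<open>An isolated vertex would be separated from the rest of the set.\<close>

lemma good_subset_Field:
  assumes "good E B"
  shows "B \<subseteq> Field E"
proof
  fix v assume v: "v \<in> B"
  show "v \<in> Field E"
  proof (rule ccontr)
    assume nv: "v \<notin> Field E"
    have c: "3 \<le> card B" using assms by (simp add: good_def)
    then have fin: "finite B" using card.infinite by fastforce
    have "card (B - {v}) = card B - 1" using v fin by simp
    then have "card (B - {v}) \<noteq> 0" using c by linarith
    then have "B - {v} \<noteq> {}" by force
    then obtain x where x: "x \<in> B - {v}" by blast
    have "card (B - {v} - {x}) = card B - 2" using v x fin by simp
    then have "card (B - {v} - {x}) \<noteq> 0" using c by linarith
    then have "B - {v} - {x} \<noteq> {}" by force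
    moreover have "E \<inter> {v} \<times> (B - {v} - {x}) = {}" using nv by (auto simp: Field_def)
    ultimately have "sepx E B x {v}" using v x by (auto simp: sepx_def)
    then show False using assms by (auto simp: good_def)
  qed
qed

lemma output_lists_if_listed:
  assumes "listed s outs" "reg s 0 = reg s rno"
  shows "output_lists s = outs"
  using assms unfolding output_lists_def listed_def by (intro nth_equalityI) auto

lemma wp_vccs_program:
  fixes G :: "nat pair_pre_digraph"
  assumes G: "pair_fin_digraph G" "pverts G = {..<n}" and es: "distinct es" "set es = parcs G"
  shows "wp vccs_program (\<lambda>s T. T \<le> 5000000000 * (n * length es + 1) \<and>
    enumerates (output_lists s) (vccs 2 (with_proj G))) (input_state n es) 0"
proof -
  let ?m = "length es"
  define E where "E = set es - Id"
  let ?V = "Field E"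
  interpret pair_fin_digraph G by fact
  have EV: "(u, v) \<in> E \<Longrightarrow> u < n \<and> v < n" for u v
    using in_arcsD1[of u v] in_arcsD2[of u v] es G(2) by (auto simp: E_def)
  have V: "?V \<subseteq> {..<n}" using EV by (auto simp: Field_def)
  have finE: "finite E" by (simp add: E_def)
  have cE: "card E \<le> ?m"
    using card_mono[of "set es" E] card_length[of es] by (auto simp: E_def)
  have cV: "card ?V \<le> 2 * ?m"
  proof -
    have "?V = fst ` E \<union> snd ` E" by (force simp: Field_def)
    then have "card ?V \<le> card (fst ` E) + card (snd ` E)" by (simp add: card_Un_le)
    also have "\<dots> \<le> 2 * card E" using card_image_le[OF finE, of fst] card_image_le[OF finE, of snd] by simp
    finally show ?thesis using cE by simp
  qed
  have cn: "card ?V \<le> n" using card_mono[OF _ V] by simp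
  have mn: "?m \<le> n ^ 2"
  proof -
    have "set es \<subseteq> {..<n} \<times> {..<n}" using in_arcsD1 in_arcsD2 es G(2) by fastforce
    then have "card (set es) \<le> card ({..<n} \<times> {..<n})" by (intro card_mono) auto
    then show ?thesis using distinct_card[OF es(1)] by (simp add: power2_eq_square)
  qed
  have finV: "finite ?V" using V finite_subset by blast
  show ?thesis
    unfolding vccs_program_def
    apply (subst wp_Seq)
    apply (rule wp_init[OF es(1), folded E_def])
    subgoal premises p for s1 T1
    proof -
      let ?D = "reg s1 rD"
      have b: "bounds E ?V ?m ?D n" using finV V cV finE cE p(4,5) by (simp add: bounds_def)
      have r: "reserve E ?m ?D s1 (\<lambda>_. ?V) (\<lambda>_. ?V) \<le> 4000000000 * (n * ?m) + 100"
      proof -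
        have EE: "E \<inter> ?V \<times> ?V = E" by (auto simp: Field_def)
        have e: "reserve E ?m ?D s1 (\<lambda>_. ?V) (\<lambda>_. ?V) =
            phi ?m ?D (rate ?m ?D) (card ?V) (card E) (card ?V)"
          using p(2,3) by (simp add: reserve_def Phi_def EE)
        show ?thesis
        proof (cases "?m = 0")
          case True
          then have "E = {}" by (simp add: E_def)
          then show ?thesis unfolding e using True by (simp add: phi_def)
        next
          case False
          then have n1: "1 \<le> n" using mn by (cases n) auto
          show ?thesis
            unfolding e
            by (rule total_le[OF cn cV cE local_cost_le[OF p(6) mn n1] n1])
        qed
      qed
      show ?thesis
        apply (subst wp_Seq)
        apply (rule wp_rounds[OF b p(1)])
        subgoal premises q for s2 T2 outs
        proof -
          let ?s = "s2\<lparr>reg := (reg s2)(rn := reg s2 rno)\<rparr>"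
          have "output_lists ?s = outs"
            by (rule output_lists_if_listed) (use q(1) in \<open>simp_all add: listed_def\<close>)
          moreover have "enumerates outs (vccs 2 (with_proj G))"
          proof (rule enumerates_vccs_2[OF G(1)])
            have gd: "good (parcs G) X \<longleftrightarrow> good E X" for X using good_Diff_Id[of "parcs G" X] es by (simp add: E_def)
            show "distinct xs \<and> set xs \<subseteq> pverts G \<and> good (parcs G) (set xs)" if "xs \<in> set outs" for xs
              using q(2) that V G(2) by (auto simp: cover_def gd)
            show "\<exists>xs\<in>set outs. A \<subseteq> set xs" if "A \<subseteq> pverts G" "good (parcs G) A" for A
              using q(2) that(2) good_subset_Field[of E A] by (auto simp: cover_def gd)
            show "sorted_wrt (\<lambda>A B. card (A \<inter> B) \<le> 1) (map set outs)" using q(2) by (simp add: cover_def)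
          qed
          moreover have "T2 + 2 \<le> 5000000000 * (n * ?m + 1)"
          proof -
            have "?m \<le> n * ?m" using mn by (cases n) auto
            then have "T2 + 2 \<le> 5000000000 * (n * ?m) + 5000000000" using q(3) r p(7) by linarith
            then show ?thesis by simp
          qed
          ultimately show ?thesis by simp
        qed
        done
    qed
    done
qed

theorem theorem4:
  shows "\<exists>(c :: com) (d :: nat) (K :: nat). \<forall>(G :: nat pair_pre_digraph) (n :: nat) (m :: nat) es.
    pair_fin_digraph G \<and> card (pverts G) = n \<and> card (parcs G) = m \<and>
    pverts G = {..<n} \<and> distinct es \<and> set es = parcs G \<longrightarrow>
      (\<exists>t s. exec ((n + 2) ^ d) c (input_state n es) t s \<and>
             t \<le> K * (n * m + 1) \<and>
             enumerates (output_lists s) (vccs 2 (with_proj G)))"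
proof -
  obtain K :: nat where K: "K = 5000000000" by simp
  have main: "\<exists>t s. exec ((n + 2) ^ (2 * K + 4)) vccs_program (input_state n es) t s \<and>
             t \<le> K * (n * m + 1) \<and> enumerates (output_lists s) (vccs 2 (with_proj G))"
    if *: "pair_fin_digraph G" "card (parcs G) = m" "pverts G = {..<n}" "distinct es" "set es = parcs G"
    for G :: "nat pair_pre_digraph" and n m es
  proof -
    interpret pair_fin_digraph G by fact
    have m: "length es = m" using * distinct_card by fastforce
    have lt: "fst (es ! i) < n \<and> snd (es ! i) < n" if "i < length es" for i
    proof -
      have "(fst (es ! i), snd (es ! i)) \<in> parcs G" using that *(5) nth_mem by fastforce
      then show ?thesis using in_arcsD1 in_arcsD2 *(3) by blast
    qed
    have mn: "m \<le> n * n"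
    proof -
      have "set es \<subseteq> {..<n} \<times> {..<n}" using in_arcsD1 in_arcsD2 * by fastforce
      then have "card (set es) \<le> card ({..<n} \<times> {..<n})" by (intro card_mono) auto
      then show ?thesis using distinct_card[OF *(4)] m by simp
    qed
    obtain W t s where e: "exec W vccs_program (input_state n es) t s"
      and t: "t \<le> K * (n * m + 1)" and en: "enumerates (output_lists s) (vccs 2 (with_proj G))"
      using wp_vccs_program[OF *(1,3,4,5)] unfolding wp_def m K by auto
    have ce: "cells_le (n + n * n) (input_state n es)"
      using m mn lt unfolding cells_le_def input_state_def by (auto intro: less_imp_le trans_le_add1)
    \<comment> \<open>Cells are at most \<open>n + n * n\<close> in the beginning and grow by at
      most 2 per step; with \<open>n * m + 1 \<le> (n + 2)^3\<close>, all words are below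
      \<open>(2 * K + 1) * (n + 2)^3\<close>. The constant is absorbed through
      \<open>2 * K + 1 \<le> 2 ^ (2 * K + 1)\<close>, which explains the exponent
      \<open>2 * K + 4\<close>.\<close>
    let ?X = "(n + 2) ^ 3"
    have X: "?X = n * n * n + 6 * (n * n) + 12 * n + 8" by (simp add: power3_eq_cube algebra_simps)
    have "n * m \<le> n * n * n" using mn by simp
    then have "n * m + 1 \<le> ?X" unfolding X by linarith
    then have "K * (n * m + 1) \<le> K * ?X" by (rule mult_le_mono2)
    moreover have "n + n * n < ?X" unfolding X by linarith
    ultimately have "n + n * n + 2 * t < (2 * K + 1) * ?X" using t by (simp add: algebra_simps)
    also have "\<dots> \<le> (n + 2) ^ (2 * K + 1) * ?X"
    proof (rule mult_le_mono1)
      have "2 * K + 1 \<le> 2 ^ (2 * K + 1)" by (rule less_imp_le[OF less_exp])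
      also have "\<dots> \<le> (n + 2) ^ (2 * K + 1)" by (rule power_mono) auto
      finally show "2 * K + 1 \<le> (n + 2) ^ (2 * K + 1)" .
    qed
    also have "\<dots> = (n + 2) ^ (2 * K + 4)" by (simp only: power_add[symmetric]) simp
    finally have "n + n * n + 2 * t < (n + 2) ^ (2 * K + 4)" .
    then show ?thesis using exec_word[OF e lim_vccs_program ce] t en by blast
  qed
  show ?thesis
  proof (rule exI[of _ vccs_program], rule exI[of _ "2 * K + 4"], rule exI[of _ K], intro allI impI, elim conjE)
    fix G :: "nat pair_pre_digraph" and n m es
    assume "pair_fin_digraph G" "card (parcs G) = m" "pverts G = {..<n}" "distinct es" "set es = parcs G"
    then show "\<exists>t s. exec ((n + 2) ^ (2 * K + 4)) vccs_program (input_state n es) t s \<and>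
        t \<le> K * (n * m + 1) \<and> enumerates (output_lists s) (vccs 2 (with_proj G))"
      by (rule main)
  qed
qed

end
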